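(* Let $f(x)=a+bx+\int_0^\infty(1-e^{-sx})\,\bar\nu(ds)$ be a Bernstein function with Lévy triplet $(a,b,\bar\nu)$, let ${}^fL(t)$, $t\ge 0$, be the inverse process of a subordinator ${}^f\sigma$ with Laplace exponent $f$, and let $l_t(B)=\Pr\{{}^fL(t)\in B\}$ be the distribution of ${}^fL(t)$. Assume that $\bar\nu(0,\infty)=\infty$ and that $s\mapsto\nu(s)=a+\bar\nu(s,\infty)$ is absolutely continuous on $(0,\infty)$. Let $(T_t)_{t\ge0}$ be a strongly continuous ($C_0$-) semigroup on a Banach space $(\mathfrak B,\|\cdot\|_{\mathfrak B})$ such that $\|T_tu\|_{\mathfrak B}\le\|u\|_{\mathfrak B}$ for all $t\ge 0$, $u\in\mathfrak B$, and let $(A,\mathrm{Dom}(A))$ be its generator. Define, for $u\in\mathfrak B$ and $t\ge 0$, the Bochner integral $$\mathcal T_tu=\int_0^\infty T_su\;l_t(ds).$$ Then: 1. $\mathcal T_t$ is a uniformly bounded (in $t$) linear operator on $\mathfrak B$; 2. $\mathcal T_tu$ is strongly continuous for every $u\in\mathfrak B$; 3. for every $u\in\mathrm{Dom}(A)$, $q(t)=\mathcal T_tu$ solves the problem $${}^f\mathfrak D_tq(t)=Aq(t),\quad 0<t<\infty,\qquad q(0)=u,$$ where ${}^f\mathfrak D_tq(t)=b\frac{d}{dt}q(t)+\int_0^t\frac{\partial}{\partial t}q(t-s)\,\nu(s)\,ds$.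
   Context: A Bernstein function is one of the form $f(x)=a+bx+\int_0^\infty(1-e^{-sx})\bar\nu(ds)$, $x>0$, with $a,b\ge0$ and $\bar\nu$ a non-negative measure on $(0,\infty)$ (the Lévy measure) satisfying $\int_0^\infty(z\wedge1)\,\bar\nu(dz)<\infty$; it extends to $\Re\lambda>0$. The function $\nu(s)=a+\bar\nu(s,\infty)$, $s>0$, is called its tail; it is integrable on $(0,1)$. Absolute continuity of $\nu$ on $(0,\infty)$ is understood as absolute continuity on compact subintervals of $(0,\infty)$. A subordinator ${}^f\sigma(t)$, $t\ge0$, with Laplace exponent $f$ is a process with values in $[0,\infty]$ ($\infty$ absorbing), non-decreasing right-continuous paths started at $0$, and independent and homogeneous increments up to its lifetime $\zeta=\inf\{t\ge 0:{}^f\sigma(t)=\infty\}$, with $\mathbb E e^{-\lambda\,{}^f\sigma(t)}=e^{-tf(\lambda)}$ (convention $e^{-\infty}=0$). Its inverse (hitting-time) is ${}^fL(t)=\inf\{s>0:{}^f\sigma(s)>t\}$. The operator ${}^f\mathfrak D_t$ is the generalized Dzerbayshan–Caputo derivative on the positive half-axis according to $f$; for $\mathfrak B$-valued functions the derivatives and integrals are taken in $\mathfrak B$. *)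

theory Defs
  imports "HOL-Probability.Probability"
begin

section \<open>Bernstein functions\<close>

definition levy_measure :: "real measure \<Rightarrow> bool" where
  "levy_measure m \<longleftrightarrow>
     sets m = sets (restrict_space borel {0<..}) \<and>
     (\<integral>\<^sup>+z. ennreal (min z 1) \<partial>m) < \<infinity>"

definition bernstein_with_triplet ::
    "(real \<Rightarrow> real) \<Rightarrow> real \<Rightarrow> real \<Rightarrow> real measure \<Rightarrow> bool" where
  "bernstein_with_triplet f a b m \<longleftrightarrow>
     0 \<le> a \<and> 0 \<le> b \<and> levy_measure m \<and>
     (\<forall>x>0. f x = a + b * x + (\<integral>s. (1 - exp (- (s * x))) \<partial>m))"

definition levy_tail :: "real \<Rightarrow> real measure \<Rightarrow> real \<Rightarrow> real" where
  "levy_tail a m s = a + measure m {s<..}"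

text \<open>The usual \<open>\<epsilon>\<close>-\<open>\<delta>\<close> notion on the interval from \<open>c\<close> to \<open>d\<close>.\<close>

definition abs_cont_on_interval ::
    "real \<Rightarrow> real \<Rightarrow> (real \<Rightarrow> 'b::real_normed_vector) \<Rightarrow> bool" where
  "abs_cont_on_interval c d g \<longleftrightarrow>
     (\<forall>\<epsilon>>0. \<exists>\<delta>>0. \<forall>(n::nat) x y.
        (\<forall>i<n. c \<le> x i \<and> x i \<le> y i \<and> y i \<le> d) \<and>
        disjoint_family_on (\<lambda>i. {x i<..<y i}) {..<n} \<and>
        (\<Sum>i<n. y i - x i) < \<delta> \<longrightarrow>
        (\<Sum>i<n. norm (g (y i) - g (x i))) < \<epsilon>)"


section \<open>Subordinators and their inverses\<close>

text \<open>
  A process is a family \<open>\<sigma> t\<close> of random variables with values in \<open>[0, \<infinity>]\<close>; only times \<open>t \<ge> 0\<close>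
  are meaningful.
\<close>

definition lifetime :: "(real \<Rightarrow> 'w \<Rightarrow> ennreal) \<Rightarrow> 'w \<Rightarrow> ennreal" where
  "lifetime \<sigma> \<omega> = Inf {ennreal t | t. 0 \<le> t \<and> \<sigma> t \<omega> = \<infinity>}"

definition past_events ::
    "'w measure \<Rightarrow> (real \<Rightarrow> 'w \<Rightarrow> ennreal) \<Rightarrow> real \<Rightarrow> 'w set set" where
  "past_events M \<sigma> t =
     sigma_sets (space M) {\<sigma> r -` B \<inter> space M | r B. 0 \<le> r \<and> r \<le> t \<and> B \<in> sets borel}"

text \<open>
  Independence and homogeneity of the increments up to the lifetime: conditionally on \<open>t < \<zeta>\<close> the
  increment \<open>\<sigma> (t + s) - \<sigma> t\<close> is independent of the past up to time \<open>t\<close> and has the law of \<open>\<sigma> s\<close>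
  (an increment is \<open>\<infinity>\<close> if the process dies in between). The identity is multiplied by the
  probability of \<open>t < \<zeta>\<close>. That \<open>\<infinity>\<close> is absorbing is contained in monotonicity.
\<close>

definition subordinator ::
    "'w measure \<Rightarrow> (real \<Rightarrow> real) \<Rightarrow> (real \<Rightarrow> 'w \<Rightarrow> ennreal) \<Rightarrow> bool" where
  "subordinator M f \<sigma> \<longleftrightarrow>
     prob_space M \<and>
     (\<forall>t\<ge>0. \<sigma> t \<in> borel_measurable M) \<and>
     (\<forall>\<omega>\<in>space M. \<sigma> 0 \<omega> = 0 \<and> mono_on {0..} (\<lambda>t. \<sigma> t \<omega>) \<and>
        (\<forall>t\<ge>0. continuous (at_right t) (\<lambda>s. \<sigma> s \<omega>))) \<and>
     (\<forall>t\<ge>0. \<forall>s\<ge>0. \<forall>F\<in>past_events M \<sigma> t. \<forall>B\<in>sets borel.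
        measure M (F \<inter> {\<omega>\<in>space M. ennreal t < lifetime \<sigma> \<omega> \<and> \<sigma> (t + s) \<omega> - \<sigma> t \<omega> \<in> B}) =
        measure M (F \<inter> {\<omega>\<in>space M. ennreal t < lifetime \<sigma> \<omega>}) *
        measure M {\<omega>\<in>space M. \<sigma> s \<omega> \<in> B}) \<and>
     (\<forall>t\<ge>0. \<forall>x>0.
        (\<integral>\<omega>. (if \<sigma> t \<omega> = \<infinity> then 0 else exp (- (x * enn2real (\<sigma> t \<omega>)))) \<partial>M) = exp (- (t * f x)))"

definition inverse_process :: "(real \<Rightarrow> 'w \<Rightarrow> ennreal) \<Rightarrow> real \<Rightarrow> 'w \<Rightarrow> ennreal" where
  "inverse_process \<sigma> t \<omega> = Inf {ennreal s | s. 0 < s \<and> ennreal t < \<sigma> s \<omega>}"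

definition inverse_law ::
    "'w measure \<Rightarrow> (real \<Rightarrow> 'w \<Rightarrow> ennreal) \<Rightarrow> real \<Rightarrow> ennreal measure" where
  "inverse_law M \<sigma> t = distr M borel (inverse_process \<sigma> t)"


section \<open>The Bochner integral in an arbitrary Banach space\<close>

text \<open>
  The library's \<open>has_bochner_integral\<close> is restricted to second countable, i.e. separable, spaces.
  Here \<open>f\<close> is strongly measurable because it is an almost everywhere limit of simple functions.
  That condition also makes \<open>norm (f x - s i x)\<close> almost everywhere equal to a measurable function,
  so its \<open>nn_integral\<close> is the genuine integral.
\<close>

definition has_bochner ::
    "'a measure \<Rightarrow> ('a \<Rightarrow> 'b::real_normed_vector) \<Rightarrow> 'b \<Rightarrow> bool" where
  "has_bochner M f I \<longleftrightarrow>
     (\<exists>s :: nat \<Rightarrow> 'a \<Rightarrow> 'b.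
        (\<forall>i. Bochner_Integration.simple_bochner_integrable M (s i)) \<and>
        (AE x in M. (\<lambda>i. s i x) \<longlonglongrightarrow> f x) \<and>
        (\<lambda>i. \<integral>\<^sup>+x. ennreal (norm (f x - s i x)) \<partial>M) \<longlonglongrightarrow> 0 \<and>
        (\<lambda>i. Bochner_Integration.simple_bochner_integral M (s i)) \<longlonglongrightarrow> I)"

definition bochner_integrable_on ::
    "'a measure \<Rightarrow> 'a set \<Rightarrow> ('a \<Rightarrow> 'b::real_normed_vector) \<Rightarrow> bool" where
  "bochner_integrable_on M S f \<longleftrightarrow> (\<exists>I. has_bochner M (\<lambda>x. indicator S x *\<^sub>R f x) I)"

definition bochner_integral_on ::
    "'a measure \<Rightarrow> 'a set \<Rightarrow> ('a \<Rightarrow> 'b::real_normed_vector) \<Rightarrow> 'b" where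
  "bochner_integral_on M S f = (THE I. has_bochner M (\<lambda>x. indicator S x *\<^sub>R f x) I)"


section \<open>Semigroups\<close>

definition C0_semigroup :: "(real \<Rightarrow> 'b::banach \<Rightarrow>\<^sub>L 'b) \<Rightarrow> bool" where
  "C0_semigroup T \<longleftrightarrow>
     T 0 = id_blinfun \<and>
     (\<forall>s\<ge>0. \<forall>t\<ge>0. T (s + t) = T s o\<^sub>L T t) \<and>
     (\<forall>u. ((\<lambda>t. blinfun_apply (T t) u) \<longlongrightarrow> u) (at_right 0))"

definition generator_dom :: "(real \<Rightarrow> 'b::banach \<Rightarrow>\<^sub>L 'b) \<Rightarrow> 'b set" where
  "generator_dom T =
     {u. \<exists>v. ((\<lambda>h. (blinfun_apply (T h) u - u) /\<^sub>R h) \<longlongrightarrow> v) (at_right 0)}"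

definition generator :: "(real \<Rightarrow> 'b::banach \<Rightarrow>\<^sub>L 'b) \<Rightarrow> 'b \<Rightarrow> 'b" where
  "generator T u = Lim (at_right 0) (\<lambda>h. (blinfun_apply (T h) u - u) /\<^sub>R h)"

text \<open>\<open>time_changed M \<sigma> T t u\<close> is the integral of \<open>T s u\<close> against the law of the inverse process over
  \<open>0 \<le> s < \<infinity>\<close>.\<close>

definition time_changed ::
    "'w measure \<Rightarrow> (real \<Rightarrow> 'w \<Rightarrow> ennreal) \<Rightarrow> (real \<Rightarrow> 'b::banach \<Rightarrow>\<^sub>L 'b) \<Rightarrow> real \<Rightarrow> 'b \<Rightarrow> 'b" where
  "time_changed M \<sigma> T t u =
     bochner_integral_on (inverse_law M \<sigma> t) {..<\<infinity>} (\<lambda>s. blinfun_apply (T (enn2real s)) u)"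


section \<open>The generalized Dzerbayshan-Caputo derivative\<close>

text \<open>
  \<open>has_DC_derivative b \<nu> q D t\<close>: the derivative
  \<open>b q'(t) + \<integral>\<^sub>0\<^sup>t (\<partial>/\<partial>t) q(t - s) \<nu>(s) ds\<close> exists and equals \<open>D\<close>. As for the classical Caputo
  derivative, \<open>q\<close> is absolutely continuous on \<open>[0, t]\<close> and the derivative under the integral is an
  almost everywhere one, in the norm of the space; its existence has to be required, since a space
  without the Radon-Nikodym property contains absolutely continuous functions that are nowhere
  differentiable. The term \<open>b q'(t)\<close> is absent if \<open>b = 0\<close>.
\<close>

definition has_DC_derivative ::
    "real \<Rightarrow> (real \<Rightarrow> real) \<Rightarrow> (real \<Rightarrow> 'b::banach) \<Rightarrow> 'b \<Rightarrow> real \<Rightarrow> bool" where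
  "has_DC_derivative b \<nu> q D t \<longleftrightarrow>
     abs_cont_on_interval 0 t q \<and>
     (b \<noteq> 0 \<longrightarrow> q differentiable (at t)) \<and>
     (AE s in lborel. 0 < s \<and> s < t \<longrightarrow> q differentiable (at (t - s))) \<and>
     bochner_integrable_on lborel {0<..<t} (\<lambda>s. \<nu> s *\<^sub>R vector_derivative q (at (t - s))) \<and>
     D = b *\<^sub>R vector_derivative q (at t) +
         bochner_integral_on lborel {0<..<t} (\<lambda>s. \<nu> s *\<^sub>R vector_derivative q (at (t - s)))"

end

theory Submission
  imports Defs
begin

text \<open>
  Only the one-dimensional laws of the subordinator matter, since \<open>P (L t > s) = P (\<sigma> s \<le> t)\<close> for \<open>s > 0\<close>.
  Since the Levy measure is infinite and absolutely continuous, these laws have a jointly measurable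
  density \<open>k s x\<close> for \<open>s > 0\<close>. Hence, for \<open>u\<close> in the domain of \<open>A\<close>, \<open>q t\<close> is \<open>u\<close> plus the integral over
  \<open>0 < x < t\<close> of \<open>g x\<close>, the integral of \<open>k s x T\<^sub>s A u\<close> over \<open>s\<close>, and Lebesgue differentiation, applied to
  step function approximations of the orbit, yields \<open>q' = g\<close> almost everywhere in the norm.
  Comparing Laplace transforms gives the renewal equation \<open>b U\<^sub>S + \<nu> * U\<^sub>S = P (\<sigma> S \<le> \<cdot>)\<close> for the potential
  density \<open>U\<^sub>S\<close> after time \<open>S\<close>. So \<open>L t\<close> has the density \<open>b k s t + (\<nu> * k s) t\<close>, and integrating
  \<open>T\<^sub>s A u\<close> against it turns \<open>A q\<close> into \<open>b q' + \<nu> * q'\<close>. Laplace transforms give this for almost every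
  \<open>t\<close> only. If \<open>b = 0\<close>, the renewal equation extends to every \<open>t\<close> because \<open>U\<^sub>S\<close> is \<open>U\<^sub>0\<close> convolved with
  the law of \<open>\<sigma> S\<close>; if \<open>b > 0\<close>, then \<open>U\<^sub>0\<close> is bounded by \<open>1 / b\<close>, so \<open>\<nu> * q'\<close> and therefore \<open>q'\<close> are
  continuous.
\<close>

section \<open>The Bochner integral\<close>

text \<open>The space may be non-separable, so measurability of vector-valued maps cannot be taken
  from the separable theory, and absolutely continuous maps into it may be nowhere differentiable.
  Both obstacles are met in one way: every vector that occurs is an integral of a bounded continuous
  orbit against a scalar kernel, and replacing the orbit by its values on a finite grid leaves
  finitely many scalar integrals times fixed vectors. Fubini and differentiation are then scalar
  statements, and the grid error has a measurable scalar majorant whose integral tends to 0. The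
  time derivative falls on scalar kernels only: \<open>T\<^sub>r u - u\<close> is the integral of
  \<open>T\<^sub>s A u\<close> over 0 < s < r, and averaging over the law of L t turns the indicator
  of s < r into P (L t > s), a distribution function in t. Infinite Levy mass excludes an atom of
  the laws at the drift point, about which the absolute continuity of the tail says nothing. Tails
  of L t are compared at countably many levels, because each renewal equation holds off a null set
  of times that depends on the level.\<close>

lemma has_bochner_cong_AE:
  assumes "AE x in N. F x = G x"
  shows "has_bochner N F I \<longleftrightarrow> has_bochner N G I"
proof -
  have *: "has_bochner N G I" if F: "has_bochner N F I" and eq: "AE x in N. F x = G x"
    for F G :: "'a \<Rightarrow> 'b::real_normed_vector"
  proof -
    obtain s :: "nat \<Rightarrow> 'a \<Rightarrow> 'b" where s: "\<And>i. Bochner_Integration.simple_bochner_integrable N (s i)"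
      "AE x in N. (\<lambda>i. s i x) \<longlonglongrightarrow> F x"
      "(\<lambda>i. \<integral>\<^sup>+x. ennreal (norm (F x - s i x)) \<partial>N) \<longlonglongrightarrow> 0"
      "(\<lambda>i. Bochner_Integration.simple_bochner_integral N (s i)) \<longlonglongrightarrow> I"
      using F unfolding has_bochner_def by blast
    have "(\<integral>\<^sup>+x. ennreal (norm (F x - s i x)) \<partial>N) = (\<integral>\<^sup>+x. ennreal (norm (G x - s i x)) \<partial>N)" for i
      using eq by (intro nn_integral_cong_AE) auto
    moreover have "AE x in N. (\<lambda>i. s i x) \<longlonglongrightarrow> G x"
      using eq s(2) by eventually_elim simp
    ultimately show ?thesis
      unfolding has_bochner_def using s by auto
  qed
  show ?thesis
    using *[of F G] *[of G F] assms by (auto simp: eq_commute)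
qed

text \<open>\<open>norm (F x - s i x)\<close> is not known to be measurable, and
  \<open>nn_integral\<close> is additive only on measurable functions, so a measurable majorant
  stands in for it. Almost everywhere convergence is left out because it is recovered along a
  subsequence.\<close>

definition approx_simple ::
    "'a measure \<Rightarrow> ('a \<Rightarrow> 'b::real_normed_vector) \<Rightarrow> 'b \<Rightarrow> (nat \<Rightarrow> 'a \<Rightarrow> 'b) \<Rightarrow> (nat \<Rightarrow> 'a \<Rightarrow> ennreal) \<Rightarrow> bool"
  where "approx_simple N F I s \<phi> \<longleftrightarrow>
    (\<forall>i. Bochner_Integration.simple_bochner_integrable N (s i)) \<and>
    (\<forall>i. \<phi> i \<in> borel_measurable N) \<and>
    (\<forall>i. AE x in N. ennreal (norm (F x - s i x)) \<le> \<phi> i x) \<and>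
    (\<lambda>i. \<integral>\<^sup>+x. \<phi> i x \<partial>N) \<longlonglongrightarrow> 0 \<and>
    (\<lambda>i. Bochner_Integration.simple_bochner_integral N (s i)) \<longlonglongrightarrow> I"

lemma approx_simpleD:
  assumes "approx_simple N F I s \<phi>"
  shows "Bochner_Integration.simple_bochner_integrable N (s i)"
    "\<phi> i \<in> borel_measurable N"
    "AE x in N. ennreal (norm (F x - s i x)) \<le> \<phi> i x"
    "(\<lambda>i. \<integral>\<^sup>+x. \<phi> i x \<partial>N) \<longlonglongrightarrow> 0"
    "(\<lambda>i. Bochner_Integration.simple_bochner_integral N (s i)) \<longlonglongrightarrow> I"
  using assms unfolding approx_simple_def by blast+

text \<open>Where the simple functions converge, \<open>norm (F x - s i x)\<close> is the limit in j
  of \<open>norm (s j x - s i x)\<close>. These are real simple functions, so their limit is a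
  measurable majorant even if the space is not separable.\<close>

lemma has_bochner_approx_simple:
  fixes F :: "'a \<Rightarrow> 'b::real_normed_vector"
  assumes "has_bochner N F I"
  shows "\<exists>s \<phi>. approx_simple N F I s \<phi>"
proof -
  obtain s :: "nat \<Rightarrow> 'a \<Rightarrow> 'b" where s: "\<And>i. Bochner_Integration.simple_bochner_integrable N (s i)"
    "AE x in N. (\<lambda>i. s i x) \<longlonglongrightarrow> F x"
    "(\<lambda>i. \<integral>\<^sup>+x. ennreal (norm (F x - s i x)) \<partial>N) \<longlonglongrightarrow> 0"
    "(\<lambda>i. Bochner_Integration.simple_bochner_integral N (s i)) \<longlonglongrightarrow> I"
    using assms unfolding has_bochner_def by blast
  define \<phi> where "\<phi> i x = ennreal (lim (\<lambda>j. norm (s j x - s i x)))" for i x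
  have sf: "simple_function N (s i)" for i
    using s(1)[of i] by (auto elim: simple_bochner_integrable.cases)
  have "(\<lambda>x. norm (s j x - s i x)) \<in> borel_measurable N" for i j
    by (intro borel_measurable_simple_function simple_function_compose2[OF sf sf])
  then have m: "\<phi> i \<in> borel_measurable N" for i
    unfolding \<phi>_def by measurable
  have eq: "AE x in N. ennreal (norm (F x - s i x)) = \<phi> i x" for i
    using s(2)
  proof eventually_elim
    fix x assume "(\<lambda>i. s i x) \<longlonglongrightarrow> F x"
    then have "(\<lambda>j. norm (s j x - s i x)) \<longlonglongrightarrow> norm (F x - s i x)"
      by (intro tendsto_intros)
    then show "ennreal (norm (F x - s i x)) = \<phi> i x"
      by (simp add: \<phi>_def limI)
  qed
  then have "(\<integral>\<^sup>+x. ennreal (norm (F x - s i x)) \<partial>N) = (\<integral>\<^sup>+x. \<phi> i x \<partial>N)" for i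
    by (intro nn_integral_cong_AE)
  with s(3) have "(\<lambda>i. \<integral>\<^sup>+x. \<phi> i x \<partial>N) \<longlonglongrightarrow> 0" by simp
  moreover have "AE x in N. ennreal (norm (F x - s i x)) \<le> \<phi> i x" for i
    using eq[of i] by eventually_elim simp
  ultimately have "approx_simple N F I s \<phi>"
    using s m by (auto simp: approx_simple_def)
  then show ?thesis by blast
qed

text \<open>A triangle inequality routed through F and G. The two functions may coincide: with F = G
  and \<psi> = 0 it becomes the Cauchy estimate for the approximating integrals.\<close>

lemma simple_bochner_integral_dist_bound:
  fixes F G :: "'a \<Rightarrow> 'b::real_normed_vector"
  assumes s: "Bochner_Integration.simple_bochner_integrable N s" and t: "Bochner_Integration.simple_bochner_integrable N t"
    and [measurable]: "\<phi> \<in> borel_measurable N" "\<theta> \<in> borel_measurable N" "\<psi> \<in> borel_measurable N"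
    and le: "AE x in N. ennreal (norm (F x - s x)) \<le> \<phi> x"
      "AE x in N. ennreal (norm (G x - t x)) \<le> \<theta> x"
      "AE x in N. ennreal (norm (F x - G x)) \<le> \<psi> x"
  shows "ennreal (norm (Bochner_Integration.simple_bochner_integral N s - Bochner_Integration.simple_bochner_integral N t))
    \<le> (\<integral>\<^sup>+x. \<phi> x \<partial>N) + (\<integral>\<^sup>+x. \<theta> x \<partial>N) + (\<integral>\<^sup>+x. \<psi> x \<partial>N)"
proof -
  have "ennreal (norm (Bochner_Integration.simple_bochner_integral N s - Bochner_Integration.simple_bochner_integral N t)) =
      norm (Bochner_Integration.simple_bochner_integral N (\<lambda>x. s x - t x))"
    using s t by (subst simple_bochner_integral_diff) auto
  also have "\<dots> \<le> Bochner_Integration.simple_bochner_integral N (\<lambda>x. norm (s x - t x))"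
    using simple_bochner_integrable_compose2[of "(-)" N s t] s t
    by (auto intro!: simple_bochner_integral_norm_bound)
  also have "\<dots> = (\<integral>\<^sup>+x. norm (s x - t x) \<partial>N)"
    using simple_bochner_integrable_compose2[of "\<lambda>x y. norm (x - y)" N s t] s t
    by (auto intro!: simple_bochner_integral_eq_nn_integral)
  also have "\<dots> \<le> (\<integral>\<^sup>+x. \<phi> x + \<theta> x + \<psi> x \<partial>N)"
  proof (rule nn_integral_mono_AE)
    show "AE x in N. ennreal (norm (s x - t x)) \<le> \<phi> x + \<theta> x + \<psi> x"
      using le
    proof eventually_elim
      fix x
      assume *: "ennreal (norm (F x - s x)) \<le> \<phi> x" "ennreal (norm (G x - t x)) \<le> \<theta> x"
        "ennreal (norm (F x - G x)) \<le> \<psi> x"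
      have "norm (s x - t x) = norm ((F x - G x) - (F x - s x) + (G x - t x))" by simp
      also have "\<dots> \<le> norm (F x - G x) + norm (F x - s x) + norm (G x - t x)"
        by (metis (no_types, lifting) add_right_mono norm_triangle_ineq norm_triangle_ineq4 order_trans)
      finally have "ennreal (norm (s x - t x))
          \<le> ennreal (norm (F x - s x)) + ennreal (norm (G x - t x)) + ennreal (norm (F x - G x))"
        by (simp add: algebra_simps flip: ennreal_plus)
      also have "\<dots> \<le> \<phi> x + \<theta> x + \<psi> x"
        by (intro add_mono *)
      finally show "ennreal (norm (s x - t x)) \<le> \<phi> x + \<theta> x + \<psi> x" .
    qed
  qed
  also have "\<dots> = (\<integral>\<^sup>+x. \<phi> x \<partial>N) + (\<integral>\<^sup>+x. \<theta> x \<partial>N) + (\<integral>\<^sup>+x. \<psi> x \<partial>N)"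
    by (simp add: nn_integral_add)
  finally show ?thesis .
qed

text \<open>In the limit of the preceding estimate the two approximation errors vanish. Uniqueness
  of the integral and the norm bound are the cases F = G with \<psi> = 0, and G = 0.\<close>

lemma has_bochner_dist_bound:
  assumes "has_bochner N F I" "has_bochner N G J"
    and \<psi>: "\<psi> \<in> borel_measurable N" "AE x in N. ennreal (norm (F x - G x)) \<le> \<psi> x"
  shows "ennreal (norm (I - J)) \<le> (\<integral>\<^sup>+x. \<psi> x \<partial>N)"
proof -
  obtain s \<phi> where "approx_simple N F I s \<phi>"
    using has_bochner_approx_simple[OF assms(1)] by blast
  note s = approx_simpleD[OF this]
  obtain t \<theta> where "approx_simple N G J t \<theta>"
    using has_bochner_approx_simple[OF assms(2)] by blast
  note t = approx_simpleD[OF this]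
  have "(\<lambda>i. ennreal (norm (Bochner_Integration.simple_bochner_integral N (s i) - Bochner_Integration.simple_bochner_integral N (t i)))) \<longlonglongrightarrow> ennreal (norm (I - J))"
    using s(5) t(5) by (intro tendsto_ennrealI tendsto_intros)
  moreover have "(\<lambda>i. (\<integral>\<^sup>+x. \<phi> i x \<partial>N) + (\<integral>\<^sup>+x. \<theta> i x \<partial>N) + (\<integral>\<^sup>+x. \<psi> x \<partial>N)) \<longlonglongrightarrow> 0 + 0 + (\<integral>\<^sup>+x. \<psi> x \<partial>N)"
    using s(4) t(4) by (intro tendsto_intros)
  moreover have "ennreal (norm (Bochner_Integration.simple_bochner_integral N (s i) - Bochner_Integration.simple_bochner_integral N (t i)))
      \<le> (\<integral>\<^sup>+x. \<phi> i x \<partial>N) + (\<integral>\<^sup>+x. \<theta> i x \<partial>N) + (\<integral>\<^sup>+x. \<psi> x \<partial>N)" for i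
    by (rule simple_bochner_integral_dist_bound[OF s(1) t(1) s(2) t(2) \<psi>(1) s(3) t(3) \<psi>(2)])
  ultimately show ?thesis
    using LIMSEQ_le by fastforce
qed

lemma has_bochner_unique:
  assumes "has_bochner N F I" "has_bochner N F J"
  shows "I = J"
  using has_bochner_dist_bound[OF assms, of "\<lambda>_. 0"] by (simp add: ennreal_eq_0_iff)

lemma bochner_integral_on_eq:
  "has_bochner M (\<lambda>x. indicator S x *\<^sub>R f x) I \<Longrightarrow> bochner_integral_on M S f = I"
  unfolding bochner_integral_on_def using has_bochner_unique by blast

lemma has_bochner_simple:
  "Bochner_Integration.simple_bochner_integrable N s \<Longrightarrow> has_bochner N s (Bochner_Integration.simple_bochner_integral N s)"
  unfolding has_bochner_def by (intro exI[of _ "\<lambda>_. s"]) (auto simp flip: zero_ennreal_def)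

lemma has_bochner_zero: "has_bochner N (\<lambda>_. 0::'b::real_normed_vector) 0"
proof -
  have "Bochner_Integration.simple_bochner_integrable N (\<lambda>_. 0::'b)"
    by (auto intro: simple_bochner_integrable.intros)
  moreover have "Bochner_Integration.simple_bochner_integral N (\<lambda>_. 0::'b) = 0"
    by (simp add: simple_bochner_integral_def image_constant_conv)
  ultimately show ?thesis
    using has_bochner_simple[of N "\<lambda>_. 0::'b"] by simp
qed

lemma has_bochner_norm_bound:
  assumes "has_bochner N F I" "\<psi> \<in> borel_measurable N" "AE x in N. ennreal (norm (F x)) \<le> \<psi> x"
  shows "ennreal (norm I) \<le> (\<integral>\<^sup>+x. \<psi> x \<partial>N)"
  using has_bochner_dist_bound[OF assms(1) has_bochner_zero, of \<psi>] assms(2,3) by simp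

text \<open>Along indices whose integrals are at most (1/2)^n, the functions have an integrable and
  hence almost everywhere finite sum, so their values tend to 0.\<close>

lemma AE_subsequence_tendsto_0:
  fixes \<phi> :: "nat \<Rightarrow> 'a \<Rightarrow> ennreal"
  assumes [measurable]: "\<And>i. \<phi> i \<in> borel_measurable N"
    and lim: "(\<lambda>i. \<integral>\<^sup>+x. \<phi> i x \<partial>N) \<longlonglongrightarrow> 0"
  obtains r :: "nat \<Rightarrow> nat" where "strict_mono r" "AE x in N. (\<lambda>i. \<phi> (r i) x) \<longlonglongrightarrow> 0"
proof -
  have "\<exists>k>m. (\<integral>\<^sup>+x. \<phi> k x \<partial>N) < ennreal ((1/2)^n)" for n m
  proof -
    have "eventually (\<lambda>i. (\<integral>\<^sup>+x. \<phi> i x \<partial>N) < ennreal ((1/2)^n)) sequentially"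
      using order_tendstoD(2)[OF lim, of "ennreal ((1/2)^n)"] by simp
    then have "eventually (\<lambda>i. (\<integral>\<^sup>+x. \<phi> i x \<partial>N) < ennreal ((1/2)^n) \<and> m < i) sequentially"
      using eventually_gt_at_top by (rule eventually_conj)
    then show ?thesis
      by (auto dest!: eventually_happens)
  qed
  then have "\<forall>n m. \<exists>k. m < k \<and> (\<integral>\<^sup>+x. \<phi> k x \<partial>N) < ennreal ((1/2)^n)" by blast
  then obtain h where h: "\<And>n m. m < h n m \<and> (\<integral>\<^sup>+x. \<phi> (h n m) x \<partial>N) < ennreal ((1/2)^n)"
    by metis
  define r where "r = rec_nat (h 0 0) (\<lambda>n m. h (Suc n) m)"
  have r: "strict_mono r"
    unfolding strict_mono_Suc_iff r_def using h by simp
  have le: "(\<integral>\<^sup>+x. \<phi> (r n) x \<partial>N) \<le> ennreal ((1/2)^n)" for n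
    using h[THEN conjunct2, THEN less_imp_le] by (cases n) (auto simp: r_def simp del: power_Suc intro: h[THEN conjunct2, THEN less_imp_le, of 0, simplified])
  have "(\<integral>\<^sup>+x. (\<Sum>n. \<phi> (r n) x) \<partial>N) = (\<Sum>n. \<integral>\<^sup>+x. \<phi> (r n) x \<partial>N)"
    by (rule nn_integral_suminf) auto
  also have "\<dots> \<le> (\<Sum>n. ennreal ((1/2)^n))"
    by (intro suminf_le le) auto
  also have "\<dots> < \<infinity>"
    by (subst suminf_ennreal_eq[where x="2"]) (auto intro!: sums_mult_iff[THEN iffD1] geometric_sums[of "1/2::real", simplified])
  finally have "AE x in N. (\<Sum>n. \<phi> (r n) x) \<noteq> \<infinity>"
    by (intro nn_integral_PInf_AE) auto
  then have "AE x in N. (\<lambda>i. \<phi> (r i) x) \<longlonglongrightarrow> 0"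
  proof eventually_elim
    fix x assume *: "(\<Sum>n. \<phi> (r n) x) \<noteq> \<infinity>"
    have fin: "\<phi> (r n) x \<noteq> \<infinity>" for n
      using * by (metis ennreal_suminf_lessD infinity_ennreal_def less_top)
    have eq: "\<phi> (r n) x = ennreal (enn2real (\<phi> (r n) x))" for n
      using fin[of n] by (simp add: less_top)
    have "summable (\<lambda>n. enn2real (\<phi> (r n) x))"
      by (rule summable_suminf_not_top) (use * eq in auto)
    then have "(\<lambda>n. ennreal (enn2real (\<phi> (r n) x))) \<longlonglongrightarrow> ennreal 0"
      by (intro tendsto_ennrealI summable_LIMSEQ_zero)
    then show "(\<lambda>i. \<phi> (r i) x) \<longlonglongrightarrow> 0"
      using eq by simp
  qed
  with r that show ?thesis by blast
qed

text \<open>Converse of the passage to majorants: the almost everywhere convergence demanded by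
  \<open>has_bochner\<close> is extracted along a subsequence, along which the limits of the
  integrals persist.\<close>

lemma has_bochnerI:
  assumes s: "\<And>i. Bochner_Integration.simple_bochner_integrable N (s i)"
    and \<phi>: "\<And>i. \<phi> i \<in> borel_measurable N"
    and le: "\<And>i. AE x in N. ennreal (norm (F x - s i x)) \<le> \<phi> i x"
    and lim: "(\<lambda>i. \<integral>\<^sup>+x. \<phi> i x \<partial>N) \<longlonglongrightarrow> 0"
    and I: "(\<lambda>i. Bochner_Integration.simple_bochner_integral N (s i)) \<longlonglongrightarrow> I"
  shows "has_bochner N F I"
proof -
  obtain r :: "nat \<Rightarrow> nat" where r: "strict_mono r" "AE x in N. (\<lambda>i. \<phi> (r i) x) \<longlonglongrightarrow> 0"
    by (rule AE_subsequence_tendsto_0[OF \<phi> lim])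
  have "AE x in N. \<forall>i. ennreal (norm (F x - s i x)) \<le> \<phi> i x"
    using le by (simp add: AE_all_countable)
  with r(2) have AE: "AE x in N. (\<lambda>i. s (r i) x) \<longlonglongrightarrow> F x"
  proof eventually_elim
    fix x assume *: "(\<lambda>i. \<phi> (r i) x) \<longlonglongrightarrow> 0" "\<forall>i. ennreal (norm (F x - s i x)) \<le> \<phi> i x"
    have "(\<lambda>i. ennreal (norm (F x - s (r i) x))) \<longlonglongrightarrow> ennreal 0"
      by (rule tendsto_sandwich[OF _ _ tendsto_const]) (use * in auto)
    then have "(\<lambda>i. norm (F x - s (r i) x)) \<longlonglongrightarrow> 0"
      by (subst (asm) tendsto_ennreal_iff) auto
    then show "(\<lambda>i. s (r i) x) \<longlonglongrightarrow> F x"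
      by (simp only: norm_minus_commute[of "F x"] tendsto_norm_zero_iff LIM_zero_iff)
  qed
  have "(\<lambda>i. \<integral>\<^sup>+x. ennreal (norm (F x - s (r i) x)) \<partial>N) \<longlonglongrightarrow> 0"
    by (rule tendsto_sandwich[OF _ _ tendsto_const LIMSEQ_subseq_LIMSEQ[OF lim r(1), unfolded o_def]])
      (auto intro!: always_eventually nn_integral_mono_AE le)
  moreover have "(\<lambda>i. Bochner_Integration.simple_bochner_integral N (s (r i))) \<longlonglongrightarrow> I"
    using LIMSEQ_subseq_LIMSEQ[OF I r(1)] by (simp add: o_def)
  ultimately show ?thesis
    unfolding has_bochner_def using s AE by (intro exI[of _ "\<lambda>i. s (r i)"]) auto
qed

lemma has_bochner_approx:
  assumes "has_bochner N F I" "0 < e"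
  obtains s \<phi> where "Bochner_Integration.simple_bochner_integrable N s" "\<phi> \<in> borel_measurable N"
    "AE x in N. ennreal (norm (F x - s x)) \<le> \<phi> x" "(\<integral>\<^sup>+x. \<phi> x \<partial>N) < ennreal e"
    "norm (Bochner_Integration.simple_bochner_integral N s - I) < e"
proof -
  obtain s \<phi> where "approx_simple N F I s \<phi>"
    using has_bochner_approx_simple[OF assms(1)] by blast
  note s = approx_simpleD[OF this]
  have "eventually (\<lambda>i. (\<integral>\<^sup>+x. \<phi> i x \<partial>N) < ennreal e) sequentially"
    using s(4) assms(2) by (intro order_tendstoD) auto
  moreover have "eventually (\<lambda>i. dist (Bochner_Integration.simple_bochner_integral N (s i)) I < e) sequentially"
    using s(5) assms(2) by (rule tendstoD)
  ultimately have "eventually (\<lambda>i. (\<integral>\<^sup>+x. \<phi> i x \<partial>N) < ennreal e \<and>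
      dist (Bochner_Integration.simple_bochner_integral N (s i)) I < e) sequentially"
    by (rule eventually_conj)
  then obtain i where "(\<integral>\<^sup>+x. \<phi> i x \<partial>N) < ennreal e" "dist (Bochner_Integration.simple_bochner_integral N (s i)) I < e"
    by (auto dest!: eventually_happens)
  with s show ?thesis
    by (intro that[of "s i" "\<phi> i"]) (auto simp: dist_norm)
qed

text \<open>The Bochner integral is closed under L1 convergence. The values \<open>In\<close> are
  not assumed to converge: a diagonal choice of simple functions has Cauchy integrals, and
  completeness of the space supplies I.\<close>

lemma has_bochner_limit:
  fixes F :: "'a \<Rightarrow> 'b::banach"
  assumes Fn: "\<And>n::nat. has_bochner N (Fn n) (In n)"
    and [measurable]: "\<And>n. \<psi> n \<in> borel_measurable N"
    and le: "\<And>n. AE x in N. ennreal (norm (F x - Fn n x)) \<le> \<psi> n x"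
    and lim: "(\<lambda>n. \<integral>\<^sup>+x. \<psi> n x \<partial>N) \<longlonglongrightarrow> 0"
  shows "\<exists>I. In \<longlonglongrightarrow> I \<and> has_bochner N F I"
proof -
  define P where "P n s \<phi> \<longleftrightarrow> Bochner_Integration.simple_bochner_integrable N s \<and> \<phi> \<in> borel_measurable N \<and>
      (AE x in N. ennreal (norm (Fn n x - s x)) \<le> \<phi> x) \<and> (\<integral>\<^sup>+x. \<phi> x \<partial>N) < ennreal (1 / Suc n) \<and>
      norm (Bochner_Integration.simple_bochner_integral N s - In n) < 1 / Suc n"
    for n and s :: "'a \<Rightarrow> 'b" and \<phi>
  have "\<exists>s \<phi>. P n s \<phi>" for n
    unfolding P_def by (rule has_bochner_approx[OF Fn[of n], of "1 / Suc n"]) auto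
  then obtain s \<phi> where P: "\<And>n. P n (s n) (\<phi> n)"
    by metis
  then have s: "\<And>n. Bochner_Integration.simple_bochner_integrable N (s n)"
    "\<And>n. \<phi> n \<in> borel_measurable N"
    "\<And>n. AE x in N. ennreal (norm (Fn n x - s n x)) \<le> \<phi> n x"
    "\<And>n. (\<integral>\<^sup>+x. \<phi> n x \<partial>N) < ennreal (1 / Suc n)"
    "\<And>n. norm (Bochner_Integration.simple_bochner_integral N (s n) - In n) < 1 / Suc n"
    unfolding P_def by blast+
  note s(2)[measurable]
  define \<theta> where "\<theta> n x = \<phi> n x + \<psi> n x" for n x
  have [measurable]: "\<theta> n \<in> borel_measurable N" for n
    unfolding \<theta>_def by measurable
  have le': "AE x in N. ennreal (norm (F x - s n x)) \<le> \<theta> n x" for n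
    using le[of n] s(3)[of n]
  proof eventually_elim
    fix x assume *: "ennreal (norm (F x - Fn n x)) \<le> \<psi> n x" "ennreal (norm (Fn n x - s n x)) \<le> \<phi> n x"
    have "norm (F x - s n x) \<le> norm (Fn n x - s n x) + norm (F x - Fn n x)"
      using norm_triangle_ineq[of "F x - Fn n x" "Fn n x - s n x"] by simp
    then have "ennreal (norm (F x - s n x)) \<le> ennreal (norm (Fn n x - s n x)) + ennreal (norm (F x - Fn n x))"
      by (simp flip: ennreal_plus)
    also have "\<dots> \<le> \<theta> n x" unfolding \<theta>_def by (intro add_mono *)
    finally show "ennreal (norm (F x - s n x)) \<le> \<theta> n x" .
  qed
  have "(\<lambda>n. ennreal (1 / Suc n)) \<longlonglongrightarrow> ennreal 0"
    by (intro tendsto_ennrealI LIMSEQ_Suc[OF lim_1_over_n, unfolded o_def])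
  then have "(\<lambda>n. ennreal (1 / Suc n)) \<longlonglongrightarrow> 0" by simp
  then have "(\<lambda>n. \<integral>\<^sup>+x. \<phi> n x \<partial>N) \<longlonglongrightarrow> 0"
    by (rule tendsto_sandwich[OF _ _ tendsto_const, rotated 2])
      (use s(4)[THEN less_imp_le] in \<open>auto intro!: always_eventually\<close>)
  from tendsto_add[OF this lim] have lim': "(\<lambda>n. \<integral>\<^sup>+x. \<theta> n x \<partial>N) \<longlonglongrightarrow> 0"
    by (simp add: \<theta>_def nn_integral_add)
  have "Cauchy (\<lambda>n. Bochner_Integration.simple_bochner_integral N (s n))"
  proof (rule metric_CauchyI)
    fix e :: real assume "0 < e"
    then have "eventually (\<lambda>n. (\<integral>\<^sup>+x. \<theta> n x \<partial>N) < ennreal (e / 2)) sequentially"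
      using lim' by (intro order_tendstoD) auto
    then obtain M where M: "\<And>n. n \<ge> M \<Longrightarrow> (\<integral>\<^sup>+x. \<theta> n x \<partial>N) < ennreal (e / 2)"
      by (auto simp: eventually_sequentially)
    show "\<exists>M. \<forall>m\<ge>M. \<forall>n\<ge>M. dist (Bochner_Integration.simple_bochner_integral N (s m)) (Bochner_Integration.simple_bochner_integral N (s n)) < e"
    proof (intro exI allI impI)
      fix m n assume "m \<ge> M" "n \<ge> M"
      have "ennreal (norm (Bochner_Integration.simple_bochner_integral N (s m) - Bochner_Integration.simple_bochner_integral N (s n)))
          \<le> (\<integral>\<^sup>+x. \<theta> m x \<partial>N) + (\<integral>\<^sup>+x. \<theta> n x \<partial>N) + (\<integral>\<^sup>+x. 0 \<partial>N)"
        by (rule simple_bochner_integral_dist_bound[OF s(1) s(1) _ _ _ le' le']) auto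
      also have "\<dots> < ennreal (e / 2) + ennreal (e / 2)"
        using M[OF \<open>m \<ge> M\<close>] M[OF \<open>n \<ge> M\<close>] by (simp add: add_strict_mono)
      also have "\<dots> = ennreal e" using \<open>0 < e\<close> by (simp flip: ennreal_plus)
      finally show "dist (Bochner_Integration.simple_bochner_integral N (s m)) (Bochner_Integration.simple_bochner_integral N (s n)) < e"
        using \<open>0 < e\<close> by (simp add: dist_norm ennreal_less_iff)
    qed
  qed
  then obtain I where I: "(\<lambda>n. Bochner_Integration.simple_bochner_integral N (s n)) \<longlonglongrightarrow> I"
    using Cauchy_convergent_iff convergent_def by blast
  have "has_bochner N F I"
    by (rule has_bochnerI[OF s(1) _ le' lim' I]) simp
  moreover have "(\<lambda>n. Bochner_Integration.simple_bochner_integral N (s n) - In n) \<longlonglongrightarrow> 0"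
    by (rule Lim_null_comparison[OF _ LIMSEQ_Suc[OF lim_1_over_n, unfolded o_def]])
      (auto intro!: always_eventually less_imp_le[OF s(5)[simplified]])
  from tendsto_diff[OF I this] have "In \<longlonglongrightarrow> I" by simp
  ultimately show ?thesis by blast
qed

lemma has_bochner_bounded_linear:
  assumes T: "bounded_linear T" and F: "has_bochner N F I"
  shows "has_bochner N (\<lambda>x. T (F x)) (T I)"
proof -
  interpret T: bounded_linear T by fact
  obtain K where K: "K > 0" "\<And>x. norm (T x) \<le> norm x * K" using T.pos_bounded by blast
  obtain s \<phi> where "approx_simple N F I s \<phi>"
    using has_bochner_approx_simple[OF F] by blast
  note s = approx_simpleD[OF this]
  note s(2)[measurable]
  show ?thesis
  proof (rule has_bochnerI[where s="\<lambda>i x. T (s i x)" and \<phi>="\<lambda>i x. \<phi> i x * ennreal K"])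
    show "Bochner_Integration.simple_bochner_integrable N (\<lambda>x. T (s i x))" for i
      using simple_bochner_integrable_compose2[OF _ s(1) s(1), of "\<lambda>x _. T x"] by (simp add: T.zero)
    show "(\<lambda>i. Bochner_Integration.simple_bochner_integral N (\<lambda>x. T (s i x))) \<longlonglongrightarrow> T I"
      using T.tendsto[OF s(5)] by (simp add: simple_bochner_integral_linear[OF T.linear_axioms s(1)])
    show "AE x in N. ennreal (norm (T (F x) - T (s i x))) \<le> \<phi> i x * ennreal K" for i
      using s(3)[of i]
    proof eventually_elim
      fix x assume *: "ennreal (norm (F x - s i x)) \<le> \<phi> i x"
      have "ennreal (norm (T (F x) - T (s i x))) \<le> ennreal (norm (F x - s i x)) * ennreal K"
        using K by (simp add: T.diff[symmetric] ennreal_leI flip: ennreal_mult)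
      also have "\<dots> \<le> \<phi> i x * ennreal K" by (intro mult_right_mono *) auto
      finally show "ennreal (norm (T (F x) - T (s i x))) \<le> \<phi> i x * ennreal K" .
    qed
    have "(\<lambda>i. (\<integral>\<^sup>+x. \<phi> i x \<partial>N) * ennreal K) \<longlonglongrightarrow> 0 * ennreal K"
      by (intro tendsto_mult_ennreal s(4) tendsto_const) auto
    then show "(\<lambda>i. \<integral>\<^sup>+x. \<phi> i x * ennreal K \<partial>N) \<longlonglongrightarrow> 0"
      by (simp add: nn_integral_multc)
  qed simp
qed

lemma has_bochner_scaleR:
  "has_bochner N F I \<Longrightarrow> has_bochner N (\<lambda>x. c *\<^sub>R F x) (c *\<^sub>R I)"
  by (rule has_bochner_bounded_linear[OF bounded_linear_scaleR_right])

lemma has_bochner_add: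
  assumes "has_bochner N F I" "has_bochner N G J"
  shows "has_bochner N (\<lambda>x. F x + G x) (I + J)"
proof -
  obtain s \<phi> where "approx_simple N F I s \<phi>"
    using has_bochner_approx_simple[OF assms(1)] by blast
  note s = approx_simpleD[OF this]
  obtain t \<theta> where "approx_simple N G J t \<theta>"
    using has_bochner_approx_simple[OF assms(2)] by blast
  note t = approx_simpleD[OF this]
  note s(2)[measurable] t(2)[measurable]
  show ?thesis
  proof (rule has_bochnerI[where s="\<lambda>i x. s i x + t i x" and \<phi>="\<lambda>i x. \<phi> i x + \<theta> i x"])
    show "Bochner_Integration.simple_bochner_integrable N (\<lambda>x. s i x + t i x)" for i
      using simple_bochner_integrable_compose2[OF _ s(1) t(1), of "(+)"] by simp
    show "(\<lambda>i. Bochner_Integration.simple_bochner_integral N (\<lambda>x. s i x + t i x)) \<longlonglongrightarrow> I + J"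
      using tendsto_add[OF s(5) t(5)] by (simp add: simple_bochner_integral_add[OF s(1) t(1)])
    show "AE x in N. ennreal (norm (F x + G x - (s i x + t i x))) \<le> \<phi> i x + \<theta> i x" for i
      using s(3)[of i] t(3)[of i]
    proof eventually_elim
      fix x assume *: "ennreal (norm (F x - s i x)) \<le> \<phi> i x" "ennreal (norm (G x - t i x)) \<le> \<theta> i x"
      have "ennreal (norm (F x + G x - (s i x + t i x))) \<le> ennreal (norm (F x - s i x)) + ennreal (norm (G x - t i x))"
        using norm_triangle_ineq[of "F x - s i x" "G x - t i x"]
        by (simp add: algebra_simps flip: ennreal_plus)
      also have "\<dots> \<le> \<phi> i x + \<theta> i x" by (intro add_mono *)
      finally show "ennreal (norm (F x + G x - (s i x + t i x))) \<le> \<phi> i x + \<theta> i x" .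
    qed
    show "(\<lambda>i. \<integral>\<^sup>+x. \<phi> i x + \<theta> i x \<partial>N) \<longlonglongrightarrow> 0"
      using tendsto_add[OF s(4) t(4)] by (simp add: nn_integral_add)
  qed simp
qed

lemma has_bochner_minus: "has_bochner N F I \<Longrightarrow> has_bochner N (\<lambda>x. - F x) (- I)"
  by (rule has_bochner_bounded_linear[OF bounded_linear_minus[OF bounded_linear_ident]])

lemma has_bochner_diff:
  "has_bochner N F I \<Longrightarrow> has_bochner N G J \<Longrightarrow> has_bochner N (\<lambda>x. F x - G x) (I - J)"
  using has_bochner_add[OF _ has_bochner_minus] by fastforce

lemma has_bochner_sum:
  assumes "finite A" "\<And>i. i \<in> A \<Longrightarrow> has_bochner N (F i) (I i)"
  shows "has_bochner N (\<lambda>x. \<Sum>i\<in>A. F i x) (\<Sum>i\<in>A. I i)"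
  using assms by (induction rule: finite_induct) (auto intro: has_bochner_zero has_bochner_add)

text \<open>The bridge from the library's integral: for real w both notions admit the same simple
  approximants, and multiplying a fixed vector by a real is bounded linear.\<close>

lemma has_bochner_scaleR_left:
  fixes w :: "'a \<Rightarrow> real"
  assumes "has_bochner_integral N w c"
  shows "has_bochner N (\<lambda>x. w x *\<^sub>R y) (c *\<^sub>R y)"
proof -
  have "has_bochner N w c"
    using assms
  proof (cases rule: has_bochner_integral.cases)
    case (1 s)
    then have [measurable]: "w \<in> borel_measurable N" "\<And>i. s i \<in> borel_measurable N"
      by (auto intro: borel_measurable_simple_function elim: simple_bochner_integrable.cases)
    show ?thesis
      by (rule has_bochnerI[OF 1(2) _ _ 1(3,4)])
auto
  qed
  then show ?thesis
    by (rule has_bochner_bounded_linear[OF bounded_linear_scaleR_left])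
qed

lemma has_bochner_distr:
  assumes h[measurable]: "h \<in> measurable N K" and F: "has_bochner (distr N K h) F I"
  shows "has_bochner N (\<lambda>x. F (h x)) I"
proof -
  obtain s \<phi> where "approx_simple (distr N K h) F I s \<phi>"
    using has_bochner_approx_simple[OF F] by blast
  note s = approx_simpleD[OF this]
  have [measurable]: "\<phi> i \<in> borel_measurable K" for i using s(2)[of i] by simp
  have sf: "simple_function K (s i)" for i
    using s(1)[of i] by (auto elim!: simple_bochner_integrable.cases simp: simple_function_def)
  have sf': "simple_function N (\<lambda>x. s i (h x))" for i
    using simple_function_comp[OF h sf[of i]] by (simp add: o_def)
  have [measurable]: "s i \<in> K \<rightarrow>\<^sub>M count_space UNIV" for i
    using sf by (rule measurable_simple_function)
  have sbi: "Bochner_Integration.simple_bochner_integrable N (\<lambda>x. s i (h x))" for i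
  proof (intro simple_bochner_integrable.intros sf')
    have "emeasure (distr N K h) {y \<in> space K. s i y \<noteq> 0} = emeasure N {y \<in> space N. s i (h y) \<noteq> 0}"
      by (subst emeasure_distr) (auto intro!: arg_cong[where f="emeasure N"] dest: measurable_space[OF h])
    then show "emeasure N {y \<in> space N. s i (h y) \<noteq> 0} \<noteq> \<infinity>"
      using s(1)[of i] by (auto elim!: simple_bochner_integrable.cases)
  qed
  have eq: "Bochner_Integration.simple_bochner_integral N (\<lambda>x. s i (h x)) = Bochner_Integration.simple_bochner_integral (distr N K h) (s i)" for i
  proof -
    have "Bochner_Integration.simple_bochner_integral N (\<lambda>x. s i (h x)) =
        (\<Sum>y\<in>(\<lambda>x. s i (h x)) ` space N. measure N {x\<in>space N. s i (h x) = y} *\<^sub>R y)"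
      by (simp add: simple_bochner_integral_def)
    \<comment> \<open>The added terms belong to values of \<open>s i\<close> that are not attained
      on the image of h; their preimages are empty.\<close>
    also have "\<dots> = (\<Sum>y\<in>s i ` space K. measure N {x\<in>space N. s i (h x) = y} *\<^sub>R y)"
    proof (rule sum.mono_neutral_left)
      show "finite (s i ` space K)" using sf[of i] by (simp add: simple_function_def)
      show "(\<lambda>x. s i (h x)) ` space N \<subseteq> s i ` space K" using measurable_space[OF h] by auto
      show "\<forall>y\<in>s i ` space K - (\<lambda>x. s i (h x)) ` space N. measure N {x \<in> space N. s i (h x) = y} *\<^sub>R y = 0"
      proof
        fix y assume "y \<in> s i ` space K - (\<lambda>x. s i (h x)) ` space N"
        then have "{x \<in> space N. s i (h x) = y} = {}" by (auto simp: image_iff)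
        then show "measure N {x \<in> space N. s i (h x) = y} *\<^sub>R y = 0"
          by (metis measure_empty scaleR_zero_left)
      qed
    qed
    also have "\<dots> = Bochner_Integration.simple_bochner_integral (distr N K h) (s i)"
      unfolding simple_bochner_integral_def
    proof (rule sum.cong)
      fix y assume "y \<in> s i ` space (distr N K h)"
      have "measure (distr N K h) {x \<in> space K. s i x = y} = measure N {x \<in> space N. s i (h x) = y}"
        by (subst measure_distr) (auto intro!: arg_cong[where f="measure N"] dest: measurable_space[OF h])
      then show "measure N {x \<in> space N. s i (h x) = y} *\<^sub>R y = measure (distr N K h) {x \<in> space (distr N K h). s i x = y} *\<^sub>R y"
        by simp
    qed simp
    finally show ?thesis .
  qed
  show ?thesis
  proof (rule has_bochnerI[OF sbi])
    show "(\<lambda>x. \<phi> i (h x)) \<in> borel_measurable N" for i by measurable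
    show "AE x in N. ennreal (norm (F (h x) - s i (h x))) \<le> \<phi> i (h x)" for i
      using AE_distrD[OF h s(3)[of i]] .
    show "(\<lambda>i. \<integral>\<^sup>+ x. \<phi> i (h x) \<partial>N) \<longlonglongrightarrow> 0"
      using s(4) by (subst (asm) nn_integral_distr) auto
    show "(\<lambda>i. Bochner_Integration.simple_bochner_integral N (\<lambda>x. s i (h x))) \<longlonglongrightarrow> I"
      using s(5) by (simp add: eq)
  qed
qed

section \<open>Bounded continuous integrands\<close>

text \<open>Rounding down to multiples of 1 / Suc n after clamping to [-n, n]. The clamp makes the
  range finite, so that any vector-valued function composed with \<open>grid n\<close> has finitely
  many values, while the points still converge.\<close>

definition grid :: "nat \<Rightarrow> real \<Rightarrow> real" where
  "grid n x = of_int \<lfloor>real (Suc n) * max (- real n) (min (real n) x)\<rfloor> / real (Suc n)"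

lemma grid_tendsto: "(\<lambda>n. grid n x) \<longlonglongrightarrow> x"
proof -
  obtain N :: nat where N: "\<bar>x\<bar> \<le> real N"
    using real_arch_simple by blast
  have "eventually (\<lambda>n. norm (grid n x - x) \<le> 1 / real (Suc n)) sequentially"
    using eventually_ge_at_top[of N]
  proof eventually_elim
    fix n assume "N \<le> n"
    with N have "max (- real n) (min (real n) x) = x" by auto
    then have "grid n x = of_int \<lfloor>real (Suc n) * x\<rfloor> / real (Suc n)"
      by (simp add: grid_def)
    moreover have "\<bar>of_int \<lfloor>real (Suc n) * x\<rfloor> - real (Suc n) * x\<bar> \<le> 1"
      by linarith
    moreover have "norm (grid n x - x) = \<bar>real (Suc n) * grid n x - real (Suc n) * x\<bar> / real (Suc n)"
      by (simp add: abs_mult flip: right_diff_distrib)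
    ultimately show "norm (grid n x - x) \<le> 1 / real (Suc n)"
      by (simp add: divide_right_mono)
  qed
  then have "(\<lambda>n. grid n x - x) \<longlonglongrightarrow> 0"
    by (rule Lim_null_comparison) (rule LIMSEQ_Suc[OF lim_1_over_n, unfolded o_def])
  then show ?thesis by (simp add: LIM_zero_iff)
qed

lemma finite_range_grid: "finite (range (grid n))"
proof (rule finite_subset)
  show "range (grid n) \<subseteq> (\<lambda>i::int. of_int i / real (Suc n)) ` {- int (Suc n * n) .. int (Suc n * n)}"
  proof (rule subsetI, elim imageE)
    fix y x assume y: "y = grid n x"
    define c where "c = max (- real n) (min (real n) x)"
    have c: "- real n \<le> c" "c \<le> real n" by (auto simp: c_def)
    have "real (Suc n) * (- real n) \<le> real (Suc n) * c" "real (Suc n) * c \<le> real (Suc n) * real n"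
      using c by (intro mult_left_mono; simp)+
    then have "of_int (- int (Suc n * n)) \<le> real (Suc n) * c" "real (Suc n) * c \<le> of_int (int (Suc n * n))"
      by (simp_all only: of_int_minus of_int_of_nat_eq of_nat_mult mult_minus_right of_int_mult)
    then have "\<lfloor>real (Suc n) * c\<rfloor> \<in> {- int (Suc n * n) .. int (Suc n * n)}"
      by (simp only: atLeastAtMost_iff le_floor_iff floor_le_iff simp_thms)
    then show "y \<in> (\<lambda>i::int. of_int i / real (Suc n)) ` {- int (Suc n * n) .. int (Suc n * n)}"
      unfolding y grid_def c_def[symmetric] by blast
  qed
qed simp

lemma grid_measurable[measurable]: "grid n \<in> borel_measurable borel"
  unfolding grid_def by measurable

lemma grid_vimage_sets[measurable]: "grid n -` {z} \<in> sets borel"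
  using measurable_sets[OF grid_measurable, of "{z}"] by simp

definition grid_sum :: "nat \<Rightarrow> real measure \<Rightarrow> (real \<Rightarrow> real) \<Rightarrow> (real \<Rightarrow> 'b::banach) \<Rightarrow> 'b" where
  "grid_sum n N w G = (\<Sum>z\<in>range (grid n). (\<integral>x. w x * indicator (grid n -` {z}) x \<partial>N) *\<^sub>R G z)"

text \<open>As a limit of grid sums, the integral of w G depends on w only through its scalar
  integrals over grid cells. Changes of density and exchanges of integrals can thus be checked cell
  by cell.\<close>

definition weighted_integral :: "real measure \<Rightarrow> (real \<Rightarrow> real) \<Rightarrow> (real \<Rightarrow> 'b::banach) \<Rightarrow> 'b" where
  "weighted_integral N w G = lim (\<lambda>n. grid_sum n N w G)"

lemma has_bochner_grid_sum:
  assumes sets: "sets N = sets borel" and w: "integrable N w"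
  shows "has_bochner N (\<lambda>x. w x *\<^sub>R G (grid n x)) (grid_sum n N w G)"
proof -
  have "integrable N (\<lambda>x. w x * indicator (grid n -` {z}) x)" for z
    using w by (rule integrable_real_mult_indicator[rotated]) (simp add: sets grid_vimage_sets)
  then have "has_bochner N (\<lambda>x. \<Sum>z\<in>range (grid n). (w x * indicator (grid n -` {z}) x) *\<^sub>R G z) (grid_sum n N w G)"
    unfolding grid_sum_def
    by (intro has_bochner_sum has_bochner_scaleR_left has_bochner_integral_integrable finite_range_grid)
  moreover have "(\<Sum>z\<in>range (grid n). (w x * indicator (grid n -` {z}) x) *\<^sub>R G z) = w x *\<^sub>R G (grid n x)" for x
  proof -
    have "(\<Sum>z\<in>range (grid n). (w x * indicator (grid n -` {z}) x) *\<^sub>R G z)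
        = (\<Sum>z\<in>range (grid n). if z = grid n x then w x *\<^sub>R G z else 0)"
      by (intro sum.cong) (auto simp: indicator_def)
    then show ?thesis by (simp add: finite_range_grid)
  qed
  ultimately show ?thesis by simp
qed

locale bounded_continuous =
  fixes G :: "real \<Rightarrow> 'b::banach" and C :: real
  assumes cont: "continuous_on UNIV G" and bound: "\<And>s. norm (G s) \<le> C"
begin

lemma C_nonneg: "0 \<le> C"
  using bound[of 0] norm_ge_zero order_trans by blast

definition grid_error :: "nat \<Rightarrow> real \<Rightarrow> real" where
  "grid_error n s = norm (G s - G (grid n s))"

text \<open>On each of the finitely many cells the error is a continuous real function
  \<open>norm (G s - G z)\<close>, which gives measurability also in a non-separable space.\<close>

lemma grid_error_measurable[measurable]: "grid_error n \<in> borel_measurable borel"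
proof -
  have "grid_error n = (\<lambda>s. \<Sum>z\<in>range (grid n). norm (G s - G z) * indicator (grid n -` {z}) s)"
  proof
    fix s
    have "(\<Sum>z\<in>range (grid n). norm (G s - G z) * indicator (grid n -` {z}) s)
        = (\<Sum>z\<in>range (grid n). if z = grid n s then norm (G s - G z) else 0)"
      by (intro sum.cong) (auto simp: indicator_def)
    then show "grid_error n s = (\<Sum>z\<in>range (grid n). norm (G s - G z) * indicator (grid n -` {z}) s)"
      by (simp add: finite_range_grid grid_error_def)
  qed
  moreover have [measurable]: "(\<lambda>s. norm (G s - G z)) \<in> borel_measurable borel" for z
    by (intro borel_measurable_continuous_onI continuous_intros cont)
  ultimately show ?thesis by simp
qed

lemma grid_error_le: "grid_error n s \<le> 2 * C"
  using norm_triangle_ineq4[of "G s" "G (grid n s)"] bound[of s] bound[of "grid n s"]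
  by (simp add: grid_error_def)

lemma grid_error_tendsto: "(\<lambda>n. grid_error n s) \<longlonglongrightarrow> 0"
proof -
  have "isCont G s" using cont by (simp add: continuous_on_eq_continuous_at)
  then have "(\<lambda>n. G (grid n s)) \<longlonglongrightarrow> G s"
    using grid_tendsto by (rule isCont_tendsto_compose)
  then have "(\<lambda>n. norm (G s - G (grid n s))) \<longlonglongrightarrow> norm (G s - G s)"
    by (intro tendsto_intros)
  then show ?thesis by (simp add: grid_error_def)
qed

text \<open>Dominated convergence with bound 2 C |w|. The map h serves product spaces, where the
  error is evaluated in the second coordinate.\<close>

lemma nn_integral_grid_error_tendsto:
  assumes w: "integrable N w" and h[measurable]: "h \<in> borel_measurable N"
  shows "(\<lambda>n. \<integral>\<^sup>+x. ennreal (\<bar>w x\<bar> * grid_error n (h x)) \<partial>N) \<longlonglongrightarrow> 0"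
proof -
  have [measurable]: "w \<in> borel_measurable N" using w by simp
  have "(\<lambda>n. \<integral>\<^sup>+x. ennreal (\<bar>w x\<bar> * grid_error n (h x)) \<partial>N) \<longlonglongrightarrow> (\<integral>\<^sup>+x. ennreal 0 \<partial>N)"
  proof (rule nn_integral_dominated_convergence[where w="\<lambda>x. ennreal (\<bar>w x\<bar> * (2 * C))"])
    show "AE x in N. ennreal (\<bar>w x\<bar> * grid_error j (h x)) \<le> ennreal (\<bar>w x\<bar> * (2 * C))" for j
      by (intro AE_I2 ennreal_leI mult_left_mono grid_error_le) auto
    have "integrable N (\<lambda>x. \<bar>w x\<bar> * (2 * C))" using w by auto
    then show "(\<integral>\<^sup>+x. ennreal (\<bar>w x\<bar> * (2 * C)) \<partial>N) < \<infinity>"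
      using C_nonneg by (subst nn_integral_eq_integral) auto
    show "AE x in N. (\<lambda>i. ennreal (\<bar>w x\<bar> * grid_error i (h x))) \<longlonglongrightarrow> ennreal 0"
    proof (intro AE_I2 tendsto_ennrealI)
      fix x show "(\<lambda>i. \<bar>w x\<bar> * grid_error i (h x)) \<longlonglongrightarrow> 0"
        using tendsto_mult[OF tendsto_const[of "\<bar>w x\<bar>"] grid_error_tendsto[of "h x"]] by simp
    qed
  qed auto
  then show ?thesis by simp
qed

lemma grid_sum_tendsto_has_bochner:
  assumes sets: "sets N = sets borel" and w: "integrable N w"
  shows "(\<lambda>n. grid_sum n N w G) \<longlonglongrightarrow> weighted_integral N w G"
    and "has_bochner N (\<lambda>x. w x *\<^sub>R G x) (weighted_integral N w G)"
proof -
  have [measurable]: "w \<in> borel_measurable N" using w by simp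
  have [measurable]: "(\<lambda>x. x) \<in> borel_measurable N" "grid_error n \<in> borel_measurable N" for n
    by (simp_all add: measurable_cong_sets[OF sets refl])
  have "\<exists>I. (\<lambda>n. grid_sum n N w G) \<longlonglongrightarrow> I \<and> has_bochner N (\<lambda>x. w x *\<^sub>R G x) I"
  proof (rule has_bochner_limit[OF has_bochner_grid_sum[OF sets w]])
    show "AE x in N. ennreal (norm (w x *\<^sub>R G x - w x *\<^sub>R G (grid n x))) \<le> ennreal (\<bar>w x\<bar> * grid_error n x)" for n
      by (simp add: grid_error_def flip: scaleR_diff_right)
    show "(\<lambda>n. \<integral>\<^sup>+x. ennreal (\<bar>w x\<bar> * grid_error n x) \<partial>N) \<longlonglongrightarrow> 0"
      by (rule nn_integral_grid_error_tendsto[OF w]) simp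
  qed simp
  then show "(\<lambda>n. grid_sum n N w G) \<longlonglongrightarrow> weighted_integral N w G"
    "has_bochner N (\<lambda>x. w x *\<^sub>R G x) (weighted_integral N w G)"
    unfolding weighted_integral_def by (auto simp: limI)
qed

lemma weighted_integral_eq:
  "sets N = sets borel \<Longrightarrow> integrable N w \<Longrightarrow> has_bochner N (\<lambda>x. w x *\<^sub>R G x) I \<Longrightarrow> weighted_integral N w G = I"
  using grid_sum_tendsto_has_bochner(2) has_bochner_unique by blast

lemma norm_weighted_integral_le:
  assumes "sets N = sets borel" "integrable N w"
  shows "norm (weighted_integral N w G) \<le> C * (\<integral>x. \<bar>w x\<bar> \<partial>N)"
proof -
  have [measurable]: "w \<in> borel_measurable N" using assms by simp
  have "ennreal (norm (weighted_integral N w G)) \<le> (\<integral>\<^sup>+x. ennreal (C * \<bar>w x\<bar>) \<partial>N)"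
  proof (rule has_bochner_norm_bound[OF grid_sum_tendsto_has_bochner(2)[OF assms]])
    show "AE x in N. ennreal (norm (w x *\<^sub>R G x)) \<le> ennreal (C * \<bar>w x\<bar>)"
      using bound by (intro AE_I2 ennreal_leI) (simp add: mult.commute[of C] mult_left_mono)
  qed simp
  also have "\<dots> = ennreal (\<integral>x. C * \<bar>w x\<bar> \<partial>N)"
    using assms C_nonneg by (intro nn_integral_eq_integral) auto
  finally show ?thesis
    using C_nonneg by (simp add: ennreal_le_iff)
qed

lemma weighted_integral_density:
  assumes sets: "sets N = sets borel" and w: "integrable N w" "\<And>x. 0 \<le> w x"
  shows "weighted_integral (density N (\<lambda>x. ennreal (w x))) (\<lambda>_. 1) G = weighted_integral N w G"
proof -
  have [measurable]: "w \<in> borel_measurable N" using w by simp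
  have "grid_sum n (density N (\<lambda>x. ennreal (w x))) (\<lambda>_. 1) G = grid_sum n N w G" for n
    unfolding grid_sum_def
  proof (intro sum.cong refl arg_cong2[where f=scaleR])
    fix z
    have "indicator (grid n -` {z}) \<in> borel_measurable N"
      by (intro borel_measurable_indicator) (simp add: sets grid_vimage_sets)
    then show "(\<integral>x. 1 * indicator (grid n -` {z}) x \<partial>density N (\<lambda>x. ennreal (w x))) =
        (\<integral>x. w x * indicator (grid n -` {z}) x \<partial>N)"
      using w by (subst integral_density) auto
  qed
  then show ?thesis by (simp add: weighted_integral_def)
qed

text \<open>For grid sums the claim is Fubini's theorem for scalar kernels, cell by cell. The
  integrated grid errors tend to 0, so closedness under L1 limits finishes the argument. The last
  two conclusions keep these errors explicit because the differentiation theorem needs them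
  pointwise in x.\<close>

lemma weighted_integral_Fubini:
  fixes k :: "'a \<Rightarrow> real \<Rightarrow> real"
  assumes N: "sigma_finite_measure N" and P: "sigma_finite_measure P" and sets: "sets P = sets borel"
    and k: "integrable (N \<Otimes>\<^sub>M P) (\<lambda>(x, s). k x s)"
  shows "has_bochner N (\<lambda>x. weighted_integral P (k x) G) (weighted_integral P (\<lambda>s. \<integral>x. k x s \<partial>N) G)"
    and "(\<lambda>n. \<integral>\<^sup>+x. (\<integral>\<^sup>+s. ennreal (\<bar>k x s\<bar> * grid_error n s) \<partial>P) \<partial>N) \<longlonglongrightarrow> 0"
    and "AE x in N. \<forall>n. ennreal (norm (weighted_integral P (k x) G - grid_sum n P (k x) G))
        \<le> (\<integral>\<^sup>+s. ennreal (\<bar>k x s\<bar> * grid_error n s) \<partial>P)"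
proof -
  interpret pair_sigma_finite N P
    using N P by (intro pair_sigma_finite.intro)
  have m[measurable]: "(\<lambda>(x, s). k x s) \<in> borel_measurable (N \<Otimes>\<^sub>M P)" using k by (rule borel_measurable_integrable)
  have e[measurable]: "grid_error n \<in> borel_measurable P" "grid n -` {z} \<in> sets P" for n z
    by (simp_all add: measurable_cong_sets[OF sets refl] sets grid_vimage_sets)
  have id: "(\<lambda>s. s) \<in> P \<rightarrow>\<^sub>M borel"
    by (simp add: measurable_cong_sets[OF sets refl])
  have sndm: "snd \<in> borel_measurable (N \<Otimes>\<^sub>M P)"
    using measurable_comp[OF measurable_snd id] by (simp add: o_def)
  define \<psi> where "\<psi> n x = (\<integral>\<^sup>+s. ennreal (\<bar>k x s\<bar> * grid_error n s) \<partial>P)" for n x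
  have [measurable]: "\<psi> n \<in> borel_measurable N" for n
    unfolding \<psi>_def by measurable
  have \<psi>0: "(\<lambda>n. \<integral>\<^sup>+x. \<psi> n x \<partial>N) \<longlonglongrightarrow> 0"
  proof -
    have "(\<integral>\<^sup>+x. \<psi> n x \<partial>N) = (\<integral>\<^sup>+p. ennreal (\<bar>case p of (x, s) \<Rightarrow> k x s\<bar> * grid_error n (snd p)) \<partial>(N \<Otimes>\<^sub>M P))" for n
      unfolding \<psi>_def by (subst M2.nn_integral_fst[symmetric]) auto
    then show ?thesis
      using nn_integral_grid_error_tendsto[OF k sndm] by simp
  qed
  then show "(\<lambda>n. \<integral>\<^sup>+x. (\<integral>\<^sup>+s. ennreal (\<bar>k x s\<bar> * grid_error n s) \<partial>P) \<partial>N) \<longlonglongrightarrow> 0"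
    by (simp add: \<psi>_def)
  have ae: "AE x in N. integrable P (k x)"
    using AE_integrable_fst'[OF k] by simp
  have le: "ennreal (norm (weighted_integral P (k x) G - grid_sum n P (k x) G)) \<le> \<psi> n x"
    if x: "integrable P (k x)" for x n
    unfolding \<psi>_def
  proof (rule has_bochner_dist_bound[OF grid_sum_tendsto_has_bochner(2)[OF sets x] has_bochner_grid_sum[OF sets x]])
    show "(\<lambda>s. ennreal (\<bar>k x s\<bar> * grid_error n s)) \<in> borel_measurable P"
      using x by measurable
  qed (simp add: grid_error_def flip: scaleR_diff_right)
  show "AE x in N. \<forall>n. ennreal (norm (weighted_integral P (k x) G - grid_sum n P (k x) G))
        \<le> (\<integral>\<^sup>+s. ennreal (\<bar>k x s\<bar> * grid_error n s) \<partial>P)"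
    using ae by eventually_elim (use le in \<open>auto simp: \<psi>_def\<close>)
  define c where "c n z x s = k x s * indicator (grid n -` {z}) s" for n z x s
  have c: "integrable (N \<Otimes>\<^sub>M P) (\<lambda>(x, s). c n z x s)" for n z
  proof -
    have "integrable (N \<Otimes>\<^sub>M P) (\<lambda>(x, s). c n z x s) \<longleftrightarrow> integrable (N \<Otimes>\<^sub>M P)
        (\<lambda>p. (case p of (x, s) \<Rightarrow> k x s) * indicator (snd -` (grid n -` {z}) \<inter> space (N \<Otimes>\<^sub>M P)) p)"
      by (rule Bochner_Integration.integrable_cong) (auto simp: c_def indicator_def)
    moreover have "integrable (N \<Otimes>\<^sub>M P) (\<lambda>p. (case p of (x, s) \<Rightarrow> k x s) * indicator (snd -` (grid n -` {z}) \<inter> space (N \<Otimes>\<^sub>M P)) p)"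
      by (rule integrable_real_mult_indicator[OF _ k]) measurable
    ultimately show ?thesis by simp
  qed
  have "has_bochner N (\<lambda>x. grid_sum n P (k x) G) (grid_sum n P (\<lambda>s. \<integral>x. k x s \<partial>N) G)" for n
  proof -
    have "has_bochner N (\<lambda>x. (\<integral>s. c n z x s \<partial>P) *\<^sub>R G z) ((\<integral>s. (\<integral>x. k x s \<partial>N) * indicator (grid n -` {z}) s \<partial>P) *\<^sub>R G z)" for z
    proof (rule has_bochner_scaleR_left)
      have "has_bochner_integral N (\<lambda>x. \<integral>s. c n z x s \<partial>P) (\<integral>x. (\<integral>s. c n z x s \<partial>P) \<partial>N)"
        using integrable_fst'[OF c[of n z]] by (intro has_bochner_integral_integrable) simp
      also have "(\<integral>x. (\<integral>s. c n z x s \<partial>P) \<partial>N) = (\<integral>s. (\<integral>x. c n z x s \<partial>N) \<partial>P)"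
        using Fubini_integral[OF c[of n z]] by simp
      also have "\<dots> = (\<integral>s. (\<integral>x. k x s \<partial>N) * indicator (grid n -` {z}) s \<partial>P)"
        by (simp add: c_def)
      finally show "has_bochner_integral N (\<lambda>x. \<integral>s. c n z x s \<partial>P) (\<integral>s. (\<integral>x. k x s \<partial>N) * indicator (grid n -` {z}) s \<partial>P)" .
    qed
    then show ?thesis
      unfolding grid_sum_def c_def by (intro has_bochner_sum finite_range_grid)
  qed
  then have "\<exists>I. (\<lambda>n. grid_sum n P (\<lambda>s. \<integral>x. k x s \<partial>N) G) \<longlonglongrightarrow> I \<and> has_bochner N (\<lambda>x. weighted_integral P (k x) G) I"
  proof (rule has_bochner_limit[OF _ _ _ \<psi>0])
    show "AE x in N. ennreal (norm (weighted_integral P (k x) G - grid_sum n P (k x) G)) \<le> \<psi> n x" for n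
      using ae by eventually_elim (rule le)
  qed simp
  moreover have "(\<lambda>n. grid_sum n P (\<lambda>s. \<integral>x. k x s \<partial>N) G) \<longlonglongrightarrow> weighted_integral P (\<lambda>s. \<integral>x. k x s \<partial>N) G"
    using integrable_snd[OF k] by (intro grid_sum_tendsto_has_bochner[OF sets]) simp
  ultimately show "has_bochner N (\<lambda>x. weighted_integral P (k x) G) (weighted_integral P (\<lambda>s. \<integral>x. k x s \<partial>N) G)"
    using LIMSEQ_unique by blast
qed

end

section \<open>Uniqueness of Laplace transforms\<close>

text \<open>Weighting by exp (-x) makes both measures finite, and transforms at positive integers
  become moments of exp (-x), which lives in [0, 1]. Polynomials and then, by Weierstrass, all
  continuous functions of exp (-x) have equal integrals, and these determine the distribution
  functions.\<close>

lemma measure_eqI_Laplace: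
  fixes M N :: "real measure"
  assumes sets: "sets M = sets borel" "sets N = sets borel"
    and supp: "AE x in M. 0 \<le> x" "AE x in N. 0 \<le> x"
    and eq: "\<And>n::nat. 1 \<le> n \<Longrightarrow> (\<integral>\<^sup>+x. ennreal (exp (- (real n * x))) \<partial>M) = (\<integral>\<^sup>+x. ennreal (exp (- (real n * x))) \<partial>N)"
    and fin: "(\<integral>\<^sup>+x. ennreal (exp (- x)) \<partial>M) < \<infinity>"
  shows "M = N"
proof -
  \<comment> \<open>The n-th moment under the weighted measure is the transform at n + 1, and the
    weight can be undone because it is positive.\<close>
  have D: "finite_borel_measure (density K (\<lambda>x. ennreal (exp (- x)))) \<and>
      (AE x in density K (\<lambda>x. ennreal (exp (- x))). 0 \<le> x) \<and>
      K = density (density K (\<lambda>x. ennreal (exp (- x)))) (\<lambda>x. ennreal (exp x)) \<and>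
      (\<forall>n. (\<integral>\<^sup>+x. ennreal (exp (- x) ^ n) \<partial>density K (\<lambda>x. ennreal (exp (- x)))) =
         (\<integral>\<^sup>+x. ennreal (exp (- (real (Suc n) * x))) \<partial>K))"
    if s: "sets K = sets borel" and K: "(\<integral>\<^sup>+x. ennreal (exp (- x)) \<partial>K) < \<infinity>" and p: "AE x in K. 0 \<le> x"
    for K :: "real measure"
  proof (intro conjI allI)
    note [measurable_cong] = s
    show "finite_borel_measure (density K (\<lambda>x. ennreal (exp (- x))))"
    proof (intro finite_borel_measure.intro finite_measureI finite_borel_measure_axioms.intro)
      show "emeasure (density K (\<lambda>x. ennreal (exp (- x)))) (space (density K (\<lambda>x. ennreal (exp (- x))))) \<noteq> \<infinity>"
        using K sets_eq_imp_space_eq[OF s] by (simp add: emeasure_density)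
    qed (simp add: s)
    show "AE x in density K (\<lambda>x. ennreal (exp (- x))). 0 \<le> x"
      using p by (subst AE_density) auto
    have "density (density K (\<lambda>x. ennreal (exp (- x)))) (\<lambda>x. ennreal (exp x)) = density K (\<lambda>x. 1)"
      by (subst density_density_eq) (auto simp: exp_minus_inverse mult.commute simp flip: ennreal_mult)
    then show "K = density (density K (\<lambda>x. ennreal (exp (- x)))) (\<lambda>x. ennreal (exp x))"
      by (simp add: density_1)
    show "(\<integral>\<^sup>+x. ennreal (exp (- x) ^ n) \<partial>density K (\<lambda>x. ennreal (exp (- x)))) =
         (\<integral>\<^sup>+x. ennreal (exp (- (real (Suc n) * x))) \<partial>K)" for n
      by (subst nn_integral_density)
        (auto simp: exp_of_nat_mult[symmetric] algebra_simps simp flip: ennreal_mult exp_add)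
  qed
  define A where "A = density M (\<lambda>x. ennreal (exp (- x)))"
  define B where "B = density N (\<lambda>x. ennreal (exp (- x)))"
  have finN: "(\<integral>\<^sup>+x. ennreal (exp (- x)) \<partial>N) < \<infinity>"
    using fin eq[of 1] by simp
  note DA = D[OF sets(1) fin supp(1), folded A_def]
  note DB = D[OF sets(2) finN supp(2), folded B_def]
  interpret A: finite_borel_measure A using DA by simp
  interpret B: finite_borel_measure B using DB by simp
  note sA[measurable_cong] = A.M_is_borel and sB[measurable_cong] = B.M_is_borel
  have pA: "AE x in A. 0 \<le> x" and pB: "AE x in B. 0 \<le> x" using DA DB by auto
  have bA: "integrable A f" if [measurable]: "f \<in> borel_measurable borel" and "\<And>x. 0 \<le> x \<Longrightarrow> \<bar>f x\<bar> \<le> c" for f :: "real \<Rightarrow> real" and c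
    using pA that by (intro A.integrable_const_bound[of _ c]) (auto elim: eventually_mono)
  have bB: "integrable B f" if [measurable]: "f \<in> borel_measurable borel" and "\<And>x. 0 \<le> x \<Longrightarrow> \<bar>f x\<bar> \<le> c" for f :: "real \<Rightarrow> real" and c
    using pB that by (intro B.integrable_const_bound[of _ c]) (auto elim: eventually_mono)
  have pw: "integrable A (\<lambda>x. exp (- x) ^ n)" "integrable B (\<lambda>x. exp (- x) ^ n)" for n
    by (intro bA[where c=1] bB[where c=1]; simp add: power_le_one)+
  have mom: "(\<integral>x. exp (- x) ^ n \<partial>A) = (\<integral>x. exp (- x) ^ n \<partial>B)" for n
  proof -
    have "(\<integral>\<^sup>+x. ennreal (exp (- x) ^ n) \<partial>A) = (\<integral>\<^sup>+x. ennreal (exp (- x) ^ n) \<partial>B)"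
      using DA DB eq[of "Suc n"] by simp
    then show ?thesis
      by (simp add: integral_eq_nn_integral pw)
  qed
  have poly: "(\<integral>x. p (exp (- x)) \<partial>A) = (\<integral>x. p (exp (- x)) \<partial>B)" if rp: "real_polynomial_function p" for p
  proof -
    obtain a n where p: "p = (\<lambda>x. \<Sum>i\<le>n. a i * x ^ i)"
      using rp unfolding real_polynomial_function_iff_sum by blast
    show ?thesis
      unfolding p by (simp add: Bochner_Integration.integral_sum pw mom)
  qed
  have cts: "(\<integral>x. g (exp (- x)) \<partial>A) = (\<integral>x. g (exp (- x)) \<partial>B)"
    if g: "continuous_on UNIV g" for g :: "real \<Rightarrow> real"
  proof -
    have [measurable]: "g \<in> borel_measurable borel"
      using g by (rule borel_measurable_continuous_onI)
    have "compact (g ` {0..1})"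
      using continuous_on_subset[OF g] by (intro compact_continuous_image) auto
    then obtain c where c: "\<And>y. y \<in> {0..1} \<Longrightarrow> \<bar>g y\<bar> \<le> c"
      by (metis bounded_iff compact_imp_bounded imageI real_norm_def)
    have gi: "integrable A (\<lambda>x. g (exp (- x)))" "integrable B (\<lambda>x. g (exp (- x)))"
      using c by (intro bA[where c=c] bB[where c=c]; simp)+
    \<comment> \<open>The summand 1 keeps the tolerance e / T meaningful when both measures
      vanish.\<close>
    define T where "T = measure A (space A) + measure B (space B) + 1"
    have T: "T > 0" by (simp add: T_def add_nonneg_pos)
    have "\<bar>(\<integral>x. g (exp (- x)) \<partial>A) - (\<integral>x. g (exp (- x)) \<partial>B)\<bar> \<le> 0 + e" if "0 < e" for e
    proof -
      obtain p where p: "real_polynomial_function p" "\<And>y. y \<in> {0..1} \<Longrightarrow> \<bar>g y - p y\<bar> < e / T"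
        using Stone_Weierstrass_real_polynomial_function[of "{0..1::real}" g "e / T"] continuous_on_subset[OF g]
          \<open>0 < e\<close> T by auto
      have "continuous_on UNIV p"
        using p(1) by (simp add: continuous_on_polymonial_function real_polynomial_function_eq)
      then have [measurable]: "p \<in> borel_measurable borel"
        by (rule borel_measurable_continuous_onI)
      have le: "\<bar>g (exp (- x)) - p (exp (- x))\<bar> \<le> e / T" if "0 \<le> x" for x
        using p(2)[of "exp (- x)"] that by simp
      have di: "integrable A (\<lambda>x. g (exp (- x)) - p (exp (- x)))" "integrable B (\<lambda>x. g (exp (- x)) - p (exp (- x)))"
        using le by (intro bA[where c="e / T"] bB[where c="e / T"]; simp)+
      then have pi: "integrable A (\<lambda>x. p (exp (- x)))" "integrable B (\<lambda>x. p (exp (- x)))"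
        using Bochner_Integration.integrable_diff[OF gi(1) di(1)] Bochner_Integration.integrable_diff[OF gi(2) di(2)] by simp_all
      have "(\<integral>x. g (exp (- x)) \<partial>A) - (\<integral>x. g (exp (- x)) \<partial>B) =
          (\<integral>x. g (exp (- x)) - p (exp (- x)) \<partial>A) - (\<integral>x. g (exp (- x)) - p (exp (- x)) \<partial>B)"
        using gi pi poly[OF p(1)] by simp
      moreover have "\<bar>\<integral>x. g (exp (- x)) - p (exp (- x)) \<partial>A\<bar> \<le> (\<integral>x. e / T \<partial>A)"
        using le pA di by (intro order_trans[OF integral_abs_bound] integral_mono_AE) (auto elim: eventually_mono)
      moreover have "\<bar>\<integral>x. g (exp (- x)) - p (exp (- x)) \<partial>B\<bar> \<le> (\<integral>x. e / T \<partial>B)"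
        using le pB di by (intro order_trans[OF integral_abs_bound] integral_mono_AE) (auto elim: eventually_mono)
      ultimately have "\<bar>(\<integral>x. g (exp (- x)) \<partial>A) - (\<integral>x. g (exp (- x)) \<partial>B)\<bar> \<le> (measure A (space A) + measure B (space B)) * (e / T)"
        by (simp add: algebra_simps)
      also have "\<dots> \<le> T * (e / T)"
        using \<open>0 < e\<close> T by (intro mult_right_mono) (auto simp: T_def)
      finally show ?thesis using T by simp
    qed
    then show ?thesis using field_le_epsilon[of "\<bar>(\<integral>x. g (exp (- x)) \<partial>A) - (\<integral>x. g (exp (- x)) \<partial>B)\<bar>" 0] by auto
  qed
  have "cdf A c = cdf B c" for c
  proof -
    \<comment> \<open>A continuous ramp in y = exp (-x): it equals 1 for x \<le> c and falls to 0
      with slope j beyond, so it tends to the indicator of x \<le> c.\<close>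
    define g where "g j y = max 0 (1 - real j * max 0 (exp (- c) - y))" for j y
    have [measurable]: "g j \<in> borel_measurable borel" for j
      unfolding g_def by measurable
    have lim: "(\<lambda>j. g j (exp (- x))) \<longlonglongrightarrow> indicator {..c} x" for x
    proof (cases "x \<le> c")
      case True
      then have "g j (exp (- x)) = 1" for j by (simp add: g_def)
      with True show ?thesis by simp
    next
      case False
      then have d: "0 < exp (- c) - exp (- x)" by simp
      obtain N :: nat where N: "1 / (exp (- c) - exp (- x)) < real N"
        using reals_Archimedean2 by blast
      have "g j (exp (- x)) = 0" if "N \<le> j" for j
      proof -
        have "1 \<le> real N * (exp (- c) - exp (- x))" using N d by (simp add: field_simps)
        also have "\<dots> \<le> real j * (exp (- c) - exp (- x))" using that d by (intro mult_right_mono) auto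
        finally show ?thesis using d by (simp add: g_def)
      qed
      then have "eventually (\<lambda>j. g j (exp (- x)) = indicator {..c} x) sequentially"
        using False by (auto simp: eventually_sequentially)
      then show ?thesis by (rule tendsto_eventually)
    qed
    have "(\<lambda>j. \<integral>x. g j (exp (- x)) \<partial>A) \<longlonglongrightarrow> (\<integral>x. indicator {..c} x \<partial>A)"
      by (rule integral_dominated_convergence[where w="\<lambda>_. 1"]) (auto simp: lim, auto simp: g_def)
    moreover have "(\<lambda>j. \<integral>x. g j (exp (- x)) \<partial>B) \<longlonglongrightarrow> (\<integral>x. indicator {..c} x \<partial>B)"
      by (rule integral_dominated_convergence[where w="\<lambda>_. 1"]) (auto simp: lim, auto simp: g_def)
    moreover have "(\<integral>x. g j (exp (- x)) \<partial>A) = (\<integral>x. g j (exp (- x)) \<partial>B)" for j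
      by (rule cts) (auto simp: g_def intro!: continuous_intros)
    ultimately have "(\<integral>x. indicator {..c} x \<partial>A) = (\<integral>x. indicator {..c} x \<partial>B :: real)"
      using LIMSEQ_unique by simp
    then show ?thesis
      by (simp add: cdf_def sets_eq_imp_space_eq[OF sA] sets_eq_imp_space_eq[OF sB])
  qed
  then have "A = B"
    by (intro cdf_unique' ext) unfold_locales
  then show "M = N"
    using DA DB by metis
qed

section \<open>Lebesgue differentiation\<close>

text \<open>The weak type inequality of Hardy and Littlewood for intervals with one end at x, with a
  Borel cover in place of the bad set, whose measurability is not at hand. Vitali's lemma selects
  disjoint balls of radius r whose fivefold dilates, of length 10 r, cover the bad set; each ball
  carries mass above \<epsilon> r, whence the factor 10 / \<epsilon>.\<close>

lemma maximal_inequality: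
  fixes \<phi> :: "real \<Rightarrow> real"
  assumes \<phi>: "integrable lborel \<phi>" "\<And>x. 0 \<le> \<phi> x" and \<epsilon>: "0 < \<epsilon>"
  shows "\<exists>W\<in>sets lborel. {x. \<exists>y. \<epsilon> * \<bar>y - x\<bar> < (\<integral>z. \<phi> z * indicator {min x y<..<max x y} z \<partial>lborel)} \<subseteq> W \<and>
    emeasure lborel W \<le> ennreal (10 / \<epsilon> * (\<integral>z. \<phi> z \<partial>lborel))"
proof -
  define E where "E = {x. \<exists>y. \<epsilon> * \<bar>y - x\<bar> < (\<integral>z. \<phi> z * indicator {min x y<..<max x y} z \<partial>lborel)}"
  have [measurable]: "\<phi> \<in> borel_measurable borel" using \<phi>(1) by simp
  define Y where "Y x = (SOME y. \<epsilon> * \<bar>y - x\<bar> < (\<integral>z. \<phi> z * indicator {min x y<..<max x y} z \<partial>lborel))" for x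
  define r where "r x = \<bar>Y x - x\<bar>" for x
  have Y: "\<epsilon> * r x < (\<integral>z. \<phi> z * indicator {min x (Y x)<..<max x (Y x)} z \<partial>lborel)" if "x \<in> E" for x
    unfolding r_def Y_def using that[unfolded E_def] by (auto intro: someI_ex)
  have int: "integrable lborel (\<lambda>z. \<phi> z * indicator S z)" if "S \<in> sets borel" for S
    using that \<phi>(1) by (intro integrable_real_mult_indicator) auto
  have bd: "(\<integral>z. \<phi> z * indicator S z \<partial>lborel) \<le> (\<integral>z. \<phi> z \<partial>lborel)" if "S \<in> sets borel" for S
    using \<phi> int[OF that] by (intro integral_mono) (auto simp: indicator_def)
  have rpos: "0 < r x" if "x \<in> E" for x
    using Y[OF that] by (cases "Y x = x") (auto simp: r_def)
  \<comment> \<open>The covering lemma requires bounded radii; the total integral bounds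
    them.\<close>
  have rB: "0 < r x \<and> r x \<le> (\<integral>z. \<phi> z \<partial>lborel) / \<epsilon>" if "x \<in> E" for x
    using Y[OF that] bd[of "{min x (Y x)<..<max x (Y x)}"] \<epsilon> rpos[OF that] by (simp add: field_simps)
  have sub: "E \<subseteq> (\<Union>x\<in>E. ball x (r x))"
    using rpos by fastforce
  obtain D where D: "countable D" "D \<subseteq> E"
    "pairwise (\<lambda>i j. disjnt (ball i (r i)) (ball j (r j))) D"
    "E \<subseteq> (\<Union>i\<in>D. ball i (5 * r i))"
    by (rule Vitali_covering_lemma_balls[where a="\<lambda>x. x" and r=r, OF sub rB]) auto
  define W where "W = (\<Union>i\<in>D. ball i (5 * r i))"
  define \<mu> where "\<mu> = density lborel (\<lambda>x. ennreal (\<phi> x))"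
  \<comment> \<open>The countable family of balls is enumerated by the naturals, with empty sets at
    indices that do not occur, so that countable additivity and subadditivity apply.\<close>
  define S where "S n = (if n \<in> to_nat_on D ` D then ball (from_nat_into D n) (r (from_nat_into D n)) else {})" for n
  define V where "V n = (if n \<in> to_nat_on D ` D then ball (from_nat_into D n) (5 * r (from_nat_into D n)) else {})" for n
  have fn: "from_nat_into D (to_nat_on D x) = x" if "x \<in> D" for x
    using that D(1) by simp
  have VS: "emeasure lborel (V n) \<le> ennreal (10 / \<epsilon>) * emeasure \<mu> (S n)" for n
  proof (cases "n \<in> to_nat_on D ` D")
    case True
    then obtain x where x: "x \<in> D" "n = to_nat_on D x" by auto
    have xE: "x \<in> E" using x D(2) by blast
    have eqV: "V n = ball x (5 * r x)" "S n = ball x (r x)" using x fn True by (auto simp: V_def S_def)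
    have "emeasure lborel (V n) = ennreal (10 * r x)"
      using rpos[OF xE] by (simp add: eqV ball_eq_greaterThanLessThan)
    also have "\<dots> = ennreal (10 / \<epsilon> * (\<epsilon> * r x))" using \<epsilon> by simp
    also have "\<dots> \<le> ennreal (10 / \<epsilon> * (\<integral>z. \<phi> z * indicator {min x (Y x)<..<max x (Y x)} z \<partial>lborel))"
      using Y[OF xE] \<epsilon> by (intro ennreal_leI mult_left_mono) auto
    also have "\<dots> = ennreal (10 / \<epsilon>) * ennreal (\<integral>z. \<phi> z * indicator {min x (Y x)<..<max x (Y x)} z \<partial>lborel)"
      using \<epsilon> \<phi>(2) by (intro ennreal_mult) auto
    also have "ennreal (\<integral>z. \<phi> z * indicator {min x (Y x)<..<max x (Y x)} z \<partial>lborel) \<le> emeasure \<mu> (S n)"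
    proof -
      have "ennreal (\<integral>z. \<phi> z * indicator {min x (Y x)<..<max x (Y x)} z \<partial>lborel)
          = (\<integral>\<^sup>+z. ennreal (\<phi> z * indicator {min x (Y x)<..<max x (Y x)} z) \<partial>lborel)"
        using \<phi>(2) by (intro nn_integral_eq_integral[symmetric] int) auto
      also have "\<dots> \<le> (\<integral>\<^sup>+z. ennreal (\<phi> z) * indicator (S n) z \<partial>lborel)"
        by (intro nn_integral_mono) (auto simp: indicator_def eqV r_def dist_real_def)
      also have "\<dots> = emeasure \<mu> (S n)"
        by (simp add: \<mu>_def emeasure_density eqV)
      finally show ?thesis .
    qed
    finally show ?thesis by (simp add: mult_left_mono)
  next
    case False
    then have "V n = {}" "S n = {}" by (auto simp: V_def S_def)
    then show ?thesis by simp
  qed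
  have Wsub: "W = (\<Union>n. V n)"
  proof (intro equalityI subsetI)
    fix y assume "y \<in> W"
    then obtain x where "x \<in> D" "y \<in> ball x (5 * r x)" by (auto simp: W_def)
    then show "y \<in> (\<Union>n. V n)"
      using fn by (intro UN_I[of "to_nat_on D x"]) (auto simp: V_def)
  next
    fix y assume "y \<in> (\<Union>n. V n)"
    then obtain n where n: "y \<in> V n" by auto
    then obtain x where "x \<in> D" "n = to_nat_on D x" by (auto simp: V_def split: if_splits)
    then show "y \<in> W" using n fn by (auto simp: W_def V_def)
  qed
  have disj: "disjoint_family S"
  proof (unfold disjoint_family_on_def, intro ballI impI)
    fix m n :: nat assume "m \<noteq> n"
    show "S m \<inter> S n = {}"
    proof (cases "m \<in> to_nat_on D ` D \<and> n \<in> to_nat_on D ` D")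
      case True
      then obtain x y where xy: "x \<in> D" "m = to_nat_on D x" "y \<in> D" "n = to_nat_on D y" by auto
      then have "x \<noteq> y" using \<open>m \<noteq> n\<close> by auto
      then have "disjnt (ball x (r x)) (ball y (r y))" using D(3) xy by (auto simp: pairwise_def)
      then show ?thesis using xy fn by (auto simp: S_def disjnt_def)
    qed (auto simp: S_def)
  qed
  have "emeasure lborel W \<le> (\<Sum>n. emeasure lborel (V n))"
    unfolding Wsub by (rule emeasure_subadditive_countably) (auto simp: V_def)
  also have "\<dots> \<le> (\<Sum>n. ennreal (10 / \<epsilon>) * emeasure \<mu> (S n))"
    by (intro suminf_le VS) auto
  also have "\<dots> = ennreal (10 / \<epsilon>) * emeasure \<mu> (\<Union>n. S n)"
  proof -
    have "range S \<subseteq> sets \<mu>" by (auto simp: \<mu>_def S_def)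
    then show ?thesis using suminf_emeasure[OF _ disj, of \<mu>] by simp
  qed
  also have "\<dots> \<le> ennreal (10 / \<epsilon>) * emeasure \<mu> UNIV"
    by (intro mult_left_mono emeasure_mono) (auto simp: \<mu>_def)
  also have "emeasure \<mu> UNIV = ennreal (\<integral>z. \<phi> z \<partial>lborel)"
    using \<phi> by (simp add: \<mu>_def emeasure_density nn_integral_eq_integral)
  also have "ennreal (10 / \<epsilon>) * \<dots> = ennreal (10 / \<epsilon> * (\<integral>z. \<phi> z \<partial>lborel))"
    using \<epsilon> \<phi>(2) by (intro ennreal_mult[symmetric]) auto
  finally have "emeasure lborel W \<le> ennreal (10 / \<epsilon> * (\<integral>z. \<phi> z \<partial>lborel))" .
  moreover have "W \<in> sets lborel"
    unfolding W_def by (intro sets.countable_UN'[OF D(1)]) auto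
  ultimately show ?thesis
    using D(4) unfolding W_def E_def[symmetric] by blast
qed

text \<open>Almost everywhere differentiation passes to L1 limits. Off a small set the maximal
  inequality bounds increments of Q - Qn n by \<epsilon> |y - x|, and Chebyshev's inequality bounds
  \<phi> n by \<epsilon>. A point that is bad for every n lies in sets of arbitrarily small
  measure.\<close>

lemma has_vector_derivative_AE_limit:
  fixes Q :: "real \<Rightarrow> 'b::real_normed_vector"
  assumes Qn: "\<And>n::nat. AE x in lborel. (Qn n has_vector_derivative gn n x) (at x)"
    and \<phi>: "\<And>n. integrable lborel (\<phi> n)" "\<And>n x. 0 \<le> \<phi> n x"
    and lim: "(\<lambda>n. \<integral>z. \<phi> n z \<partial>lborel) \<longlonglongrightarrow> 0"
    and incr: "\<And>n x y. norm ((Q y - Qn n y) - (Q x - Qn n x)) \<le> (\<integral>z. \<phi> n z * indicator {min x y<..<max x y} z \<partial>lborel)"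
    and g: "AE x in lborel. \<forall>n. norm (g x - gn n x) \<le> \<phi> n x"
  shows "AE x in lborel. (Q has_vector_derivative g x) (at x)"
proof -
  have [measurable]: "\<phi> n \<in> borel_measurable borel" for n using \<phi>(1)[of n] by simp
  have small: "AE x in lborel. \<exists>n. (\<forall>y. (\<integral>z. \<phi> n z * indicator {min x y<..<max x y} z \<partial>lborel) \<le> \<epsilon> * \<bar>y - x\<bar>) \<and> \<phi> n x \<le> \<epsilon>"
    if \<epsilon>: "0 < \<epsilon>" for \<epsilon>
  proof -
    define E where "E n = {x. \<exists>y. \<epsilon> * \<bar>y - x\<bar> < (\<integral>z. \<phi> n z * indicator {min x y<..<max x y} z \<partial>lborel)}" for n
    have "\<forall>n. \<exists>W. W \<in> sets lborel \<and> E n \<subseteq> W \<and> emeasure lborel W \<le> ennreal (10 / \<epsilon> * (\<integral>z. \<phi> n z \<partial>lborel))"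
      unfolding E_def using maximal_inequality[OF \<phi>(1) \<phi>(2) \<epsilon>] by blast
    then obtain W where W: "\<And>n. W n \<in> sets lborel" "\<And>n. E n \<subseteq> W n"
      "\<And>n. emeasure lborel (W n) \<le> ennreal (10 / \<epsilon> * (\<integral>z. \<phi> n z \<partial>lborel))"
      by metis
    \<comment> \<open>The bad set of the maximal function has measure at most 10 / \<epsilon> times
      the integral and the Chebyshev set at most 1 / \<epsilon> times it; this is the 11
      below.\<close>
    define V where "V n = W n \<union> {x. \<epsilon> < \<phi> n x}" for n
    have [measurable]: "W n \<in> sets borel" for n using W(1)[of n] by simp
    have [measurable]: "V n \<in> sets lborel" for n
      unfolding V_def using W(1) by measurable
    have "emeasure lborel (V n) \<le> ennreal (11 / \<epsilon> * (\<integral>z. \<phi> n z \<partial>lborel))" for n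
    proof -
      have "emeasure lborel {x. \<epsilon> < \<phi> n x} \<le> (\<integral>\<^sup>+x. ennreal (\<phi> n x / \<epsilon>) \<partial>lborel)"
      proof -
        have "emeasure lborel {x. \<epsilon> < \<phi> n x} = (\<integral>\<^sup>+x. indicator {x. \<epsilon> < \<phi> n x} x \<partial>lborel)"
          by simp
        also have "\<dots> \<le> (\<integral>\<^sup>+x. ennreal (\<phi> n x / \<epsilon>) \<partial>lborel)"
          using \<epsilon> by (intro nn_integral_mono) (auto simp: indicator_def)
        finally show ?thesis .
      qed
      also have "\<dots> = ennreal (1 / \<epsilon> * (\<integral>z. \<phi> n z \<partial>lborel))"
        using \<phi> \<epsilon> by (subst nn_integral_eq_integral) auto
      finally have "emeasure lborel (W n) + emeasure lborel {x. \<epsilon> < \<phi> n x}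
          \<le> ennreal (10 / \<epsilon> * (\<integral>z. \<phi> n z \<partial>lborel)) + ennreal (1 / \<epsilon> * (\<integral>z. \<phi> n z \<partial>lborel))"
        using W(3) by (intro add_mono)
      moreover have "emeasure lborel (V n) \<le> emeasure lborel (W n) + emeasure lborel {x. \<epsilon> < \<phi> n x}"
        unfolding V_def by (intro emeasure_subadditive) (auto simp: W(1))
      moreover have "ennreal (10 / \<epsilon> * (\<integral>z. \<phi> n z \<partial>lborel)) + ennreal (1 / \<epsilon> * (\<integral>z. \<phi> n z \<partial>lborel))
          = ennreal (11 / \<epsilon> * (\<integral>z. \<phi> n z \<partial>lborel))"
        using \<epsilon> \<phi> by (subst ennreal_plus[symmetric]) (auto simp: field_simps)
      ultimately show ?thesis by simp
    qed
    then have "emeasure lborel (\<Inter>n. V n) \<le> ennreal (11 / \<epsilon> * (\<integral>z. \<phi> n z \<partial>lborel))" for n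
      by (meson INT_lower UNIV_I emeasure_mono \<open>\<And>n. V n \<in> sets lborel\<close> order_trans)
    moreover have "(\<lambda>n. ennreal (11 / \<epsilon> * (\<integral>z. \<phi> n z \<partial>lborel))) \<longlonglongrightarrow> ennreal (11 / \<epsilon> * 0)"
      by (intro tendsto_ennrealI tendsto_intros lim)
    ultimately have "emeasure lborel (\<Inter>n. V n) \<le> ennreal (11 / \<epsilon> * 0)"
      by (intro LIMSEQ_le_const[where X="\<lambda>n. ennreal (11 / \<epsilon> * (\<integral>z. \<phi> n z \<partial>lborel))"]) auto
    moreover have "(\<Inter>n. V n) \<in> sets lborel"
      by (rule sets.countable_INT'') measurable
    ultimately have "(\<Inter>n. V n) \<in> null_sets lborel"
      by (intro null_setsI) auto
    then show ?thesis
    proof (rule AE_I', intro subsetI INT_I)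
      fix x n
      assume x: "x \<in> {x \<in> space lborel. \<not> (\<exists>n. (\<forall>y. (\<integral>z. \<phi> n z * indicator {min x y<..<max x y} z \<partial>lborel) \<le> \<epsilon> * \<bar>y - x\<bar>) \<and> \<phi> n x \<le> \<epsilon>)}"
      then have "x \<in> E n \<or> \<epsilon> < \<phi> n x"
        unfolding E_def by (auto simp: not_le)
      then show "x \<in> V n"
        using W(2) by (auto simp: V_def)
    qed
  qed
  have "AE x in lborel. \<forall>j::nat. \<exists>n. (\<forall>y. (\<integral>z. \<phi> n z * indicator {min x y<..<max x y} z \<partial>lborel) \<le> (1 / Suc j) * \<bar>y - x\<bar>) \<and> \<phi> n x \<le> 1 / Suc j"
    unfolding AE_all_countable by (intro allI small) simp
  moreover have "AE x in lborel. \<forall>n. (Qn n has_vector_derivative gn n x) (at x)"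
    unfolding AE_all_countable using Qn by blast
  ultimately show ?thesis
    using g
  proof eventually_elim
    fix x
    assume sm: "\<forall>j::nat. \<exists>n. (\<forall>y. (\<integral>z. \<phi> n z * indicator {min x y<..<max x y} z \<partial>lborel) \<le> (1 / Suc j) * \<bar>y - x\<bar>) \<and> \<phi> n x \<le> 1 / Suc j"
      and d: "\<forall>n. (Qn n has_vector_derivative gn n x) (at x)"
      and gx: "\<forall>n. norm (g x - gn n x) \<le> \<phi> n x"
    show "(Q has_vector_derivative g x) (at x)"
      unfolding has_vector_derivative_def has_derivative_at_alt
    proof (intro conjI allI impI bounded_linear_scaleR_left)
      fix e :: real assume "0 < e"
      \<comment> \<open>Three errors, each at most |y - x| / Suc j, have to stay below e |y - x|
        together.\<close>
      obtain j where j: "3 / e < real j" using reals_Archimedean2 by blast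
      then have "3 / e < Suc j" by simp
      then have j3: "3 * (1 / Suc j) < e" using \<open>0 < e\<close> by (simp add: field_simps)
      obtain n where n: "\<And>y. (\<integral>z. \<phi> n z * indicator {min x y<..<max x y} z \<partial>lborel) \<le> (1 / Suc j) * \<bar>y - x\<bar>" "\<phi> n x \<le> 1 / Suc j"
        using sm by blast
      obtain d where d: "d > 0" "\<And>y. norm (y - x) < d \<Longrightarrow> norm (Qn n y - Qn n x - (y - x) *\<^sub>R gn n x) \<le> (1 / Suc j) * norm (y - x)"
        using d[rule_format, of n] unfolding has_vector_derivative_def has_derivative_at_alt
        by (metis of_nat_0_less_iff zero_less_Suc zero_less_divide_1_iff)
      show "\<exists>d>0. \<forall>y. norm (y - x) < d \<longrightarrow> norm (Q y - Q x - (y - x) *\<^sub>R g x) \<le> e * norm (y - x)"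
      proof (intro exI conjI allI impI)
        fix y assume y: "norm (y - x) < d"
        have "Q y - Q x - (y - x) *\<^sub>R g x = ((Q y - Qn n y) - (Q x - Qn n x)) +
            (Qn n y - Qn n x - (y - x) *\<^sub>R gn n x) - (y - x) *\<^sub>R (g x - gn n x)"
          by (simp add: algebra_simps)
        also have "norm \<dots> \<le> norm ((Q y - Qn n y) - (Q x - Qn n x)) +
            norm (Qn n y - Qn n x - (y - x) *\<^sub>R gn n x) + norm ((y - x) *\<^sub>R (g x - gn n x))"
          using norm_triangle_ineq4 norm_triangle_ineq by (meson add_right_mono order_trans)
        also have "\<dots> \<le> (1 / Suc j) * \<bar>y - x\<bar> + (1 / Suc j) * \<bar>y - x\<bar> + (1 / Suc j) * \<bar>y - x\<bar>"
        proof (intro add_mono)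
          show "norm ((Q y - Qn n y) - (Q x - Qn n x)) \<le> (1 / Suc j) * \<bar>y - x\<bar>"
            using incr[where n=n and x=x and y=y] n(1)[of y] by simp
          show "norm (Qn n y - Qn n x - (y - x) *\<^sub>R gn n x) \<le> (1 / Suc j) * \<bar>y - x\<bar>"
            using d(2)[OF y] by simp
          have "norm (g x - gn n x) \<le> 1 / Suc j" using gx n(2) order_trans by blast
          then have "\<bar>y - x\<bar> * norm (g x - gn n x) \<le> \<bar>y - x\<bar> * (1 / Suc j)"
            by (intro mult_left_mono) auto
          then show "norm ((y - x) *\<^sub>R (g x - gn n x)) \<le> (1 / Suc j) * \<bar>y - x\<bar>"
            by (simp add: mult.commute)
        qed
        also have "\<dots> = 3 * (1 / Suc j) * \<bar>y - x\<bar>" by simp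
        also have "\<dots> \<le> e * norm (y - x)"
          using mult_right_mono[OF less_imp_le[OF j3], of "\<bar>y - x\<bar>"] by simp
        finally show "norm (Q y - Q x - (y - x) *\<^sub>R g x) \<le> e * norm (y - x)" .
      qed (use d in simp)
    qed
  qed
qed

definition primitive :: "(real \<Rightarrow> real) \<Rightarrow> real \<Rightarrow> real" where
  "primitive c t = (\<integral>z. c z * indicator {..t} z \<partial>lborel)"

lemma primitive_diff:
  assumes c: "integrable lborel c" and "x \<le> y"
  shows "primitive c y - primitive c x = (\<integral>z. c z * indicator {x<..<y} z \<partial>lborel)"
proof -
  have int: "integrable lborel (\<lambda>z. c z * indicator S z)" if "S \<in> sets borel" for S
    using that c by (intro integrable_real_mult_indicator) auto
  have [measurable]: "c \<in> borel_measurable borel" using c by simp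
  have "primitive c y - primitive c x = (\<integral>z. c z * indicator {..y} z - c z * indicator {..x} z \<partial>lborel)"
    unfolding primitive_def by (intro Bochner_Integration.integral_diff[symmetric] int) auto
  also have "\<dots> = (\<integral>z. c z * indicator {x<..<y} z \<partial>lborel)"
  proof (rule integral_cong_AE)
    show "AE z in lborel. c z * indicator {..y} z - c z * indicator {..x} z = c z * indicator {x<..<y} z"
      using AE_lborel_singleton[of y] by eventually_elim (use \<open>x \<le> y\<close> in \<open>auto simp: indicator_def\<close>)
  qed auto
  finally show ?thesis .
qed

lemma primitive_increment_bound:
  assumes c: "integrable lborel c"
  shows "\<bar>primitive c y - primitive c x\<bar> \<le> (\<integral>z. \<bar>c z\<bar> * indicator {min x y<..<max x y} z \<partial>lborel)"
proof -
  have *: "\<bar>primitive c y - primitive c x\<bar> \<le> (\<integral>z. \<bar>c z\<bar> * indicator {x<..<y} z \<partial>lborel)" if "x \<le> y" for x y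
    unfolding primitive_diff[OF c that]
    by (rule order_trans[OF integral_abs_bound]) (simp add: abs_mult)
  show ?thesis
    using *[of x y] *[of y x] by (cases "x \<le> y") (auto simp: min_def max_def abs_minus_commute)
qed

lemma primitive_add_diff:
  assumes "integrable lborel c" "integrable lborel d"
  shows "primitive (\<lambda>z. c z + d z) t = primitive c t + primitive d t"
    "primitive (\<lambda>z. c z - d z) t = primitive c t - primitive d t"
  using assms by (auto simp: primitive_def ring_distribs integrable_real_mult_indicator
    intro!: Bochner_Integration.integral_add Bochner_Integration.integral_diff)

lemma primitive_has_derivative_continuous:
  assumes c: "integrable lborel c" and cont: "continuous_on UNIV c"
  shows "(primitive c has_vector_derivative c x) (at x)"
  unfolding has_vector_derivative_def has_derivative_at_alt
proof (intro conjI allI impI bounded_linear_scaleR_left)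
  fix e :: real assume "0 < e"
  have [measurable]: "c \<in> borel_measurable borel" using c by simp
  have "isCont c x" using cont by (simp add: continuous_on_eq_continuous_at)
  then obtain d where d: "d > 0" "\<And>z. dist z x < d \<Longrightarrow> dist (c z) (c x) < e"
    using \<open>0 < e\<close> unfolding continuous_at_eps_delta by metis
  have *: "\<bar>primitive c v - primitive c u - (v - u) * c x\<bar> \<le> e * (v - u)"
    if uv: "u \<le> v" "\<And>z. z \<in> {u<..<v} \<Longrightarrow> dist z x < d" for u v
  proof -
    have i: "integrable lborel (\<lambda>z. c z * indicator {u<..<v} z)"
      using c by (intro integrable_real_mult_indicator) auto
    have i': "integrable lborel (\<lambda>z. k * indicator {u<..<v} z)" "(\<integral>z. k * indicator {u<..<v} z \<partial>lborel) = k * (v - u)" for k :: real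
      using uv by (auto intro!: integrable_mult_right)
    have "primitive c v - primitive c u - (v - u) * c x = (\<integral>z. c z * indicator {u<..<v} z - c x * indicator {u<..<v} z \<partial>lborel)"
      using i i' uv(1) by (simp add: primitive_diff[OF c uv(1)])
    also have "\<bar>\<dots>\<bar> \<le> (\<integral>z. \<bar>c z * indicator {u<..<v} z - c x * indicator {u<..<v} z\<bar> \<partial>lborel)"
      by (rule integral_abs_bound)
    also have "\<dots> \<le> (\<integral>z. e * indicator {u<..<v} z \<partial>lborel)"
    proof (intro integral_mono integrable_abs Bochner_Integration.integrable_diff i i')
      fix z show "\<bar>c z * indicator {u<..<v} z - c x * indicator {u<..<v} z\<bar> \<le> e * indicator {u<..<v} z"
        using d(2)[of z] uv(2)[of z] by (auto simp: indicator_def dist_real_def)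
    qed
    finally show ?thesis using uv(1) by simp
  qed
  show "\<exists>d>0. \<forall>y. norm (y - x) < d \<longrightarrow> norm (primitive c y - primitive c x - (y - x) *\<^sub>R c x) \<le> e * norm (y - x)"
  proof (intro exI[of _ d] conjI allI impI d)
    fix y assume y: "norm (y - x) < d"
    show "norm (primitive c y - primitive c x - (y - x) *\<^sub>R c x) \<le> e * norm (y - x)"
    proof (cases "x \<le> y")
      case True
      then show ?thesis using *[of x y] y by (auto simp: dist_real_def)
    next
      case False
      have "norm (primitive c y - primitive c x - (y - x) *\<^sub>R c x) = \<bar>primitive c x - primitive c y - (x - y) * c x\<bar>"
        by (simp add: abs_minus_commute algebra_simps)
      then show ?thesis using *[of y x] y False by (auto simp: dist_real_def)
    qed
  qed
qed

text \<open>Induction over integrable functions. An indicator is approximated in L1 by continuous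
  functions, which are handled by the fundamental theorem of calculus; sums are immediate, and
  dominated limits fall under the criterion for L1 limits.\<close>

theorem Lebesgue_differentiation:
  assumes "integrable lborel c"
  shows "AE x in lborel. (primitive c has_vector_derivative c x) (at x)"
  using assms
proof (induction c rule: integrable_induct)
  case (base A k)
  have A: "A \<in> sets lebesgue" using base by simp
  have [measurable]: "A \<in> sets borel" using base by simp
  have "\<exists>(h :: real \<Rightarrow> real) S. continuous_on UNIV h \<and> integrable lborel h \<and> S \<in> sets lborel \<and> emeasure lborel S < ennreal (2 / Suc n) \<and>
      (\<forall>x. \<bar>indicator A x - h x\<bar> \<le> indicator S x)" for n
  proof -
    \<comment> \<open>A is squeezed between a closed F and an open U with small gaps on both sides.
      A Urysohn function for F and the complement of U then differs from the indicator of A only on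
      U - F.\<close>
    obtain U where U: "open U" "A \<subseteq> U" "U - A \<in> lmeasurable" "emeasure lebesgue (U - A) < ennreal (1 / Suc n)"
      by (rule sets_lebesgue_outer_open[OF A, of "1 / Suc n"]) auto
    obtain F where F: "closed F" "F \<subseteq> A" "A - F \<in> lmeasurable" "emeasure lebesgue (A - F) < ennreal (1 / Suc n)"
      by (rule sets_lebesgue_inner_closed[OF A, of "1 / Suc n"]) auto
    have "closed (- U)" "F \<inter> - U = {}" using U F by auto
    then have "\<exists>h :: real \<Rightarrow> real. continuous_on UNIV h \<and> (\<forall>x. h x \<in> closed_segment 1 0) \<and>
        (\<forall>x\<in>F. h x = 1) \<and> (\<forall>x\<in>- U. h x = 0)"
      using Urysohn[OF F(1), of "- U" 1 0] by (metis (no_types, lifting))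
    then obtain h :: "real \<Rightarrow> real" where h: "continuous_on UNIV h" "\<And>x. h x \<in> closed_segment 1 0"
      "\<And>x. x \<in> F \<Longrightarrow> h x = 1" "\<And>x. x \<in> - U \<Longrightarrow> h x = 0"
      by blast
    have h01: "0 \<le> h x" "h x \<le> 1" for x using h(2)[of x] by (auto simp: closed_segment_eq_real_ivl)
    have [measurable]: "U \<in> sets borel" "F \<in> sets borel" using U F by auto
    have [measurable]: "h \<in> borel_measurable borel" using h(1) by (rule borel_measurable_continuous_onI)
    have UA: "emeasure lborel (U - A) < ennreal (1 / Suc n)" "emeasure lborel (A - F) < ennreal (1 / Suc n)"
      using U(4) F(4) by simp_all
    have "emeasure lborel (U - F) = emeasure lborel ((U - A) \<union> (A - F))"
      using U(2) F(2) by (intro arg_cong[where f="emeasure lborel"]) auto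
    also have "\<dots> \<le> emeasure lborel (U - A) + emeasure lborel (A - F)"
      by (intro emeasure_subadditive) auto
    also have "\<dots> < ennreal (1 / Suc n) + ennreal (1 / Suc n)"
      using UA by (intro add_strict_mono)
    also have "\<dots> = ennreal (2 / Suc n)" by (simp flip: ennreal_plus)
    finally have UF: "emeasure lborel (U - F) < ennreal (2 / Suc n)" .
    have "emeasure lborel U = emeasure lborel ((U - A) \<union> A)"
      using U(2) by (intro arg_cong[where f="emeasure lborel"]) auto
    also have "\<dots> \<le> emeasure lborel (U - A) + emeasure lborel A"
      by (intro emeasure_subadditive) auto
    also have "\<dots> < \<infinity>"
      using UA(1) base(2) by (metis ennreal_add_less_top ennreal_less_top infinity_ennreal_def order.strict_trans)
    finally have "integrable lborel (indicator U :: real \<Rightarrow> real)" by simp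
    then have "integrable lborel h"
      by (rule Bochner_Integration.integrable_bound) (use h01 h(4) in \<open>auto simp: indicator_def\<close>)
    moreover have "\<bar>indicator A x - h x\<bar> \<le> indicator (U - F) x" for x
      using h01[of x] h(3)[of x] h(4)[of x] U(2) F(2) by (auto simp: indicator_def)
    ultimately show ?thesis
      using h(1) UF by (intro exI[of _ h] exI[of _ "U - F"]) auto
  qed
  then obtain h S where h: "\<And>n. continuous_on UNIV (h n)" "\<And>n. integrable lborel (h n :: real \<Rightarrow> real)"
    "\<And>n. S n \<in> sets lborel" "\<And>n. emeasure lborel (S n) < ennreal (2 / Suc n)"
    "\<And>n x. \<bar>indicator A x - h n x\<bar> \<le> indicator (S n) x"
    by metis
  have Ai: "integrable lborel (\<lambda>x. indicator A x *\<^sub>R k)" using base by simp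
  have hi: "integrable lborel (\<lambda>x. h n x *\<^sub>R k)" for n using h(2)[of n] by simp
  have Si: "integrable lborel (\<lambda>x. \<bar>k\<bar> * indicator (S n) x)" for n
    using h(3)[of n] h(4)[of n] by (intro integrable_mult_right integrable_real_indicator) (auto intro: less_trans)
  have le: "\<bar>indicator A x * k - h n x * k\<bar> \<le> \<bar>k\<bar> * indicator (S n) x" for n x
    using mult_right_mono[OF h(5)[of x n], of "\<bar>k\<bar>"]
    unfolding left_diff_distrib[symmetric] by (simp add: abs_mult mult.commute)
  show ?case
  proof (rule has_vector_derivative_AE_limit[where Qn="\<lambda>n. primitive (\<lambda>x. h n x *\<^sub>R k)" and gn="\<lambda>n x. h n x *\<^sub>R k"
        and \<phi>="\<lambda>n x. \<bar>k\<bar> * indicator (S n) x"])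
    show "AE x in lborel. (primitive (\<lambda>x. h n x *\<^sub>R k) has_vector_derivative h n x *\<^sub>R k) (at x)" for n
      by (intro AE_I2 primitive_has_derivative_continuous hi continuous_intros h)
    have m: "measure lborel (S n) \<le> 2 / Suc n" for n
      using h(4)[of n] by (simp add: measure_def enn2real_leI less_imp_le)
    have "(\<lambda>n. \<bar>k\<bar> * measure lborel (S n)) \<longlonglongrightarrow> \<bar>k\<bar> * 0"
    proof (intro tendsto_mult tendsto_const)
      have "(\<lambda>n. 2 * (1 / real (Suc n))) \<longlonglongrightarrow> 2 * 0"
        by (intro tendsto_mult tendsto_const LIMSEQ_Suc[OF lim_1_over_n, unfolded o_def])
      then have "(\<lambda>n. 2 / real (Suc n)) \<longlonglongrightarrow> 0" by simp
      then show "(\<lambda>n. measure lborel (S n)) \<longlonglongrightarrow> 0"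
        by (rule tendsto_sandwich[OF _ _ tendsto_const, rotated 2]) (use m in \<open>auto intro!: always_eventually\<close>)
    qed
    then show "(\<lambda>n. \<integral>z. \<bar>k\<bar> * indicator (S n) z \<partial>lborel) \<longlonglongrightarrow> 0" by simp
    show "AE x in lborel. \<forall>n. norm (indicator A x *\<^sub>R k - h n x *\<^sub>R k) \<le> \<bar>k\<bar> * indicator (S n) x"
      using le by simp
    fix n x y
    have di: "integrable lborel (\<lambda>x. indicator A x *\<^sub>R k - h n x *\<^sub>R k)"
      by (intro Bochner_Integration.integrable_diff Ai hi)
    have "norm ((primitive (\<lambda>x. indicator A x *\<^sub>R k) y - primitive (\<lambda>x. h n x *\<^sub>R k) y) -
        (primitive (\<lambda>x. indicator A x *\<^sub>R k) x - primitive (\<lambda>x. h n x *\<^sub>R k) x))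
        \<le> (\<integral>z. \<bar>indicator A z *\<^sub>R k - h n z *\<^sub>R k\<bar> * indicator {min x y<..<max x y} z \<partial>lborel)"
      using primitive_increment_bound[OF di, of y x] by (simp add: primitive_add_diff(2)[OF Ai hi, simplified])
    also have "\<dots> \<le> (\<integral>z. \<bar>k\<bar> * indicator (S n) z * indicator {min x y<..<max x y} z \<partial>lborel)"
      using le by (intro integral_mono integrable_real_mult_indicator integrable_abs di Si mult_right_mono) auto
    finally show "norm ((primitive (\<lambda>x. indicator A x *\<^sub>R k) y - primitive (\<lambda>x. h n x *\<^sub>R k) y) -
        (primitive (\<lambda>x. indicator A x *\<^sub>R k) x - primitive (\<lambda>x. h n x *\<^sub>R k) x))
        \<le> (\<integral>z. \<bar>k\<bar> * indicator (S n) z * indicator {min x y<..<max x y} z \<partial>lborel)" .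
  qed (use Si in auto)
next
  case (add f g)
  from add(3,4) show ?case
  proof eventually_elim
    fix x assume "(primitive f has_vector_derivative f x) (at x)" "(primitive g has_vector_derivative g x) (at x)"
    then have "((\<lambda>t. primitive f t + primitive g t) has_vector_derivative f x + g x) (at x)"
      by (rule has_vector_derivative_add)
    then show "(primitive (\<lambda>x. f x + g x) has_vector_derivative f x + g x) (at x)"
      using primitive_add_diff(1)[OF add(1,2)] by presburger
  qed
next
  case (lim f s)
  have di: "integrable lborel (\<lambda>x. f x - s n x)" for n
    by (intro Bochner_Integration.integrable_diff lim(4) lim(1))
  have [measurable]: "f \<in> borel_measurable borel" "s n \<in> borel_measurable borel" for n
    using borel_measurable_integrable[OF lim(1)[of n]] borel_measurable_integrable[OF lim(4)] by simp_all
  show ?case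
  proof (rule has_vector_derivative_AE_limit[where Qn="\<lambda>n. primitive (s n)" and gn=s and \<phi>="\<lambda>n x. \<bar>f x - s n x\<bar>"])
    show "AE x in lborel. (primitive (s n) has_vector_derivative s n x) (at x)" for n by (rule lim(5))
    \<comment> \<open>The induction principle bounds |s n| by 2 |f|, so |f - s n| is at most 3
      |f|.\<close>
    have "(\<lambda>n. \<integral>z. \<bar>f z - s n z\<bar> \<partial>lborel) \<longlonglongrightarrow> (\<integral>z. 0 \<partial>(lborel :: real measure))"
    proof (rule integral_dominated_convergence[where f="\<lambda>_. 0::real" and s="\<lambda>n z. \<bar>f z - s n z\<bar>" and w="\<lambda>x. 3 * \<bar>f x\<bar>"])
      show "AE x in lborel. (\<lambda>n. \<bar>f x - s n x\<bar>) \<longlonglongrightarrow> 0"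
      proof (rule AE_I2)
        fix x assume "x \<in> space (lborel :: real measure)"
        from tendsto_diff[OF tendsto_const[of "f x"] lim(2)[OF this]]
        show "(\<lambda>n. \<bar>f x - s n x\<bar>) \<longlonglongrightarrow> 0" by (simp add: tendsto_rabs_zero)
      qed
      show "AE x in lborel. norm \<bar>f x - s n x\<bar> \<le> 3 * \<bar>f x\<bar>" for n
        using lim(3)[of _ n] by (intro AE_I2) (auto simp: abs_le_iff, (smt (verit))+)
    qed (use lim(4) in auto)
    then show "(\<lambda>n. \<integral>z. \<bar>f z - s n z\<bar> \<partial>lborel) \<longlonglongrightarrow> 0" by simp
    show "norm ((primitive f y - primitive (s n) y) - (primitive f x - primitive (s n) x))
        \<le> (\<integral>z. \<bar>f z - s n z\<bar> * indicator {min x y<..<max x y} z \<partial>lborel)" for n x y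
      using primitive_increment_bound[OF di[of n], of y x] by (simp add: primitive_add_diff(2)[OF lim(4) lim(1)])
  qed (use di in auto)
qed

section \<open>Levy measures with absolutely continuous tail\<close>

lemma open_component_real_interval:
  fixes U :: "real set"
  assumes U: "open U" "bounded U" and I: "I \<in> components U"
  shows "open I" "Inf I \<le> Sup I" "{Inf I<..<Sup I} \<subseteq> I" "I \<subseteq> {Inf I<..<Sup I}"
proof -
  have IU: "I \<subseteq> U" "I \<noteq> {}" "connected I"
    using I in_components_subset in_components_nonempty in_components_connected by blast+
  show op: "open I"
    unfolding open_contains_ball
  proof
    fix x assume x: "x \<in> I"
    then obtain e where e: "0 < e" "ball x e \<subseteq> U"
      using IU(1) U(1) open_contains_ball by blast
    then have "ball x e \<subseteq> I"
      using x by (intro components_maximal[OF I]) auto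
    with e show "\<exists>e>0. ball x e \<subseteq> I" by blast
  qed
  have bd: "bdd_above I" "bdd_below I"
    using bounded_subset[OF U(2) IU(1)] by (auto intro: bounded_imp_bdd_above bounded_imp_bdd_below)
  show "Inf I \<le> Sup I" using bd IU(2) by (intro cInf_le_cSup)
  show "{Inf I<..<Sup I} \<subseteq> I"
  proof
    fix z assume z: "z \<in> {Inf I<..<Sup I}"
    obtain u v where "u \<in> I" "u < z" "v \<in> I" "z < v"
      using z cInf_less_iff[OF IU(2) bd(2)] less_cSup_iff[OF IU(2) bd(1)] by auto
    then show "z \<in> I"
      using IU(3) unfolding connected_iff_interval by (meson less_imp_le)
  qed
  show "I \<subseteq> {Inf I<..<Sup I}"
  proof
    fix z assume z: "z \<in> I"
    then obtain e where e: "0 < e" "cball z e \<subseteq> I" using op open_contains_cball by blast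
    then have "z - e \<in> I" "z + e \<in> I" by (auto simp: subset_eq dist_real_def)
    then have "Inf I \<le> z - e" "z + e \<le> Sup I" using bd by (auto intro: cInf_lower cSup_upper)
    then show "z \<in> {Inf I<..<Sup I}" using e by auto
  qed
qed

text \<open>Absolute continuity controls finite families of intervals. The null set is enclosed in
  an open set of measure below \<delta>, whose components are disjoint intervals; every finite
  partial sum of their masses is at most \<epsilon>, hence so is the whole sum.\<close>

lemma null_sets_of_abs_cont_tail:
  fixes N :: "real measure" and g :: "real \<Rightarrow> real"
  assumes sets: "sets N = sets borel"
    and tail: "\<And>x y. c \<le> x \<Longrightarrow> x \<le> y \<Longrightarrow> y \<le> d \<Longrightarrow> emeasure N {x<..y} = ennreal (g x - g y)"
    and ac: "abs_cont_on_interval c d g"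
    and Z: "Z \<in> null_sets lborel"
  shows "emeasure N (Z \<inter> {c<..<d}) = 0"
proof -
  have [measurable]: "Z \<in> sets borel" using Z by auto
  have le: "emeasure N (Z \<inter> {c<..<d}) \<le> ennreal \<epsilon>" if \<epsilon>: "0 < \<epsilon>" for \<epsilon>
  proof -
    obtain \<delta> where \<delta>: "\<delta> > 0" and ac': "\<And>(n::nat) x y. (\<forall>i<n. c \<le> x i \<and> x i \<le> y i \<and> y i \<le> d) \<Longrightarrow>
        disjoint_family_on (\<lambda>i. {x i<..<y i}) {..<n} \<Longrightarrow> (\<Sum>i<n. y i - x i) < \<delta> \<Longrightarrow>
        (\<Sum>i<n. norm (g (y i) - g (x i))) < \<epsilon>"
      using ac \<epsilon> unfolding abs_cont_on_interval_def by meson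
    have "Z \<in> sets lebesgue" by simp
    then obtain W where W: "open W" "Z \<subseteq> W" "W - Z \<in> lmeasurable" "emeasure lebesgue (W - Z) < ennreal \<delta>"
      using sets_lebesgue_outer_open \<delta> by metis
    have [measurable]: "W \<in> sets borel" using W(1) by simp
    define U where "U = W \<inter> {c<..<d}"
    have U: "open U" "bounded U" unfolding U_def using W(1) by (auto intro: bounded_subset[of "{c<..<d}"])
    have [measurable]: "U \<in> sets borel" using U(1) by simp
    have "emeasure lborel U \<le> emeasure lborel ((W - Z) \<union> Z)"
      by (intro emeasure_mono) (auto simp: U_def)
    also have "\<dots> \<le> emeasure lborel (W - Z) + emeasure lborel Z"
      by (intro emeasure_subadditive) auto
    also have "\<dots> < ennreal \<delta>"
      using W(4) Z by auto
    finally have U\<delta>: "emeasure lborel U < ennreal \<delta>" .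
    define \<C> where "\<C> = components U"
    note comp = open_component_real_interval[OF U, folded \<C>_def]
    have disjC: "pairwise disjnt \<C>"
      using pairwise_disjoint_components[of U] by (auto simp: \<C>_def pairwise_def disjnt_def)
    have cnt: "countable \<C>"
      using comp(1) disjC by (rule countable_disjoint_open_subsets)
    define I where "I n = (if n \<in> to_nat_on \<C> ` \<C> then from_nat_into \<C> n else {})" for n
    \<comment> \<open>Indices without a component get the degenerate interval from c to c, which is
      admissible in the definition of absolute continuity and contributes nothing.\<close>
    define x where "x n = (if n \<in> to_nat_on \<C> ` \<C> then Inf (I n) else c)" for n
    define y where "y n = (if n \<in> to_nat_on \<C> ` \<C> then Sup (I n) else c)" for n
    have IC: "I n \<in> \<C>" if "n \<in> to_nat_on \<C> ` \<C>" for n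
      using that cnt by (auto simp: I_def)
    have UI: "U = (\<Union>n. I n)"
    proof -
      have "U = \<Union>\<C>" by (simp add: \<C>_def)
      also have "\<dots> = (\<Union>n. I n)"
      proof (intro equalityI subsetI)
        fix z assume "z \<in> \<Union>\<C>"
        then obtain A where A: "A \<in> \<C>" "z \<in> A" by auto
        then have "I (to_nat_on \<C> A) = A" using cnt by (auto simp: I_def)
        then show "z \<in> (\<Union>n. I n)" using A by blast
      next
        fix z assume "z \<in> (\<Union>n. I n)"
        then obtain n where n: "z \<in> I n" by auto
        then have "n \<in> to_nat_on \<C> ` \<C>" by (auto simp: I_def split: if_splits)
        then show "z \<in> \<Union>\<C>" using IC n by blast
      qed
      finally show ?thesis .
    qed
    have eqI: "I n = {x n<..<y n}" for n
    proof (cases "n \<in> to_nat_on \<C> ` \<C>")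
      case True
      then show ?thesis using comp(3,4)[OF IC[OF True]] by (auto simp: x_def y_def)
    qed (auto simp: I_def x_def y_def)
    have Im: "I n \<in> sets borel" for n
      unfolding eqI by simp
    have disj: "disjoint_family I"
    proof (unfold disjoint_family_on_def, intro ballI impI)
      fix p q :: nat assume "p \<noteq> q"
      show "I p \<inter> I q = {}"
      proof (cases "p \<in> to_nat_on \<C> ` \<C> \<and> q \<in> to_nat_on \<C> ` \<C>")
        case True
        then obtain A B where AB: "A \<in> \<C>" "p = to_nat_on \<C> A" "B \<in> \<C>" "q = to_nat_on \<C> B" by auto
        then have "disjnt A B" using disjC \<open>p \<noteq> q\<close> by (metis pairwiseD)
        then show ?thesis using AB cnt by (auto simp: I_def disjnt_def)
      qed (auto simp: I_def)
    qed
    \<comment> \<open>The default value c lies in the admissible range only if c \<le> d; otherwise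
      the interval is empty and the bound trivial.\<close>
    have xy: "c \<le> x n \<and> x n \<le> y n \<and> y n \<le> d \<or> \<not> c \<le> d" for n
    proof (cases "n \<in> to_nat_on \<C> ` \<C>")
      case True
      have "I n \<subseteq> U" using UI by auto
      then have "I n \<subseteq> {c<..<d}" by (auto simp: U_def)
      moreover have ne: "I n \<noteq> {}" using IC[OF True] in_components_nonempty unfolding \<C>_def by blast
      ultimately have "c \<le> Inf (I n)" "Sup (I n) \<le> d"
        by (auto intro!: cInf_greatest cSup_least)
      then show ?thesis using True comp(2)[OF IC[OF True]] by (simp add: x_def y_def)
    qed (auto simp: x_def y_def)
    show ?thesis
    proof (cases "c \<le> d")
      case True
      then have xy: "c \<le> x n" "x n \<le> y n" "y n \<le> d" for n using xy by auto
      have dj: "disjoint_family_on (\<lambda>i. {x i<..<y i}) {..<n}" for n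
        using disj unfolding disjoint_family_on_def eqI by blast
      have len: "(\<Sum>i<n. y i - x i) < \<delta>" for n
      proof -
        have "ennreal (\<Sum>i<n. y i - x i) = (\<Sum>i<n. emeasure lborel (I i))"
          using xy by (simp add: eqI sum_ennreal)
        also have "\<dots> = emeasure lborel (\<Union>i<n. I i)"
          using dj by (intro sum_emeasure) (auto simp: eqI)
        also have "\<dots> \<le> emeasure lborel U"
        proof (rule emeasure_mono)
          show "(\<Union>i<n. I i) \<subseteq> U" using UI by auto
        qed simp
        finally have "ennreal (\<Sum>i<n. y i - x i) < ennreal \<delta>" using U\<delta> by simp
        then show ?thesis using xy by (simp add: ennreal_less_iff sum_nonneg)
      qed
      have part: "(\<Sum>i<n. emeasure N (I i)) \<le> ennreal \<epsilon>" for n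
      proof -
        \<comment> \<open>Half-open intervals enter because a difference of tails is the mass of
          such an interval.\<close>
        have "(\<Sum>i<n. emeasure N (I i)) \<le> (\<Sum>i<n. emeasure N {x i<..y i})"
          by (intro sum_mono emeasure_mono) (auto simp: eqI sets)
        also have "\<dots> = (\<Sum>i<n. ennreal (g (x i) - g (y i)))"
          using tail xy by simp
        also have "\<dots> \<le> (\<Sum>i<n. ennreal (norm (g (y i) - g (x i))))"
          by (intro sum_mono ennreal_leI) simp
        also have "\<dots> = ennreal (\<Sum>i<n. norm (g (y i) - g (x i)))"
          by (simp add: sum_ennreal)
        also have "\<dots> \<le> ennreal \<epsilon>"
          using ac'[of n x y] xy len[of n] dj[of n]
          by (intro ennreal_leI less_imp_le) auto
        finally show ?thesis .
      qed
      have "emeasure N (Z \<inter> {c<..<d}) \<le> emeasure N U"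
        using W(2) by (intro emeasure_mono) (auto simp: U_def sets)
      also have "\<dots> = (\<Sum>n. emeasure N (I n))"
        unfolding UI using disj by (intro suminf_emeasure[symmetric]) (auto simp: sets Im)
      also have "\<dots> \<le> ennreal \<epsilon>"
        by (rule suminf_le_const) (use part in auto)
      finally show ?thesis .
    qed auto
  qed
  have "emeasure N (Z \<inter> {c<..<d}) \<le> 0"
  proof (rule ennreal_le_epsilon)
    fix e :: real assume "0 < e"
    from le[OF this] show "emeasure N (Z \<inter> {c<..<d}) \<le> 0 + ennreal e" by simp
  qed
  then show ?thesis by simp
qed

locale levy_exponent =
  fixes f :: "real \<Rightarrow> real" and a b :: real and m :: "real measure"
  assumes bernstein: "bernstein_with_triplet f a b m"
    and infinite: "emeasure m {0<..} = \<infinity>"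
    and abs_cont: "\<And>c d. 0 < c \<Longrightarrow> c \<le> d \<Longrightarrow> abs_cont_on_interval c d (levy_tail a m)"
begin

text \<open>The measure m lives on the subspace sigma-algebra of the half-line. Transported to the
  Borel sets of the whole line it can be multiplied and convolved with the laws of the
  subordinator.\<close>

definition lev :: "real measure" where
  "lev = distr m borel (\<lambda>x. x)"

lemma a_nonneg: "0 \<le> a" and b_nonneg: "0 \<le> b"
  and sets_m: "sets m = sets (restrict_space borel {0<..})"
  and fin_m: "(\<integral>\<^sup>+z. ennreal (min z 1) \<partial>m) < \<infinity>"
  and f_eq: "\<And>x. 0 < x \<Longrightarrow> f x = a + b * x + (\<integral>s. (1 - exp (- (s * x))) \<partial>m)"
  using bernstein by (auto simp: bernstein_with_triplet_def levy_measure_def)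

lemma space_m: "space m = {0<..}"
  using sets_eq_imp_space_eq[OF sets_m] by (simp add: space_restrict_space)

lemma id_measurable: "(\<lambda>x. x) \<in> m \<rightarrow>\<^sub>M borel"
  by (subst measurable_cong_sets[OF sets_m refl]) (auto intro: measurable_restrict_space1)

lemma borel_measurable_m: "g \<in> borel_measurable borel \<Longrightarrow> g \<in> borel_measurable m"
  using measurable_comp[OF id_measurable, of g borel] by (simp add: comp_def)

lemma sets_lev[simp, measurable_cong]: "sets lev = sets borel"
  by (simp add: lev_def)

lemma space_lev[simp]: "space lev = UNIV"
  by (simp add: lev_def)

lemma nn_integral_lev: "g \<in> borel_measurable borel \<Longrightarrow> (\<integral>\<^sup>+x. g x \<partial>lev) = (\<integral>\<^sup>+x. g x \<partial>m)"
  unfolding lev_def by (subst nn_integral_distr[OF id_measurable]) auto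

lemma emeasure_lev: "B \<in> sets borel \<Longrightarrow> emeasure lev B = emeasure m (B \<inter> {0<..})"
  unfolding lev_def by (subst emeasure_distr[OF id_measurable]) (auto simp: space_m)

lemma AE_lev_pos: "AE x in lev. 0 < x"
  unfolding lev_def by (subst AE_distr_iff[OF id_measurable]) (auto simp: space_m intro!: AE_I2)

lemma lev_min: "(\<integral>\<^sup>+z. ennreal (min z 1) \<partial>lev) < \<infinity>"
  using fin_m by (subst nn_integral_lev) auto

lemma lev_infinite: "emeasure lev {0<..} = \<infinity>"
  using infinite by (simp add: emeasure_lev)

text \<open>Markov's inequality for min z 1, which is at least min s 1 beyond s.\<close>

lemma lev_tail_finite:
  assumes "0 < s" shows "emeasure lev {s<..} < \<infinity>"
proof -
  define k where "k = 1 / min s 1"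
  have k: "0 < k" "1 \<le> k * min z 1" if "s < z" for z
    using assms that by (auto simp: k_def field_simps min_def)
  have "emeasure lev {s<..} = (\<integral>\<^sup>+z. indicator {s<..} z \<partial>lev)" by simp
  also have "\<dots> \<le> (\<integral>\<^sup>+z. ennreal k * ennreal (min z 1) \<partial>lev)"
  proof (intro nn_integral_mono)
    fix z show "indicator {s<..} z \<le> ennreal k * ennreal (min z 1)"
      using k[of z] assms by (auto simp: indicator_def simp flip: ennreal_mult ennreal_1 intro!: ennreal_leI)
  qed
  also have "\<dots> = ennreal k * (\<integral>\<^sup>+z. ennreal (min z 1) \<partial>lev)"
    by (rule nn_integral_cmult) simp
  also have "\<dots> < \<infinity>" using lev_min by (simp add: ennreal_mult_less_top)
  finally show ?thesis .
qed

lemma emeasure_lev_nonpos: "emeasure lev {..0} = 0"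
proof -
  have "{..0::real} \<inter> {0<..} = {}" by auto
  then show ?thesis by (simp add: emeasure_lev)
qed

sublocale lev: sigma_finite_measure lev
proof
  let ?A = "insert {..0} (range (\<lambda>n. {1 / real (Suc n)<..}))"
  show "\<exists>A. countable A \<and> A \<subseteq> sets lev \<and> \<Union>A = space lev \<and> (\<forall>a\<in>A. emeasure lev a \<noteq> \<infinity>)"
  proof (intro exI[of _ ?A] conjI ballI)
    show "\<Union>?A = space lev"
    proof (intro equalityI subsetI)
      fix x :: real
      show "x \<in> \<Union>?A"
      proof (cases "0 < x")
        case True
        then obtain n where "1 / real (Suc n) < x" using reals_Archimedean by (auto simp: inverse_eq_divide)
        then show ?thesis by auto
      qed auto
    qed simp
    fix A assume "A \<in> ?A"
    then consider "A = {..0}" | n where "A = {1 / real (Suc n)<..}" by blast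
    then show "emeasure lev A \<noteq> \<infinity>"
    proof cases
      case (2 n)
      then show ?thesis using lev_tail_finite[of "1 / real (Suc n)"] by simp
    qed (simp add: emeasure_lev_nonpos)
  qed auto
qed

lemma levy_tail_eq: "0 < s \<Longrightarrow> ennreal (levy_tail a m s) = ennreal a + emeasure lev {s<..}"
proof -
  assume s: "0 < s"
  have "{s<..} \<inter> {0<..} = {s<..}" using s by auto
  then have "emeasure lev {s<..} = emeasure m {s<..}" by (simp add: emeasure_lev)
  then have "emeasure lev {s<..} = ennreal (measure m {s<..})"
    using lev_tail_finite[OF s] by (simp add: emeasure_eq_ennreal_measure)
  then show ?thesis
    using a_nonneg by (simp add: levy_tail_def)
qed

lemma levy_tail_nonneg: "0 \<le> levy_tail a m s"
  using a_nonneg by (simp add: levy_tail_def)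

lemma levy_tail_diff:
  assumes "0 < x" "x \<le> y" shows "emeasure lev {x<..y} = ennreal (levy_tail a m x - levy_tail a m y)"
proof -
  have "emeasure lev {x<..y} + emeasure lev {y<..} = emeasure lev ({x<..y} \<union> {y<..})"
    by (rule plus_emeasure) auto
  also have "{x<..y} \<union> {y<..} = {x<..}" using assms by auto
  finally have "ennreal (levy_tail a m x) = emeasure lev {x<..y} + ennreal (levy_tail a m y)"
    using levy_tail_eq[of x] levy_tail_eq[of y] assms by (simp add: ac_simps)
  then have "emeasure lev {x<..y} = ennreal (levy_tail a m x) - ennreal (levy_tail a m y)"
    by (metis ennreal_add_diff_cancel_right ennreal_neq_top)
  also have "\<dots> = ennreal (levy_tail a m x - levy_tail a m y)"
    by (rule ennreal_minus[OF levy_tail_nonneg])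
  finally show ?thesis .
qed

lemma levy_tail_antimono: "0 < x \<Longrightarrow> x \<le> y \<Longrightarrow> levy_tail a m y \<le> levy_tail a m x"
proof -
  assume xy: "0 < x" "x \<le> y"
  then have "ennreal (levy_tail a m y) \<le> ennreal (levy_tail a m x)"
    unfolding levy_tail_eq[OF xy(1)] levy_tail_eq[OF less_le_trans[OF xy]]
    by (intro add_left_mono emeasure_mono) auto
  then show ?thesis
    using ennreal_le_iff[OF levy_tail_nonneg] by blast
qed

text \<open>Absolute continuity of the tail is given on compact subintervals; the intervals from 1 /
  Suc n to Suc n exhaust the half-line.\<close>

lemma lev_null_sets:
  assumes Z: "Z \<in> null_sets lborel" shows "emeasure lev Z = 0"
proof -
  have [measurable]: "Z \<in> sets borel" using Z by auto
  let ?I = "\<lambda>n. {1 / real (Suc n)<..<real (Suc n)}"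
  have z: "Z \<inter> ?I n \<in> null_sets lev" for n
  proof (rule null_setsI)
    have n: "0 < 1 / real (Suc n)" "1 / real (Suc n) \<le> real (Suc n)"
      by (auto simp: field_simps intro!: add_increasing)
    show "emeasure lev (Z \<inter> ?I n) = 0"
    proof (rule null_sets_of_abs_cont_tail[where g="levy_tail a m", OF sets_lev _ abs_cont[OF n] Z])
      fix x y assume "1 / real (Suc n) \<le> x" "x \<le> y"
      then show "emeasure lev {x<..y} = ennreal (levy_tail a m x - levy_tail a m y)"
        using n(1) by (intro levy_tail_diff) linarith+
    qed
  qed simp
  have "Z \<subseteq> {..0} \<union> (\<Union>n. Z \<inter> ?I n)"
  proof
    fix x assume x: "x \<in> Z"
    show "x \<in> {..0} \<union> (\<Union>n. Z \<inter> ?I n)"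
    proof (cases "0 < x")
      case True
      then obtain n where n: "1 / real (Suc n) < x" using reals_Archimedean by (auto simp: inverse_eq_divide)
      obtain k :: nat where k: "x < real k" using reals_Archimedean2 by blast
      have "1 / real (Suc (max n k)) \<le> 1 / real (Suc n)" by (simp add: frac_le)
      then have "x \<in> ?I (max n k)" using n k by auto
      then show ?thesis using x by blast
    qed auto
  qed
  moreover have "{..0} \<union> (\<Union>n. Z \<inter> ?I n) \<in> null_sets lev"
    using z by (intro null_sets.Un null_sets_UN null_setsI emeasure_lev_nonpos) auto
  ultimately have "Z \<in> null_sets lev"
    by (rule null_sets_subset[rotated 2]) simp
  then show ?thesis by auto
qed

lemma one_minus_exp_le: "0 < z \<Longrightarrow> 0 < x \<Longrightarrow> 1 - exp (- (z * x)) \<le> max 1 x * min z 1" for z x :: real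
proof -
  assume "0 < z" "0 < x"
  have "1 - exp (- (z * x)) \<le> z * x" using exp_ge_add_one_self[of "- (z * x)"] by linarith
  moreover have "1 - exp (- (z * x)) \<le> max 1 x"
    using exp_ge_zero[of "- (z * x)"] by linarith
  moreover have "z * x \<le> max 1 x * z"
    using mult_left_mono[of x "max 1 x" z] \<open>0 < z\<close> by (simp add: mult.commute)
  ultimately show ?thesis by (cases "z \<le> 1") simp_all
qed

lemma ennreal_f:
  assumes "0 < x"
  shows "0 \<le> f x" "ennreal (f x) = ennreal a + ennreal (b * x) + (\<integral>\<^sup>+z. ennreal (1 - exp (- (z * x))) \<partial>lev)"
proof -
  have [measurable]: "(\<lambda>s. exp (- (s * x))) \<in> borel_measurable m"
    by (rule borel_measurable_m) simp
  have "(\<integral>\<^sup>+z. ennreal (1 - exp (- (z * x))) \<partial>m) \<le> (\<integral>\<^sup>+z. ennreal (max 1 x) * ennreal (min z 1) \<partial>m)"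
  proof (rule nn_integral_mono)
    fix z assume "z \<in> space m"
    then have "0 < z" by (simp add: space_m)
    then have "ennreal (1 - exp (- (z * x))) \<le> ennreal (max 1 x * min z 1)"
      by (intro ennreal_leI one_minus_exp_le assms)
    also have "\<dots> = ennreal (max 1 x) * ennreal (min z 1)"
      using \<open>0 < z\<close> by (intro ennreal_mult) auto
    finally show "ennreal (1 - exp (- (z * x))) \<le> ennreal (max 1 x) * ennreal (min z 1)" .
  qed
  also have "\<dots> = ennreal (max 1 x) * (\<integral>\<^sup>+z. ennreal (min z 1) \<partial>m)"
    by (rule nn_integral_cmult) (rule borel_measurable_m, simp)
  also have "\<dots> < \<infinity>" using fin_m by (simp add: ennreal_mult_less_top)
  finally have fin: "(\<integral>\<^sup>+z. ennreal (1 - exp (- (z * x))) \<partial>m) < \<infinity>" .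
  have pos: "AE z in m. 0 \<le> 1 - exp (- (z * x))"
    using assms by (intro AE_I2) (auto simp: space_m)
  have i: "integrable m (\<lambda>z. 1 - exp (- (z * x)))"
    using fin pos by (intro integrableI_nonneg) auto
  then have "ennreal (\<integral>z. 1 - exp (- (z * x)) \<partial>m) = (\<integral>\<^sup>+z. ennreal (1 - exp (- (z * x))) \<partial>lev)"
    using pos by (subst nn_integral_lev) (auto simp: nn_integral_eq_integral)
  moreover have nn: "0 \<le> (\<integral>z. 1 - exp (- (z * x)) \<partial>m)"
    by (rule integral_nonneg_AE[OF pos])
  ultimately show "ennreal (f x) = ennreal a + ennreal (b * x) + (\<integral>\<^sup>+z. ennreal (1 - exp (- (z * x))) \<partial>lev)"
    using a_nonneg b_nonneg assms by (simp add: f_eq)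
  show "0 \<le> f x" using nn a_nonneg b_nonneg assms by (simp add: f_eq)
qed

text \<open>Were f x = 0, the integral of 1 - exp (-z x), which is positive for z > 0, would vanish
  and with it the whole Levy measure, contrary to its infinite mass.\<close>

lemma f_pos: "0 < x \<Longrightarrow> 0 < f x"
proof (rule ccontr)
  assume x: "0 < x" "\<not> 0 < f x"
  then have "ennreal (f x) = 0" by (simp add: ennreal_neg)
  then have "(\<integral>\<^sup>+z. ennreal (1 - exp (- (z * x))) \<partial>lev) = 0"
    using ennreal_f(2)[OF x(1)] by simp
  then have "AE z in lev. ennreal (1 - exp (- (z * x))) = 0"
    by (subst (asm) nn_integral_0_iff_AE) auto
  with AE_lev_pos have "AE z in lev. False"
  proof eventually_elim
    fix z assume "0 < z" "ennreal (1 - exp (- (z * x))) = 0"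
    then show False using mult_pos_pos[OF \<open>0 < z\<close> x(1)] by (simp add: ennreal_eq_0_iff)
  qed
  then have "emeasure lev UNIV = 0"
    using AE_iff_measurable[of UNIV lev "\<lambda>_. False"] by simp
  moreover have "emeasure lev {0<..} \<le> emeasure lev UNIV"
    by (rule emeasure_mono) auto
  ultimately have "emeasure lev {0<..} \<le> 0" by simp
  then show False using lev_infinite by simp
qed

text \<open>Monotone convergence: on the positive half-line the integrand increases to 1, so the
  limit is the total mass. This growth later rules out an atom of the laws at the drift
  point.\<close>

lemma jump_part_tendsto_top:
  "(\<lambda>n. \<integral>\<^sup>+z. ennreal (1 - exp (- (z * real (Suc n)))) \<partial>lev) \<longlonglongrightarrow> \<infinity>"
proof -
  have "(\<lambda>n. \<integral>\<^sup>+z. ennreal (1 - exp (- (z * real (Suc n)))) \<partial>lev) \<longlonglongrightarrow> (\<integral>\<^sup>+z. indicator {0<..} z \<partial>lev)"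
  proof (rule nn_integral_LIMSEQ)
    show "incseq (\<lambda>n z. ennreal (1 - exp (- (z * real (Suc n)))))"
    proof (intro incseq_SucI le_funI)
      fix n and z :: real
      show "ennreal (1 - exp (- (z * real (Suc n)))) \<le> ennreal (1 - exp (- (z * real (Suc (Suc n)))))"
      proof (cases "0 \<le> z")
        case True then show ?thesis by (intro ennreal_leI) (auto simp: mult_left_mono)
      next
        case False
        then have "1 - exp (- (z * real (Suc n))) \<le> 0" by (simp add: mult_le_0_iff)
        then show ?thesis by (simp add: ennreal_neg)
      qed
    qed
    fix z :: real
    show "(\<lambda>n. ennreal (1 - exp (- (z * real (Suc n))))) \<longlonglongrightarrow> indicator {0<..} z"
    proof (cases "0 < z")
      case True
      have "(\<lambda>n. exp (- z) ^ Suc n) \<longlonglongrightarrow> 0"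
        using True by (intro LIMSEQ_Suc LIMSEQ_power_zero) simp
      then have "(\<lambda>n. ennreal (1 - exp (- z) ^ Suc n)) \<longlonglongrightarrow> ennreal (1 - 0)"
        by (intro tendsto_ennrealI tendsto_intros)
      moreover have "exp (- (z * real (Suc n))) = exp (- z) ^ Suc n" for n
        by (simp only: exp_of_nat_mult[symmetric]) (simp add: algebra_simps)
      ultimately show ?thesis using True by simp
    next
      case False
      then have "1 - exp (- (z * real (Suc n))) \<le> 0" for n by (simp add: mult_le_0_iff)
      then show ?thesis using False by (simp add: ennreal_neg)
    qed
  qed auto
  then show ?thesis using lev_infinite by simp
qed

text \<open>Cut off at 0 so that convolutions may run over the whole line and still see only the
  interval from 0 to t.\<close>

definition nu :: "real \<Rightarrow> ennreal" where
  "nu y = (if 0 < y then ennreal (levy_tail a m y) else 0)"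

text \<open>Writing the tail as an integral of indicators over the jump sizes gives its
  measurability and prepares for Tonelli's theorem.\<close>

lemma nu_eq: "nu y = indicator {0<..} y * ennreal a + (\<integral>\<^sup>+s. indicator {0<..<s} y \<partial>lev)"
proof (cases "0 < y")
  case True
  have "(\<integral>\<^sup>+s. indicator {0<..<s} y \<partial>lev) = (\<integral>\<^sup>+s. indicator {y<..} s \<partial>lev)"
    using True by (intro nn_integral_cong) (auto simp: indicator_def)
  then show ?thesis using True by (simp add: nu_def levy_tail_eq)
qed (simp add: nu_def)

lemma nu_measurable[measurable]: "nu \<in> borel_measurable borel"
proof -
  have "(\<lambda>y. indicator {0<..} y * ennreal a + (\<integral>\<^sup>+s. indicator {0<..<s} y \<partial>lev)) \<in> borel_measurable borel"
  proof -
    have [measurable]: "(\<lambda>(y, s). indicator {0<..<s} y :: ennreal) \<in> borel_measurable (borel \<Otimes>\<^sub>M lev)"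
    proof -
      have "(\<lambda>(y, s::real). indicator {0<..<s} y :: ennreal) = (\<lambda>p. if 0 < fst p \<and> fst p < snd p then 1 else 0)"
        by (auto simp: indicator_def)
      moreover have "(\<lambda>p. if 0 < fst p \<and> fst p < snd p then 1 else 0 :: ennreal) \<in> borel_measurable (borel \<Otimes>\<^sub>M lev)"
        by measurable
      ultimately show ?thesis by (simp only:)
    qed
    show ?thesis by measurable
  qed
  then show ?thesis by (simp add: nu_eq[abs_def])
qed

lemma nn_integral_exp_Icc:
  assumes "0 < x" "0 \<le> s"
  shows "(\<integral>\<^sup>+y. ennreal (exp (- (x * y))) * indicator {0..s} y \<partial>lborel) = ennreal ((1 - exp (- (x * s))) / x)"
proof -
  have "(\<integral>\<^sup>+y. ennreal (exp (- (x * y))) * indicator {0..s} y \<partial>lborel)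
      = ennreal ((\<lambda>y. - exp (- (x * y)) / x) s - (\<lambda>y. - exp (- (x * y)) / x) 0)"
    using assms by (intro nn_integral_FTC_Icc) (auto intro!: derivative_eq_intros)
  then show ?thesis by (simp add: diff_divide_distrib)
qed

lemma nn_integral_exp_atLeast:
  assumes "0 < (x::real)"
  shows "(\<integral>\<^sup>+y. ennreal (exp (- (x * y))) * indicator {s..} y \<partial>lborel) = ennreal (exp (- (x * s)) / x)"
proof -
  have "((\<lambda>y. - exp (- (x * y)) / x) \<longlongrightarrow> 0) at_top"
    using assms by real_asymp
  then have "(\<integral>\<^sup>+y. ennreal (exp (- (x * y))) * indicator {s..} y \<partial>lborel)
      = ennreal (0 - (\<lambda>y. - exp (- (x * y)) / x) s)"
    using assms by (intro nn_integral_FTC_atLeast) (auto intro!: derivative_eq_intros)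
  then show ?thesis by simp
qed

text \<open>By Tonelli's theorem a jump size z contributes (1 - exp (-z x)) / x, and the constant a
  contributes a / x. The drift b is kept on the left as a summand, which avoids subtraction in the
  extended reals.\<close>

lemma Laplace_nu:
  assumes x: "0 < x"
  shows "ennreal b + (\<integral>\<^sup>+y. ennreal (exp (- (x * y))) * nu y \<partial>lborel) = ennreal (f x / x)"
proof -
  have [measurable]: "(\<lambda>(s, y). ennreal (exp (- (x * y))) * indicator {0<..<s} y) \<in> borel_measurable (lev \<Otimes>\<^sub>M lborel)"
  proof -
    have "(\<lambda>(s, y). ennreal (exp (- (x * y))) * indicator {0<..<s} y) = (\<lambda>p. if 0 < snd p \<and> snd p < fst p then ennreal (exp (- (x * snd p))) else 0)"
      by (auto simp: indicator_def)
    moreover have "(\<lambda>p. if 0 < snd p \<and> snd p < fst p then ennreal (exp (- (x * snd p))) else 0) \<in> borel_measurable (lev \<Otimes>\<^sub>M lborel)"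
      by measurable
    ultimately show ?thesis by simp
  qed
  have [measurable]: "(\<lambda>s. indicator {0<..<s} y :: ennreal) \<in> borel_measurable lev" for y :: real
  proof -
    have "(\<lambda>s. indicator {0<..<s} y :: ennreal) = (\<lambda>s. if 0 < y \<and> y < s then 1 else 0)" by (auto simp: indicator_def)
    moreover have "(\<lambda>s. if 0 < y \<and> y < s then 1 else 0 :: ennreal) \<in> borel_measurable lev"
      by measurable
    ultimately show ?thesis by simp
  qed
  interpret P: pair_sigma_finite lev lborel ..
  have [measurable]: "(\<lambda>y. \<integral>\<^sup>+s. ennreal (exp (- (x * y))) * indicator {0<..<s} y \<partial>lev) \<in> borel_measurable lborel"
  proof (rule lev.borel_measurable_nn_integral)
    have "(\<lambda>(y, s). ennreal (exp (- (x * y))) * indicator {0<..<s} y) = (\<lambda>p. if 0 < fst p \<and> fst p < snd p then ennreal (exp (- (x * fst p))) else 0)"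
      by (auto simp: indicator_def)
    moreover have "(\<lambda>p. if 0 < fst p \<and> fst p < snd p then ennreal (exp (- (x * fst p))) else 0) \<in> borel_measurable (lborel \<Otimes>\<^sub>M lev)"
      by measurable
    ultimately show "(\<lambda>(y, s). ennreal (exp (- (x * y))) * indicator {0<..<s} y) \<in> borel_measurable (lborel \<Otimes>\<^sub>M lev)" by simp
  qed
  have "(\<integral>\<^sup>+y. ennreal (exp (- (x * y))) * nu y \<partial>lborel) =
      (\<integral>\<^sup>+y. (ennreal (exp (- (x * y))) * indicator {0<..} y) * ennreal a + (\<integral>\<^sup>+s. ennreal (exp (- (x * y))) * indicator {0<..<s} y \<partial>lev) \<partial>lborel)"
    by (simp add: nu_eq distrib_left mult.assoc nn_integral_cmult)
  also have "\<dots> = (\<integral>\<^sup>+y. ennreal (exp (- (x * y))) * indicator {0<..} y \<partial>lborel) * ennreal a +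
      (\<integral>\<^sup>+y. \<integral>\<^sup>+s. ennreal (exp (- (x * y))) * indicator {0<..<s} y \<partial>lev \<partial>lborel)"
    by (subst nn_integral_add) (auto simp: nn_integral_multc)
  also have "(\<integral>\<^sup>+y. ennreal (exp (- (x * y))) * indicator {0<..} y \<partial>lborel)
      = (\<integral>\<^sup>+y. ennreal (exp (- (x * y))) * indicator {0..} y \<partial>lborel)"
    by (rule nn_integral_cong_AE) (use AE_lborel_singleton[of 0] in \<open>eventually_elim, auto simp: indicator_def\<close>)
  also have "\<dots> = ennreal (1 / x)"
    using nn_integral_exp_atLeast[OF x, of 0] by simp
  also have "(\<integral>\<^sup>+y. \<integral>\<^sup>+s. ennreal (exp (- (x * y))) * indicator {0<..<s} y \<partial>lev \<partial>lborel)
      = (\<integral>\<^sup>+s. \<integral>\<^sup>+y. ennreal (exp (- (x * y))) * indicator {0<..<s} y \<partial>lborel \<partial>lev)"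
    by (rule P.Fubini') simp
  also have "\<dots> = (\<integral>\<^sup>+s. ennreal (1 - exp (- (s * x))) * ennreal (1 / x) \<partial>lev)"
  proof (rule nn_integral_cong_AE)
    show "AE s in lev. (\<integral>\<^sup>+y. ennreal (exp (- (x * y))) * indicator {0<..<s} y \<partial>lborel) = ennreal (1 - exp (- (s * x))) * ennreal (1 / x)"
      using AE_lev_pos
    proof eventually_elim
      fix s :: real assume s: "0 < s"
      have "(\<integral>\<^sup>+y. ennreal (exp (- (x * y))) * indicator {0<..<s} y \<partial>lborel) = (\<integral>\<^sup>+y. ennreal (exp (- (x * y))) * indicator {0..s} y \<partial>lborel)"
        by (rule nn_integral_cong_AE)
          (use AE_lborel_singleton[of 0] AE_lborel_singleton[of s] in \<open>eventually_elim, auto simp: indicator_def\<close>)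
      also have "\<dots> = ennreal (1 - exp (- (s * x))) * ennreal (1 / x)"
        using x s by (subst nn_integral_exp_Icc) (auto simp: mult.commute simp flip: ennreal_mult)
      finally show "(\<integral>\<^sup>+y. ennreal (exp (- (x * y))) * indicator {0<..<s} y \<partial>lborel) = ennreal (1 - exp (- (s * x))) * ennreal (1 / x)" .
    qed
  qed
  also have "\<dots> = (\<integral>\<^sup>+s. ennreal (1 - exp (- (s * x))) \<partial>lev) * ennreal (1 / x)"
    by (rule nn_integral_multc) simp
  finally have eq: "(\<integral>\<^sup>+y. ennreal (exp (- (x * y))) * nu y \<partial>lborel) =
      (ennreal a + (\<integral>\<^sup>+s. ennreal (1 - exp (- (s * x))) \<partial>lev)) * ennreal (1 / x)"
    by (simp add: distrib_right distrib_left mult.commute)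
  have "ennreal b = ennreal (b * x) * ennreal (1 / x)"
    using x b_nonneg by (simp flip: ennreal_mult)
  then have "ennreal b + (\<integral>\<^sup>+y. ennreal (exp (- (x * y))) * nu y \<partial>lborel) = ennreal (f x) * ennreal (1 / x)"
    unfolding eq ennreal_f(2)[OF x] by (simp add: distrib_left ac_simps)
  then show ?thesis
    using x ennreal_f(1)[OF x] by (simp flip: ennreal_mult)
qed

end

section \<open>Difference quotients of Laplace transforms\<close>

lemma ennreal_eq_top_cases: "x \<noteq> (\<infinity>::ennreal) \<Longrightarrow> x = ennreal (enn2real x)"
  by (simp add: less_top)

text \<open>Together with the upper bound u this fixes 1 - exp (-u) to first order, so that
  derivatives can be computed by a sandwich.\<close>

lemma one_minus_exp_lower: "0 \<le> u \<Longrightarrow> u / (1 + u) \<le> 1 - exp (- u)" for u :: real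
proof -
  assume u: "0 \<le> u"
  have "exp (- u) = 1 / exp u" by (simp add: exp_minus inverse_eq_divide)
  also have "\<dots> \<le> 1 / (1 + u)"
    using exp_ge_add_one_self[of u] u by (intro divide_left_mono) auto
  finally show ?thesis using u by (simp add: field_simps)
qed

lemma one_minus_exp_upper: "1 - exp (- u) \<le> u" for u :: real
  using exp_ge_add_one_self[of "- u"] by simp

lemma difference_quotient_exp_eq:
  "real (Suc n) * (exp (- (x * y)) - exp (- ((x + 1 / real (Suc n)) * y)))
    = exp (- (x * y)) * (real (Suc n) * (1 - exp (- (y / real (Suc n)))))"
proof -
  have "- ((x + 1 / real (Suc n)) * y) = - (x * y) + - (y / real (Suc n))"
    by (simp add: distrib_right)
  then have "exp (- ((x + 1 / real (Suc n)) * y)) = exp (- (x * y)) * exp (- (y / real (Suc n)))"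
    by (simp only: exp_add)
  then show ?thesis by (simp only:) (simp add: right_diff_distrib mult.left_commute)
qed

lemma difference_quotient_exp_tendsto:
  assumes "0 \<le> (y::real)"
  shows "(\<lambda>n. real (Suc n) * (exp (- (x * y)) - exp (- ((x + 1 / real (Suc n)) * y)))) \<longlonglongrightarrow> y * exp (- (x * y))"
proof -
  have eq: "real (Suc n) * (exp (- (x * y)) - exp (- ((x + 1 / real (Suc n)) * y)))
      = exp (- (x * y)) * (real (Suc n) * (1 - exp (- (y / real (Suc n)))))" for n
    by (rule difference_quotient_exp_eq)
  have lim: "(\<lambda>n. y * (1 / real (Suc n))) \<longlonglongrightarrow> y * 0"
    by (intro tendsto_mult tendsto_const LIMSEQ_Suc[OF lim_1_over_n, unfolded o_def])
  have "(\<lambda>n. y / (1 + y * (1 / real (Suc n)))) \<longlonglongrightarrow> y / (1 + y * 0)"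
    by (intro tendsto_divide tendsto_add tendsto_const lim) simp
  then have "(\<lambda>n. y / (1 + y / real (Suc n))) \<longlonglongrightarrow> y" by simp
  then have "(\<lambda>n. real (Suc n) * (1 - exp (- (y / real (Suc n))))) \<longlonglongrightarrow> y"
  proof (rule tendsto_sandwich[OF _ _ _ tendsto_const, rotated 2])
    show "\<forall>\<^sub>F n in sequentially. y / (1 + y / real (Suc n)) \<le> real (Suc n) * (1 - exp (- (y / real (Suc n))))"
    proof (intro always_eventually allI)
      fix n
      have "real (Suc n) * ((y / real (Suc n)) / (1 + y / real (Suc n))) \<le> real (Suc n) * (1 - exp (- (y / real (Suc n))))"
        using assms by (intro mult_left_mono one_minus_exp_lower) auto
      then show "y / (1 + y / real (Suc n)) \<le> real (Suc n) * (1 - exp (- (y / real (Suc n))))" by simp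
    qed
    show "\<forall>\<^sub>F n in sequentially. real (Suc n) * (1 - exp (- (y / real (Suc n)))) \<le> y"
    proof (intro always_eventually allI)
      fix n
      have "real (Suc n) * (1 - exp (- (y / real (Suc n)))) \<le> real (Suc n) * (y / real (Suc n))"
        by (intro mult_left_mono one_minus_exp_upper) auto
      then show "real (Suc n) * (1 - exp (- (y / real (Suc n)))) \<le> y" by simp
    qed
  qed
  then have "(\<lambda>n. exp (- (x * y)) * (real (Suc n) * (1 - exp (- (y / real (Suc n)))))) \<longlonglongrightarrow> exp (- (x * y)) * y"
    by (rule tendsto_mult[OF tendsto_const])
  then show ?thesis unfolding eq by (simp add: mult.commute)
qed

lemma difference_quotient_exp_bounds:
  assumes "0 \<le> (y::real)"
  shows "0 \<le> real (Suc n) * (exp (- (x * y)) - exp (- ((x + 1 / real (Suc n)) * y)))"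
    and "real (Suc n) * (exp (- (x * y)) - exp (- ((x + 1 / real (Suc n)) * y))) \<le> y * exp (- (x * y))"
proof -
  have eq: "real (Suc n) * (exp (- (x * y)) - exp (- ((x + 1 / real (Suc n)) * y)))
      = exp (- (x * y)) * (real (Suc n) * (1 - exp (- (y / real (Suc n)))))"
    by (rule difference_quotient_exp_eq)
  show "0 \<le> real (Suc n) * (exp (- (x * y)) - exp (- ((x + 1 / real (Suc n)) * y)))"
    unfolding eq using assms by (intro mult_nonneg_nonneg) auto
  have "real (Suc n) * (1 - exp (- (y / real (Suc n)))) \<le> real (Suc n) * (y / real (Suc n))"
    by (intro mult_left_mono one_minus_exp_upper) auto
  then have "real (Suc n) * (1 - exp (- (y / real (Suc n)))) \<le> y" by simp
  then have "exp (- (x * y)) * (real (Suc n) * (1 - exp (- (y / real (Suc n))))) \<le> exp (- (x * y)) * y"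
    by (intro mult_left_mono) auto
  then show "real (Suc n) * (exp (- (x * y)) - exp (- ((x + 1 / real (Suc n)) * y))) \<le> y * exp (- (x * y))"
    unfolding eq by (simp add: mult.commute)
qed

text \<open>Differentiating a Laplace transform under the integral sign, along the increments \<open>1 / Suc n\<close>.\<close>

lemma Laplace_difference_quotient_tendsto:
  fixes N :: "real measure"
  assumes sets[measurable_cong]: "sets N = sets borel" and pos: "AE y in N. 0 \<le> y"
    and int: "integrable N (\<lambda>y. y * exp (- (x * y)))"
  shows "(\<lambda>n. \<integral>y. real (Suc n) * (exp (- (x * y)) - exp (- ((x + 1 / real (Suc n)) * y))) \<partial>N)
    \<longlonglongrightarrow> (\<integral>y. y * exp (- (x * y)) \<partial>N)"
proof (rule integral_dominated_convergence[where w="\<lambda>y. y * exp (- (x * y))"])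
  show "AE y in N. (\<lambda>n. real (Suc n) * (exp (- (x * y)) - exp (- ((x + 1 / real (Suc n)) * y)))) \<longlonglongrightarrow> y * exp (- (x * y))"
    using pos by eventually_elim (rule difference_quotient_exp_tendsto)
  show "AE y in N. norm (real (Suc n) * (exp (- (x * y)) - exp (- ((x + 1 / real (Suc n)) * y)))) \<le> y * exp (- (x * y))" for n
    using pos
  proof eventually_elim
    fix y :: real assume "0 \<le> y"
    from difference_quotient_exp_bounds[OF this, of n x]
    show "norm (real (Suc n) * (exp (- (x * y)) - exp (- ((x + 1 / real (Suc n)) * y)))) \<le> y * exp (- (x * y))"
      unfolding real_norm_def abs_le_iff by linarith
  qed
qed (use int in measurable)

section \<open>Absolute continuity of driftless infinitely divisible laws\<close>

context levy_exponent
begin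

definition jump :: "real \<Rightarrow> real" where
  "jump x = (\<integral>z. (1 - exp (- (z * x))) \<partial>lev)"

lemma integrable_jump: "0 < x \<Longrightarrow> integrable lev (\<lambda>z. 1 - exp (- (z * x)))"
proof (rule integrableI_nonneg)
  assume x: "0 < x"
  show "AE z in lev. 0 \<le> 1 - exp (- (z * x))"
    using AE_lev_pos by eventually_elim (use x in simp)
  have "(\<integral>\<^sup>+z. ennreal (1 - exp (- (z * x))) \<partial>lev) \<le> ennreal (f x)"
    unfolding ennreal_f(2)[OF x] by simp
  then show "(\<integral>\<^sup>+z. ennreal (1 - exp (- (z * x))) \<partial>lev) < \<infinity>"
    by (simp add: le_less_trans)
qed simp

lemma ennreal_jump: "0 < x \<Longrightarrow> ennreal (jump x) = (\<integral>\<^sup>+z. ennreal (1 - exp (- (z * x))) \<partial>lev)"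
proof -
  assume x: "0 < x"
  have "AE z in lev. 0 \<le> 1 - exp (- (z * x))"
    using AE_lev_pos by eventually_elim (use x in simp)
  then show ?thesis
    unfolding jump_def by (intro nn_integral_eq_integral[symmetric] integrable_jump x)
qed

lemma jump_nonneg: "0 < x \<Longrightarrow> 0 \<le> jump x"
proof -
  assume x: "0 < x"
  have "AE z in lev. 0 \<le> 1 - exp (- (z * x))"
    using AE_lev_pos by eventually_elim (use x in simp)
  then show ?thesis unfolding jump_def by (rule integral_nonneg_AE)
qed

lemma f_jump: "0 < x \<Longrightarrow> f x = a + b * x + jump x"
proof -
  assume x: "0 < x"
  have 0: "0 \<le> a + b * x + jump x"
    using a_nonneg b_nonneg x jump_nonneg[OF x] by simp
  have "ennreal (f x) = ennreal (a + b * x + jump x)"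
    unfolding ennreal_f(2)[OF x] ennreal_jump[OF x, symmetric]
    using a_nonneg b_nonneg x jump_nonneg[OF x] by simp
  then show ?thesis
    using ennreal_inj[OF ennreal_f(1)[OF x] 0] by blast
qed

lemma integrable_lev_deriv: "0 < x \<Longrightarrow> integrable lev (\<lambda>z. z * exp (- (x * z)))"
proof (rule integrableI_nonneg)
  assume x: "0 < x"
  show "AE z in lev. 0 \<le> z * exp (- (x * z))"
    using AE_lev_pos by eventually_elim simp
  have "(\<integral>\<^sup>+z. ennreal (z * exp (- (x * z))) \<partial>lev) \<le> (\<integral>\<^sup>+z. ennreal (max 1 (1 / x)) * ennreal (min z 1) \<partial>lev)"
  proof (rule nn_integral_mono_AE)
    show "AE z in lev. ennreal (z * exp (- (x * z))) \<le> ennreal (max 1 (1 / x)) * ennreal (min z 1)"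
      using AE_lev_pos
    proof eventually_elim
      fix z :: real assume z: "0 < z"
      have "x * z * exp (- (x * z)) \<le> 1"
      proof -
        have "x * z \<le> exp (x * z)" using exp_ge_add_one_self[of "x * z"] by linarith
        then have "x * z * exp (- (x * z)) \<le> exp (x * z) * exp (- (x * z))" by (intro mult_right_mono) auto
        then show ?thesis by (simp add: exp_minus_inverse)
      qed
      then have 1: "z * exp (- (x * z)) \<le> 1 / x" using x by (simp add: field_simps)
      have 2: "z * exp (- (x * z)) \<le> z * 1"
        using x z by (intro mult_left_mono) auto
      have 3: "1 * z \<le> max 1 (1 / x) * z" using z by (intro mult_right_mono) auto
      have "z * exp (- (x * z)) \<le> max 1 (1 / x) * min z 1"
      proof (cases "z \<le> 1")
        case True
        then have "min z 1 = z" by simp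
        then show ?thesis using 2 3 by simp
      next
        case False
        then have "min z 1 = 1" by simp
        moreover have "1 / x \<le> max 1 (1 / x)" by simp
        ultimately show ?thesis using 1 by simp
      qed
      then have "ennreal (z * exp (- (x * z))) \<le> ennreal (max 1 (1 / x) * min z 1)" by (rule ennreal_leI)
      also have "\<dots> = ennreal (max 1 (1 / x)) * ennreal (min z 1)" using z by (intro ennreal_mult) auto
      finally show "ennreal (z * exp (- (x * z))) \<le> ennreal (max 1 (1 / x)) * ennreal (min z 1)" .
    qed
  qed
  also have "\<dots> = ennreal (max 1 (1 / x)) * (\<integral>\<^sup>+z. ennreal (min z 1) \<partial>lev)"
    by (rule nn_integral_cmult) simp
  also have "\<dots> < \<infinity>" using lev_min by (simp add: ennreal_mult_less_top)
  finally show "(\<integral>\<^sup>+z. ennreal (z * exp (- (x * z))) \<partial>lev) < \<infinity>" .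
qed simp

lemma jump_difference_quotient:
  assumes x: "0 < x"
  shows "(\<lambda>n. real (Suc n) * (jump (x + 1 / real (Suc n)) - jump x)) \<longlonglongrightarrow> (\<integral>z. z * exp (- (x * z)) \<partial>lev)"
proof -
  have pos: "AE y in lev. 0 \<le> y" using AE_lev_pos by eventually_elim simp
  have "(\<integral>y. real (Suc n) * (exp (- (x * y)) - exp (- ((x + 1 / real (Suc n)) * y))) \<partial>lev)
      = real (Suc n) * (jump (x + 1 / real (Suc n)) - jump x)" for n
  proof -
    have x': "0 < x + 1 / real (Suc n)" using x by (intro add_pos_pos) auto
    have "jump (x + 1 / real (Suc n)) - jump x =
        (\<integral>y. (1 - exp (- (y * (x + 1 / real (Suc n))))) - (1 - exp (- (y * x))) \<partial>lev)"
      unfolding jump_def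
      by (rule Bochner_Integration.integral_diff[symmetric]) (intro integrable_jump x x')+
    also have "\<dots> = (\<integral>y. exp (- (x * y)) - exp (- ((x + 1 / real (Suc n)) * y)) \<partial>lev)"
      by (simp add: mult.commute)
    finally show ?thesis by simp
  qed
  then show ?thesis
    using Laplace_difference_quotient_tendsto[OF sets_lev pos integrable_lev_deriv[OF x]] by simp
qed

lemma jump_tendsto_top: "filterlim (\<lambda>n. jump (real (Suc n))) at_top sequentially"
proof -
  have "ennreal (jump (real (Suc n))) = (\<integral>\<^sup>+z. ennreal (1 - exp (- (z * real (Suc n)))) \<partial>lev)" for n
    by (rule ennreal_jump) simp
  then have lim: "(\<lambda>n. ennreal (jump (real (Suc n)))) \<longlonglongrightarrow> \<infinity>"
    using jump_part_tendsto_top by simp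
  show ?thesis
    unfolding filterlim_at_top
  proof
    fix Z :: real
    have "\<forall>\<^sub>F n in sequentially. ennreal Z < ennreal (jump (real (Suc n)))"
      by (rule order_tendstoD(1)[OF lim]) simp
    then show "\<forall>\<^sub>F n in sequentially. Z \<le> jump (real (Suc n))"
    proof eventually_elim
      fix n assume "ennreal Z < ennreal (jump (real (Suc n)))"
      then show "Z \<le> jump (real (Suc n))"
        using ennreal_leI[of "jump (real (Suc n))" Z] by (meson linorder_le_cases not_less)
    qed
  qed
qed

text \<open>Steutel's argument: the Laplace transform shows \<open>y \<mu>(dy) = s (z \<nu>(dz)) * \<mu>\<close>, and the right-hand side
  inherits absolute continuity from the Levy measure.\<close>

lemma abs_cont_driftless:
  fixes N :: "real measure"
  assumes sets[measurable_cong]: "sets N = sets borel" and pos: "AE y in N. 0 \<le> y" and s: "0 < s"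
    and lap: "\<And>x. 0 < x \<Longrightarrow> (\<integral>\<^sup>+y. ennreal (exp (- (x * y))) \<partial>N) = ennreal (exp (- (s * (a + jump x))))"
    and fin: "finite_measure N" and Z: "Z \<in> null_sets lborel"
  shows "emeasure N Z = 0"
proof -
  interpret N: finite_measure N by fact
  have [measurable]: "Z \<in> sets borel" using Z by auto
  have space: "space N = UNIV" using sets_eq_imp_space_eq[OF sets] by simp
  have bound: "y * exp (- (x * y)) \<le> 1 / x" if "0 < x" "0 \<le> y" for x y :: real
  proof -
    have "x * y \<le> exp (x * y)" using exp_ge_add_one_self[of "x * y"] by linarith
    then have "x * y * exp (- (x * y)) \<le> exp (x * y) * exp (- (x * y))" by (intro mult_right_mono) auto
    then have "x * y * exp (- (x * y)) \<le> 1" by (simp add: exp_minus_inverse)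
    then show ?thesis using that by (simp add: field_simps)
  qed
  have int1: "integrable N (\<lambda>y. y * exp (- (x * y)))" if x: "0 < x" for x
  proof (rule N.integrable_const_bound[of _ "1 / x"])
    show "AE y in N. norm (y * exp (- (x * y))) \<le> 1 / x"
      using pos by eventually_elim (use bound[OF x] in simp)
  qed simp
  have int0: "integrable N (\<lambda>y. exp (- (x * y)))" if x: "0 < x" for x
  proof (rule N.integrable_const_bound[of _ 1])
    show "AE y in N. norm (exp (- (x * y))) \<le> 1"
      using pos by eventually_elim (use x in simp)
  qed simp
  have lapr: "(\<integral>y. exp (- (x * y)) \<partial>N) = exp (- (s * (a + jump x)))" if x: "0 < x" for x
    using lap[OF x] nn_integral_eq_integral[OF int0[OF x]] by simp
  have deriv: "(\<integral>y. y * exp (- (x * y)) \<partial>N) = s * (\<integral>z. z * exp (- (x * z)) \<partial>lev) * exp (- (s * (a + jump x)))"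
    if x: "0 < x" for x
  proof -
    define D where "D = (\<integral>z. z * exp (- (x * z)) \<partial>lev)"
    \<comment> \<open>\<open>d n\<close> tends to 0 while Suc n times \<open>d n\<close> tends to D.
      The bounds u / (1 + u) \<le> 1 - exp (-u) \<le> u at u = s \<open>d n\<close> then give the
      derivative of the exponential on the right-hand side of \<open>lap\<close>.\<close>
    define d where "d n = jump (x + 1 / real (Suc n)) - jump x" for n
    have nd: "(\<lambda>n. real (Suc n) * d n) \<longlonglongrightarrow> D"
      unfolding d_def D_def by (rule jump_difference_quotient[OF x])
    have d0: "0 \<le> d n" for n
    proof -
      have x': "0 < x + 1 / real (Suc n)" using x by (intro add_pos_pos) auto
      have "jump x \<le> jump (x + 1 / real (Suc n))"
        unfolding jump_def
      proof (rule integral_mono_AE[OF integrable_jump[OF x] integrable_jump[OF x']])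
        show "AE z in lev. 1 - exp (- (z * x)) \<le> 1 - exp (- (z * (x + 1 / real (Suc n))))"
          using AE_lev_pos by eventually_elim (simp add: distrib_left)
      qed
      then show ?thesis by (simp add: d_def)
    qed
    have "(\<lambda>n. (1 / real (Suc n)) * (real (Suc n) * d n)) \<longlonglongrightarrow> 0 * D"
      by (intro tendsto_mult nd LIMSEQ_Suc[OF lim_1_over_n, unfolded o_def])
    then have d_lim: "d \<longlonglongrightarrow> 0" by simp
    have up: "(\<lambda>n. s * (real (Suc n) * d n)) \<longlonglongrightarrow> s * D"
      by (intro tendsto_mult tendsto_const nd)
    have "(\<lambda>n. s * (real (Suc n) * d n) / (1 + s * d n)) \<longlonglongrightarrow> s * D / (1 + s * 0)"
      by (intro tendsto_divide up tendsto_add tendsto_mult tendsto_const d_lim) simp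
    then have low: "(\<lambda>n. s * (real (Suc n) * d n) / (1 + s * d n)) \<longlonglongrightarrow> s * D" by simp
    have "(\<lambda>n. real (Suc n) * (1 - exp (- (s * d n)))) \<longlonglongrightarrow> s * D"
    proof (rule tendsto_sandwich[OF _ _ low up])
      show "\<forall>\<^sub>F n in sequentially. s * (real (Suc n) * d n) / (1 + s * d n) \<le> real (Suc n) * (1 - exp (- (s * d n)))"
      proof (intro always_eventually allI)
        fix n
        have "real (Suc n) * (s * d n / (1 + s * d n)) \<le> real (Suc n) * (1 - exp (- (s * d n)))"
          using s d0[of n] by (intro mult_left_mono one_minus_exp_lower) auto
        then show "s * (real (Suc n) * d n) / (1 + s * d n) \<le> real (Suc n) * (1 - exp (- (s * d n)))"
          by (simp add: mult.left_commute)
      qed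
      show "\<forall>\<^sub>F n in sequentially. real (Suc n) * (1 - exp (- (s * d n))) \<le> s * (real (Suc n) * d n)"
      proof (intro always_eventually allI)
        fix n
        have "real (Suc n) * (1 - exp (- (s * d n))) \<le> real (Suc n) * (s * d n)"
          by (intro mult_left_mono one_minus_exp_upper) auto
        then show "real (Suc n) * (1 - exp (- (s * d n))) \<le> s * (real (Suc n) * d n)"
          by (simp add: mult.left_commute)
      qed
    qed
    then have "(\<lambda>n. exp (- (s * (a + jump x))) * (real (Suc n) * (1 - exp (- (s * d n))))) \<longlonglongrightarrow> exp (- (s * (a + jump x))) * (s * D)"
      by (rule tendsto_mult[OF tendsto_const])
    moreover have "exp (- (s * (a + jump x))) * (real (Suc n) * (1 - exp (- (s * d n)))) =
        (\<integral>y. real (Suc n) * (exp (- (x * y)) - exp (- ((x + 1 / real (Suc n)) * y))) \<partial>N)" for n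
    proof -
      have x': "0 < x + 1 / real (Suc n)" using x by (intro add_pos_pos) auto
      have "exp (- (s * (a + jump x))) * exp (- (s * d n)) = exp (- (s * (a + jump (x + 1 / real (Suc n)))))"
        by (simp add: d_def algebra_simps flip: exp_add)
      then have "exp (- (s * (a + jump x))) * (1 - exp (- (s * d n)))
          = (\<integral>y. exp (- (x * y)) \<partial>N) - (\<integral>y. exp (- ((x + 1 / real (Suc n)) * y)) \<partial>N)"
        unfolding lapr[OF x] lapr[OF x'] by (simp add: right_diff_distrib)
      also have "\<dots> = (\<integral>y. exp (- (x * y)) - exp (- ((x + 1 / real (Suc n)) * y)) \<partial>N)"
        by (rule Bochner_Integration.integral_diff[OF int0[OF x] int0[OF x'], symmetric])
      finally show ?thesis by simp
    qed
    ultimately have "(\<lambda>n. \<integral>y. real (Suc n) * (exp (- (x * y)) - exp (- ((x + 1 / real (Suc n)) * y))) \<partial>N)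
        \<longlonglongrightarrow> exp (- (s * (a + jump x))) * (s * D)" by (simp only:)
    from LIMSEQ_unique[OF this Laplace_difference_quotient_tendsto[OF sets pos int1[OF x]]]
    show ?thesis by (simp add: D_def mult.commute)
  qed
  \<comment> \<open>Weighting by y erases a possible atom at 0, so it is excluded separately: its
    mass is at most the transform at Suc n, which tends to 0 because \<open>jump\<close> is
    unbounded.\<close>
  have atom: "emeasure N {0} = 0"
  proof -
    have le: "emeasure N {0} \<le> ennreal (exp (- (s * (a + jump (real (Suc n))))))" for n
    proof -
      have "emeasure N {0} = (\<integral>\<^sup>+y. indicator {0} y \<partial>N)" by simp
      also have "\<dots> \<le> (\<integral>\<^sup>+y. ennreal (exp (- (real (Suc n) * y))) \<partial>N)"
        by (intro nn_integral_mono) (auto simp: indicator_def)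
      finally show ?thesis by (simp only: lap of_nat_0_less_iff zero_less_Suc)
    qed
    have "filterlim (\<lambda>n. s * (a + jump (real (Suc n)))) at_top sequentially"
      by (intro filterlim_tendsto_pos_mult_at_top[OF tendsto_const s] filterlim_tendsto_add_at_top[OF tendsto_const] jump_tendsto_top)
    then have "filterlim (\<lambda>n. - (s * (a + jump (real (Suc n))))) at_bot sequentially"
      by (simp add: filterlim_uminus_at_bot)
    then have "(\<lambda>n. exp (- (s * (a + jump (real (Suc n)))))) \<longlonglongrightarrow> 0"
      by (rule filterlim_compose[OF exp_at_bot])
    then have "(\<lambda>n. ennreal (exp (- (s * (a + jump (real (Suc n))))))) \<longlonglongrightarrow> ennreal 0"
      by (rule tendsto_ennrealI)
    then have "emeasure N {0} \<le> ennreal 0"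
      using le by (intro LIMSEQ_le_const) auto
    then show ?thesis by simp
  qed
  interpret P: pair_sigma_finite N lev ..
  \<comment> \<open>\<open>A\<close> is N weighted by y, and \<open>B\<close> the convolution of N
    with \<open>lev\<close> weighted by s z. Their transforms are minus the derivatives of the two
    sides of \<open>lap\<close>.\<close>
  define A where "A = density N (\<lambda>y. ennreal y)"
  define B where "B = distr (density (N \<Otimes>\<^sub>M lev) (\<lambda>(y, z). ennreal (s * z))) borel (\<lambda>(y, z). y + z)"
  have [measurable]: "(\<lambda>(y, z). y + z) \<in> borel_measurable (N \<Otimes>\<^sub>M lev)"
    "(\<lambda>(y, z). ennreal (s * z)) \<in> borel_measurable (N \<Otimes>\<^sub>M lev)" by measurable
  have nnB: "(\<integral>\<^sup>+y. g y \<partial>B) = (\<integral>\<^sup>+y. \<integral>\<^sup>+z. ennreal (s * z) * g (y + z) \<partial>lev \<partial>N)"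
    if [measurable]: "g \<in> borel_measurable borel" for g
  proof -
    have "(\<integral>\<^sup>+y. g y \<partial>B) = (\<integral>\<^sup>+p. g (case p of (y, z) \<Rightarrow> y + z) \<partial>density (N \<Otimes>\<^sub>M lev) (\<lambda>(y, z). ennreal (s * z)))"
      unfolding B_def by (rule nn_integral_distr) auto
    also have "\<dots> = (\<integral>\<^sup>+p. (case p of (y, z) \<Rightarrow> ennreal (s * z)) * g (case p of (y, z) \<Rightarrow> y + z) \<partial>(N \<Otimes>\<^sub>M lev))"
      by (rule nn_integral_density) auto
    also have "\<dots> = (\<integral>\<^sup>+y. \<integral>\<^sup>+z. ennreal (s * z) * g (y + z) \<partial>lev \<partial>N)"
      by (subst lev.nn_integral_fst[symmetric]) auto
    finally show ?thesis .
  qed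
  have AB: "A = B"
  proof (rule measure_eqI_Laplace)
    show "sets A = sets borel" "sets B = sets borel" by (simp_all add: A_def B_def sets)
    show "AE x in A. 0 \<le> x"
      unfolding A_def using pos by (subst AE_density) auto
    have "(\<integral>\<^sup>+x. indicator {..<0} x \<partial>B) = (\<integral>\<^sup>+y. \<integral>\<^sup>+z. ennreal (s * z) * indicator {..<0} (y + z) \<partial>lev \<partial>N)"
      by (rule nnB) simp
    also have "\<dots> = (\<integral>\<^sup>+y. 0 \<partial>N)"
    proof (rule nn_integral_cong_AE)
      show "AE y in N. (\<integral>\<^sup>+z. ennreal (s * z) * indicator {..<0} (y + z) \<partial>lev) = 0"
        using pos
      proof eventually_elim
        fix y :: real assume y: "0 \<le> y"
        have "(\<integral>\<^sup>+z. ennreal (s * z) * indicator {..<0} (y + z) \<partial>lev) = (\<integral>\<^sup>+z. 0 \<partial>lev)"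
        proof (rule nn_integral_cong_AE)
          show "AE z in lev. ennreal (s * z) * indicator {..<0} (y + z) = 0"
            using AE_lev_pos by eventually_elim (use y in \<open>simp add: indicator_def\<close>)
        qed
        then show "(\<integral>\<^sup>+z. ennreal (s * z) * indicator {..<0} (y + z) \<partial>lev) = 0" by simp
      qed
    qed
    finally have "emeasure B {..<0} = 0" by (simp add: B_def)
    then have "{..<0} \<in> null_sets B" by (intro null_setsI) (auto simp: B_def)
    then show "AE x in B. 0 \<le> x"
      by (rule AE_I') (auto simp: not_le)
    have lapA: "(\<integral>\<^sup>+x. ennreal (exp (- (r * x))) \<partial>A) = ennreal (\<integral>y. y * exp (- (r * y)) \<partial>N)" if r: "0 < r" for r
    proof -
      have "(\<integral>\<^sup>+x. ennreal (exp (- (r * x))) \<partial>A) = (\<integral>\<^sup>+x. ennreal x * ennreal (exp (- (r * x))) \<partial>N)"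
        unfolding A_def by (rule nn_integral_density) auto
      also have "\<dots> = (\<integral>\<^sup>+x. ennreal (x * exp (- (r * x))) \<partial>N)"
        using pos by (intro nn_integral_cong_AE) (auto elim!: eventually_mono simp: ennreal_mult)
      also have "\<dots> = ennreal (\<integral>y. y * exp (- (r * y)) \<partial>N)"
        using pos by (intro nn_integral_eq_integral int1[OF r]) (auto elim!: eventually_mono)
      finally show ?thesis .
    qed
    have lapB: "(\<integral>\<^sup>+x. ennreal (exp (- (r * x))) \<partial>B) = ennreal (s * (\<integral>z. z * exp (- (r * z)) \<partial>lev) * exp (- (s * (a + jump r))))" if r: "0 < r" for r
    proof -
      have D: "(\<integral>\<^sup>+z. ennreal (s * z) * ennreal (exp (- (r * z))) \<partial>lev) = ennreal (s * (\<integral>z. z * exp (- (r * z)) \<partial>lev))"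
      proof -
        have "(\<integral>\<^sup>+z. ennreal (s * z) * ennreal (exp (- (r * z))) \<partial>lev) = (\<integral>\<^sup>+z. ennreal (s * (z * exp (- (r * z)))) \<partial>lev)"
          using AE_lev_pos s by (intro nn_integral_cong_AE) (auto elim!: eventually_mono simp: mult.assoc simp flip: ennreal_mult)
        also have "\<dots> = ennreal (\<integral>z. s * (z * exp (- (r * z))) \<partial>lev)"
          using AE_lev_pos s integrable_lev_deriv[OF r]
          by (intro nn_integral_eq_integral) (auto elim!: eventually_mono)
        finally show ?thesis by simp
      qed
      have "(\<integral>\<^sup>+x. ennreal (exp (- (r * x))) \<partial>B) = (\<integral>\<^sup>+y. \<integral>\<^sup>+z. ennreal (s * z) * ennreal (exp (- (r * (y + z)))) \<partial>lev \<partial>N)"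
        by (rule nnB) simp
      also have "\<dots> = (\<integral>\<^sup>+y. \<integral>\<^sup>+z. ennreal (exp (- (r * y))) * (ennreal (s * z) * ennreal (exp (- (r * z)))) \<partial>lev \<partial>N)"
      proof -
        have "ennreal (exp (- (r * (y + z)))) = ennreal (exp (- (r * y))) * ennreal (exp (- (r * z)))" for y z
        proof -
          have "- (r * (y + z)) = - (r * y) + - (r * z)" by (simp add: distrib_left)
          then show ?thesis by (simp only: exp_add) (rule ennreal_mult, simp_all)
        qed
        then show ?thesis by (simp only: ac_simps)
      qed
      also have "\<dots> = (\<integral>\<^sup>+y. ennreal (exp (- (r * y))) * ennreal (s * (\<integral>z. z * exp (- (r * z)) \<partial>lev)) \<partial>N)"
        by (simp add: nn_integral_cmult D)
      also have "\<dots> = (\<integral>\<^sup>+y. ennreal (exp (- (r * y))) \<partial>N) * ennreal (s * (\<integral>z. z * exp (- (r * z)) \<partial>lev))"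
        by (rule nn_integral_multc) simp
      also have "\<dots> = ennreal (exp (- (s * (a + jump r)))) * ennreal (s * (\<integral>z. z * exp (- (r * z)) \<partial>lev))"
        by (simp only: lap[OF r])
      also have "\<dots> = ennreal (s * (\<integral>z. z * exp (- (r * z)) \<partial>lev) * exp (- (s * (a + jump r))))"
      proof -
        have "AE z in lev. 0 \<le> z * exp (- (r * z))" using AE_lev_pos by eventually_elim simp
        then have "0 \<le> s * (\<integral>z. z * exp (- (r * z)) \<partial>lev)" using s by (intro mult_nonneg_nonneg integral_nonneg_AE) auto
        then show ?thesis by (simp add: mult.commute flip: ennreal_mult)
      qed
      finally show ?thesis .
    qed
    show "(\<integral>\<^sup>+x. ennreal (exp (- (real n * x))) \<partial>A) = (\<integral>\<^sup>+x. ennreal (exp (- (real n * x))) \<partial>B)" if "1 \<le> n" for n :: nat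
    proof -
      have "0 < real n" using that by simp
      then show ?thesis by (simp only: lapA lapB deriv)
    qed
    show "(\<integral>\<^sup>+x. ennreal (exp (- x)) \<partial>A) < \<infinity>"
      using lapA[of 1] by simp
  qed
  have "emeasure B Z = (\<integral>\<^sup>+y. indicator Z y \<partial>B)" by (simp add: B_def)
  also have "\<dots> = (\<integral>\<^sup>+y. \<integral>\<^sup>+z. ennreal (s * z) * indicator Z (y + z) \<partial>lev \<partial>N)"
    by (rule nnB) simp
  \<comment> \<open>For fixed y only a translate of Z is seen; it is Lebesgue null and therefore
    null for \<open>lev\<close>.\<close>
  also have "\<dots> = (\<integral>\<^sup>+y. 0 \<partial>N)"
  proof (rule nn_integral_cong)
    fix y
    have "(\<lambda>z. y + z) -` Z \<in> null_sets lborel"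
    proof (rule null_setsI)
      have "emeasure lborel Z = emeasure (distr lborel borel (\<lambda>z. y + z)) Z"
        using lborel_distr_plus[of y] by simp
      also have "\<dots> = emeasure lborel ((\<lambda>z. y + z) -` Z)"
        by (subst emeasure_distr) auto
      finally show "emeasure lborel ((\<lambda>z. y + z) -` Z) = 0" using Z by auto
      show "(\<lambda>z. y + z) -` Z \<in> sets lborel"
        using measurable_sets[of "\<lambda>z. y + z" borel borel Z] by simp
    qed
    then have "(\<lambda>z. y + z) -` Z \<in> null_sets lev"
      using lev_null_sets by (intro null_setsI) auto
    then have "AE z in lev. y + z \<notin> Z"
      by (rule AE_I') auto
    then have "(\<integral>\<^sup>+z. ennreal (s * z) * indicator Z (y + z) \<partial>lev) = (\<integral>\<^sup>+z. 0 \<partial>lev)"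
      by (intro nn_integral_cong_AE) (auto elim!: eventually_mono)
    then show "(\<integral>\<^sup>+z. ennreal (s * z) * indicator Z (y + z) \<partial>lev) = 0" by simp
  qed
  finally have "emeasure A Z = 0" by (simp add: AB)
  then have "(\<integral>\<^sup>+y. ennreal y * indicator Z y \<partial>N) = 0"
    by (simp add: A_def emeasure_density)
  then have "AE y in N. ennreal y * indicator Z y = 0"
    by (subst (asm) nn_integral_0_iff_AE) auto
  moreover have "AE y in N. y \<noteq> 0"
    using atom by (intro AE_I'[of "{0}"]) (auto intro!: null_setsI)
  ultimately have "AE y in N. y \<notin> Z"
    using pos by eventually_elim (auto simp: indicator_def ennreal_eq_0_iff split: if_splits)
  then show ?thesis
    using AE_iff_measurable[of Z N "\<lambda>y. y \<notin> Z"] by (simp add: space)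
qed

end

section \<open>The laws of a subordinator\<close>

lemma null_sets_translate:
  assumes Z: "Z \<in> null_sets lborel" shows "(\<lambda>z::real. y + z) -` Z \<in> null_sets lborel"
proof (rule null_setsI)
  have [measurable]: "Z \<in> sets borel" using Z by auto
  have "emeasure lborel Z = emeasure (distr lborel borel (\<lambda>z. y + z)) Z"
    using lborel_distr_plus[of y] by simp
  also have "\<dots> = emeasure lborel ((\<lambda>z. y + z) -` Z)"
    by (subst emeasure_distr) auto
  finally show "emeasure lborel ((\<lambda>z. y + z) -` Z) = 0" using Z by auto
  show "(\<lambda>z. y + z) -` Z \<in> sets lborel"
    using measurable_sets[of "\<lambda>z. y + z" borel borel Z] by simp
qed

lemma difference_quotient_sequence:
  assumes "(g has_vector_derivative D) (at x)"
  shows "(\<lambda>n. real (Suc n) * (g (x + 1 / real (Suc n)) - g x)) \<longlonglongrightarrow> (D :: real)"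
proof -
  have "DERIV g x :> D"
    using assms by (simp add: has_real_derivative_iff_has_vector_derivative)
  then have 1: "((\<lambda>h. (g (x + h) - g x) / h) \<longlongrightarrow> D) (at 0)"
    by (simp add: DERIV_def)
  have 2: "filterlim (\<lambda>n. 1 / real (Suc n)) (at 0) sequentially"
    by (rule filterlim_atI[OF LIMSEQ_Suc[OF lim_1_over_n, unfolded o_def]]) simp
  from filterlim_compose[OF 1 2] show ?thesis by (simp add: mult.commute)
qed

text \<open>The least multiple of 1 / Suc n strictly beyond x. Strictness makes the approach to x
  one from the right, where distribution functions are continuous, and the values lie in a countable
  set.\<close>

definition right_grid :: "nat \<Rightarrow> real \<Rightarrow> real" where
  "right_grid n x = of_int (\<lfloor>real (Suc n) * x\<rfloor> + 1) / real (Suc n)"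

lemma filterlim_right_grid: "filterlim (\<lambda>n. right_grid n x) (at_right x) sequentially"
proof -
  have gt: "x < of_int (\<lfloor>real (Suc n) * x\<rfloor> + 1) / real (Suc n)" for n
  proof -
    have "real (Suc n) * x < of_int (\<lfloor>real (Suc n) * x\<rfloor> + 1)" by linarith
    then show ?thesis by (simp add: pos_less_divide_eq mult.commute)
  qed
  have le: "of_int (\<lfloor>real (Suc n) * x\<rfloor> + 1) / real (Suc n) \<le> x + 1 / real (Suc n)" for n
  proof -
    have "of_int (\<lfloor>real (Suc n) * x\<rfloor> + 1) \<le> real (Suc n) * x + 1" by linarith
    then have "of_int (\<lfloor>real (Suc n) * x\<rfloor> + 1) / real (Suc n) \<le> (real (Suc n) * x + 1) / real (Suc n)"
      by (rule divide_right_mono) simp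
    then show ?thesis by (simp add: add_divide_distrib)
  qed
  have "(\<lambda>n. x + 1 / real (Suc n)) \<longlonglongrightarrow> x + 0"
    by (intro tendsto_add tendsto_const LIMSEQ_Suc[OF lim_1_over_n, unfolded o_def])
  then have "(\<lambda>n. x + 1 / real (Suc n)) \<longlonglongrightarrow> x" by simp
  then have lim: "(\<lambda>n. of_int (\<lfloor>real (Suc n) * x\<rfloor> + 1) / real (Suc n)) \<longlonglongrightarrow> x"
    by (rule tendsto_sandwich[OF _ _ tendsto_const, rotated 2])
      (auto intro!: always_eventually less_imp_le[OF gt] le simp del: of_nat_Suc of_int_add)
  show ?thesis
    unfolding filterlim_at right_grid_def
  proof (intro conjI lim always_eventually allI)
    fix n
    show "of_int (\<lfloor>real (Suc n) * x\<rfloor> + 1) / real (Suc n) \<in> {x<..}"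
      unfolding greaterThan_iff by (rule gt)
    show "of_int (\<lfloor>real (Suc n) * x\<rfloor> + 1) / real (Suc n) \<noteq> x"
      by (rule less_imp_neq[OF gt, symmetric])
  qed
qed

locale subordinator_process = levy_exponent f a b m + P: prob_space M
  for f :: "real \<Rightarrow> real" and a b :: real and m :: "real measure" and M :: "'w measure" +
  fixes \<sigma> :: "real \<Rightarrow> 'w \<Rightarrow> ennreal"
  assumes sub: "subordinator M f \<sigma>"
begin

lemma \<sigma>_measurable: "0 \<le> t \<Longrightarrow> \<sigma> t \<in> borel_measurable M"
  and \<sigma>_zero: "\<omega> \<in> space M \<Longrightarrow> \<sigma> 0 \<omega> = 0"
  using sub by (auto simp: subordinator_def)

lemma \<sigma>_mono: "\<omega> \<in> space M \<Longrightarrow> 0 \<le> s \<Longrightarrow> s \<le> t \<Longrightarrow> \<sigma> s \<omega> \<le> \<sigma> t \<omega>"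
proof -
  assume w: "\<omega> \<in> space M" "0 \<le> s" "s \<le> t"
  have "mono_on {0..} (\<lambda>t. \<sigma> t \<omega>)" using sub w by (auto simp: subordinator_def)
  from mono_onD[OF this, of s t] show ?thesis using w by auto
qed

lemma \<sigma>_right_continuous: "\<omega> \<in> space M \<Longrightarrow> 0 \<le> t \<Longrightarrow> ((\<lambda>s. \<sigma> s \<omega>) \<longlongrightarrow> \<sigma> t \<omega>) (at_right t)"
  using sub by (auto simp: subordinator_def continuous_within)

text \<open>The law of \<open>\<sigma> s\<close> on finite values. The density discards the event
  that the process has died, so the total mass may be below 1.\<close>

definition mu :: "real \<Rightarrow> real measure" where
  "mu s = distr (density M (\<lambda>\<omega>. if \<sigma> s \<omega> = \<infinity> then 0 else 1)) borel (\<lambda>\<omega>. enn2real (\<sigma> s \<omega>))"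

lemma sets_mu[simp, measurable_cong]: "sets (mu s) = sets borel"
  by (simp add: mu_def)

lemma space_mu[simp]: "space (mu s) = UNIV"
  by (simp add: mu_def)

lemma nn_integral_mu:
  assumes s: "0 \<le> s" and [measurable]: "g \<in> borel_measurable borel"
  shows "(\<integral>\<^sup>+y. g y \<partial>mu s) = (\<integral>\<^sup>+\<omega>. (if \<sigma> s \<omega> = \<infinity> then 0 else 1) * g (enn2real (\<sigma> s \<omega>)) \<partial>M)"
proof -
  note \<sigma>_measurable[OF s, measurable]
  have "(\<integral>\<^sup>+y. g y \<partial>mu s) = (\<integral>\<^sup>+\<omega>. g (enn2real (\<sigma> s \<omega>)) \<partial>density M (\<lambda>\<omega>. if \<sigma> s \<omega> = \<infinity> then 0 else 1))"
    unfolding mu_def by (rule nn_integral_distr) auto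
  also have "\<dots> = (\<integral>\<^sup>+\<omega>. (if \<sigma> s \<omega> = \<infinity> then 0 else 1) * g (enn2real (\<sigma> s \<omega>)) \<partial>M)"
    by (rule nn_integral_density) auto
  finally show ?thesis .
qed

lemma emeasure_mu_atMost:
  assumes s: "0 \<le> s" and t: "0 \<le> t"
  shows "emeasure (mu s) {..t} = emeasure M {\<omega> \<in> space M. \<sigma> s \<omega> \<le> ennreal t}"
proof -
  note \<sigma>_measurable[OF s, measurable]
  have "emeasure (mu s) {..t} = (\<integral>\<^sup>+y. indicator {..t} y \<partial>mu s)" by simp
  also have "\<dots> = (\<integral>\<^sup>+\<omega>. (if \<sigma> s \<omega> = \<infinity> then 0 else 1) * indicator {..t} (enn2real (\<sigma> s \<omega>)) \<partial>M)"
    by (rule nn_integral_mu[OF s]) simp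
  also have "\<dots> = (\<integral>\<^sup>+\<omega>. indicator {\<omega> \<in> space M. \<sigma> s \<omega> \<le> ennreal t} \<omega> \<partial>M)"
  proof (rule nn_integral_cong)
    fix \<omega> assume w: "\<omega> \<in> space M"
    show "(if \<sigma> s \<omega> = \<infinity> then 0 else 1) * indicator {..t} (enn2real (\<sigma> s \<omega>))
        = (indicator {\<omega> \<in> space M. \<sigma> s \<omega> \<le> ennreal t} \<omega> :: ennreal)"
      using t w by (cases "\<sigma> s \<omega>" rule: ennreal_cases) (auto simp: indicator_def top_unique)
  qed
  also have "\<dots> = emeasure M {\<omega> \<in> space M. \<sigma> s \<omega> \<le> ennreal t}"
    by (rule nn_integral_indicator) measurable
  finally show ?thesis .
qed

lemma AE_mu_nonneg: "0 \<le> s \<Longrightarrow> AE y in mu s. 0 \<le> y"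
  unfolding mu_def using \<sigma>_measurable[of s] by (subst AE_distr_iff) auto

lemma emeasure_mu_UNIV_le: "0 \<le> s \<Longrightarrow> emeasure (mu s) UNIV \<le> 1"
proof -
  assume s: "0 \<le> s"
  have "emeasure (mu s) UNIV = (\<integral>\<^sup>+y. 1 \<partial>mu s)" by simp
  also have "\<dots> = (\<integral>\<^sup>+\<omega>. (if \<sigma> s \<omega> = \<infinity> then 0 else 1) * 1 \<partial>M)"
    by (rule nn_integral_mu[OF s]) simp
  also have "\<dots> \<le> (\<integral>\<^sup>+\<omega>. 1 \<partial>M)" by (intro nn_integral_mono) simp
  also have "\<dots> = 1" by (simp add: P.emeasure_space_1)
  finally show ?thesis .
qed

lemma finite_measure_mu: "0 \<le> s \<Longrightarrow> finite_measure (mu s)"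
  using emeasure_mu_UNIV_le[of s] by (intro finite_measureI) (auto simp: top_unique)

lemma Laplace_mu:
  assumes s: "0 \<le> s" and x: "0 < x"
  shows "(\<integral>\<^sup>+y. ennreal (exp (- (x * y))) \<partial>mu s) = ennreal (exp (- (s * f x)))"
proof -
  note \<sigma>_measurable[OF s, measurable]
  have "(\<integral>\<^sup>+y. ennreal (exp (- (x * y))) \<partial>mu s)
      = (\<integral>\<^sup>+\<omega>. (if \<sigma> s \<omega> = \<infinity> then 0 else 1) * ennreal (exp (- (x * enn2real (\<sigma> s \<omega>)))) \<partial>M)"
    by (rule nn_integral_mu[OF s]) simp
  also have "\<dots> = (\<integral>\<^sup>+\<omega>. ennreal (if \<sigma> s \<omega> = \<infinity> then 0 else exp (- (x * enn2real (\<sigma> s \<omega>)))) \<partial>M)"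
    by (intro nn_integral_cong) auto
  also have "\<dots> = ennreal (\<integral>\<omega>. (if \<sigma> s \<omega> = \<infinity> then 0 else exp (- (x * enn2real (\<sigma> s \<omega>)))) \<partial>M)"
  proof (rule nn_integral_eq_integral)
    show "integrable M (\<lambda>\<omega>. if \<sigma> s \<omega> = \<infinity> then 0 else exp (- (x * enn2real (\<sigma> s \<omega>))))"
      using x by (intro P.integrable_const_bound[of _ 1]) auto
  qed auto
  also have "(\<integral>\<omega>. (if \<sigma> s \<omega> = \<infinity> then 0 else exp (- (x * enn2real (\<sigma> s \<omega>)))) \<partial>M) = exp (- (s * f x))"
    using sub s x by (auto simp: subordinator_def)
  finally show ?thesis .
qed

text \<open>The exponential Markov inequality. Letting x grow locates the drift; letting s grow at x
  = 1 shows that the inverse process is finite.\<close>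

lemma emeasure_mu_le_Laplace:
  assumes s: "0 \<le> s" and x: "0 < x"
  shows "emeasure (mu s) {..t} \<le> ennreal (exp (x * t - s * f x))"
proof -
  have "emeasure (mu s) {..t} = (\<integral>\<^sup>+y. indicator {..t} y \<partial>mu s)" by simp
  also have "\<dots> \<le> (\<integral>\<^sup>+y. ennreal (exp (x * t)) * ennreal (exp (- (x * y))) \<partial>mu s)"
  proof (rule nn_integral_mono)
    fix y
    show "indicator {..t} y \<le> ennreal (exp (x * t)) * ennreal (exp (- (x * y)))"
    proof (cases "y \<le> t")
      case True
      then have "1 \<le> exp (x * t) * exp (- (x * y))"
        using x by (simp add: mult_left_mono flip: exp_add)
      then have "ennreal 1 \<le> ennreal (exp (x * t) * exp (- (x * y)))" by (rule ennreal_leI)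
      then show ?thesis using True by (simp add: ennreal_mult)
    qed simp
  qed
  also have "\<dots> = ennreal (exp (x * t)) * (\<integral>\<^sup>+y. ennreal (exp (- (x * y))) \<partial>mu s)"
    by (rule nn_integral_cmult) simp
  also have "\<dots> = ennreal (exp (x * t)) * ennreal (exp (- (s * f x)))"
    by (simp only: Laplace_mu[OF s x])
  also have "\<dots> = ennreal (exp (x * t - s * f x))"
    by (simp add: exp_diff exp_minus divide_inverse flip: ennreal_mult)
  finally show ?thesis .
qed

text \<open>Since f x \<ge> b x, the exponential bound at a point y < s b is at most exp (- x (s b -
  y)), which vanishes as x grows.\<close>

lemma AE_mu_drift:
  assumes s: "0 < s" shows "AE y in mu s. s * b \<le> y"
proof -
  have z: "emeasure (mu s) {..y} = 0" if y: "y < s * b" for y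
  proof -
    have le: "emeasure (mu s) {..y} \<le> ennreal (exp (- (real (Suc n) * (s * b - y))))" for n
    proof -
      have p: "0 < real (Suc n)" by simp
      have "s * (b * real (Suc n)) \<le> s * f (real (Suc n))"
        using s f_jump[OF p] jump_nonneg[OF p] a_nonneg by (intro mult_left_mono) auto
      then have "real (Suc n) * y - s * f (real (Suc n)) \<le> - (real (Suc n) * (s * b - y))"
        by (simp add: right_diff_distrib mult.left_commute mult.commute)
      then have "ennreal (exp (real (Suc n) * y - s * f (real (Suc n)))) \<le> ennreal (exp (- (real (Suc n) * (s * b - y))))"
        by (intro ennreal_leI) simp
      with emeasure_mu_le_Laplace[OF less_imp_le[OF s] p] show ?thesis by (rule order_trans)
    qed
    have "(\<lambda>n. exp (- (s * b - y)) ^ Suc n) \<longlonglongrightarrow> 0"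
      using y by (intro LIMSEQ_Suc LIMSEQ_power_zero) simp
    moreover have "exp (- (real (Suc n) * (s * b - y))) = exp (- (s * b - y)) ^ Suc n" for n
      by (simp only: exp_of_nat_mult[symmetric] mult_minus_right)
    ultimately have "(\<lambda>n. exp (- (real (Suc n) * (s * b - y)))) \<longlonglongrightarrow> 0" by (simp only:)
    then have "(\<lambda>n. ennreal (exp (- (real (Suc n) * (s * b - y))))) \<longlonglongrightarrow> ennreal 0"
      by (rule tendsto_ennrealI)
    then have "emeasure (mu s) {..y} \<le> ennreal 0"
      by (rule LIMSEQ_le_const) (use le in blast)
    then show ?thesis by simp
  qed
  have "(\<Union>n. {..s * b - 1 / real (Suc n)}) \<in> null_sets (mu s)"
    by (intro null_sets_UN null_setsI z) auto
  then show ?thesis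
  proof (rule AE_I', intro subsetI)
    fix y assume "y \<in> {y \<in> space (mu s). \<not> s * b \<le> y}"
    then have "0 < s * b - y" by simp
    then obtain n where "1 / real (Suc n) < s * b - y" using reals_Archimedean[of "s * b - y"] by (auto simp: inverse_eq_divide)
    then have "y \<in> {..s * b - 1 / real (Suc n)}" by simp
    then show "y \<in> (\<Union>n. {..s * b - 1 / real (Suc n)})" by blast
  qed
qed

text \<open>Shifting the law by s b removes the drift from its exponent and leaves a +
  \<open>jump\<close>, for which absolute continuity is known; translations preserve null
  sets.\<close>

lemma mu_null_sets:
  assumes s: "0 < s" and Z: "Z \<in> null_sets lborel"
  shows "emeasure (mu s) Z = 0"
proof -
  have [measurable]: "Z \<in> sets borel" using Z by auto
  define N where "N = distr (mu s) borel (\<lambda>y. y - s * b)"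
  have "emeasure N ((\<lambda>y. s * b + y) -` Z) = 0"
  proof (rule abs_cont_driftless[OF _ _ s])
    show "sets N = sets borel" by (simp add: N_def)
    show "AE y in N. 0 \<le> y"
      unfolding N_def using AE_mu_drift[OF s] by (subst AE_distr_iff) auto
    show "finite_measure N"
      unfolding N_def using finite_measure_mu[of s] s by (intro finite_measure.finite_measure_distr) auto
    show "(\<lambda>y. s * b + y) -` Z \<in> null_sets lborel" by (rule null_sets_translate[OF Z])
    fix x :: real assume x: "0 < x"
    have "(\<integral>\<^sup>+y. ennreal (exp (- (x * y))) \<partial>N) = (\<integral>\<^sup>+y. ennreal (exp (- (x * (y - s * b)))) \<partial>mu s)"
      unfolding N_def by (rule nn_integral_distr) auto
    also have "\<dots> = (\<integral>\<^sup>+y. ennreal (exp (x * (s * b))) * ennreal (exp (- (x * y))) \<partial>mu s)"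
      by (intro nn_integral_cong) (simp add: right_diff_distrib exp_diff exp_minus divide_inverse flip: ennreal_mult)
    also have "\<dots> = ennreal (exp (x * (s * b))) * (\<integral>\<^sup>+y. ennreal (exp (- (x * y))) \<partial>mu s)"
      by (rule nn_integral_cmult) simp
    also have "\<dots> = ennreal (exp (x * (s * b))) * ennreal (exp (- (s * f x)))"
      using s by (simp only: Laplace_mu[OF _ x] less_imp_le)
    also have "\<dots> = ennreal (exp (x * (s * b) + - (s * f x)))"
      unfolding exp_add by (rule ennreal_mult[symmetric]) simp_all
    also have "x * (s * b) + - (s * f x) = - (s * (a + jump x))"
      by (simp add: f_jump[OF x] algebra_simps)
    finally show "(\<integral>\<^sup>+y. ennreal (exp (- (x * y))) \<partial>N) = ennreal (exp (- (s * (a + jump x))))" .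
  qed
  moreover have "emeasure N ((\<lambda>y. s * b + y) -` Z) = emeasure (mu s) Z"
  proof -
    have "(\<lambda>y. s * b + y) -` Z \<in> sets borel"
      using measurable_sets[of "\<lambda>y. s * b + y" borel borel Z] by simp
    then have "emeasure N ((\<lambda>y. s * b + y) -` Z) = emeasure (mu s) ((\<lambda>y. y - s * b) -` ((\<lambda>y. s * b + y) -` Z) \<inter> space (mu s))"
      unfolding N_def by (intro emeasure_distr) auto
    also have "(\<lambda>y. y - s * b) -` ((\<lambda>y. s * b + y) -` Z) \<inter> space (mu s) = Z" by auto
    finally show ?thesis .
  qed
  ultimately show ?thesis by simp
qed

text \<open>The clamp at time 0 makes this antitone in s on the whole line, from which measurability
  in s follows.\<close>

definition cdfm :: "real \<Rightarrow> real \<Rightarrow> real" where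
  "cdfm s x = measure (mu (max 0 s)) {..x}"

lemma emeasure_mu_eq_cdfm: "0 \<le> s \<Longrightarrow> emeasure (mu s) {..x} = ennreal (cdfm s x)"
proof -
  assume s: "0 \<le> s"
  interpret finite_measure "mu s" by (rule finite_measure_mu[OF s])
  show ?thesis using s by (simp add: cdfm_def emeasure_eq_measure max_def)
qed

lemma cdfm_neg: "x < 0 \<Longrightarrow> cdfm s x = 0"
proof -
  assume x: "x < 0"
  have "AE y in mu (max 0 s). y \<notin> {..x}"
    using AE_mu_nonneg[of "max 0 s", OF max.cobounded1] by eventually_elim (use x in simp)
  then have "emeasure (mu (max 0 s)) {..x} = 0"
    using AE_iff_measurable[of "{..x}" "mu (max 0 s)" "\<lambda>y. y \<notin> {..x}"] by auto
  then show ?thesis by (simp add: cdfm_def measure_def)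
qed

lemma cdfm_nonneg: "0 \<le> cdfm s x" and cdfm_le_1: "cdfm s x \<le> 1"
proof -
  show "0 \<le> cdfm s x" by (simp add: cdfm_def)
  have "emeasure (mu (max 0 s)) {..x} \<le> emeasure (mu (max 0 s)) UNIV" by (rule emeasure_mono) auto
  also have "\<dots> \<le> 1" by (rule emeasure_mu_UNIV_le) simp
  finally show "cdfm s x \<le> 1" unfolding cdfm_def measure_def by (simp add: enn2real_leI)
qed

lemma cdfm_mono: "x \<le> y \<Longrightarrow> cdfm s x \<le> cdfm s y"
proof -
  assume xy: "x \<le> y"
  interpret finite_measure "mu (max 0 s)" by (rule finite_measure_mu) simp
  show ?thesis unfolding cdfm_def by (rule finite_measure_mono) (use xy in auto)
qed

lemma cdfm_antimono: "s \<le> s' \<Longrightarrow> cdfm s' x \<le> cdfm s x"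
proof (cases "x < 0")
  case False
  assume le: "s \<le> s'"
  have "emeasure (mu (max 0 s')) {..x} \<le> emeasure (mu (max 0 s)) {..x}"
  proof -
    have "\<sigma> (max 0 s) \<omega> \<le> \<sigma> (max 0 s') \<omega>" if "\<omega> \<in> space M" for \<omega>
      using that le by (intro \<sigma>_mono) (auto simp: max_def)
    then have "{\<omega> \<in> space M. \<sigma> (max 0 s') \<omega> \<le> ennreal x} \<subseteq> {\<omega> \<in> space M. \<sigma> (max 0 s) \<omega> \<le> ennreal x}"
      using order_trans by blast
    moreover have "{\<omega> \<in> space M. \<sigma> (max 0 s) \<omega> \<le> ennreal x} \<in> sets M"
      using \<sigma>_measurable[of "max 0 s"] by simp
    ultimately show ?thesis
      using False by (simp add: emeasure_mu_atMost emeasure_mono)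
  qed
  then have "ennreal (cdfm s' x) \<le> ennreal (cdfm s x)"
    using emeasure_mu_eq_cdfm[of "max 0 s" x] emeasure_mu_eq_cdfm[of "max 0 s'" x] by (simp add: cdfm_def)
  then show ?thesis using cdfm_nonneg by simp
qed (simp add: cdfm_neg)

lemma cdfm_right_limit: "(\<lambda>n. cdfm s (right_grid n x)) \<longlonglongrightarrow> cdfm s x"
proof -
  interpret finite_borel_measure "mu (max 0 s)"
    using finite_measure_mu[of "max 0 s"] by (intro finite_borel_measure.intro finite_borel_measure_axioms.intro) auto
  have eq: "cdfm s = cdf (mu (max 0 s))" by (auto simp: cdfm_def cdf_def)
  have rc: "(cdf (mu (max 0 s)) \<longlongrightarrow> cdf (mu (max 0 s)) x) (at_right x)"
    using cdf_is_right_cont by (simp add: continuous_within)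
  from filterlim_compose[OF rc filterlim_right_grid] show ?thesis by (simp only: eq)
qed

text \<open>Joint measurability from monotonicity in s and right continuity in x: the second
  argument is approximated from the right by a grid with countably many values.\<close>

lemma cdfm_measurable[measurable]: "(\<lambda>p. cdfm (fst p) (snd p)) \<in> borel_measurable (borel \<Otimes>\<^sub>M borel)"
proof (rule borel_measurable_LIMSEQ_real)
  show "(\<lambda>n. cdfm (fst p) (of_int (\<lfloor>real (Suc n) * snd p\<rfloor> + 1) / real (Suc n))) \<longlonglongrightarrow> cdfm (fst p) (snd p)" for p
    using cdfm_right_limit by (simp only: right_grid_def)
  have [measurable]: "(\<lambda>s. cdfm s x) \<in> borel_measurable borel" for x
  proof -
    have "(\<lambda>s. - cdfm s x) \<in> borel_measurable borel"
      by (rule borel_measurable_mono) (auto intro!: monoI cdfm_antimono)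
    then have "(\<lambda>s. - (- cdfm s x)) \<in> borel_measurable borel" by (rule borel_measurable_uminus)
    then show ?thesis by simp
  qed
  show "(\<lambda>p. cdfm (fst p) (of_int (\<lfloor>real (Suc n) * snd p\<rfloor> + 1) / real (Suc n))) \<in> borel_measurable (borel \<Otimes>\<^sub>M borel)" for n
  proof (rule measurable_compose_countable[where g="\<lambda>p. \<lfloor>real (Suc n) * snd p\<rfloor> + 1" and f="\<lambda>i p. cdfm (fst p) (of_int i / real (Suc n))"])
    show "(\<lambda>p. cdfm (fst p) (of_int i / real (Suc n))) \<in> borel_measurable (borel \<Otimes>\<^sub>M borel)" for i
      by measurable
    show "(\<lambda>p. \<lfloor>real (Suc n) * snd p\<rfloor> + 1) \<in> borel \<Otimes>\<^sub>M borel \<rightarrow>\<^sub>M count_space UNIV"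
      by measurable
  qed
qed

text \<open>Radon-Nikodym yields a density for each s separately, with no control over the
  dependence on s. This lower limit of difference quotients is one explicit version, jointly
  measurable in s and x; the lower limit always exists in the extended reals.\<close>

definition kern :: "real \<Rightarrow> real \<Rightarrow> real" where
  "kern s x = (if 0 < s \<and> 0 < x
     then enn2real (liminf (\<lambda>n. ennreal (real (Suc n) * (cdfm s (x + 1 / real (Suc n)) - cdfm s x)))) else 0)"

lemma kern_nonneg: "0 \<le> kern s x"
  by (simp add: kern_def)

lemma kern_measurable[measurable]: "(\<lambda>p. kern (fst p) (snd p)) \<in> borel_measurable (borel \<Otimes>\<^sub>M borel)"
proof -
  have [measurable]: "(\<lambda>p. cdfm (fst p) (snd p + 1 / real (Suc n))) \<in> borel_measurable (borel \<Otimes>\<^sub>M borel)" for n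
    using measurable_compose[of "\<lambda>p. (fst p, snd p + 1 / real (Suc n))" "borel \<Otimes>\<^sub>M borel" "borel \<Otimes>\<^sub>M borel", OF _ cdfm_measurable]
    by simp
  show ?thesis
    unfolding kern_def by measurable
qed

text \<open>A Radon-Nikodym density has the distribution function as its primitive, so Lebesgue
  differentiation identifies it almost everywhere with the limit of the quotients in
  \<open>kern\<close>.\<close>

lemma mu_density:
  assumes s: "0 < s"
  shows "mu s = density lborel (\<lambda>x. ennreal (kern s x))"
proof -
  interpret finite_measure "mu s" by (rule finite_measure_mu) (use s in simp)
  have "absolutely_continuous lborel (mu s)"
    unfolding absolutely_continuous_def using mu_null_sets[OF s] by (auto intro!: null_setsI)
  then obtain h where h[measurable]: "h \<in> borel_measurable borel" "density lborel h = mu s"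
    using sigma_finite_measure.Radon_Nikodym[OF lborel.sigma_finite_measure_axioms, of "mu s"] by auto
  have hfin: "(\<integral>\<^sup>+x. h x \<partial>lborel) \<noteq> \<infinity>"
  proof -
    have "(\<integral>\<^sup>+x. h x \<partial>lborel) = emeasure (mu s) UNIV"
      unfolding h(2)[symmetric] by (simp add: emeasure_density)
    then show ?thesis by simp
  qed
  have "AE x in lborel. h x \<noteq> \<infinity>" by (rule nn_integral_PInf_AE[OF _ hfin]) simp
  then have hc: "AE x in lborel. h x = ennreal (enn2real (h x))"
    by eventually_elim (rule ennreal_eq_top_cases)
  define c where "c x = enn2real (h x)" for x
  have [measurable]: "c \<in> borel_measurable borel" unfolding c_def by measurable
  have hc: "AE x in lborel. h x = ennreal (c x)" using hc by (simp add: c_def)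
  have cint: "integrable lborel c"
  proof (rule integrableI_nonneg)
    have "(\<integral>\<^sup>+x. ennreal (c x) \<partial>lborel) = (\<integral>\<^sup>+x. h x \<partial>lborel)"
      using hc by (intro nn_integral_cong_AE) (auto elim!: eventually_mono)
    then show "(\<integral>\<^sup>+x. ennreal (c x) \<partial>lborel) < \<infinity>" using hfin by (simp add: less_top)
  qed (auto simp: c_def)
  have prim: "primitive c t = cdfm s t" for t
  proof -
    have "emeasure (mu s) {..t} = (\<integral>\<^sup>+x. h x * indicator {..t} x \<partial>lborel)"
      unfolding h(2)[symmetric] by (rule emeasure_density) auto
    also have "\<dots> = (\<integral>\<^sup>+x. ennreal (c x * indicator {..t} x) \<partial>lborel)"
      using hc by (intro nn_integral_cong_AE) (auto elim!: eventually_mono simp: indicator_def)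
    also have "\<dots> = ennreal (primitive c t)"
      unfolding primitive_def
    proof (rule nn_integral_eq_integral)
      show "integrable lborel (\<lambda>x. c x * indicator {..t} x)"
        by (rule integrable_real_mult_indicator[OF _ cint]) simp
    qed (simp add: c_def)
    finally have "ennreal (cdfm s t) = ennreal (primitive c t)"
      using emeasure_mu_eq_cdfm[of s t] s by simp
    moreover have "0 \<le> primitive c t"
      unfolding primitive_def by (rule integral_nonneg_AE) (auto simp: c_def)
    ultimately show ?thesis using cdfm_nonneg[of s t] ennreal_inj by metis
  qed
  \<comment> \<open>\<open>kern\<close> is 0 on the left half-line by definition, so the density has
    to vanish there too.\<close>
  have "emeasure (mu s) {..0} = 0"
  proof -
    have "{0::real} \<in> null_sets lborel" by (intro null_setsI) auto
    then have "AE y in mu s. y \<noteq> 0"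
      using mu_null_sets[OF s, of "{0}"] by (intro AE_I'[of "{0}"] null_setsI) auto
    with AE_mu_nonneg[of s] s have "AE y in mu s. y \<notin> {..0}"
      by (auto elim!: eventually_elim2)
    then show ?thesis
      using AE_iff_measurable[of "{..0}" "mu s" "\<lambda>y. y \<notin> {..0}"] by auto
  qed
  then have "(\<integral>\<^sup>+x. h x * indicator {..0} x \<partial>lborel) = 0"
    unfolding h(2)[symmetric] by (subst (asm) emeasure_density) auto
  then have h0: "AE x in lborel. h x * indicator {..0} x = 0"
    by (subst (asm) nn_integral_0_iff_AE) auto
  have "AE x in lborel. h x = ennreal (kern s x)"
    using hc h0 Lebesgue_differentiation[OF cint]
  proof eventually_elim
    fix x assume 1: "h x = ennreal (c x)" "h x * indicator {..0} x = 0" and d: "(primitive c has_vector_derivative c x) (at x)"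
    show "h x = ennreal (kern s x)"
    proof (cases "0 < x")
      case True
      have "(\<lambda>n. real (Suc n) * (primitive c (x + 1 / real (Suc n)) - primitive c x)) \<longlonglongrightarrow> c x"
        using d by (rule difference_quotient_sequence)
      then have "(\<lambda>n. ennreal (real (Suc n) * (cdfm s (x + 1 / real (Suc n)) - cdfm s x))) \<longlonglongrightarrow> ennreal (c x)"
        unfolding prim by (rule tendsto_ennrealI)
      then have "liminf (\<lambda>n. ennreal (real (Suc n) * (cdfm s (x + 1 / real (Suc n)) - cdfm s x))) = ennreal (c x)"
        by (intro lim_imp_Liminf) auto
      then have "kern s x = c x"
        using True s by (simp only: kern_def) (simp add: c_def)
      then show ?thesis using 1(1) by simp
    next
      case False
      then have "h x = 0" "kern s x = 0" using 1(2) by (simp_all add: kern_def)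
      then show ?thesis by simp
    qed
  qed
  then have "density lborel h = density lborel (\<lambda>x. ennreal (kern s x))"
  proof (intro density_cong)
    show "(\<lambda>x. ennreal (kern s x)) \<in> borel_measurable lborel"
    proof -
      have "(\<lambda>x. kern s x) \<in> borel_measurable borel"
        using measurable_compose[of "\<lambda>x. (s, x)" borel "borel \<Otimes>\<^sub>M borel" "\<lambda>p. kern (fst p) (snd p)" borel]
          kern_measurable by simp
      then show ?thesis by measurable
    qed
  qed auto
  then show ?thesis by (simp add: h(2))
qed

end

section \<open>Renewal equations\<close>

text \<open>Equality of tails is asked at positive rational levels only: almost everywhere
  statements, one per level, can be combined over a countable set. Right continuity reaches the
  remaining levels, and finiteness comes from the tails being at most 1.\<close>

lemma measure_eqI_tails:
  fixes N1 N2 :: "real measure"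
  assumes sets: "sets N1 = sets borel" "sets N2 = sets borel"
    and nonpos: "emeasure N1 {..0} = 0" "emeasure N2 {..0} = 0"
    and tails: "\<And>(i::int) n. 0 < i \<Longrightarrow> emeasure N1 {of_int i / real (Suc n)<..} = emeasure N2 {of_int i / real (Suc n)<..}"
    and le: "\<And>s. 0 < s \<Longrightarrow> emeasure N1 {s<..} \<le> 1"
  shows "N1 = N2"
proof -
  have fin: "finite_borel_measure N"
    if s: "sets N = sets borel" and 0: "emeasure N {..0} = 0"
      and t: "\<And>(i::int) n. 0 < i \<Longrightarrow> emeasure N {of_int i / real (Suc n)<..} \<le> 1" for N :: "real measure"
  proof (intro finite_borel_measure.intro finite_measureI finite_borel_measure_axioms.intro s)
    have "{0<..} = (\<Union>n. {1 / real (Suc n)<..})"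
    proof (intro equalityI subsetI)
      fix x :: real assume "x \<in> {0<..}"
      then obtain n where "1 / real (Suc n) < x" using reals_Archimedean[of x] by (auto simp: inverse_eq_divide)
      then show "x \<in> (\<Union>n. {1 / real (Suc n)<..})" by auto
    next
      fix x :: real assume "x \<in> (\<Union>n. {1 / real (Suc n)<..})"
      then obtain n where "1 / real (Suc n) < x" by auto
      moreover have "0 < 1 / real (Suc n)" by simp
      ultimately have "0 < x" by linarith
      then show "x \<in> {0<..}" by simp
    qed
    moreover have "(SUP n. emeasure N {1 / real (Suc n)<..}) = emeasure N (\<Union>n. {1 / real (Suc n)<..})"
    proof (rule SUP_emeasure_incseq)
      show "incseq (\<lambda>n. {1 / real (Suc n)<..})"
      proof (rule incseq_SucI)
        fix n have "1 / real (Suc (Suc n)) \<le> 1 / real (Suc n)" by (intro frac_le) auto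
        then show "{1 / real (Suc n)<..} \<subseteq> {1 / real (Suc (Suc n))<..}" by auto
      qed
    qed (auto simp: s)
    moreover have "(SUP n. emeasure N {1 / real (Suc n)<..}) \<le> 1"
      using t[of 1] by (intro SUP_least) simp
    ultimately have 1: "emeasure N {0<..} \<le> 1" by simp
    have "emeasure N (space N) = emeasure N ({..0} \<union> {0<..})"
      using sets_eq_imp_space_eq[OF s] by (intro arg_cong[where f="emeasure N"]) auto
    also have "\<dots> \<le> emeasure N {..0} + emeasure N {0<..}"
      by (intro emeasure_subadditive) (auto simp: s)
    also have "\<dots> \<le> 1" using 0 1 by simp
    finally show "emeasure N (space N) \<noteq> \<infinity>" by (auto simp: top_unique)
  qed
  have pos: "0 < of_int i / real (Suc n)" if "0 < i" for i :: int and n using that by simp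
  interpret A: finite_borel_measure N1
    by (rule fin[OF sets(1) nonpos(1)]) (rule le[OF pos])
  interpret B: finite_borel_measure N2
    by (rule fin[OF sets(2) nonpos(2)]) (metis tails le[OF pos])
  have tail_cdf: "measure N1 {x<..} = measure N1 UNIV - cdf N1 x" "measure N2 {x<..} = measure N2 UNIV - cdf N2 x" for x
  proof -
    have "UNIV - {..x} = {x<..}" by auto
    then show "measure N1 {x<..} = measure N1 UNIV - cdf N1 x" "measure N2 {x<..} = measure N2 UNIV - cdf N2 x"
      using A.finite_measure_Diff[of UNIV "{..x}"] B.finite_measure_Diff[of UNIV "{..x}"] sets
      by (simp_all add: cdf_def)
  qed
  have gridpos: "\<exists>i>0. right_grid n x = of_int i / real (Suc n)" if "0 \<le> x" for n x
  proof -
    have "0 \<le> real (Suc n) * x" using that by simp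
    then have "0 < \<lfloor>real (Suc n) * x\<rfloor> + 1" by linarith
    then show ?thesis unfolding right_grid_def by blast
  qed
  have tl: "measure N1 {right_grid n x<..} = measure N2 {right_grid n x<..}" if x: "0 \<le> x" for n x
  proof -
    obtain i where i: "0 < i" "right_grid n x = of_int i / real (Suc n)" using gridpos[OF x] by blast
    show ?thesis unfolding i(2) measure_def by (simp only: tails[OF i(1)])
  qed
  have rlim: "(\<lambda>n. cdf N1 (right_grid n x)) \<longlonglongrightarrow> cdf N1 x" "(\<lambda>n. cdf N2 (right_grid n x)) \<longlonglongrightarrow> cdf N2 x" for x
    using filterlim_compose[OF A.cdf_is_right_cont[of x, unfolded continuous_within] filterlim_right_grid]
      filterlim_compose[OF B.cdf_is_right_cont[of x, unfolded continuous_within] filterlim_right_grid] by simp_all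
  have zero: "cdf N1 x = 0" "cdf N2 x = 0" if "x \<le> 0" for x
  proof -
    have "emeasure N1 {..x} \<le> emeasure N1 {..0}" "emeasure N2 {..x} \<le> emeasure N2 {..0}"
      using that by (auto intro!: emeasure_mono simp: sets)
    then show "cdf N1 x = 0" "cdf N2 x = 0" using nonpos by (simp_all add: cdf_def measure_def)
  qed
  \<comment> \<open>Tails determine distribution functions only up to the total mass, which is read
    off from positive levels decreasing to 0.\<close>
  have total: "measure N1 UNIV = measure N2 UNIV"
  proof -
    have "(\<lambda>n. measure N1 UNIV - cdf N1 (right_grid n 0)) \<longlonglongrightarrow> measure N1 UNIV - cdf N1 0"
      "(\<lambda>n. measure N2 UNIV - cdf N2 (right_grid n 0)) \<longlonglongrightarrow> measure N2 UNIV - cdf N2 0"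
      by (intro tendsto_diff tendsto_const rlim)+
    moreover have "measure N1 UNIV - cdf N1 (right_grid n 0) = measure N2 UNIV - cdf N2 (right_grid n 0)" for n
      using tl[of 0 n] by (simp add: tail_cdf)
    ultimately have "measure N1 UNIV - cdf N1 0 = measure N2 UNIV - cdf N2 0"
      using LIMSEQ_unique by simp
    then show ?thesis by (simp add: zero)
  qed
  have "cdf N1 x = cdf N2 x" for x
  proof (cases "x \<le> 0")
    case False
    have "cdf N1 (right_grid n x) = cdf N2 (right_grid n x)" for n
      using tl[of x n] False by (simp add: tail_cdf total)
    then show ?thesis using rlim[of x] LIMSEQ_unique by simp
  qed (simp add: zero)
  then show ?thesis
    by (intro cdf_unique' ext) unfold_locales
qed

definition conv :: "(real \<Rightarrow> ennreal) \<Rightarrow> (real \<Rightarrow> ennreal) \<Rightarrow> real \<Rightarrow> ennreal" where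
  "conv \<phi> \<psi> t = (\<integral>\<^sup>+x. \<phi> (t - x) * \<psi> x \<partial>lborel)"

lemma conv_measurable[measurable]:
  assumes [measurable]: "\<phi> \<in> borel_measurable borel" "\<psi> \<in> borel_measurable borel"
  shows "conv \<phi> \<psi> \<in> borel_measurable borel"
  unfolding conv_def[abs_def] by measurable

lemma nn_integral_lborel_shift:
  fixes g :: "real \<Rightarrow> ennreal"
  assumes "g \<in> borel_measurable borel"
  shows "(\<integral>\<^sup>+t. g (t - x) \<partial>lborel) = (\<integral>\<^sup>+t. g t \<partial>lborel)"
  using nn_integral_real_affine[OF assms, of 1 "- x"] by (simp add: add.commute)

lemma Laplace_conv:
  assumes [measurable]: "\<phi> \<in> borel_measurable borel" "\<psi> \<in> borel_measurable borel"
  shows "(\<integral>\<^sup>+t. ennreal (exp (- (r * t))) * conv \<phi> \<psi> t \<partial>lborel) =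
    (\<integral>\<^sup>+t. ennreal (exp (- (r * t))) * \<phi> t \<partial>lborel) * (\<integral>\<^sup>+t. ennreal (exp (- (r * t))) * \<psi> t \<partial>lborel)"
proof -
  have exp: "ennreal (exp (- (r * t))) = ennreal (exp (- (r * (t - x)))) * ennreal (exp (- (r * x)))" for t x
  proof -
    have "- (r * t) = - (r * (t - x)) + - (r * x)" by (simp add: right_diff_distrib)
    then show ?thesis by (simp only: exp_add) (rule ennreal_mult, simp_all)
  qed
  have "(\<integral>\<^sup>+t. ennreal (exp (- (r * t))) * conv \<phi> \<psi> t \<partial>lborel) =
      (\<integral>\<^sup>+t. \<integral>\<^sup>+x. ennreal (exp (- (r * t))) * (\<phi> (t - x) * \<psi> x) \<partial>lborel \<partial>lborel)"
    unfolding conv_def by (intro nn_integral_cong nn_integral_cmult[symmetric]) measurable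
  also have "\<dots> = (\<integral>\<^sup>+x. \<integral>\<^sup>+t. ennreal (exp (- (r * t))) * (\<phi> (t - x) * \<psi> x) \<partial>lborel \<partial>lborel)"
    by (rule lborel_pair.Fubini') measurable
  also have "\<dots> = (\<integral>\<^sup>+x. (\<integral>\<^sup>+t. ennreal (exp (- (r * t))) * \<phi> t \<partial>lborel) * (ennreal (exp (- (r * x))) * \<psi> x) \<partial>lborel)"
  proof (rule nn_integral_cong)
    fix x
    have "(\<integral>\<^sup>+t. ennreal (exp (- (r * t))) * (\<phi> (t - x) * \<psi> x) \<partial>lborel)
        = (\<integral>\<^sup>+t. (ennreal (exp (- (r * (t - x)))) * \<phi> (t - x)) * (ennreal (exp (- (r * x))) * \<psi> x) \<partial>lborel)"
      by (intro nn_integral_cong) (subst exp[of _ x], simp only: ac_simps)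
    also have "\<dots> = (\<integral>\<^sup>+t. ennreal (exp (- (r * (t - x)))) * \<phi> (t - x) \<partial>lborel) * (ennreal (exp (- (r * x))) * \<psi> x)"
      by (rule nn_integral_multc) measurable
    also have "(\<integral>\<^sup>+t. ennreal (exp (- (r * (t - x)))) * \<phi> (t - x) \<partial>lborel) = (\<integral>\<^sup>+t. ennreal (exp (- (r * t))) * \<phi> t \<partial>lborel)"
      by (rule nn_integral_lborel_shift) measurable
    finally show "(\<integral>\<^sup>+t. ennreal (exp (- (r * t))) * (\<phi> (t - x) * \<psi> x) \<partial>lborel)
        = (\<integral>\<^sup>+t. ennreal (exp (- (r * t))) * \<phi> t \<partial>lborel) * (ennreal (exp (- (r * x))) * \<psi> x)" .
  qed
  also have "\<dots> = (\<integral>\<^sup>+t. ennreal (exp (- (r * t))) * \<phi> t \<partial>lborel) * (\<integral>\<^sup>+t. ennreal (exp (- (r * t))) * \<psi> t \<partial>lborel)"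
    by (rule nn_integral_cmult) measurable
  finally show ?thesis .
qed

lemma AE_density_eqI_Laplace:
  fixes g h :: "real \<Rightarrow> ennreal"
  assumes [measurable]: "g \<in> borel_measurable borel" "h \<in> borel_measurable borel"
    and supp: "\<And>t. t < 0 \<Longrightarrow> g t = 0" "\<And>t. t < 0 \<Longrightarrow> h t = 0"
    and eq: "\<And>r. 0 < r \<Longrightarrow> (\<integral>\<^sup>+t. ennreal (exp (- (r * t))) * g t \<partial>lborel) = (\<integral>\<^sup>+t. ennreal (exp (- (r * t))) * h t \<partial>lborel)"
    and fin: "(\<integral>\<^sup>+t. ennreal (exp (- t)) * g t \<partial>lborel) < \<infinity>"
  shows "AE t in lborel. g t = h t"
proof (rule sigma_finite_measure.density_unique[OF lborel.sigma_finite_measure_axioms])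
  show "density lborel g = density lborel h"
  proof (rule measure_eqI_Laplace)
    show "AE t in density lborel g. 0 \<le> t" "AE t in density lborel h. 0 \<le> t"
      using supp by (auto simp: AE_density intro!: AE_I2) (metis less_irrefl not_le)+
    show "(\<integral>\<^sup>+t. ennreal (exp (- (real n * t))) \<partial>density lborel g) = (\<integral>\<^sup>+t. ennreal (exp (- (real n * t))) \<partial>density lborel h)"
      if "1 \<le> n" for n :: nat
      using eq[of "real n"] that by (simp add: nn_integral_density mult.commute)
    show "(\<integral>\<^sup>+t. ennreal (exp (- t)) \<partial>density lborel g) < \<infinity>"
      using fin by (simp add: nn_integral_density mult.commute)
  qed simp_all
qed simp_all

section \<open>Potential densities and the renewal equation\<close>

context subordinator_process
begin

lemma kern_eq_0: "x \<le> 0 \<Longrightarrow> kern s x = 0" "s \<le> 0 \<Longrightarrow> kern s x = 0"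
  by (simp_all add: kern_def)

lemma kern_measurable_pair[measurable]:
  "(\<lambda>(s, x). kern s x) \<in> borel_measurable (borel \<Otimes>\<^sub>M borel)"
  using kern_measurable by (simp add: case_prod_unfold)

definition pot :: "real \<Rightarrow> real \<Rightarrow> ennreal" where
  "pot S x = (\<integral>\<^sup>+s. indicator {S<..} s * ennreal (kern s x) \<partial>lborel)"

lemma pot_measurable[measurable]: "pot S \<in> borel_measurable borel"
  unfolding pot_def[abs_def] by measurable

lemma pot_eq_0: "x \<le> 0 \<Longrightarrow> pot S x = 0"
  by (simp add: pot_def kern_eq_0)

lemma Laplace_kern:
  assumes "0 < s" "0 < r"
  shows "(\<integral>\<^sup>+x. ennreal (exp (- (r * x))) * ennreal (kern s x) \<partial>lborel) = ennreal (exp (- (s * f r)))"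
proof -
  have "(\<integral>\<^sup>+x. ennreal (exp (- (r * x))) \<partial>mu s) = (\<integral>\<^sup>+x. ennreal (kern s x) * ennreal (exp (- (r * x))) \<partial>lborel)"
    unfolding mu_density[OF assms(1)] by (rule nn_integral_density) measurable
  then show ?thesis using Laplace_mu[of s r] assms by (simp add: mult.commute)
qed

lemma Laplace_pot:
  assumes S: "0 \<le> S" and r: "0 < r"
  shows "(\<integral>\<^sup>+x. ennreal (exp (- (r * x))) * pot S x \<partial>lborel) = ennreal (exp (- (S * f r)) / f r)"
proof -
  have "(\<integral>\<^sup>+x. ennreal (exp (- (r * x))) * pot S x \<partial>lborel)
      = (\<integral>\<^sup>+x. \<integral>\<^sup>+s. ennreal (exp (- (r * x))) * (indicator {S<..} s * ennreal (kern s x)) \<partial>lborel \<partial>lborel)"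
    unfolding pot_def by (intro nn_integral_cong nn_integral_cmult[symmetric]) measurable
  also have "\<dots> = (\<integral>\<^sup>+s. \<integral>\<^sup>+x. ennreal (exp (- (r * x))) * (indicator {S<..} s * ennreal (kern s x)) \<partial>lborel \<partial>lborel)"
    by (rule lborel_pair.Fubini') measurable
  also have "\<dots> = (\<integral>\<^sup>+s. ennreal (exp (- (f r * s))) * indicator {S..} s \<partial>lborel)"
  proof (rule nn_integral_cong_AE)
    show "AE s in lborel. (\<integral>\<^sup>+x. ennreal (exp (- (r * x))) * (indicator {S<..} s * ennreal (kern s x)) \<partial>lborel)
        = ennreal (exp (- (f r * s))) * indicator {S..} s"
      using AE_lborel_singleton[of S]
    proof eventually_elim
      fix s assume s: "s \<noteq> S"
      show "(\<integral>\<^sup>+x. ennreal (exp (- (r * x))) * (indicator {S<..} s * ennreal (kern s x)) \<partial>lborel)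
        = ennreal (exp (- (f r * s))) * indicator {S..} s"
      proof (cases "S < s")
        case True
        then show ?thesis using Laplace_kern[of s r] r S by (simp add: mult.commute)
      next
        case False
        then show ?thesis using s by simp
      qed
    qed
  qed
  also have "\<dots> = ennreal (exp (- (f r * S)) / f r)"
    by (rule nn_integral_exp_atLeast[OF f_pos[OF r]])
  finally show ?thesis by (simp add: mult.commute)
qed

text \<open>By Tonelli's theorem the transform of a distribution function is that of the measure
  divided by r.\<close>

lemma nn_integral_exp_cdfm:
  assumes S: "0 \<le> S" and r: "0 < r"
  shows "(\<integral>\<^sup>+t. ennreal (exp (- (r * t))) * (indicator {0<..} t * ennreal (cdfm S t)) \<partial>lborel) = ennreal (exp (- (S * f r)) / r)"
proof -
  interpret mu: finite_measure "mu S" by (rule finite_measure_mu[OF S])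
  interpret Q: pair_sigma_finite lborel "mu S" ..
  have "(\<integral>\<^sup>+t. ennreal (exp (- (r * t))) * (indicator {0<..} t * ennreal (cdfm S t)) \<partial>lborel)
      = (\<integral>\<^sup>+t. \<integral>\<^sup>+y. ennreal (exp (- (r * t))) * (indicator {0<..} t * indicator {y..} t) \<partial>mu S \<partial>lborel)"
  proof (rule nn_integral_cong)
    fix t
    have "ennreal (cdfm S t) = (\<integral>\<^sup>+y. indicator {..t} y \<partial>mu S)"
      using emeasure_mu_eq_cdfm[OF S, of t] by simp
    also have "\<dots> = (\<integral>\<^sup>+y. indicator {y..} t \<partial>mu S)"
      by (intro nn_integral_cong) (simp add: indicator_def)
    finally have "ennreal (exp (- (r * t))) * (indicator {0<..} t * ennreal (cdfm S t))
        = ennreal (exp (- (r * t))) * indicator {0<..} t * (\<integral>\<^sup>+y. indicator {y..} t \<partial>mu S)"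
      by (simp add: mult.assoc)
    also have "\<dots> = (\<integral>\<^sup>+y. ennreal (exp (- (r * t))) * indicator {0<..} t * indicator {y..} t \<partial>mu S)"
    proof (rule nn_integral_cmult[symmetric])
      have "(\<lambda>y. indicator {y..} t :: ennreal) = indicator {..t}" by (auto simp: indicator_def)
      then show "(\<lambda>y. indicator {y..} t :: ennreal) \<in> borel_measurable (mu S)" by simp
    qed
    finally show "ennreal (exp (- (r * t))) * (indicator {0<..} t * ennreal (cdfm S t))
        = (\<integral>\<^sup>+y. ennreal (exp (- (r * t))) * (indicator {0<..} t * indicator {y..} t) \<partial>mu S)"
      by (simp add: mult.assoc)
  qed
  also have "\<dots> = (\<integral>\<^sup>+y. \<integral>\<^sup>+t. ennreal (exp (- (r * t))) * (indicator {0<..} t * indicator {y..} t) \<partial>lborel \<partial>mu S)"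
  proof (rule Q.Fubini'[symmetric])
    have "(\<lambda>(t, y). ennreal (exp (- (r * t))) * (indicator {0<..} t * indicator {y..} t))
        = (\<lambda>p. if 0 < fst p \<and> snd p \<le> fst p then ennreal (exp (- (r * fst p))) else 0)"
      by (auto simp: indicator_def)
    moreover have "(\<lambda>p. if 0 < fst p \<and> snd p \<le> fst p then ennreal (exp (- (r * fst p))) else 0) \<in> borel_measurable (lborel \<Otimes>\<^sub>M mu S)"
      by measurable
    ultimately show "(\<lambda>(t, y). ennreal (exp (- (r * t))) * (indicator {0<..} t * indicator {y..} t)) \<in> borel_measurable (lborel \<Otimes>\<^sub>M mu S)"
      by (simp only:)
  qed
  also have "\<dots> = (\<integral>\<^sup>+y. ennreal (exp (- (r * y))) * ennreal (1 / r) \<partial>mu S)"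
  proof (rule nn_integral_cong_AE)
    show "AE y in mu S. (\<integral>\<^sup>+t. ennreal (exp (- (r * t))) * (indicator {0<..} t * indicator {y..} t) \<partial>lborel) = ennreal (exp (- (r * y))) * ennreal (1 / r)"
      using AE_mu_nonneg[OF S]
    proof eventually_elim
      fix y :: real assume y: "0 \<le> y"
      have "(\<integral>\<^sup>+t. ennreal (exp (- (r * t))) * (indicator {0<..} t * indicator {y..} t) \<partial>lborel)
          = (\<integral>\<^sup>+t. ennreal (exp (- (r * t))) * indicator {y..} t \<partial>lborel)"
        by (rule nn_integral_cong_AE) (use AE_lborel_singleton[of 0] in \<open>eventually_elim, use y in \<open>auto simp: indicator_def\<close>\<close>)
      also have "\<dots> = ennreal (exp (- (r * y)) / r)" by (rule nn_integral_exp_atLeast[OF r])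
      also have "\<dots> = ennreal (exp (- (r * y))) * ennreal (1 / r)"
        using r by (simp flip: ennreal_mult)
      finally show "(\<integral>\<^sup>+t. ennreal (exp (- (r * t))) * (indicator {0<..} t * indicator {y..} t) \<partial>lborel) = ennreal (exp (- (r * y))) * ennreal (1 / r)" .
    qed
  qed
  also have "\<dots> = (\<integral>\<^sup>+y. ennreal (exp (- (r * y))) \<partial>mu S) * ennreal (1 / r)"
    by (rule nn_integral_multc) simp
  also have "\<dots> = ennreal (exp (- (S * f r)) / r)"
    unfolding Laplace_mu[OF S r] using r by (simp flip: ennreal_mult)
  finally show ?thesis .
qed

lemma nu_eq_0: "x \<le> 0 \<Longrightarrow> nu x = 0"
  by (simp add: nu_def)

lemma conv_nu_eq_0: "t \<le> 0 \<Longrightarrow> (\<And>x. x \<le> 0 \<Longrightarrow> \<psi> x = 0) \<Longrightarrow> conv nu \<psi> t = 0"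
proof -
  assume t: "t \<le> 0" and \<psi>: "\<And>x. x \<le> 0 \<Longrightarrow> \<psi> x = 0"
  have "nu (t - x) * \<psi> x = 0" for x
    using t \<psi>[of x] nu_eq_0[of "t - x"] by (cases "x \<le> 0") auto
  then have "conv nu \<psi> t = (\<integral>\<^sup>+x. 0 \<partial>(lborel :: real measure))"
    unfolding conv_def by (intro nn_integral_cong)
  then show ?thesis by simp
qed

text \<open>The left side has transform (f r / r) (exp (-S f r) / f r). The factor f r cancels, and
  what remains is the transform of the distribution function of \<open>\<sigma> S\<close>.\<close>

lemma renewal_equation:
  assumes S: "0 \<le> S"
  shows "AE t in lborel. ennreal b * pot S t + conv nu (pot S) t = indicator {0<..} t * ennreal (cdfm S t)"
proof (rule AE_density_eqI_Laplace)
  have lap: "(\<integral>\<^sup>+t. ennreal (exp (- (r * t))) * (ennreal b * pot S t + conv nu (pot S) t) \<partial>lborel) = ennreal (exp (- (S * f r)) / r)"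
    if r: "0 < r" for r
  proof -
    have "(\<integral>\<^sup>+t. ennreal (exp (- (r * t))) * (ennreal b * pot S t + conv nu (pot S) t) \<partial>lborel)
        = (\<integral>\<^sup>+t. ennreal b * (ennreal (exp (- (r * t))) * pot S t) + ennreal (exp (- (r * t))) * conv nu (pot S) t \<partial>lborel)"
      by (simp add: distrib_left ac_simps)
    also have "\<dots> = (\<integral>\<^sup>+t. ennreal b * (ennreal (exp (- (r * t))) * pot S t) \<partial>lborel) + (\<integral>\<^sup>+t. ennreal (exp (- (r * t))) * conv nu (pot S) t \<partial>lborel)"
      by (rule nn_integral_add) measurable
    also have "(\<integral>\<^sup>+t. ennreal b * (ennreal (exp (- (r * t))) * pot S t) \<partial>lborel) = ennreal b * (\<integral>\<^sup>+t. ennreal (exp (- (r * t))) * pot S t \<partial>lborel)"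
      by (rule nn_integral_cmult) measurable
    also have "(\<integral>\<^sup>+t. ennreal (exp (- (r * t))) * conv nu (pot S) t \<partial>lborel)
        = (\<integral>\<^sup>+t. ennreal (exp (- (r * t))) * nu t \<partial>lborel) * (\<integral>\<^sup>+t. ennreal (exp (- (r * t))) * pot S t \<partial>lborel)"
      by (rule Laplace_conv) measurable
    also have "ennreal b * (\<integral>\<^sup>+t. ennreal (exp (- (r * t))) * pot S t \<partial>lborel) + \<dots>
        = (ennreal b + (\<integral>\<^sup>+t. ennreal (exp (- (r * t))) * nu t \<partial>lborel)) * (\<integral>\<^sup>+t. ennreal (exp (- (r * t))) * pot S t \<partial>lborel)"
      by (rule distrib_right[symmetric])
    also have "\<dots> = ennreal (f r / r) * ennreal (exp (- (S * f r)) / f r)"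
      by (simp only: Laplace_nu[OF r] Laplace_pot[OF S r])
    also have "\<dots> = ennreal (exp (- (S * f r)) / r)"
      using r f_pos[OF r] by (simp flip: ennreal_mult)
    finally show ?thesis .
  qed
  then show "(\<integral>\<^sup>+t. ennreal (exp (- (r * t))) * (ennreal b * pot S t + conv nu (pot S) t) \<partial>lborel)
      = (\<integral>\<^sup>+t. ennreal (exp (- (r * t))) * (indicator {0<..} t * ennreal (cdfm S t)) \<partial>lborel)" if "0 < r" for r
    using that nn_integral_exp_cdfm[OF S that] by simp
  show "(\<integral>\<^sup>+t. ennreal (exp (- t)) * (ennreal b * pot S t + conv nu (pot S) t) \<partial>lborel) < \<infinity>"
    using lap[of 1] by simp
  show "(\<lambda>t. indicator {0<..} t * ennreal (cdfm S t)) \<in> borel_measurable borel"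
  proof -
    have "(\<lambda>t. cdfm S t) \<in> borel_measurable borel"
      by (rule borel_measurable_mono) (auto intro!: monoI cdfm_mono)
    then show ?thesis by measurable
  qed
  show "(\<lambda>t. ennreal b * pot S t + conv nu (pot S) t) \<in> borel_measurable borel"
    by measurable
  show "ennreal b * pot S t + conv nu (pot S) t = 0" if "t < 0" for t
    using pot_eq_0[of t S] conv_nu_eq_0[of t "pot S"] pot_eq_0 that by simp
  show "indicator {0<..} t * ennreal (cdfm S t) = 0" if "t < 0" for t
    using that by simp
qed

text \<open>The Markov property at time S in terms of transforms: exp (-S f) / f is the product of
  the transforms of \<open>mu S\<close> and of \<open>pot 0\<close>.\<close>

lemma AE_pot_eq_mu_pot:
  assumes S: "0 < S"
  shows "AE x in lborel. pot S x = (\<integral>\<^sup>+y. pot 0 (x - y) \<partial>mu S)"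
proof (rule AE_density_eqI_Laplace)
  interpret mu: finite_measure "mu S" by (rule finite_measure_mu) (use S in simp)
  interpret Q: pair_sigma_finite lborel "mu S" ..
  show "(\<lambda>x. \<integral>\<^sup>+y. pot 0 (x - y) \<partial>mu S) \<in> borel_measurable borel"
  proof (rule mu.borel_measurable_nn_integral)
    have "(\<lambda>p. fst p - snd p) \<in> borel \<Otimes>\<^sub>M mu S \<rightarrow>\<^sub>M borel" by measurable
    from measurable_compose[OF this pot_measurable[of 0]]
    show "(\<lambda>(x, y). pot 0 (x - y)) \<in> borel_measurable (borel \<Otimes>\<^sub>M mu S)"
      by (simp add: case_prod_unfold)
  qed
  have ae: "AE y in mu S. 0 \<le> y" using AE_mu_nonneg[of S] S by simp
  show "(\<integral>\<^sup>+y. pot 0 (x - y) \<partial>mu S) = 0" if "x < 0" for x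
  proof -
    have "(\<integral>\<^sup>+y. pot 0 (x - y) \<partial>mu S) = (\<integral>\<^sup>+y. 0 \<partial>mu S)"
      by (rule nn_integral_cong_AE) (use ae in \<open>eventually_elim, use that in \<open>simp add: pot_eq_0\<close>\<close>)
    then show ?thesis by simp
  qed
  show "(\<integral>\<^sup>+x. ennreal (exp (- x)) * pot S x \<partial>lborel) < \<infinity>"
    using Laplace_pot[of S 1] S by simp
  fix r :: real assume r: "0 < r"
  have exp: "ennreal (exp (- (r * x))) = ennreal (exp (- (r * y))) * ennreal (exp (- (r * (x - y))))" for x y
  proof -
    have "- (r * x) = - (r * y) + - (r * (x - y))" by (simp add: right_diff_distrib)
    then show ?thesis by (simp only: exp_add) (rule ennreal_mult, simp_all)
  qed
  have "(\<integral>\<^sup>+x. ennreal (exp (- (r * x))) * (\<integral>\<^sup>+y. pot 0 (x - y) \<partial>mu S) \<partial>lborel)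
      = (\<integral>\<^sup>+x. \<integral>\<^sup>+y. ennreal (exp (- (r * x))) * pot 0 (x - y) \<partial>mu S \<partial>lborel)"
    by (intro nn_integral_cong nn_integral_cmult[symmetric]) measurable
  also have "\<dots> = (\<integral>\<^sup>+y. \<integral>\<^sup>+x. ennreal (exp (- (r * x))) * pot 0 (x - y) \<partial>lborel \<partial>mu S)"
    by (rule Q.Fubini'[symmetric]) measurable
  also have "\<dots> = (\<integral>\<^sup>+y. ennreal (exp (- (r * y))) * ennreal (1 / f r) \<partial>mu S)"
  proof (rule nn_integral_cong)
    fix y
    have "(\<integral>\<^sup>+x. ennreal (exp (- (r * x))) * pot 0 (x - y) \<partial>lborel)
        = (\<integral>\<^sup>+x. ennreal (exp (- (r * y))) * (ennreal (exp (- (r * (x - y)))) * pot 0 (x - y)) \<partial>lborel)"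
      by (intro nn_integral_cong) (subst exp[of _ y], simp only: mult.assoc)
    also have "\<dots> = ennreal (exp (- (r * y))) * (\<integral>\<^sup>+x. ennreal (exp (- (r * (x - y)))) * pot 0 (x - y) \<partial>lborel)"
      by (rule nn_integral_cmult) measurable
    also have "(\<integral>\<^sup>+x. ennreal (exp (- (r * (x - y)))) * pot 0 (x - y) \<partial>lborel) = (\<integral>\<^sup>+x. ennreal (exp (- (r * x))) * pot 0 x \<partial>lborel)"
      by (rule nn_integral_lborel_shift) measurable
    also have "\<dots> = ennreal (1 / f r)" using Laplace_pot[of 0 r] r by simp
    finally show "(\<integral>\<^sup>+x. ennreal (exp (- (r * x))) * pot 0 (x - y) \<partial>lborel) = ennreal (exp (- (r * y))) * ennreal (1 / f r)" .
  qed
  also have "\<dots> = (\<integral>\<^sup>+y. ennreal (exp (- (r * y))) \<partial>mu S) * ennreal (1 / f r)"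
    by (rule nn_integral_multc) simp
  also have "\<dots> = ennreal (exp (- (S * f r)) / f r)"
    using S r f_pos[OF r] by (simp add: Laplace_mu flip: ennreal_mult)
  finally show "(\<integral>\<^sup>+x. ennreal (exp (- (r * x))) * pot S x \<partial>lborel)
      = (\<integral>\<^sup>+x. ennreal (exp (- (r * x))) * (\<integral>\<^sup>+y. pot 0 (x - y) \<partial>mu S) \<partial>lborel)"
    using Laplace_pot[of S r] S r by simp
qed (auto simp: pot_eq_0)

text \<open>Without drift the renewal equation holds at every time: the potential density after
  time \<open>S\<close> is smoothed by the absolutely continuous law of \<open>\<sigma> S\<close>.\<close>

lemma renewal_equation_everywhere:
  assumes b: "b = 0" and S: "0 < S" and t: "0 < t"
  shows "conv nu (pot S) t = ennreal (cdfm S t)"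
proof -
  interpret mu: finite_measure "mu S" by (rule finite_measure_mu) (use S in simp)
  interpret Q: pair_sigma_finite lborel "mu S" ..
  \<comment> \<open>At S = 0 the right-hand side is 1 for every positive time because
    \<open>\<sigma> 0\<close> vanishes.\<close>
  have H: "AE \<tau> in lborel. conv nu (pot 0) \<tau> = indicator {0<..} \<tau>"
    using renewal_equation[OF order_refl]
  proof eventually_elim
    fix \<tau> assume *: "ennreal b * pot 0 \<tau> + conv nu (pot 0) \<tau> = indicator {0<..} \<tau> * ennreal (cdfm 0 \<tau>)"
    have "cdfm 0 \<tau> = 1" if "0 < \<tau>"
    proof -
      have "ennreal (cdfm 0 \<tau>) = emeasure M {\<omega> \<in> space M. \<sigma> 0 \<omega> \<le> ennreal \<tau>}"
        using emeasure_mu_eq_cdfm[of 0 \<tau>] emeasure_mu_atMost[of 0 \<tau>] that by simp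
      also have "{\<omega> \<in> space M. \<sigma> 0 \<omega> \<le> ennreal \<tau>} = space M"
        by (auto simp: \<sigma>_zero)
      finally show ?thesis by (simp add: P.emeasure_space_1)
    qed
    then show "conv nu (pot 0) \<tau> = indicator {0<..} \<tau>"
      using * b by (auto simp: indicator_def)
  qed
  have "conv nu (pot S) t = (\<integral>\<^sup>+x. nu (t - x) * (\<integral>\<^sup>+y. pot 0 (x - y) \<partial>mu S) \<partial>lborel)"
    unfolding conv_def by (rule nn_integral_cong_AE) (use AE_pot_eq_mu_pot[OF S] in \<open>eventually_elim, simp\<close>)
  also have "\<dots> = (\<integral>\<^sup>+x. \<integral>\<^sup>+y. nu (t - x) * pot 0 (x - y) \<partial>mu S \<partial>lborel)"
    by (intro nn_integral_cong nn_integral_cmult[symmetric]) measurable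
  also have "\<dots> = (\<integral>\<^sup>+y. \<integral>\<^sup>+x. nu (t - x) * pot 0 (x - y) \<partial>lborel \<partial>mu S)"
    by (rule Q.Fubini'[symmetric]) measurable
  also have "\<dots> = (\<integral>\<^sup>+y. conv nu (pot 0) (t - y) \<partial>mu S)"
  proof (rule nn_integral_cong)
    fix y
    have "(\<integral>\<^sup>+x. nu (t - x) * pot 0 (x - y) \<partial>lborel) = (\<integral>\<^sup>+x. nu ((t - y) - (x - y)) * pot 0 (x - y) \<partial>lborel)"
      by simp
    also have "\<dots> = (\<integral>\<^sup>+x. nu ((t - y) - x) * pot 0 x \<partial>lborel)"
      by (rule nn_integral_lborel_shift[of "\<lambda>x. nu ((t - y) - x) * pot 0 x"]) measurable
    finally show "(\<integral>\<^sup>+x. nu (t - x) * pot 0 (x - y) \<partial>lborel) = conv nu (pot 0) (t - y)"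
      by (simp add: conv_def)
  qed
  also have "\<dots> = (\<integral>\<^sup>+y. indicator {..t} y \<partial>mu S)"
  proof (rule nn_integral_cong_AE)
    \<comment> \<open>The origin joins the exceptional set because at y = t the indicator of y \<le>
      t is 1 while that of 0 < t - y is 0.\<close>
    define Z where "Z = {\<tau>. conv nu (pot 0) \<tau> \<noteq> indicator {0<..} \<tau>} \<union> {0}"
    have [measurable]: "Z \<in> sets borel" unfolding Z_def by measurable
    have "AE \<tau> in lborel. \<tau> \<notin> Z"
      using H AE_lborel_singleton[of 0] by eventually_elim (auto simp: Z_def)
    then have Z: "Z \<in> null_sets lborel"
      using AE_iff_measurable[of Z lborel "\<lambda>\<tau>. \<tau> \<notin> Z"] by (intro null_setsI) auto
    have Z': "(\<lambda>y. t - y) -` Z \<in> null_sets lborel"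
    proof (rule null_setsI)
      have "emeasure lborel Z = (\<integral>\<^sup>+\<tau>. indicator Z \<tau> \<partial>lborel)" by simp
      also have "\<dots> = ennreal \<bar>- 1\<bar> * (\<integral>\<^sup>+y. indicator Z (t + (- 1) * y) \<partial>lborel)"
        by (rule nn_integral_real_affine) auto
      also have "\<dots> = (\<integral>\<^sup>+y. indicator ((\<lambda>y. t - y) -` Z) y \<partial>lborel)"
        by (simp add: indicator_def)
      also have "\<dots> = emeasure lborel ((\<lambda>y. t - y) -` Z)"
        using measurable_sets[of "\<lambda>y. t - y" borel borel Z] by simp
      finally show "emeasure lborel ((\<lambda>y. t - y) -` Z) = 0" using Z by auto
      show "(\<lambda>y. t - y) -` Z \<in> sets lborel"
        using measurable_sets[of "\<lambda>y. t - y" borel borel Z] by simp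
    qed
    then have "(\<lambda>y. t - y) -` Z \<in> null_sets (mu S)"
      using mu_null_sets[OF S Z'] by (intro null_setsI) auto
    then have "AE y in mu S. t - y \<notin> Z"
      by (rule AE_I') auto
    then show "AE y in mu S. conv nu (pot 0) (t - y) = indicator {..t} y"
      by eventually_elim (auto simp: Z_def indicator_def)
  qed
  also have "\<dots> = ennreal (cdfm S t)"
    using emeasure_mu_eq_cdfm[of S t] S by simp
  finally show ?thesis .
qed

end

section \<open>The inverse process and the density of its law\<close>

context subordinator_process
begin

lemma inverse_process_gt_imp:
  assumes "0 < s" "ennreal s < inverse_process \<sigma> t \<omega>"
  shows "\<sigma> s \<omega> \<le> ennreal t"
proof (rule ccontr)
  assume "\<not> \<sigma> s \<omega> \<le> ennreal t"
  then have "inverse_process \<sigma> t \<omega> \<le> ennreal s"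
    unfolding inverse_process_def using assms(1) by (intro Inf_lower) auto
  then show False using assms(2) by simp
qed

text \<open>Right continuity keeps the path below t until some r > s, and by monotonicity it has not
  exceeded t before r; so the infimum is at least r.\<close>

lemma inverse_process_gtI:
  assumes w: "\<omega> \<in> space M" and s: "0 \<le> s" and less: "\<sigma> s \<omega> < ennreal t"
  shows "ennreal s < inverse_process \<sigma> t \<omega>"
proof -
  have "\<forall>\<^sub>F r in at_right s. \<sigma> r \<omega> < ennreal t"
    by (rule order_tendstoD(2)[OF \<sigma>_right_continuous[OF w s] less])
  then have "\<forall>\<^sub>F r in at_right s. \<sigma> r \<omega> < ennreal t \<and> s < r"
    using eventually_at_right_less by (rule eventually_conj)
  then obtain r where r: "\<sigma> r \<omega> < ennreal t" "s < r"
    using eventually_happens[of _ "at_right s"] by auto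
  have "ennreal r \<le> inverse_process \<sigma> t \<omega>"
    unfolding inverse_process_def
  proof (rule Inf_greatest, clarify)
    fix q :: real assume q: "0 < q" "ennreal t < \<sigma> q \<omega>"
    have "r \<le> q"
    proof (rule ccontr)
      assume "\<not> r \<le> q"
      then have "\<sigma> q \<omega> \<le> \<sigma> r \<omega>" using q by (intro \<sigma>_mono[OF w]) auto
      then show False using q(2) r(1) by (meson leD less_trans not_le le_less_trans)
    qed
    then show "ennreal r \<le> ennreal q" by (rule ennreal_leI)
  qed
  moreover have "ennreal s < ennreal r" using r(2) s by (simp add: ennreal_less_iff)
  ultimately show ?thesis by (rule less_le_trans[rotated])
qed

text \<open>By monotonicity a time at which the path has passed t can be replaced by a slightly
  later rational one, so countably many events suffice.\<close>

lemma inverse_process_measurable: "inverse_process \<sigma> t \<in> borel_measurable M"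
proof (rule borel_measurableI_less)
  fix y :: ennreal
  have eq: "{\<omega> \<in> space M. inverse_process \<sigma> t \<omega> < y} =
      (\<Union>r\<in>{r\<in>\<rat>. 0 < r \<and> ennreal r < y}. {\<omega> \<in> space M. ennreal t < \<sigma> r \<omega>})"
  proof (intro equalityI subsetI)
    fix \<omega> assume "\<omega> \<in> {\<omega> \<in> space M. inverse_process \<sigma> t \<omega> < y}"
    then have w: "\<omega> \<in> space M" "inverse_process \<sigma> t \<omega> < y" by auto
    then obtain s where s: "0 < s" "ennreal t < \<sigma> s \<omega>" "ennreal s < y"
      unfolding inverse_process_def Inf_less_iff by auto
    obtain r where r: "r \<in> \<rat>" "s < r" "ennreal r < y"
    proof (cases y rule: ennreal_cases)
      case (real y')
      then have "s < y'" using s by (simp add: ennreal_less_iff)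
      then obtain r where "r \<in> \<rat>" "s < r" "r < y'" using Rats_dense_in_real by blast
      then show ?thesis using real s by (intro that[of r]) (auto simp: ennreal_less_iff)
    next
      case top
      obtain r where "r \<in> \<rat>" "s < r" "r < s + 1" using Rats_dense_in_real[of s "s + 1"] by auto
      then show ?thesis using top by (intro that[of r]) auto
    qed
    have "\<sigma> s \<omega> \<le> \<sigma> r \<omega>" using s r by (intro \<sigma>_mono[OF w(1)]) auto
    then have "ennreal t < \<sigma> r \<omega>" using s(2) by (rule less_le_trans[rotated])
    then show "\<omega> \<in> (\<Union>r\<in>{r\<in>\<rat>. 0 < r \<and> ennreal r < y}. {\<omega> \<in> space M. ennreal t < \<sigma> r \<omega>})"
      using r s(1) w(1) by (intro UN_I[of r]) auto
  next
    fix \<omega> assume "\<omega> \<in> (\<Union>r\<in>{r\<in>\<rat>. 0 < r \<and> ennreal r < y}. {\<omega> \<in> space M. ennreal t < \<sigma> r \<omega>})"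
    then obtain r where r: "0 < r" "ennreal r < y" "\<omega> \<in> space M" "ennreal t < \<sigma> r \<omega>" by auto
    then have "inverse_process \<sigma> t \<omega> \<le> ennreal r"
      unfolding inverse_process_def by (intro Inf_lower) auto
    then show "\<omega> \<in> {\<omega> \<in> space M. inverse_process \<sigma> t \<omega> < y}" using r by auto
  qed
  have "countable {r\<in>\<rat>. 0 < r \<and> ennreal r < y}"
    by (rule countable_subset[OF _ countable_rat]) auto
  then show "{\<omega> \<in> space M. inverse_process \<sigma> t \<omega> < y} \<in> sets M"
    unfolding eq
  proof (rule sets.countable_UN', intro image_subsetI)
    fix r assume "r \<in> {r\<in>\<rat>. 0 < r \<and> ennreal r < y}"
    then have "\<sigma> r \<in> borel_measurable M" by (intro \<sigma>_measurable) auto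
    then show "{\<omega> \<in> space M. ennreal t < \<sigma> r \<omega>} \<in> sets M" by measurable
  qed
qed

text \<open>Absolutely continuous laws have no atoms. This closes the gap between
  \<open>\<sigma> s\<close> < t, which forces s < L t, and \<open>\<sigma> s\<close> \<le> t, which
  follows from s < L t.\<close>

lemma emeasure_\<sigma>_eq:
  assumes s: "0 < s" and t: "0 \<le> t"
  shows "emeasure M {\<omega> \<in> space M. \<sigma> s \<omega> = ennreal t} = 0"
proof -
  have [measurable]: "\<sigma> s \<in> borel_measurable M" by (rule \<sigma>_measurable) (use s in simp)
  have "emeasure (mu s) {t} = (\<integral>\<^sup>+y. indicator {t} y \<partial>mu s)" by simp
  also have "\<dots> = (\<integral>\<^sup>+\<omega>. (if \<sigma> s \<omega> = \<infinity> then 0 else 1) * indicator {t} (enn2real (\<sigma> s \<omega>)) \<partial>M)"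
    by (rule nn_integral_mu) (use s in simp_all)
  also have "\<dots> = (\<integral>\<^sup>+\<omega>. indicator {\<omega> \<in> space M. \<sigma> s \<omega> = ennreal t} \<omega> \<partial>M)"
  proof (rule nn_integral_cong)
    fix \<omega> assume w: "\<omega> \<in> space M"
    show "(if \<sigma> s \<omega> = \<infinity> then 0 else 1) * indicator {t} (enn2real (\<sigma> s \<omega>))
        = (indicator {\<omega> \<in> space M. \<sigma> s \<omega> = ennreal t} \<omega> :: ennreal)"
      using t w by (cases "\<sigma> s \<omega>" rule: ennreal_cases) (auto simp: indicator_def)
  qed
  also have "\<dots> = emeasure M {\<omega> \<in> space M. \<sigma> s \<omega> = ennreal t}"
    by (rule nn_integral_indicator) measurable
  finally have "emeasure M {\<omega> \<in> space M. \<sigma> s \<omega> = ennreal t} = emeasure (mu s) {t}" by simp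
  also have "\<dots> = 0"
    by (rule mu_null_sets[OF s]) (auto intro: null_setsI)
  finally show ?thesis .
qed

lemma emeasure_inverse_process_gt:
  assumes s: "0 < s" and t: "0 \<le> t"
  shows "emeasure M {\<omega> \<in> space M. ennreal s < inverse_process \<sigma> t \<omega>} = ennreal (cdfm s t)"
proof (rule antisym)
  have [measurable]: "\<sigma> s \<in> borel_measurable M" by (rule \<sigma>_measurable) (use s in simp)
  note inverse_process_measurable[measurable]
  have cdf: "ennreal (cdfm s t) = emeasure M {\<omega> \<in> space M. \<sigma> s \<omega> \<le> ennreal t}"
    using emeasure_mu_eq_cdfm[of s t] emeasure_mu_atMost[of s t] s t by simp
  show "emeasure M {\<omega> \<in> space M. ennreal s < inverse_process \<sigma> t \<omega>} \<le> ennreal (cdfm s t)"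
    unfolding cdf using inverse_process_gt_imp[OF s] by (intro emeasure_mono) auto
  have "{\<omega> \<in> space M. \<sigma> s \<omega> \<le> ennreal t} \<subseteq>
      {\<omega> \<in> space M. ennreal s < inverse_process \<sigma> t \<omega>} \<union> {\<omega> \<in> space M. \<sigma> s \<omega> = ennreal t}"
  proof
    fix \<omega> assume "\<omega> \<in> {\<omega> \<in> space M. \<sigma> s \<omega> \<le> ennreal t}"
    then have "\<omega> \<in> space M" "\<sigma> s \<omega> < ennreal t \<or> \<sigma> s \<omega> = ennreal t" by auto
    then show "\<omega> \<in> {\<omega> \<in> space M. ennreal s < inverse_process \<sigma> t \<omega>} \<union> {\<omega> \<in> space M. \<sigma> s \<omega> = ennreal t}"
      using inverse_process_gtI[of \<omega> s t] s by auto
  qed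
  then have "ennreal (cdfm s t) \<le> emeasure M ({\<omega> \<in> space M. ennreal s < inverse_process \<sigma> t \<omega>} \<union> {\<omega> \<in> space M. \<sigma> s \<omega> = ennreal t})"
    unfolding cdf by (rule emeasure_mono) measurable
  also have "\<dots> \<le> emeasure M {\<omega> \<in> space M. ennreal s < inverse_process \<sigma> t \<omega>} + emeasure M {\<omega> \<in> space M. \<sigma> s \<omega> = ennreal t}"
    by (rule emeasure_subadditive) measurable
  finally show "ennreal (cdfm s t) \<le> emeasure M {\<omega> \<in> space M. ennreal s < inverse_process \<sigma> t \<omega>}"
    by (simp add: emeasure_\<sigma>_eq[OF s t])
qed

text \<open>The exponential bound at x = 1 makes the probability that L t exceeds Suc n decay
  geometrically, since f 1 > 0.\<close>

lemma AE_inverse_process_finite: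
  assumes t: "0 \<le> t" shows "AE \<omega> in M. inverse_process \<sigma> t \<omega> < \<infinity>"
proof -
  note inverse_process_measurable[measurable]
  have le: "emeasure M {\<omega> \<in> space M. inverse_process \<sigma> t \<omega> = \<infinity>} \<le> ennreal (exp t * exp (- f 1) ^ Suc n)" for n
  proof -
    have p: "0 < real (Suc n)" by simp
    have "emeasure M {\<omega> \<in> space M. inverse_process \<sigma> t \<omega> = \<infinity>} \<le> emeasure M {\<omega> \<in> space M. ennreal (real (Suc n)) < inverse_process \<sigma> t \<omega>}"
      by (intro emeasure_mono) auto
    also have "\<dots> = emeasure (mu (real (Suc n))) {..t}"
      using emeasure_inverse_process_gt[OF p t] emeasure_mu_eq_cdfm[of "real (Suc n)" t] by simp
    also have "\<dots> \<le> ennreal (exp (1 * t - real (Suc n) * f 1))"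
      by (rule emeasure_mu_le_Laplace) simp_all
    also have "exp (1 * t - real (Suc n) * f 1) = exp t * exp (- f 1) ^ Suc n"
    proof -
      have "1 * t - real (Suc n) * f 1 = t + real (Suc n) * (- f 1)" by simp
      then show ?thesis by (simp only: exp_add exp_of_nat_mult)
    qed
    finally show ?thesis .
  qed
  have "(\<lambda>n. exp (- f 1) ^ Suc n) \<longlonglongrightarrow> 0"
    using f_pos[of 1] by (intro LIMSEQ_Suc LIMSEQ_power_zero) simp
  then have "(\<lambda>n. exp t * exp (- f 1) ^ Suc n) \<longlonglongrightarrow> exp t * 0"
    by (rule tendsto_mult[OF tendsto_const])
  then have "(\<lambda>n. ennreal (exp t * exp (- f 1) ^ Suc n)) \<longlonglongrightarrow> ennreal (exp t * 0)"
    by (rule tendsto_ennrealI)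
  then have "emeasure M {\<omega> \<in> space M. inverse_process \<sigma> t \<omega> = \<infinity>} \<le> ennreal (exp t * 0)"
    by (rule LIMSEQ_le_const) (use le in blast)
  then have "{\<omega> \<in> space M. inverse_process \<sigma> t \<omega> = \<infinity>} \<in> null_sets M"
    by (intro null_setsI) auto
  then show ?thesis by (rule AE_I') (auto simp: less_top[symmetric])
qed

text \<open>The law of L t on the real line. The conversion sends \<infinity> to 0, which is
  harmless for t \<ge> 0 because L t is then almost surely finite.\<close>

definition rho :: "real \<Rightarrow> real measure" where
  "rho t = distr (inverse_law M \<sigma> t) borel enn2real"

lemma rho_eq: "rho t = distr M borel (\<lambda>\<omega>. enn2real (inverse_process \<sigma> t \<omega>))"
proof -
  have "inverse_process \<sigma> t \<in> M \<rightarrow>\<^sub>M borel" by (rule inverse_process_measurable)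
  then show ?thesis
    unfolding rho_def inverse_law_def by (subst distr_distr) (auto simp: comp_def)
qed

lemma sets_rho[simp, measurable_cong]: "sets (rho t) = sets borel" and space_rho[simp]: "space (rho t) = UNIV"
  by (simp_all add: rho_def)

lemma prob_space_rho: "prob_space (rho t)"
  unfolding rho_eq by (rule P.prob_space_distr) (use inverse_process_measurable in measurable)

lemma AE_rho_nonneg: "AE s in rho t. 0 \<le> s"
  unfolding rho_eq using inverse_process_measurable by (subst AE_distr_iff) auto

lemma AE_inverse_law_finite: "0 \<le> t \<Longrightarrow> AE y in inverse_law M \<sigma> t. y < \<infinity>"
  unfolding inverse_law_def using AE_inverse_process_finite inverse_process_measurable
  by (subst AE_distr_iff) auto

lemma emeasure_rho_tail:
  assumes s: "0 < s" and t: "0 \<le> t"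
  shows "emeasure (rho t) {s<..} = ennreal (cdfm s t)"
proof -
  note inverse_process_measurable[measurable]
  have "emeasure (rho t) {s<..} = emeasure M ((\<lambda>\<omega>. enn2real (inverse_process \<sigma> t \<omega>)) -` {s<..} \<inter> space M)"
    unfolding rho_eq by (rule emeasure_distr) measurable
  also have "\<dots> = emeasure M {\<omega> \<in> space M. ennreal s < inverse_process \<sigma> t \<omega>}"
  proof (rule emeasure_eq_AE)
    show "AE \<omega> in M. (\<omega> \<in> (\<lambda>\<omega>. enn2real (inverse_process \<sigma> t \<omega>)) -` {s<..} \<inter> space M) = (\<omega> \<in> {\<omega> \<in> space M. ennreal s < inverse_process \<sigma> t \<omega>})"
      using AE_inverse_process_finite[OF t]
    proof eventually_elim
      fix \<omega> assume "inverse_process \<sigma> t \<omega> < \<infinity>"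
      then obtain l where "0 \<le> l" "inverse_process \<sigma> t \<omega> = ennreal l"
        by (cases "inverse_process \<sigma> t \<omega>" rule: ennreal_cases) auto
      then show "(\<omega> \<in> (\<lambda>\<omega>. enn2real (inverse_process \<sigma> t \<omega>)) -` {s<..} \<inter> space M) = (\<omega> \<in> {\<omega> \<in> space M. ennreal s < inverse_process \<sigma> t \<omega>})"
        using s by (auto simp: ennreal_less_iff)
    qed
  qed measurable
  also have "\<dots> = ennreal (cdfm s t)" by (rule emeasure_inverse_process_gt[OF s t])
  finally show ?thesis .
qed

lemma emeasure_rho_nonpos:
  assumes t: "0 < t" shows "emeasure (rho t) {..0} = 0"
proof -
  note inverse_process_measurable[measurable]
  have "emeasure (rho t) {..0} = emeasure M ((\<lambda>\<omega>. enn2real (inverse_process \<sigma> t \<omega>)) -` {..0} \<inter> space M)"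
    unfolding rho_eq by (rule emeasure_distr) measurable
  also have "\<dots> = emeasure M {}"
  proof (rule emeasure_eq_AE)
    show "AE \<omega> in M. (\<omega> \<in> (\<lambda>\<omega>. enn2real (inverse_process \<sigma> t \<omega>)) -` {..0} \<inter> space M) = (\<omega> \<in> {})"
      using AE_inverse_process_finite[OF less_imp_le[OF t]]
    proof eventually_elim
      fix \<omega> assume fin: "inverse_process \<sigma> t \<omega> < \<infinity>"
      have "\<not> enn2real (inverse_process \<sigma> t \<omega>) \<le> 0" if w: "\<omega> \<in> space M"
      proof -
        have "ennreal 0 < inverse_process \<sigma> t \<omega>"
          using t by (intro inverse_process_gtI[OF w]) (auto simp: \<sigma>_zero[OF w])
        then show ?thesis using fin by (simp add: not_le enn2real_positive_iff)
      qed
      then show "(\<omega> \<in> (\<lambda>\<omega>. enn2real (inverse_process \<sigma> t \<omega>)) -` {..0} \<inter> space M) = (\<omega> \<in> {})" by auto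
    qed
  qed measurable
  finally show ?thesis by simp
qed

lemma cdfm_eq_nn_integral_kern: "0 < s \<Longrightarrow> ennreal (cdfm s t) = (\<integral>\<^sup>+x. ennreal (kern s x) * indicator {..t} x \<partial>lborel)"
  using emeasure_mu_eq_cdfm[of s t] by (simp add: mu_density emeasure_density)

lemma cdfm_zero: "0 < s \<Longrightarrow> cdfm s 0 = 0"
proof -
  assume s: "0 < s"
  have "ennreal (cdfm s 0) = (\<integral>\<^sup>+x. 0 \<partial>(lborel :: real measure))"
    unfolding cdfm_eq_nn_integral_kern[OF s] by (intro nn_integral_cong) (auto simp: indicator_def kern_eq_0)
  then show ?thesis using cdfm_nonneg[of s 0] by (simp add: ennreal_eq_0_iff)
qed

text \<open>For s > 0 the law of \<open>\<sigma> s\<close> puts no mass on 0, so the path becomes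
  positive at once and L 0 vanishes. This yields the initial condition.\<close>

lemma AE_rho_zero: "AE s in rho 0. s = 0"
proof -
  have "(\<Union>n. {1 / real (Suc n)<..}) \<in> null_sets (rho 0)"
    by (intro null_sets_UN null_setsI) (simp_all add: emeasure_rho_tail cdfm_zero)
  then have "AE s in rho 0. \<not> 0 < s"
  proof (rule AE_I', intro subsetI)
    fix s :: real assume "s \<in> {s \<in> space (rho 0). \<not> \<not> 0 < s}"
    then obtain n where "1 / real (Suc n) < s" using reals_Archimedean[of s] by (auto simp: inverse_eq_divide)
    then show "s \<in> (\<Union>n. {1 / real (Suc n)<..})" by auto
  qed
  with AE_rho_nonneg show ?thesis by eventually_elim simp
qed

text \<open>The part of the density of L t at s that is due to the tail \<nu>; the other part is b
  times \<open>kern s t\<close>.\<close>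

definition tker :: "real \<Rightarrow> real \<Rightarrow> ennreal" where
  "tker s t = conv nu (\<lambda>x. ennreal (kern s x)) t"

lemma tker_measurable[measurable]: "(\<lambda>s. tker s t) \<in> borel_measurable borel"
  unfolding tker_def conv_def by measurable

lemma nn_integral_tker: "(\<integral>\<^sup>+s. indicator {S<..} s * tker s t \<partial>lborel) = conv nu (pot S) t"
proof -
  have "(\<integral>\<^sup>+s. indicator {S<..} s * tker s t \<partial>lborel)
      = (\<integral>\<^sup>+s. \<integral>\<^sup>+x. indicator {S<..} s * (nu (t - x) * ennreal (kern s x)) \<partial>lborel \<partial>lborel)"
    unfolding tker_def conv_def by (intro nn_integral_cong nn_integral_cmult[symmetric]) measurable
  also have "\<dots> = (\<integral>\<^sup>+x. \<integral>\<^sup>+s. indicator {S<..} s * (nu (t - x) * ennreal (kern s x)) \<partial>lborel \<partial>lborel)"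
    by (rule lborel_pair.Fubini') measurable
  also have "\<dots> = (\<integral>\<^sup>+x. \<integral>\<^sup>+s. nu (t - x) * (indicator {S<..} s * ennreal (kern s x)) \<partial>lborel \<partial>lborel)"
    by (simp only: ac_simps)
  also have "\<dots> = conv nu (pot S) t"
    unfolding conv_def pot_def by (intro nn_integral_cong nn_integral_cmult) measurable
  finally show ?thesis .
qed

text \<open>Both measures are compared through their tails beyond S. Asking for the renewal equation
  at rational levels only lets the lemma serve almost every t in general and every t in the
  driftless case.\<close>

lemma rho_density:
  assumes t: "0 < t"
    and eq: "\<And>(i::int) n. 0 < i \<Longrightarrow> ennreal b * pot (of_int i / real (Suc n)) t + conv nu (pot (of_int i / real (Suc n))) t = ennreal (cdfm (of_int i / real (Suc n)) t)"
  shows "rho t = density lborel (\<lambda>s. ennreal b * ennreal (kern s t) + tker s t)"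
proof (rule measure_eqI_tails)
  show "emeasure (rho t) {..0} = 0" by (rule emeasure_rho_nonpos[OF t])
  have [measurable]: "(\<lambda>s. ennreal b * ennreal (kern s t) + tker s t) \<in> borel_measurable borel" by measurable
  have "tker s t = 0" if "s \<le> 0" for s
    using that by (simp add: tker_def conv_def kern_eq_0)
  then have "(\<integral>\<^sup>+s. (ennreal b * ennreal (kern s t) + tker s t) * indicator {..0} s \<partial>lborel) = (\<integral>\<^sup>+s. 0 \<partial>(lborel :: real measure))"
    by (intro nn_integral_cong) (auto simp: indicator_def kern_eq_0)
  then show "emeasure (density lborel (\<lambda>s. ennreal b * ennreal (kern s t) + tker s t)) {..0} = 0"
    by (simp add: emeasure_density)
  show "emeasure (rho t) {s<..} \<le> 1" if "0 < s" for s
    using emeasure_rho_tail[OF that, of t] t cdfm_le_1[of s t] by simp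
  fix i :: int and n :: nat assume i: "0 < i"
  define S where "S = of_int i / real (Suc n)"
  have S: "0 < S" using i by (simp add: S_def)
  have "emeasure (density lborel (\<lambda>s. ennreal b * ennreal (kern s t) + tker s t)) {S<..}
      = (\<integral>\<^sup>+s. (ennreal b * ennreal (kern s t) + tker s t) * indicator {S<..} s \<partial>lborel)"
    by (rule emeasure_density) measurable
  also have "\<dots> = (\<integral>\<^sup>+s. ennreal b * (indicator {S<..} s * ennreal (kern s t)) + indicator {S<..} s * tker s t \<partial>lborel)"
    by (intro nn_integral_cong) (auto simp: indicator_def)
  also have "\<dots> = (\<integral>\<^sup>+s. ennreal b * (indicator {S<..} s * ennreal (kern s t)) \<partial>lborel) + (\<integral>\<^sup>+s. indicator {S<..} s * tker s t \<partial>lborel)"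
    by (rule nn_integral_add) measurable
  also have "(\<integral>\<^sup>+s. ennreal b * (indicator {S<..} s * ennreal (kern s t)) \<partial>lborel) = ennreal b * pot S t"
    unfolding pot_def by (rule nn_integral_cmult) measurable
  also have "ennreal b * pot S t + (\<integral>\<^sup>+s. indicator {S<..} s * tker s t \<partial>lborel) = ennreal (cdfm S t)"
    unfolding nn_integral_tker using eq[OF i, of n] by (simp only: S_def)
  also have "\<dots> = emeasure (rho t) {S<..}"
    using emeasure_rho_tail[OF S, of t] t by simp
  finally show "emeasure (rho t) {of_int i / real (Suc n)<..} = emeasure (density lborel (\<lambda>s. ennreal b * ennreal (kern s t) + tker s t)) {of_int i / real (Suc n)<..}"
    by (simp only: S_def)
qed simp_all

lemma AE_rho_density:
  "AE t in lborel. 0 < t \<longrightarrow> rho t = density lborel (\<lambda>s. ennreal b * ennreal (kern s t) + tker s t)"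
proof -
  have "AE t in lborel. \<forall>(i::int) n. 0 < i \<longrightarrow>
      ennreal b * pot (of_int i / real (Suc n)) t + conv nu (pot (of_int i / real (Suc n))) t
      = indicator {0<..} t * ennreal (cdfm (of_int i / real (Suc n)) t)"
    unfolding AE_all_countable
  proof (intro allI)
    fix i :: int and n :: nat
    show "AE t in lborel. 0 < i \<longrightarrow>
      ennreal b * pot (of_int i / real (Suc n)) t + conv nu (pot (of_int i / real (Suc n))) t
      = indicator {0<..} t * ennreal (cdfm (of_int i / real (Suc n)) t)"
    proof (cases "0 < i")
      case True
      then have "0 \<le> of_int i / real (Suc n)" by simp
      from renewal_equation[OF this] show ?thesis by eventually_elim simp
    qed simp
  qed
  then show ?thesis
  proof eventually_elim
    fix t assume *: "\<forall>(i::int) n. 0 < i \<longrightarrow>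
      ennreal b * pot (of_int i / real (Suc n)) t + conv nu (pot (of_int i / real (Suc n))) t
      = indicator {0<..} t * ennreal (cdfm (of_int i / real (Suc n)) t)"
    show "0 < t \<longrightarrow> rho t = density lborel (\<lambda>s. ennreal b * ennreal (kern s t) + tker s t)"
    proof
      assume t: "0 < t"
      show "rho t = density lborel (\<lambda>s. ennreal b * ennreal (kern s t) + tker s t)"
        using * t by (intro rho_density[OF t]) (simp del: of_nat_Suc)
    qed
  qed
qed

lemma rho_density_driftless:
  assumes "b = 0" "0 < t"
  shows "rho t = density lborel (\<lambda>s. tker s t)"
proof -
  have "rho t = density lborel (\<lambda>s. ennreal b * ennreal (kern s t) + tker s t)"
  proof (rule rho_density[OF assms(2)])
    fix i :: int and n :: nat assume "0 < i"
    then have "0 < of_int i / real (Suc n)" by simp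
    from renewal_equation_everywhere[OF assms(1) this assms(2)]
    show "ennreal b * pot (of_int i / real (Suc n)) t + conv nu (pot (of_int i / real (Suc n))) t = ennreal (cdfm (of_int i / real (Suc n)) t)"
      using assms(1) by simp
  qed
  then show ?thesis by (simp add: assms(1))
qed

end

section \<open>Absolute continuity of the scalar integral\<close>

lemma integral_uniformly_small:
  \<comment> \<open>Truncation at a level K splits \<phi> into a part of small integral, which
    bounds all disjoint families at once, and a part bounded by K, which is controlled by the total
    length.\<close>
  fixes \<phi> :: "real \<Rightarrow> real"
  assumes \<phi>: "integrable lborel \<phi>" "\<And>x::real. 0 \<le> \<phi> x" and e: "0 < e"
  shows "\<exists>d>0. \<forall>(n::nat) x y. (\<forall>i<n. x i \<le> y i) \<and> disjoint_family_on (\<lambda>i. {x i<..<y i}) {..<n} \<and> (\<Sum>i<n. y i - x i) < d \<longrightarrow>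
    (\<Sum>i<n. \<integral>z. \<phi> z * indicator {x i<..<y i} z \<partial>lborel) < e"
proof -
  have [measurable]: "\<phi> \<in> borel_measurable borel" using \<phi>(1) by simp
  have int: "integrable lborel (\<lambda>z. \<phi> z * indicator S z)" if "S \<in> sets borel" for S
    by (rule integrable_real_mult_indicator[OF _ \<phi>(1)]) (use that in simp)
  have "(\<lambda>K. \<integral>z. \<phi> z - min (\<phi> z) (real K) \<partial>lborel) \<longlonglongrightarrow> (\<integral>z. 0 \<partial>(lborel :: real measure))"
  proof (rule integral_dominated_convergence[where w=\<phi>])
    show "AE z in lborel. (\<lambda>K. \<phi> z - min (\<phi> z) (real K)) \<longlonglongrightarrow> 0"
    proof (rule AE_I2)
      fix z
      obtain K0 :: nat where K0: "\<phi> z \<le> real K0" using real_arch_simple by blast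
      have "\<forall>\<^sub>F K in sequentially. \<phi> z - min (\<phi> z) (real K) = 0"
        using eventually_ge_at_top[of K0] by eventually_elim (use K0 in auto)
      then show "(\<lambda>K. \<phi> z - min (\<phi> z) (real K)) \<longlonglongrightarrow> 0" by (rule tendsto_eventually)
    qed
    show "AE z in lborel. norm (\<phi> z - min (\<phi> z) (real K)) \<le> \<phi> z" for K
      using \<phi>(2) by (intro AE_I2) (auto simp: min_def)
  qed (use \<phi>(1) in auto)
  then have "(\<lambda>K. \<integral>z. \<phi> z - min (\<phi> z) (real K) \<partial>lborel) \<longlonglongrightarrow> 0" by simp
  from order_tendstoD(2)[OF this, of "e / 2"] e
  obtain K where K: "(\<integral>z. \<phi> z - min (\<phi> z) (real K) \<partial>lborel) < e / 2"
    by (auto dest!: eventually_happens)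
  define \<psi> where "\<psi> z = \<phi> z - min (\<phi> z) (real K)" for z
  have \<psi>0: "0 \<le> \<psi> z" for z by (simp add: \<psi>_def)
  have \<psi>i: "integrable lborel \<psi>"
  proof (rule Bochner_Integration.integrable_bound[OF \<phi>(1)])
    have "\<psi> \<in> borel_measurable borel" unfolding \<psi>_def by measurable
    then show "\<psi> \<in> borel_measurable lborel" by simp
    show "AE z in lborel. norm (\<psi> z) \<le> norm (\<phi> z)"
      by (rule AE_I2) (use \<phi>(2) in \<open>auto simp: \<psi>_def min_def\<close>)
  qed
  have [measurable]: "\<psi> \<in> borel_measurable borel" using \<psi>i by simp
  have \<psi>int: "integrable lborel (\<lambda>z. \<psi> z * indicator S z)" if "S \<in> sets borel" for S
    by (rule integrable_real_mult_indicator[OF _ \<psi>i]) (use that in simp)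
  show ?thesis
  \<comment> \<open>The bounded part contributes at most K times the total length, hence at most e /
    2; the summand 1 covers K = 0.\<close>
  proof (intro exI[of _ "e / (2 * (real K + 1))"] conjI allI impI)
    show "0 < e / (2 * (real K + 1))" using e by simp
    fix n :: nat and x y :: "nat \<Rightarrow> real"
    assume A: "(\<forall>i<n. x i \<le> y i) \<and> disjoint_family_on (\<lambda>i. {x i<..<y i}) {..<n} \<and> (\<Sum>i<n. y i - x i) < e / (2 * (real K + 1))"
    have le: "(\<integral>z. \<phi> z * indicator {x i<..<y i} z \<partial>lborel) \<le> (\<integral>z. \<psi> z * indicator {x i<..<y i} z \<partial>lborel) + real K * (y i - x i)"
      if i: "i < n" for i
    proof -
      have ci: "integrable lborel (\<lambda>z. real K * indicator {x i<..<y i} z)"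
        using A i by (intro integrable_mult_right integrable_real_indicator) auto
      have "(\<integral>z. \<phi> z * indicator {x i<..<y i} z \<partial>lborel) \<le> (\<integral>z. \<psi> z * indicator {x i<..<y i} z + real K * indicator {x i<..<y i} z \<partial>lborel)"
        by (intro integral_mono int Bochner_Integration.integrable_add \<psi>int ci) (auto simp: \<psi>_def indicator_def)
      also have "\<dots> = (\<integral>z. \<psi> z * indicator {x i<..<y i} z \<partial>lborel) + real K * (y i - x i)"
        using A i by (subst Bochner_Integration.integral_add[OF \<psi>int ci]) auto
      finally show ?thesis .
    qed
    have "(\<Sum>i<n. \<integral>z. \<psi> z * indicator {x i<..<y i} z \<partial>lborel) = (\<integral>z. (\<Sum>i<n. \<psi> z * indicator {x i<..<y i} z) \<partial>lborel)"
      by (intro Bochner_Integration.integral_sum[symmetric] \<psi>int) auto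
    also have "\<dots> \<le> (\<integral>z. \<psi> z \<partial>lborel)"
    proof (intro integral_mono Bochner_Integration.integrable_sum \<psi>int \<psi>i)
      fix z
      have "(\<Sum>i<n. indicator {x i<..<y i} z) = (indicator (\<Union>i<n. {x i<..<y i}) z :: real)"
        using A by (intro indicator_UN_disjoint[symmetric]) auto
      then have "(\<Sum>i<n. \<psi> z * indicator {x i<..<y i} z) = \<psi> z * indicator (\<Union>i<n. {x i<..<y i}) z"
        by (simp flip: sum_distrib_left)
      then show "(\<Sum>i<n. \<psi> z * indicator {x i<..<y i} z) \<le> \<psi> z"
        using \<psi>0[of z] by (auto simp: indicator_def)
    qed auto
    also have "\<dots> < e / 2" using K by (simp add: \<psi>_def)
    finally have 1: "(\<Sum>i<n. \<integral>z. \<psi> z * indicator {x i<..<y i} z \<partial>lborel) < e / 2" .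
    have "(\<Sum>i<n. \<integral>z. \<phi> z * indicator {x i<..<y i} z \<partial>lborel)
        \<le> (\<Sum>i<n. (\<integral>z. \<psi> z * indicator {x i<..<y i} z \<partial>lborel) + real K * (y i - x i))"
      by (rule sum_mono) (use le in auto)
    also have "\<dots> = (\<Sum>i<n. \<integral>z. \<psi> z * indicator {x i<..<y i} z \<partial>lborel) + real K * (\<Sum>i<n. y i - x i)"
      by (simp add: sum.distrib sum_distrib_left)
    also have "\<dots> < e / 2 + real K * (\<Sum>i<n. y i - x i)" using 1 by simp
    also have "real K * (\<Sum>i<n. y i - x i) \<le> real K * (e / (2 * (real K + 1)))"
      using A by (intro mult_left_mono) auto
    also have "\<dots> \<le> e / 2" using e by (simp add: field_simps)
    finally show "(\<Sum>i<n. \<integral>z. \<phi> z * indicator {x i<..<y i} z \<partial>lborel) < e" by simp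
  qed
qed

lemma integral_interval_small:
  fixes \<phi> :: "real \<Rightarrow> real"
  assumes \<phi>: "integrable lborel \<phi>" "\<And>x::real. 0 \<le> \<phi> x" and e: "0 < e"
  shows "\<exists>d>0. \<forall>x y. x \<le> y \<and> y - x < d \<longrightarrow> (\<integral>z. \<phi> z * indicator {x<..<y} z \<partial>lborel) < e"
proof -
  obtain d where d: "d > 0" "\<forall>(n::nat) x y. (\<forall>i<n. x i \<le> y i) \<and> disjoint_family_on (\<lambda>i. {x i<..<y i}) {..<n} \<and> (\<Sum>i<n. y i - x i) < d \<longrightarrow>
    (\<Sum>i<n. \<integral>z. \<phi> z * indicator {x i<..<y i} z \<partial>lborel) < e"
    using integral_uniformly_small[OF \<phi> e] by (elim exE conjE) (rule that)
  show ?thesis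
  proof (intro exI[of _ d] conjI allI impI d(1))
    fix x y :: real assume "x \<le> y \<and> y - x < d"
    then show "(\<integral>z. \<phi> z * indicator {x<..<y} z \<partial>lborel) < e"
      using d(2)[rule_format, of 1 "\<lambda>_. x" "\<lambda>_. y"] by (simp add: disjoint_family_on_def)
  qed
qed

section \<open>Norm differentiation of weighted integrals\<close>

context bounded_continuous
begin

lemma weighted_integral_0: "weighted_integral N (\<lambda>_. 0) G = 0"
  by (simp add: weighted_integral_def grid_sum_def lim_const)

lemma weighted_integral_cmult:
  assumes "sets N = sets borel" "integrable N w"
  shows "weighted_integral N (\<lambda>x. c * w x) G = c *\<^sub>R weighted_integral N w G"
proof (rule weighted_integral_eq)
  show "has_bochner N (\<lambda>x. (c * w x) *\<^sub>R G x) (c *\<^sub>R weighted_integral N w G)"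
    using has_bochner_scaleR[OF grid_sum_tendsto_has_bochner(2)[OF assms], of c] by simp
qed (use assms in auto)

text \<open>Grid sums of the integrand are finite combinations of fixed vectors with scalar
  integrable coefficients, to which scalar differentiation applies. The scalar grid errors are the
  majorants \<phi> required by the criterion for L1 limits, so the derivative exists in
  norm.\<close>

lemma has_vector_derivative_weighted_integral:
  fixes k :: "real \<Rightarrow> real \<Rightarrow> real"
  assumes k: "integrable (lborel \<Otimes>\<^sub>M lborel) (\<lambda>(x, s). k x s)"
    and Q: "\<And>t. has_bochner lborel (\<lambda>x. indicator {..t} x *\<^sub>R weighted_integral lborel (k x) G) (Q t)"
  shows "AE x in lborel. (Q has_vector_derivative weighted_integral lborel (k x) G) (at x)"
proof -
  define c where "c n z x = (\<integral>s. k x s * indicator (grid n -` {z}) s \<partial>lborel)" for n z x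
  have ci: "integrable lborel (c n z)" for n z
  proof -
    have "integrable (lborel \<Otimes>\<^sub>M lborel) (\<lambda>p. (case p of (x, s) \<Rightarrow> k x s) * indicator (snd -` (grid n -` {z}) \<inter> space (lborel \<Otimes>\<^sub>M lborel)) p)"
      by (rule integrable_real_mult_indicator[OF _ k]) (rule measurable_sets[OF measurable_snd], simp add: grid_vimage_sets)
    moreover have "(\<lambda>p. (case p of (x, s) \<Rightarrow> k x s) * indicator (snd -` (grid n -` {z}) \<inter> space (lborel \<Otimes>\<^sub>M lborel)) p)
        = (\<lambda>(x, s). k x s * indicator (grid n -` {z}) s)"
      by (auto simp: indicator_def space_pair_measure)
    ultimately have "integrable (lborel \<Otimes>\<^sub>M lborel) (\<lambda>(x, s). k x s * indicator (grid n -` {z}) s)" by simp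
    from lborel_pair.integrable_fst'[OF this] show ?thesis by (simp add: c_def[abs_def])
  qed
  define \<psi> where "\<psi> n x = (\<integral>\<^sup>+s. ennreal (\<bar>k x s\<bar> * grid_error n s) \<partial>lborel)" for n x
  have km[measurable]: "(\<lambda>(x, s). k x s) \<in> borel_measurable (lborel \<Otimes>\<^sub>M lborel)" using k by (rule borel_measurable_integrable)
  have [measurable]: "\<psi> n \<in> borel_measurable borel" for n
  proof -
    have "\<psi> n \<in> borel_measurable lborel" unfolding \<psi>_def by measurable
    then show ?thesis by simp
  qed
  have \<psi>fin: "(\<integral>\<^sup>+x. \<psi> n x \<partial>lborel) < \<infinity>" for n
  proof -
    have "(\<integral>\<^sup>+x. \<psi> n x \<partial>lborel) \<le> (\<integral>\<^sup>+x. \<integral>\<^sup>+s. ennreal (norm (k x s)) * ennreal (2 * C) \<partial>lborel \<partial>lborel)"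
      unfolding \<psi>_def
    proof (intro nn_integral_mono)
      fix x s
      have "\<bar>k x s\<bar> * grid_error n s \<le> \<bar>k x s\<bar> * (2 * C)" by (intro mult_left_mono grid_error_le) simp
      then have "ennreal (\<bar>k x s\<bar> * grid_error n s) \<le> ennreal (\<bar>k x s\<bar> * (2 * C))" by (rule ennreal_leI)
      also have "\<dots> = ennreal (norm (k x s)) * ennreal (2 * C)"
        using C_nonneg by (simp add: ennreal_mult)
      finally show "ennreal (\<bar>k x s\<bar> * grid_error n s) \<le> ennreal (norm (k x s)) * ennreal (2 * C)" .
    qed
    also have "\<dots> = (\<integral>\<^sup>+p. ennreal (norm (case p of (x, s) \<Rightarrow> k x s)) * ennreal (2 * C) \<partial>(lborel \<Otimes>\<^sub>M lborel))"
      by (subst lborel.nn_integral_fst[symmetric]) auto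
    also have "\<dots> = (\<integral>\<^sup>+p. ennreal (norm (case p of (x, s) \<Rightarrow> k x s)) \<partial>(lborel \<Otimes>\<^sub>M lborel)) * ennreal (2 * C)"
      by (rule nn_integral_multc) measurable
    also have "\<dots> < \<infinity>"
      using k[unfolded integrable_iff_bounded] by (simp add: ennreal_mult_less_top)
    finally show ?thesis .
  qed
  have \<psi>AE: "AE x in lborel. \<forall>n. \<psi> n x = ennreal (enn2real (\<psi> n x))"
    unfolding AE_all_countable
  proof
    fix n
    have "AE x in lborel. \<psi> n x \<noteq> \<infinity>" using \<psi>fin[of n] by (intro nn_integral_PInf_AE) auto
    then show "AE x in lborel. \<psi> n x = ennreal (enn2real (\<psi> n x))"
      by eventually_elim (rule ennreal_eq_top_cases)
  qed
  define \<phi> where "\<phi> n x = enn2real (\<psi> n x)" for n x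
  have [measurable]: "\<phi> n \<in> borel_measurable borel" for n unfolding \<phi>_def by measurable
  have \<phi>nn: "(\<integral>\<^sup>+x. ennreal (\<phi> n x) \<partial>lborel) = (\<integral>\<^sup>+x. \<psi> n x \<partial>lborel)" for n
    by (rule nn_integral_cong_AE) (use \<psi>AE in \<open>eventually_elim, simp add: \<phi>_def\<close>)
  have \<phi>i: "integrable lborel (\<phi> n)" for n
  proof (rule integrableI_nonneg)
    show "(\<integral>\<^sup>+x. ennreal (\<phi> n x) \<partial>lborel) < \<infinity>" unfolding \<phi>nn by (rule \<psi>fin)
  qed (auto simp: \<phi>_def)
  have \<phi>0: "0 \<le> \<phi> n x" for n x by (simp add: \<phi>_def)
  note Fub = weighted_integral_Fubini[OF lborel.sigma_finite_measure_axioms lborel.sigma_finite_measure_axioms sets_lborel k]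
  define gn where "gn n x = grid_sum n lborel (k x) G" for n x
  define g where "g x = weighted_integral lborel (k x) G" for x
  have close: "AE x in lborel. \<forall>n. norm (g x - gn n x) \<le> \<phi> n x"
    using Fub(3) \<psi>AE
  proof eventually_elim
    fix x assume 1: "\<forall>n. ennreal (norm (weighted_integral lborel (k x) G - grid_sum n lborel (k x) G)) \<le> (\<integral>\<^sup>+s. ennreal (\<bar>k x s\<bar> * grid_error n s) \<partial>lborel)"
      and 2: "\<forall>n. \<psi> n x = ennreal (enn2real (\<psi> n x))"
    show "\<forall>n. norm (g x - gn n x) \<le> \<phi> n x"
    proof
      fix n
      have "ennreal (norm (g x - gn n x)) \<le> \<psi> n x" using 1 by (simp add: g_def gn_def \<psi>_def)
      also have "\<psi> n x = ennreal (\<phi> n x)" using 2 by (simp add: \<phi>_def)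
      finally show "norm (g x - gn n x) \<le> \<phi> n x" using \<phi>0 by (simp add: ennreal_le_iff)
    qed
  qed
  have gn_eq: "gn n x = (\<Sum>z\<in>range (grid n). c n z x *\<^sub>R G z)" for n x
    by (simp add: gn_def grid_sum_def c_def)
  define Qn where "Qn n t = (\<Sum>z\<in>range (grid n). primitive (c n z) t *\<^sub>R G z)" for n t
  have Qn: "has_bochner lborel (\<lambda>x. indicator {..t} x *\<^sub>R gn n x) (Qn n t)" for n t
  proof -
    have "has_bochner lborel (\<lambda>x. \<Sum>z\<in>range (grid n). (c n z x * indicator {..t} x) *\<^sub>R G z) (Qn n t)"
      unfolding Qn_def primitive_def
      by (intro has_bochner_sum has_bochner_scaleR_left has_bochner_integral_integrable
          integrable_real_mult_indicator finite_range_grid ci) simp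
    then show ?thesis by (simp add: gn_eq scaleR_sum_right mult.commute)
  qed
  have "AE x in lborel. (Q has_vector_derivative g x) (at x)"
  proof (rule has_vector_derivative_AE_limit[where Qn=Qn and gn=gn and \<phi>=\<phi>])
    show "AE x in lborel. (Qn n has_vector_derivative gn n x) (at x)" for n
    proof -
      have "AE x in lborel. \<forall>z\<in>range (grid n). (primitive (c n z) has_vector_derivative c n z x) (at x)"
        using finite_range_grid by (intro AE_finite_allI Lebesgue_differentiation ci)
      then show ?thesis
      proof eventually_elim
        fix x assume d: "\<forall>z\<in>range (grid n). (primitive (c n z) has_vector_derivative c n z x) (at x)"
        have "((\<lambda>t. \<Sum>z\<in>range (grid n). primitive (c n z) t *\<^sub>R G z) has_vector_derivative (\<Sum>z\<in>range (grid n). c n z x *\<^sub>R G z)) (at x)"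
        proof (rule has_vector_derivative_sum)
          fix z assume "z \<in> range (grid n)"
          then have "(primitive (c n z) has_vector_derivative c n z x) (at x)" using d by blast
          then show "((\<lambda>t. primitive (c n z) t *\<^sub>R G z) has_vector_derivative c n z x *\<^sub>R G z) (at x)"
            by (rule bounded_linear.has_vector_derivative[OF bounded_linear_scaleR_left])
        qed
        then show "(Qn n has_vector_derivative gn n x) (at x)" by (simp add: Qn_def[abs_def] gn_eq)
      qed
    qed
    show "(\<lambda>n. \<integral>z. \<phi> n z \<partial>lborel) \<longlonglongrightarrow> 0"
    proof -
      have "(\<lambda>n. \<integral>\<^sup>+x. \<psi> n x \<partial>lborel) \<longlonglongrightarrow> 0" using Fub(2) by (simp add: \<psi>_def)
      moreover have "(\<integral>\<^sup>+x. \<psi> n x \<partial>lborel) = ennreal (\<integral>z. \<phi> n z \<partial>lborel)" for n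
        unfolding \<phi>nn[symmetric] by (rule nn_integral_eq_integral[OF \<phi>i]) (simp add: \<phi>0)
      ultimately have "(\<lambda>n. ennreal (\<integral>z. \<phi> n z \<partial>lborel)) \<longlonglongrightarrow> ennreal 0" by simp
      then show ?thesis by (subst (asm) tendsto_ennreal_iff) (auto simp: \<phi>0 integral_nonneg_AE)
    qed
    have incr: "norm ((Q y - Qn n y) - (Q x - Qn n x)) \<le> (\<integral>z. \<phi> n z * indicator {x<..<y} z \<partial>lborel)" if "x \<le> y" for n x y
    proof -
      have hb: "has_bochner lborel (\<lambda>z. (indicator {..y} z *\<^sub>R g z - indicator {..y} z *\<^sub>R gn n z) - (indicator {..x} z *\<^sub>R g z - indicator {..x} z *\<^sub>R gn n z))
          ((Q y - Qn n y) - (Q x - Qn n x))"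
        using Q unfolding g_def[symmetric] by (intro has_bochner_diff Qn)
      have "ennreal (norm ((Q y - Qn n y) - (Q x - Qn n x))) \<le> (\<integral>\<^sup>+z. ennreal (\<phi> n z * indicator {x<..<y} z) \<partial>lborel)"
      proof (rule has_bochner_norm_bound[OF hb])
        show "AE z in lborel. ennreal (norm ((indicator {..y} z *\<^sub>R g z - indicator {..y} z *\<^sub>R gn n z) - (indicator {..x} z *\<^sub>R g z - indicator {..x} z *\<^sub>R gn n z)))
            \<le> ennreal (\<phi> n z * indicator {x<..<y} z)"
          using close AE_lborel_singleton[of y]
        proof eventually_elim
          fix z assume c: "\<forall>n. norm (g z - gn n z) \<le> \<phi> n z" and z: "z \<noteq> y"
          show "ennreal (norm ((indicator {..y} z *\<^sub>R g z - indicator {..y} z *\<^sub>R gn n z) - (indicator {..x} z *\<^sub>R g z - indicator {..x} z *\<^sub>R gn n z)))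
            \<le> ennreal (\<phi> n z * indicator {x<..<y} z)"
          proof (rule ennreal_leI)
            consider "z \<le> x" | "x < z" "z < y" | "y < z" using z by linarith
            then show "norm ((indicator {..y} z *\<^sub>R g z - indicator {..y} z *\<^sub>R gn n z) - (indicator {..x} z *\<^sub>R g z - indicator {..x} z *\<^sub>R gn n z))
              \<le> \<phi> n z * indicator {x<..<y} z"
              using c \<open>x \<le> y\<close> by cases auto
          qed
        qed
      qed measurable
      also have "\<dots> = ennreal (\<integral>z. \<phi> n z * indicator {x<..<y} z \<partial>lborel)"
        by (intro nn_integral_eq_integral integrable_real_mult_indicator \<phi>i) (simp_all add: \<phi>0)
      finally show ?thesis
        by (subst (asm) ennreal_le_iff) (auto simp: \<phi>0 intro!: integral_nonneg_AE)
    qed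
    show "norm ((Q y - Qn n y) - (Q x - Qn n x)) \<le> (\<integral>z. \<phi> n z * indicator {min x y<..<max x y} z \<partial>lborel)" for n x y
    proof (cases "x \<le> y")
      case True
      then show ?thesis using incr[OF True, of n] by (simp add: min_def max_def)
    next
      case False
      then have "norm ((Q x - Qn n x) - (Q y - Qn n y)) \<le> (\<integral>z. \<phi> n z * indicator {y<..<x} z \<partial>lborel)" by (intro incr) simp
      then show ?thesis using False by (simp add: min_def max_def norm_minus_commute)
    qed
  qed (use \<phi>i \<phi>0 close in auto)
  then show ?thesis by (simp add: g_def)
qed

end

section \<open>Contraction semigroups\<close>

locale contraction_semigroup =
  fixes T :: "real \<Rightarrow> 'b::banach \<Rightarrow>\<^sub>L 'b"
  assumes C0: "C0_semigroup T"
    and contraction: "\<And>t u. 0 \<le> t \<Longrightarrow> norm (blinfun_apply (T t) u) \<le> norm u"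
begin

lemma T_0: "blinfun_apply (T 0) u = u"
  and T_add: "0 \<le> s \<Longrightarrow> 0 \<le> t \<Longrightarrow> blinfun_apply (T (s + t)) u = blinfun_apply (T s) (blinfun_apply (T t) u)"
  and T_right: "((\<lambda>t. blinfun_apply (T t) u) \<longlongrightarrow> u) (at_right 0)"
  using C0 by (auto simp: C0_semigroup_def)

text \<open>Frozen at its initial value for negative times, which makes it continuous on the whole
  line as \<open>bounded_continuous\<close> requires.\<close>

definition orbit :: "'b \<Rightarrow> real \<Rightarrow> 'b" where
  "orbit u s = blinfun_apply (T (max 0 s)) u"

lemma orbit_nonneg: "0 \<le> s \<Longrightarrow> orbit u s = blinfun_apply (T s) u"
  by (simp add: orbit_def max_def)

lemma orbit_add: "orbit (u + v) s = orbit u s + orbit v s"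
  and orbit_scaleR: "orbit (c *\<^sub>R u) s = c *\<^sub>R orbit u s"
  by (simp_all add: orbit_def blinfun.add_right blinfun.scaleR_right)

lemma orbit_increment:
  assumes "0 \<le> p" "p \<le> q"
  shows "orbit u q - orbit u p = blinfun_apply (T p) (blinfun_apply (T (q - p)) u - u)"
proof -
  have "blinfun_apply (T (p + (q - p))) u = blinfun_apply (T p) (blinfun_apply (T (q - p)) u)"
    using assms by (intro T_add) auto
  then show ?thesis using assms by (simp add: orbit_nonneg blinfun.diff_right)
qed

lemma T_small:
  assumes "0 < e" shows "\<exists>d>0. \<forall>h. 0 \<le> h \<longrightarrow> h < d \<longrightarrow> norm (blinfun_apply (T h) u - u) < e"
proof -
  have "\<forall>\<^sub>F h in at_right 0. dist (blinfun_apply (T h) u) u < e"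
    using T_right assms by (rule tendstoD)
  then obtain d where d: "0 < d" "\<And>h. 0 < h \<Longrightarrow> h < d \<Longrightarrow> dist (blinfun_apply (T h) u) u < e"
    unfolding eventually_at_right_field by auto
  show ?thesis
  proof (intro exI[of _ d] conjI allI impI d(1))
    fix h assume "0 \<le> h" "h < d"
    then show "norm (blinfun_apply (T h) u - u) < e"
      using d(2)[of h] assms by (cases "h = 0") (auto simp: T_0 dist_norm)
  qed
qed

text \<open>By contraction the increment over [p, q] has norm at most that of T (q - p) u - u, so
  right continuity at 0 gives continuity from both sides.\<close>

lemma orbit_continuous: "continuous_on UNIV (orbit u)"
  unfolding continuous_on_iff
proof (intro ballI allI impI)
  fix s :: real and e :: real assume "0 < e"
  obtain d where d: "0 < d" "\<And>h. 0 \<le> h \<Longrightarrow> h < d \<Longrightarrow> norm (blinfun_apply (T h) u - u) < e"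
    using T_small[OF \<open>0 < e\<close>, of u] by auto
  have *: "norm (orbit u q - orbit u p) < e" if "0 \<le> p" "p \<le> q" "q - p < d" for p q
  proof -
    have "norm (orbit u q - orbit u p) \<le> norm (blinfun_apply (T (q - p)) u - u)"
      unfolding orbit_increment[OF that(1,2)] by (rule contraction[OF that(1)])
    also have "\<dots> < e" using that by (intro d(2)) auto
    finally show ?thesis .
  qed
  have om: "orbit u x = orbit u (max 0 x)" for x by (simp add: orbit_def)
  show "\<exists>d>0. \<forall>x'\<in>UNIV. dist x' s < d \<longrightarrow> dist (orbit u x') (orbit u s) < e"
  proof (intro exI[of _ d] conjI ballI impI d(1))
    fix t assume t: "dist t s < d"
    show "dist (orbit u t) (orbit u s) < e"
    proof (cases "s \<le> t")
      case True
      then have "norm (orbit u (max 0 t) - orbit u (max 0 s)) < e"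
        using t by (intro *) (auto simp: dist_real_def max_def)
      then show ?thesis by (simp add: dist_norm om[of t] om[of s])
    next
      case False
      then have "norm (orbit u (max 0 s) - orbit u (max 0 t)) < e"
        using t by (intro *) (auto simp: dist_real_def max_def)
      then show ?thesis by (simp add: dist_norm om[of t] om[of s] norm_minus_commute)
    qed
  qed
qed

lemma norm_orbit_le: "norm (orbit u s) \<le> norm u"
  unfolding orbit_def by (rule contraction) simp

sublocale orbit: bounded_continuous "orbit u" "norm u" for u
  by unfold_locales (rule orbit_continuous, rule norm_orbit_le)

definition Phi :: "'b \<Rightarrow> real \<Rightarrow> 'b" where
  "Phi u r = weighted_integral lborel (indicator {0<..<r}) (orbit u)"

lemma Phi_0: "Phi u 0 = 0"
proof -
  have "indicator {0<..<0} = (\<lambda>_::real. 0 :: real)" by (auto simp: indicator_def)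
  then show ?thesis unfolding Phi_def by (simp only: orbit.weighted_integral_0)
qed

lemma has_bochner_interval: "has_bochner lborel (\<lambda>s. indicator {x<..<y} s *\<^sub>R orbit u s) (weighted_integral lborel (indicator {x<..<y}) (orbit u))"
proof (rule orbit.grid_sum_tendsto_has_bochner(2))
  show "integrable lborel (indicator {x<..<y} :: real \<Rightarrow> real)"
    by (cases "x \<le> y") (auto intro!: integrable_real_indicator)
qed simp

lemma Phi_diff:
  assumes "0 \<le> x" "x \<le> y" shows "Phi u y - Phi u x = weighted_integral lborel (indicator {x<..<y}) (orbit u)"
proof -
  have "has_bochner lborel (\<lambda>s. indicator {0<..<y} s *\<^sub>R orbit u s - indicator {0<..<x} s *\<^sub>R orbit u s) (Phi u y - Phi u x)"
    unfolding Phi_def by (intro has_bochner_diff has_bochner_interval)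
  moreover have "AE s in lborel. indicator {0<..<y} s *\<^sub>R orbit u s - indicator {0<..<x} s *\<^sub>R orbit u s = indicator {x<..<y} s *\<^sub>R orbit u s"
    using AE_lborel_singleton[of x] by eventually_elim (use assms in \<open>auto simp: indicator_def\<close>)
  ultimately have "has_bochner lborel (\<lambda>s. indicator {x<..<y} s *\<^sub>R orbit u s) (Phi u y - Phi u x)"
    by (simp only: has_bochner_cong_AE)
  then show ?thesis by (rule has_bochner_unique[OF _ has_bochner_interval])
qed

lemma Phi_increment_bound:
  assumes "0 \<le> x" "x \<le> y" and w: "\<And>s. x < s \<Longrightarrow> s < y \<Longrightarrow> norm (orbit u s - w) \<le> e" and e: "0 \<le> e"
  shows "norm (Phi u y - Phi u x - (y - x) *\<^sub>R w) \<le> e * (y - x)"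
proof -
  have "has_bochner_integral lborel (indicator {x<..<y}) (y - x)"
    using has_bochner_integral_real_indicator[of "{x<..<y}" lborel] assms(2) by simp
  then have hb: "has_bochner lborel (\<lambda>s. indicator {x<..<y} s *\<^sub>R w) ((y - x) *\<^sub>R w)"
    by (rule has_bochner_scaleR_left)
  have "ennreal (norm (Phi u y - Phi u x - (y - x) *\<^sub>R w)) \<le> (\<integral>\<^sup>+s. ennreal e * indicator {x<..<y} s \<partial>lborel)"
    unfolding Phi_diff[OF assms(1,2)]
  proof (rule has_bochner_dist_bound[OF has_bochner_interval hb])
    show "AE s in lborel. ennreal (norm (indicator {x<..<y} s *\<^sub>R orbit u s - indicator {x<..<y} s *\<^sub>R w)) \<le> ennreal e * indicator {x<..<y} s"
      using w by (intro AE_I2) (auto simp: indicator_def intro!: ennreal_leI)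
  qed simp
  also have "\<dots> = ennreal (e * (y - x))"
    using assms(2) e by (simp add: nn_integral_cmult_indicator ennreal_mult)
  finally show ?thesis using assms(2) e by (simp add: ennreal_le_iff)
qed

lemma Phi_has_vector_derivative:
  assumes x: "0 \<le> x" shows "(Phi u has_vector_derivative orbit u x) (at x within {0..})"
  unfolding has_vector_derivative_def has_derivative_within_alt
proof (intro conjI allI impI bounded_linear_scaleR_left)
  fix e :: real assume "0 < e"
  have "isCont (orbit u) x" using orbit_continuous by (simp add: continuous_on_eq_continuous_at)
  then obtain d where d: "d > 0" "\<And>z. dist z x < d \<Longrightarrow> dist (orbit u z) (orbit u x) < e"
    using \<open>0 < e\<close> unfolding continuous_at_eps_delta by metis
  show "\<exists>d>0. \<forall>y\<in>{0..}. norm (y - x) < d \<longrightarrow> norm (Phi u y - Phi u x - (y - x) *\<^sub>R orbit u x) \<le> e * norm (y - x)"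
  proof (intro exI[of _ d] conjI ballI impI d(1))
    fix y assume y: "y \<in> {0..}" "norm (y - x) < d"
    show "norm (Phi u y - Phi u x - (y - x) *\<^sub>R orbit u x) \<le> e * norm (y - x)"
    proof (cases "x \<le> y")
      case True
      have "norm (Phi u y - Phi u x - (y - x) *\<^sub>R orbit u x) \<le> e * (y - x)"
        by (rule Phi_increment_bound[OF x True _ less_imp_le[OF \<open>0 < e\<close>]])
          (use d(2) y in \<open>auto simp: dist_norm intro: less_imp_le\<close>)
      then show ?thesis using True by simp
    next
      case False
      have "norm (Phi u x - Phi u y - (x - y) *\<^sub>R orbit u x) \<le> e * (x - y)"
        by (rule Phi_increment_bound[OF _ _ _ less_imp_le[OF \<open>0 < e\<close>]])
          (use d(2) y False in \<open>auto simp: dist_norm intro: less_imp_le\<close>)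
      moreover have "Phi u y - Phi u x - (y - x) *\<^sub>R orbit u x = - (Phi u x - Phi u y - (x - y) *\<^sub>R orbit u x)"
        by (simp add: algebra_simps)
      then have "norm (Phi u y - Phi u x - (y - x) *\<^sub>R orbit u x) = norm (Phi u x - Phi u y - (x - y) *\<^sub>R orbit u x)"
        by (simp only: norm_minus_cancel)
      ultimately show ?thesis using False by simp
    qed
  qed
qed

lemma generator_tendsto:
  assumes "u \<in> generator_dom T"
  shows "((\<lambda>h. (blinfun_apply (T h) u - u) /\<^sub>R h) \<longlongrightarrow> generator T u) (at_right 0)"
proof -
  obtain v where v: "((\<lambda>h. (blinfun_apply (T h) u - u) /\<^sub>R h) \<longlongrightarrow> v) (at_right 0)"
    using assms by (auto simp: generator_dom_def)
  then have "generator T u = v"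
    unfolding generator_def by (intro tendsto_Lim) auto
  with v show ?thesis by simp
qed

lemma generatorI:
  assumes "((\<lambda>h. (blinfun_apply (T h) u - u) /\<^sub>R h) \<longlongrightarrow> v) (at_right 0)"
  shows "u \<in> generator_dom T" "generator T u = v"
  using assms tendsto_Lim[OF _ assms] by (auto simp: generator_dom_def generator_def)

text \<open>The increment over [p, q] is T p applied to an increment at 0, so by contraction the
  quotient is close to T p A u uniformly in p. Continuity of the orbit of A u replaces p by x, which
  covers the left derivative as well as the right one.\<close>

lemma orbit_has_vector_derivative:
  assumes u: "u \<in> generator_dom T" and x: "0 \<le> x"
  shows "(orbit u has_vector_derivative orbit (generator T u) x) (at x within {0..})"
  unfolding has_vector_derivative_def has_derivative_within_alt
proof (intro conjI allI impI bounded_linear_scaleR_left)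
  fix e :: real assume "0 < e"
  then have e2: "0 < e / 2" by simp
  define v where "v = generator T u"
  have "\<forall>\<^sub>F h in at_right 0. dist ((blinfun_apply (T h) u - u) /\<^sub>R h) v < e / 2"
    using generator_tendsto[OF u, folded v_def] e2 by (rule tendstoD)
  then obtain d where d: "0 < d" "\<And>h. 0 < h \<Longrightarrow> h < d \<Longrightarrow> dist ((blinfun_apply (T h) u - u) /\<^sub>R h) v < e / 2"
    unfolding eventually_at_right_field by auto
  have "isCont (orbit v) x" using orbit_continuous by (simp add: continuous_on_eq_continuous_at)
  then obtain d' where d': "d' > 0" "\<And>z. dist z x < d' \<Longrightarrow> dist (orbit v z) (orbit v x) < e / 2"
    using e2 unfolding continuous_at_eps_delta by metis
  have *: "norm (orbit u q - orbit u p - (q - p) *\<^sub>R orbit v x) \<le> e * (q - p)"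
    if pq: "0 \<le> p" "p < q" "q - p < d" "dist p x < d'" for p q
  proof -
    define h where "h = q - p"
    have h: "0 < h" "h < d" using pq by (auto simp: h_def)
    have "orbit u q - orbit u p - h *\<^sub>R orbit v x
        = h *\<^sub>R (blinfun_apply (T p) ((blinfun_apply (T h) u - u) /\<^sub>R h - v) + (orbit v p - orbit v x))"
      using h pq unfolding h_def[symmetric] orbit_increment[OF pq(1) less_imp_le[OF pq(2)]]
      by (simp add: orbit_nonneg blinfun.diff_right blinfun.scaleR_right scaleR_right_diff_distrib scaleR_right_distrib)
    also have "norm \<dots> \<le> h * (norm (blinfun_apply (T p) ((blinfun_apply (T h) u - u) /\<^sub>R h - v)) + norm (orbit v p - orbit v x))"
      using h by (simp add: norm_triangle_ineq mult_left_mono)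
    also have "\<dots> \<le> h * (e / 2 + e / 2)"
    proof (intro mult_left_mono add_mono)
      have "norm (blinfun_apply (T p) ((blinfun_apply (T h) u - u) /\<^sub>R h - v)) \<le> norm ((blinfun_apply (T h) u - u) /\<^sub>R h - v)"
        by (rule contraction[OF pq(1)])
      also have "\<dots> \<le> e / 2" using d(2)[OF h] by (simp add: dist_norm)
      finally show "norm (blinfun_apply (T p) ((blinfun_apply (T h) u - u) /\<^sub>R h - v)) \<le> e / 2" .
      show "norm (orbit v p - orbit v x) \<le> e / 2" using d'(2)[OF pq(4)] by (simp add: dist_norm)
    qed (use h in simp)
    finally show ?thesis by (simp add: h_def mult.commute)
  qed
  show "\<exists>d>0. \<forall>y\<in>{0..}. norm (y - x) < d \<longrightarrow> norm (orbit u y - orbit u x - (y - x) *\<^sub>R orbit (generator T u) x) \<le> e * norm (y - x)"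
    unfolding v_def[symmetric]
  proof (intro exI[of _ "min d d'"] conjI ballI impI)
    fix y assume y: "y \<in> {0..}" "norm (y - x) < min d d'"
    consider "x < y" | "y < x" | "y = x" by linarith
    then show "norm (orbit u y - orbit u x - (y - x) *\<^sub>R orbit v x) \<le> e * norm (y - x)"
    proof cases
      case 1
      then show ?thesis using *[OF x 1] y d' by (simp add: dist_real_def)
    next
      case 2
      have "norm (orbit u x - orbit u y - (x - y) *\<^sub>R orbit v x) \<le> e * (x - y)"
        using y 2 by (intro *) (auto simp: dist_real_def)
      moreover have "orbit u y - orbit u x - (y - x) *\<^sub>R orbit v x = - (orbit u x - orbit u y - (x - y) *\<^sub>R orbit v x)"
        by (simp add: algebra_simps)
      then have "norm (orbit u y - orbit u x - (y - x) *\<^sub>R orbit v x) = norm (orbit u x - orbit u y - (x - y) *\<^sub>R orbit v x)"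
        by (simp only: norm_minus_cancel)
      ultimately show ?thesis using 2 by simp
    qed simp
  qed (use d d' in auto)
qed

text \<open>The orbit minus the integral has zero derivative on the half-line and hence keeps its
  value u at 0.\<close>

lemma orbit_eq_Phi_generator:
  assumes u: "u \<in> generator_dom T" and r: "0 \<le> r"
  shows "orbit u r - u = Phi (generator T u) r"
proof -
  have "((\<lambda>x. orbit u x - Phi (generator T u) x) has_vector_derivative 0) (at x within {0..})" if "x \<in> {0..}" for x
    using has_vector_derivative_diff[OF orbit_has_vector_derivative[OF u, of x] Phi_has_vector_derivative[of x "generator T u"]] that by simp
  then have "((\<lambda>x. orbit u x - Phi (generator T u) x) has_derivative (\<lambda>h. 0)) (at x within {0..})" if "x \<in> {0..}" for x
    using that by (simp add: has_vector_derivative_def)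
  then obtain c where c: "\<And>x. x \<in> {0..} \<Longrightarrow> orbit u x - Phi (generator T u) x = c"
    using has_derivative_zero_constant[of "{0::real..}" "\<lambda>x. orbit u x - Phi (generator T u) x"] by auto
  then have "c = u" using c[of 0] by (simp add: orbit_nonneg T_0 Phi_0)
  then show ?thesis using c[of r] r by (simp add: algebra_simps)
qed

lemma T_Phi:
  assumes d: "0 \<le> d" and h: "0 \<le> h"
  shows "blinfun_apply (T d) (Phi u h) = Phi u (h + d) - Phi u d"
proof -
  have "has_bochner lborel (\<lambda>s. blinfun_apply (T d) (indicator {0<..<h} s *\<^sub>R orbit u s)) (blinfun_apply (T d) (Phi u h))"
    unfolding Phi_def by (rule has_bochner_bounded_linear[OF blinfun.bounded_linear_right has_bochner_interval])
  moreover have "blinfun_apply (T d) (indicator {0<..<h} s *\<^sub>R orbit u s) = indicator {0<..<h} s *\<^sub>R orbit u (s + d)" for s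
    using d T_add[of d s u] by (auto simp: indicator_def orbit_nonneg add.commute blinfun.scaleR_right)
  ultimately have "has_bochner lborel (\<lambda>s. indicator {0<..<h} s *\<^sub>R orbit u (s + d)) (blinfun_apply (T d) (Phi u h))" by simp
  \<comment> \<open>Lebesgue measure is rewritten as its own image under a translation, so that
    integration against an image measure performs the substitution.\<close>
  moreover have "lborel = distr lborel borel (\<lambda>s. - d + s)" by (simp only: lborel_distr_plus)
  ultimately have "has_bochner (distr lborel borel (\<lambda>s. - d + s)) (\<lambda>s. indicator {0<..<h} s *\<^sub>R orbit u (s + d)) (blinfun_apply (T d) (Phi u h))" by simp
  then have "has_bochner lborel (\<lambda>s. indicator {0<..<h} (- d + s) *\<^sub>R orbit u ((- d + s) + d)) (blinfun_apply (T d) (Phi u h))"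
    by (rule has_bochner_distr[rotated]) simp
  moreover have "indicator {0<..<h} (- d + s) *\<^sub>R orbit u ((- d + s) + d) = indicator {d<..<h + d} s *\<^sub>R orbit u s" for s
  proof -
    have "- d + s \<in> {0<..<h} \<longleftrightarrow> s \<in> {d<..<h + d}" by auto
    then show ?thesis by (simp add: indicator_def del: greaterThanLessThan_iff)
  qed
  ultimately have "has_bochner lborel (\<lambda>s. indicator {d<..<h + d} s *\<^sub>R orbit u s) (blinfun_apply (T d) (Phi u h))"
    by (simp only:)
  then have "blinfun_apply (T d) (Phi u h) = weighted_integral lborel (indicator {d<..<h + d}) (orbit u)"
    by (rule has_bochner_unique[OF _ has_bochner_interval])
  then show ?thesis using Phi_diff[of d "h + d" u] d h by simp
qed

text \<open>T d turns the integral over [0, h] into the one over [d, h + d]. The difference quotient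
  is therefore that of \<open>Phi u\<close> at h minus that at 0, and both converge by continuity of
  the orbit.\<close>

lemma Phi_in_generator_dom:
  assumes h: "0 \<le> h" shows "Phi u h \<in> generator_dom T"
proof -
  have der: "((\<lambda>d. (Phi u (x + d) - Phi u x) /\<^sub>R d) \<longlongrightarrow> orbit u x) (at_right 0)" if x: "0 \<le> x" for x
  proof (rule tendstoI)
    fix e :: real assume e: "0 < e"
    then have e2: "0 < e / 2" by simp
    have "isCont (orbit u) x" using orbit_continuous by (simp add: continuous_on_eq_continuous_at)
    then obtain d where d: "d > 0" "\<And>z. dist z x < d \<Longrightarrow> dist (orbit u z) (orbit u x) < e / 2"
      using e2 unfolding continuous_at_eps_delta by metis
    show "\<forall>\<^sub>F k in at_right 0. dist ((Phi u (x + k) - Phi u x) /\<^sub>R k) (orbit u x) < e"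
      unfolding eventually_at_right_field
    proof (intro exI[of _ d] conjI allI impI d(1))
      fix k assume k: "0 < k" "k < d"
      have "norm (Phi u (x + k) - Phi u x - ((x + k) - x) *\<^sub>R orbit u x) \<le> e / 2 * ((x + k) - x)"
        by (rule Phi_increment_bound[OF x _ _ less_imp_le[OF e2]])
          (use d(2) k x in \<open>auto simp: dist_norm intro: less_imp_le\<close>)
      then have "norm (Phi u (x + k) - Phi u x - k *\<^sub>R orbit u x) / k \<le> e / 2" using k by (simp add: field_simps)
      moreover have "(Phi u (x + k) - Phi u x) /\<^sub>R k - orbit u x = (Phi u (x + k) - Phi u x - k *\<^sub>R orbit u x) /\<^sub>R k"
        using k by (simp add: scaleR_right_diff_distrib)
      then have "norm ((Phi u (x + k) - Phi u x) /\<^sub>R k - orbit u x) = norm (Phi u (x + k) - Phi u x - k *\<^sub>R orbit u x) / k"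
        using k by (simp add: divide_inverse_commute)
      ultimately have "norm ((Phi u (x + k) - Phi u x) /\<^sub>R k - orbit u x) \<le> e / 2"
        by (simp only:)
      then show "dist ((Phi u (x + k) - Phi u x) /\<^sub>R k) (orbit u x) < e" using e by (simp add: dist_norm)
    qed
  qed
  have "((\<lambda>d. (Phi u (h + d) - Phi u h) /\<^sub>R d - (Phi u (0 + d) - Phi u 0) /\<^sub>R d) \<longlongrightarrow> orbit u h - orbit u 0) (at_right 0)"
    by (intro tendsto_diff der h) simp
  moreover have "\<forall>\<^sub>F d in at_right 0. (Phi u (h + d) - Phi u h) /\<^sub>R d - (Phi u (0 + d) - Phi u 0) /\<^sub>R d = (blinfun_apply (T d) (Phi u h) - Phi u h) /\<^sub>R d"
    using eventually_at_right_less[of 0]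
  proof eventually_elim
    case (elim d)
    have "blinfun_apply (T d) (Phi u h) = Phi u (h + d) - Phi u d" using elim h by (intro T_Phi) auto
    then show ?case
      unfolding scaleR_right_diff_distrib[symmetric] by (simp add: Phi_0 diff_diff_eq add.commute)
  qed
  ultimately have "((\<lambda>d. (blinfun_apply (T d) (Phi u h) - Phi u h) /\<^sub>R d) \<longlongrightarrow> orbit u h - orbit u 0) (at_right 0)"
    by (rule Lim_transform_eventually)
  then show ?thesis by (rule generatorI)
qed

text \<open>The averages of the orbit over [0, h] lie in the domain and tend to u as h decreases to
  0.\<close>

lemma generator_dom_dense:
  assumes e: "0 < e" obtains w where "w \<in> generator_dom T" "norm (u - w) \<le> e"
proof -
  obtain d where d: "0 < d" "\<And>h. 0 \<le> h \<Longrightarrow> h < d \<Longrightarrow> norm (blinfun_apply (T h) u - u) < e"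
    using T_small[OF e, of u] by auto
  define h where "h = d / 2"
  have h: "0 < h" "h < d" using d(1) by (auto simp: h_def)
  have "norm (Phi u h - Phi u 0 - (h - 0) *\<^sub>R u) \<le> e * (h - 0)"
    by (rule Phi_increment_bound[OF order_refl _ _ less_imp_le[OF e]])
      (use h d(2) in \<open>auto simp: orbit_nonneg intro: less_imp_le\<close>)
  then have le: "norm (Phi u h - h *\<^sub>R u) / h \<le> e" using h by (simp add: Phi_0 field_simps)
  have "u - Phi u h /\<^sub>R h = - ((Phi u h - h *\<^sub>R u) /\<^sub>R h)"
    using h by (simp add: scaleR_right_diff_distrib)
  then have "norm (u - Phi u h /\<^sub>R h) = norm ((Phi u h - h *\<^sub>R u) /\<^sub>R h)"
    by (simp only: norm_minus_cancel)
  also have "\<dots> = norm (Phi u h - h *\<^sub>R u) / h"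
    using h unfolding norm_scaleR by (simp add: divide_inverse_commute)
  finally have 1: "norm (u - Phi u h /\<^sub>R h) \<le> e" using le by simp
  have "Phi u h \<in> generator_dom T" using h by (intro Phi_in_generator_dom) simp
  from tendsto_scaleR[OF tendsto_const[of "inverse h"] generator_tendsto[OF this]]
  have lim: "((\<lambda>k. ((blinfun_apply (T k) (Phi u h) - Phi u h) /\<^sub>R k) /\<^sub>R h) \<longlongrightarrow> generator T (Phi u h) /\<^sub>R h) (at_right 0)" .
  have "((blinfun_apply (T k) (Phi u h) - Phi u h) /\<^sub>R k) /\<^sub>R h = (blinfun_apply (T k) (Phi u h /\<^sub>R h) - Phi u h /\<^sub>R h) /\<^sub>R k" for k
    unfolding blinfun.scaleR_right scaleR_right_diff_distrib[symmetric] by (rule scaleR_left_commute)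
  with lim have "((\<lambda>k. (blinfun_apply (T k) (Phi u h /\<^sub>R h) - Phi u h /\<^sub>R h) /\<^sub>R k) \<longlongrightarrow> generator T (Phi u h) /\<^sub>R h) (at_right 0)"
    by (simp only:)
  then have "Phi u h /\<^sub>R h \<in> generator_dom T" by (rule generatorI)
  then show ?thesis using 1 by (rule that)
qed

end

context bounded_continuous
begin

lemma weighted_integral_add:
  assumes "sets N = sets borel" "integrable N w" "integrable N w'"
  shows "weighted_integral N (\<lambda>x. w x + w' x) G = weighted_integral N w G + weighted_integral N w' G"
proof (rule weighted_integral_eq)
  show "has_bochner N (\<lambda>x. (w x + w' x) *\<^sub>R G x) (weighted_integral N w G + weighted_integral N w' G)"
    unfolding scaleR_left_distrib
    by (intro has_bochner_add grid_sum_tendsto_has_bochner(2) assms)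
qed (use assms in auto)

end

section \<open>Integrability of the kernel and of the potential density\<close>

context subordinator_process
begin

text \<open>On x \<le> t the factor exp (t - x) is at least 1, so the Laplace transform at 1 bounds
  the integral.\<close>

lemma nn_integral_pot_finite: "(\<integral>\<^sup>+x. pot 0 x * indicator {..t} x \<partial>lborel) < \<infinity>"
proof -
  have "(\<integral>\<^sup>+x. pot 0 x * indicator {..t} x \<partial>lborel) \<le> (\<integral>\<^sup>+x. ennreal (exp t) * (ennreal (exp (- (1 * x))) * pot 0 x) \<partial>lborel)"
  proof (rule nn_integral_mono)
    fix x :: real
    show "pot 0 x * indicator {..t} x \<le> ennreal (exp t) * (ennreal (exp (- (1 * x))) * pot 0 x)"
    proof (cases "x \<le> t")
      case True
      have "1 * pot 0 x \<le> ennreal (exp t * exp (- x)) * pot 0 x"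
        using True by (intro mult_right_mono) (auto simp flip: exp_add)
      then show ?thesis using True by (simp add: ennreal_mult mult.assoc)
    qed simp
  qed
  also have "\<dots> = ennreal (exp t) * ennreal (exp (- (0 * f 1)) / f 1)"
    by (subst nn_integral_cmult) (auto simp: Laplace_pot[of 0 1, simplified])
  also have "\<dots> < \<infinity>" by (simp add: ennreal_mult_less_top)
  finally show ?thesis .
qed

lemma AE_pot_finite: "AE x in lborel. pot 0 x < \<infinity>"
proof -
  have "AE x in lborel. \<forall>n::nat. pot 0 x * indicator {..real n} x \<noteq> \<infinity>"
    unfolding AE_all_countable
  proof
    fix n :: nat
    show "AE x in lborel. pot 0 x * indicator {..real n} x \<noteq> \<infinity>"
      by (rule nn_integral_PInf_AE) (use nn_integral_pot_finite[of "real n"] in auto)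
  qed
  then show ?thesis
  proof eventually_elim
    fix x :: real assume A: "\<forall>n::nat. pot 0 x * indicator {..real n} x \<noteq> \<infinity>"
    obtain n :: nat where "x \<le> real n" using real_arch_simple by blast
    then show "pot 0 x < \<infinity>" using A[rule_format, of n] by (simp add: less_top)
  qed
qed

lemma integrable_pot: "integrable lborel (\<lambda>x. enn2real (pot 0 x) * indicator {..t} x)"
proof (rule integrableI_nonneg)
  have "(\<integral>\<^sup>+x. ennreal (enn2real (pot 0 x) * indicator {..t} x) \<partial>lborel) \<le> (\<integral>\<^sup>+x. pot 0 x * indicator {..t} x \<partial>lborel)"
    by (intro nn_integral_mono) (auto simp: indicator_def ennreal_enn2real_if)
  also have "\<dots> < \<infinity>" by (rule nn_integral_pot_finite)
  finally show "(\<integral>\<^sup>+x. ennreal (enn2real (pot 0 x) * indicator {..t} x) \<partial>lborel) < \<infinity>" .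
qed auto

lemma pot_eq_nn_integral_kern: "(\<integral>\<^sup>+s. ennreal (kern s x) \<partial>lborel) = pot 0 x"
  unfolding pot_def by (rule nn_integral_cong) (auto simp: indicator_def kern_eq_0)

lemma integrable_kern:
  assumes "pot 0 x < \<infinity>"
  shows "integrable lborel (\<lambda>s. kern s x)" "(\<integral>s. kern s x \<partial>lborel) = enn2real (pot 0 x)"
proof -
  show "integrable lborel (\<lambda>s. kern s x)"
    by (rule integrableI_nonneg) (use assms in \<open>auto simp: kern_nonneg pot_eq_nn_integral_kern\<close>)
  show "(\<integral>s. kern s x \<partial>lborel) = enn2real (pot 0 x)"
    by (subst integral_eq_nn_integral) (auto simp: kern_nonneg pot_eq_nn_integral_kern)
qed

text \<open>The cutoff is there because the potential measure of the whole half-line may be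
  infinite.\<close>

lemma integrable_pair_kern: "integrable (lborel \<Otimes>\<^sub>M lborel) (\<lambda>(x, s). kern s x * indicator {..L} x)"
proof (rule integrableI_bounded)
  show [measurable]: "(\<lambda>(x, s). kern s x * indicator {..L} x) \<in> borel_measurable (lborel \<Otimes>\<^sub>M lborel)"
    by measurable
  have "(\<integral>\<^sup>+p. ennreal (norm (case p of (x, s) \<Rightarrow> kern s x * indicator {..L} x)) \<partial>(lborel \<Otimes>\<^sub>M lborel))
      = (\<integral>\<^sup>+x. \<integral>\<^sup>+s. ennreal (kern s x * indicator {..L} x) \<partial>lborel \<partial>lborel)"
    by (subst lborel.nn_integral_fst[symmetric]) (auto simp: kern_nonneg)
  also have "\<dots> = (\<integral>\<^sup>+x. pot 0 x * indicator {..L} x \<partial>lborel)"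
    by (rule nn_integral_cong) (auto simp: indicator_def pot_eq_nn_integral_kern)
  also have "\<dots> < \<infinity>" by (rule nn_integral_pot_finite)
  finally show "(\<integral>\<^sup>+p. ennreal (norm (case p of (x, s) \<Rightarrow> kern s x * indicator {..L} x)) \<partial>(lborel \<Otimes>\<^sub>M lborel)) < \<infinity>" .
qed

lemma integral_kern: "(\<integral>x. kern s x * indicator {..t} x \<partial>lborel) = (if 0 < s then cdfm s t else 0)"
proof (cases "0 < s")
  case True
  have "(\<integral>x. kern s x * indicator {..t} x \<partial>lborel) = enn2real (\<integral>\<^sup>+x. ennreal (kern s x * indicator {..t} x) \<partial>lborel)"
    by (rule integral_eq_nn_integral) (auto simp: kern_nonneg)
  also have "(\<integral>\<^sup>+x. ennreal (kern s x * indicator {..t} x) \<partial>lborel) = ennreal (cdfm s t)"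
    unfolding cdfm_eq_nn_integral_kern[OF True] by (rule nn_integral_cong) (auto simp: indicator_def)
  finally show ?thesis using True by (simp add: cdfm_nonneg)
qed (simp add: kern_eq_0)

lemma nn_integral_cdfm_finite: "(\<integral>\<^sup>+s. indicator {0<..} s * ennreal (cdfm s t) \<partial>lborel) < \<infinity>"
proof -
  have "(\<integral>\<^sup>+s. indicator {0<..} s * ennreal (cdfm s t) \<partial>lborel)
      = (\<integral>\<^sup>+s. \<integral>\<^sup>+x. ennreal (kern s x) * indicator {..t} x \<partial>lborel \<partial>lborel)"
    by (rule nn_integral_cong) (auto simp: indicator_def cdfm_eq_nn_integral_kern kern_eq_0)
  also have "\<dots> = (\<integral>\<^sup>+x. \<integral>\<^sup>+s. ennreal (kern s x) * indicator {..t} x \<partial>lborel \<partial>lborel)"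
    by (rule lborel_pair.Fubini') measurable
  also have "\<dots> = (\<integral>\<^sup>+x. pot 0 x * indicator {..t} x \<partial>lborel)"
    by (rule nn_integral_cong) (auto simp: indicator_def pot_eq_nn_integral_kern)
  also have "\<dots> < \<infinity>" by (rule nn_integral_pot_finite)
  finally show ?thesis .
qed

end

section \<open>The time-changed semigroup\<close>

locale time_change = subordinator_process f a b m M \<sigma> + contraction_semigroup T
  for f :: "real \<Rightarrow> real" and a b m M \<sigma> and T :: "real \<Rightarrow> 'b::banach \<Rightarrow>\<^sub>L 'b"
begin

definition Q :: "real \<Rightarrow> 'b \<Rightarrow> 'b" where
  "Q t u = weighted_integral (rho t) (\<lambda>_. 1) (orbit u)"

lemma has_bochner_integral_rho: "has_bochner_integral (rho t) (\<lambda>_. 1::real) 1"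
proof -
  interpret R: prob_space "rho t" by (rule prob_space_rho)
  show ?thesis using has_bochner_integral_integrable[OF R.integrable_const[of "1::real"]] R.prob_space by simp
qed

lemma integrable_rho: "integrable (rho t) (\<lambda>_. 1::real)"
  using has_bochner_integral_rho by (auto simp: has_bochner_integral_iff)

lemma has_bochner_Q: "has_bochner (rho t) (orbit u) (Q t u)"
  using orbit.grid_sum_tendsto_has_bochner(2)[OF sets_rho integrable_rho] by (simp add: Q_def)

lemma has_bochner_time_changed:
  assumes t: "0 \<le> t"
  shows "has_bochner (inverse_law M \<sigma> t) (\<lambda>s. indicator {..<\<infinity>} s *\<^sub>R blinfun_apply (T (enn2real s)) u) (Q t u)"
proof -
  have "enn2real \<in> measurable (inverse_law M \<sigma> t) borel" by (simp add: inverse_law_def)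
  from has_bochner_distr[OF this has_bochner_Q[unfolded rho_def]]
  have "has_bochner (inverse_law M \<sigma> t) (\<lambda>s. orbit u (enn2real s)) (Q t u)" .
  moreover have "AE s in inverse_law M \<sigma> t. orbit u (enn2real s) = indicator {..<\<infinity>} s *\<^sub>R blinfun_apply (T (enn2real s)) u"
    using AE_inverse_law_finite[OF t] by eventually_elim (simp add: orbit_nonneg)
  ultimately show ?thesis by (simp only: has_bochner_cong_AE)
qed

lemma time_changed_eq: "0 \<le> t \<Longrightarrow> time_changed M \<sigma> T t u = Q t u"
  unfolding time_changed_def by (rule bochner_integral_on_eq[OF has_bochner_time_changed])

lemma Q_add: "Q t (u + v) = Q t u + Q t v"
proof (rule has_bochner_unique)
  show "has_bochner (rho t) (orbit (u + v)) (Q t (u + v))" by (rule has_bochner_Q)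
  have "has_bochner (rho t) (\<lambda>s. orbit u s + orbit v s) (Q t u + Q t v)"
    by (intro has_bochner_add has_bochner_Q)
  moreover have "(\<lambda>s. orbit u s + orbit v s) = orbit (u + v)" by (simp add: orbit_add fun_eq_iff)
  ultimately show "has_bochner (rho t) (orbit (u + v)) (Q t u + Q t v)" by (simp only:)
qed

lemma Q_scaleR: "Q t (c *\<^sub>R u) = c *\<^sub>R Q t u"
proof (rule has_bochner_unique)
  show "has_bochner (rho t) (orbit (c *\<^sub>R u)) (Q t (c *\<^sub>R u))" by (rule has_bochner_Q)
  have "has_bochner (rho t) (\<lambda>s. c *\<^sub>R orbit u s) (c *\<^sub>R Q t u)"
    by (intro has_bochner_scaleR has_bochner_Q)
  moreover have "(\<lambda>s. c *\<^sub>R orbit u s) = orbit (c *\<^sub>R u)" by (simp add: orbit_scaleR fun_eq_iff)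
  ultimately show "has_bochner (rho t) (orbit (c *\<^sub>R u)) (c *\<^sub>R Q t u)" by (simp only:)
qed

lemma norm_Q_le: "norm (Q t u) \<le> norm u"
proof -
  have "norm (Q t u) \<le> norm u * (\<integral>s. \<bar>1\<bar> \<partial>rho t)"
    unfolding Q_def by (rule orbit.norm_weighted_integral_le[OF sets_rho integrable_rho])
  also have "(\<integral>s. \<bar>1\<bar> \<partial>rho t) = (1::real)"
    using has_bochner_integral_integral_eq[OF has_bochner_integral_rho] by simp
  finally show ?thesis by simp
qed

lemma bounded_linear_Q: "bounded_linear (Q t)"
  by (rule bounded_linear_intro[where K=1]) (simp_all add: Q_add Q_scaleR norm_Q_le)

lemma T_Q:
  assumes h: "0 \<le> h" shows "blinfun_apply (T h) (Q t u) = Q t (blinfun_apply (T h) u)"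
proof (rule has_bochner_unique)
  show "has_bochner (rho t) (orbit (blinfun_apply (T h) u)) (Q t (blinfun_apply (T h) u))" by (rule has_bochner_Q)
  have "has_bochner (rho t) (\<lambda>s. blinfun_apply (T h) (orbit u s)) (blinfun_apply (T h) (Q t u))"
    by (rule has_bochner_bounded_linear[OF blinfun.bounded_linear_right has_bochner_Q])
  moreover have "(\<lambda>s. blinfun_apply (T h) (orbit u s)) = orbit (blinfun_apply (T h) u)"
    unfolding orbit_def using h by (auto simp: fun_eq_iff add.commute simp flip: T_add)
  ultimately show "has_bochner (rho t) (orbit (blinfun_apply (T h) u)) (blinfun_apply (T h) (Q t u))" by (simp only:)
qed

text \<open>T h commutes with the bounded operator Q t, so difference quotients and their limit pass
  through it.\<close>

lemma generator_Q:
  assumes u: "u \<in> generator_dom T"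
  shows "Q t u \<in> generator_dom T" "generator T (Q t u) = Q t (generator T u)"
proof -
  have "((\<lambda>h. Q t ((blinfun_apply (T h) u - u) /\<^sub>R h)) \<longlongrightarrow> Q t (generator T u)) (at_right 0)"
    by (rule bounded_linear.tendsto[OF bounded_linear_Q generator_tendsto[OF u]])
  moreover have "\<forall>\<^sub>F h in at_right 0. Q t ((blinfun_apply (T h) u - u) /\<^sub>R h) = (blinfun_apply (T h) (Q t u) - Q t u) /\<^sub>R h"
    using eventually_at_right_less[of 0]
    by eventually_elim (simp add: Q_scaleR T_Q bounded_linear.linear[OF bounded_linear_Q] linear_diff)
  ultimately have lim: "((\<lambda>h. (blinfun_apply (T h) (Q t u) - Q t u) /\<^sub>R h) \<longlongrightarrow> Q t (generator T u)) (at_right 0)"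
    by (rule Lim_transform_eventually)
  show "Q t u \<in> generator_dom T" "generator T (Q t u) = Q t (generator T u)"
    by (rule generatorI[OF lim])+
qed

lemma Q_zero: "Q 0 u = u"
proof (rule has_bochner_unique)
  have "AE s in rho 0. orbit u s = 1 *\<^sub>R u"
    using AE_rho_zero by eventually_elim (simp add: orbit_nonneg T_0)
  then show "has_bochner (rho 0) (\<lambda>s. 1 *\<^sub>R u) (Q 0 u)"
    using has_bochner_Q[of 0 u] by (simp only: has_bochner_cong_AE)
  show "has_bochner (rho 0) (\<lambda>s. 1 *\<^sub>R u) u"
    using has_bochner_scaleR_left[OF has_bochner_integral_rho, of 0 u] by (simp only: scaleR_one)
qed

text \<open>Fubini's theorem for the orbit formula: averaging the indicator of s < r over r leaves
  the tail P (L t > s). The dependence on t now sits in a scalar weight, which can be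
  differentiated.\<close>

lemma Q_eq_weighted_cdfm:
  assumes u: "u \<in> generator_dom T" and t: "0 \<le> t"
  shows "Q t u - u = weighted_integral lborel (\<lambda>s. if 0 < s then cdfm s t else 0) (orbit (generator T u))"
proof (rule has_bochner_unique)
  interpret R: prob_space "rho t" by (rule prob_space_rho)
  interpret RL: pair_sigma_finite "rho t" lborel ..
  have "has_bochner (rho t) (\<lambda>s. 1 *\<^sub>R u) (1 *\<^sub>R u)"
    by (rule has_bochner_scaleR_left[OF has_bochner_integral_rho])
  from has_bochner_diff[OF has_bochner_Q this]
  show "has_bochner (rho t) (\<lambda>r. orbit u r - u) (Q t u - u)" by (simp only: scaleR_one)
  have tail: "(\<integral>r. indicator {0<..<r} s \<partial>rho t) = (if 0 < s then cdfm s t else 0)" for s :: real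
  proof (cases "0 < s")
    case True
    have "(\<integral>r. indicator {0<..<r} s \<partial>rho t) = (\<integral>r. indicator {s<..} r \<partial>rho t)"
      by (rule Bochner_Integration.integral_cong) (use True in \<open>auto simp: indicator_def\<close>)
    also have "\<dots> = measure (rho t) {s<..}" by simp
    also have "\<dots> = cdfm s t"
      unfolding measure_def emeasure_rho_tail[OF True t] by (simp add: cdfm_nonneg)
    finally show ?thesis using True by simp
  qed simp
  have m[measurable]: "(\<lambda>(r, s). indicator {0<..<r} s :: real) \<in> borel_measurable (rho t \<Otimes>\<^sub>M lborel)"
  proof -
    have "{p \<in> space (borel \<Otimes>\<^sub>M borel). 0 < snd p \<and> snd p < (fst p::real)} \<in> sets (borel \<Otimes>\<^sub>M borel)"
      by measurable
    then have "{p. 0 < snd p \<and> snd p < (fst p::real)} \<in> sets (borel \<Otimes>\<^sub>M borel)"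
      by (simp add: space_pair_measure)
    moreover have "sets (rho t \<Otimes>\<^sub>M lborel) = sets (borel \<Otimes>\<^sub>M borel)" by (intro sets_pair_measure_cong) auto
    ultimately have "(indicator {p. 0 < snd p \<and> snd p < (fst p::real)} :: real \<times> real \<Rightarrow> real) \<in> borel_measurable (rho t \<Otimes>\<^sub>M lborel)"
      by (intro borel_measurable_indicator) simp
    moreover have "(\<lambda>(r, s). indicator {0<..<r} s :: real) = indicator {p. 0 < snd p \<and> snd p < (fst p::real)}"
      by (auto simp: fun_eq_iff indicator_def)
    ultimately show ?thesis by (simp only:)
  qed
  have k: "integrable (rho t \<Otimes>\<^sub>M lborel) (\<lambda>(r, s). indicator {0<..<r} s :: real)"
  proof (rule integrableI_nonneg[OF m])
    have "(\<integral>\<^sup>+p. ennreal ((\<lambda>(r, s). indicator {0<..<r} s) p) \<partial>(rho t \<Otimes>\<^sub>M lborel))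
      = (\<integral>\<^sup>+s. \<integral>\<^sup>+r. ennreal (indicator {0<..<r} s) \<partial>rho t \<partial>lborel)"
      by (subst RL.nn_integral_snd[symmetric]) (use m in auto)
    also have "\<dots> = (\<integral>\<^sup>+s. indicator {0<..} s * ennreal (cdfm s t) \<partial>lborel)"
    proof (rule nn_integral_cong)
      fix s :: real
      have "(\<integral>\<^sup>+r. ennreal (indicator {0<..<r} s) \<partial>rho t) = (\<integral>\<^sup>+r. indicator {0<..} s * indicator {s<..} r \<partial>rho t)"
        by (rule nn_integral_cong) (auto simp: indicator_def)
      also have "\<dots> = indicator {0<..} s * emeasure (rho t) {s<..}" by (simp add: nn_integral_cmult)
      also have "\<dots> = indicator {0<..} s * ennreal (cdfm s t)"
        using t by (auto simp: indicator_def emeasure_rho_tail)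
      finally show "(\<integral>\<^sup>+r. ennreal (indicator {0<..<r} s) \<partial>rho t) = indicator {0<..} s * ennreal (cdfm s t)" .
    qed
    also have "\<dots> < \<infinity>" by (rule nn_integral_cdfm_finite)
    finally show "(\<integral>\<^sup>+p. ennreal ((\<lambda>(r, s). indicator {0<..<r} s) p) \<partial>(rho t \<Otimes>\<^sub>M lborel)) < \<infinity>" .
  qed auto
  have "has_bochner (rho t) (\<lambda>r. Phi (generator T u) r) (weighted_integral lborel (\<lambda>s. if 0 < s then cdfm s t else 0) (orbit (generator T u)))"
    using orbit.weighted_integral_Fubini(1)[OF R.sigma_finite_measure_axioms lborel.sigma_finite_measure_axioms sets_lborel k, of "generator T u"]
    by (simp only: Phi_def tail)
  moreover have "AE r in rho t. Phi (generator T u) r = orbit u r - u"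
    using AE_rho_nonneg by eventually_elim (simp add: orbit_eq_Phi_generator[OF u])
  ultimately show "has_bochner (rho t) (\<lambda>r. orbit u r - u) (weighted_integral lborel (\<lambda>s. if 0 < s then cdfm s t else 0) (orbit (generator T u)))"
    by (simp only: has_bochner_cong_AE)
qed

text \<open>The candidate for the derivative of q at x: the weight \<open>cdfm s x\<close> of the
  preceding formula, differentiated in x under the integral sign.\<close>

definition velocity :: "'b \<Rightarrow> real \<Rightarrow> 'b" where
  "velocity u x = weighted_integral lborel (\<lambda>s. kern s x) (orbit (generator T u))"

lemma velocity_eq_0: "x \<le> 0 \<Longrightarrow> velocity u x = 0"
  unfolding velocity_def by (simp add: kern_eq_0 orbit.weighted_integral_0)

lemma weighted_integral_cutoff:
  "weighted_integral lborel (\<lambda>s. kern s x * indicator {..L} x) (orbit (generator T u)) = indicator {..L} x *\<^sub>R velocity u x"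
proof (cases "x \<le> L")
  case True
  then show ?thesis by (simp add: velocity_def)
next
  case False
  then show ?thesis by (simp add: orbit.weighted_integral_0)
qed

text \<open>\<open>cdfm s t\<close> is the integral of \<open>kern s x\<close> over x \<le> t, so
  Fubini's theorem exhibits the weighted integral as a primitive of the velocity.\<close>

lemma has_bochner_velocity_aux:
  "has_bochner lborel (\<lambda>x. indicator {..t} x *\<^sub>R velocity u x)
    (weighted_integral lborel (\<lambda>s. if 0 < s then cdfm s t else 0) (orbit (generator T u)))"
  using orbit.weighted_integral_Fubini(1)[OF lborel.sigma_finite_measure_axioms lborel.sigma_finite_measure_axioms sets_lborel
      integrable_pair_kern[of t], of "generator T u"]
  by (simp only: weighted_integral_cutoff integral_kern)

lemma has_bochner_velocity:
  assumes "u \<in> generator_dom T" "0 \<le> t"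
  shows "has_bochner lborel (\<lambda>x. indicator {..t} x *\<^sub>R velocity u x) (Q t u - u)"
  unfolding Q_eq_weighted_cdfm[OF assms] by (rule has_bochner_velocity_aux)

lemma norm_velocity_le:
  assumes "pot 0 x < \<infinity>"
  shows "norm (velocity u x) \<le> norm (generator T u) * enn2real (pot 0 x)"
  using orbit.norm_weighted_integral_le[OF sets_lborel integrable_kern(1)[OF assms], of "generator T u"]
  by (simp add: velocity_def kern_nonneg integrable_kern(2)[OF assms])

text \<open>The differentiation theorem wants a kernel integrable on the plane, so the velocity is
  cut off beyond n and its primitive is constant from n on. Between 0 and n this changes no
  derivative.\<close>

lemma AE_has_vector_derivative:
  assumes u: "u \<in> generator_dom T"
  shows "AE x in lborel. 0 < x \<longrightarrow> ((\<lambda>t. time_changed M \<sigma> T t u) has_vector_derivative velocity u x) (at x)"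
proof -
  define R where "R t = weighted_integral lborel (\<lambda>s. if 0 < s then cdfm s t else 0) (orbit (generator T u))" for t
  have "AE x in lborel. ((\<lambda>t. R (min t (real n))) has_vector_derivative
      weighted_integral lborel (\<lambda>s. kern s x * indicator {..real n} x) (orbit (generator T u))) (at x)" for n :: nat
  proof (rule orbit.has_vector_derivative_weighted_integral[OF integrable_pair_kern])
    fix t
    have "has_bochner lborel (\<lambda>x. indicator {..min t (real n)} x *\<^sub>R velocity u x) (R (min t (real n)))"
      unfolding R_def by (rule has_bochner_velocity_aux)
    moreover have "indicator {..min t (real n)} x *\<^sub>R velocity u x
        = indicator {..t} x *\<^sub>R weighted_integral lborel (\<lambda>s. kern s x * indicator {..real n} x) (orbit (generator T u))" for x
      unfolding weighted_integral_cutoff by (auto simp: indicator_def)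
    ultimately show "has_bochner lborel (\<lambda>x. indicator {..t} x *\<^sub>R weighted_integral lborel (\<lambda>s. kern s x * indicator {..real n} x) (orbit (generator T u)))
        (R (min t (real n)))" by (simp only:)
  qed
  then have "AE x in lborel. \<forall>n. ((\<lambda>t. R (min t (real n))) has_vector_derivative
      weighted_integral lborel (\<lambda>s. kern s x * indicator {..real n} x) (orbit (generator T u))) (at x)"
    unfolding AE_all_countable by (intro allI)
  then show ?thesis
  proof eventually_elim
    fix x assume A: "\<forall>n. ((\<lambda>t. R (min t (real n))) has_vector_derivative
      weighted_integral lborel (\<lambda>s. kern s x * indicator {..real n} x) (orbit (generator T u))) (at x)"
    show "0 < x \<longrightarrow> ((\<lambda>t. time_changed M \<sigma> T t u) has_vector_derivative velocity u x) (at x)"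
    proof
      assume x: "0 < x"
      obtain n :: nat where n: "x < real n" using reals_Archimedean2 by blast
      have "((\<lambda>t. R (min t (real n))) has_vector_derivative velocity u x) (at x)"
        using A[rule_format, of n] n unfolding weighted_integral_cutoff by simp
      then have "((\<lambda>t. u + R (min t (real n))) has_vector_derivative 0 + velocity u x) (at x)"
        by (intro has_vector_derivative_add has_vector_derivative_const)
      then have "((\<lambda>t. time_changed M \<sigma> T t u) has_vector_derivative 0 + velocity u x) (at x)"
      proof (rule has_vector_derivative_transform_within_open)
        show "open {0<..<real n}" "x \<in> {0<..<real n}" using x n by auto
        fix t assume "t \<in> {0<..<real n}"
        then show "u + R (min t (real n)) = time_changed M \<sigma> T t u"
          using Q_eq_weighted_cdfm[OF u, of t] by (simp add: time_changed_eq R_def min_def algebra_simps)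
      qed
      then show "((\<lambda>t. time_changed M \<sigma> T t u) has_vector_derivative velocity u x) (at x)" by simp
    qed
  qed
qed

lemma has_bochner_Q_diff:
  assumes u: "u \<in> generator_dom T" and xy: "0 \<le> x" "x \<le> y"
  shows "has_bochner lborel (\<lambda>z. indicator {x<..<y} z *\<^sub>R velocity u z) (Q y u - Q x u)"
proof -
  have "has_bochner lborel (\<lambda>z. indicator {..y} z *\<^sub>R velocity u z - indicator {..x} z *\<^sub>R velocity u z) ((Q y u - u) - (Q x u - u))"
    using xy by (intro has_bochner_diff has_bochner_velocity u) auto
  moreover have "AE z in lborel. indicator {..y} z *\<^sub>R velocity u z - indicator {..x} z *\<^sub>R velocity u z = indicator {x<..<y} z *\<^sub>R velocity u z"
    using AE_lborel_singleton[of y] by eventually_elim (use xy in \<open>auto simp: indicator_def\<close>)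
  ultimately have "has_bochner lborel (\<lambda>z. indicator {x<..<y} z *\<^sub>R velocity u z) ((Q y u - u) - (Q x u - u))"
    by (simp only: has_bochner_cong_AE)
  then show ?thesis by simp
qed

text \<open>The potential density times the norm of A u majorizes the velocity almost everywhere,
  and it is a scalar function integrable up to any finite time.\<close>

lemma norm_Q_diff_le:
  assumes u: "u \<in> generator_dom T" and xy: "0 \<le> x" "x \<le> y" "y \<le> t"
  shows "norm (Q y u - Q x u) \<le> (\<integral>z. (norm (generator T u) * (enn2real (pot 0 z) * indicator {..t} z)) * indicator {x<..<y} z \<partial>lborel)"
    (is "_ \<le> integral\<^sup>L lborel ?F")
proof -
  have i: "integrable lborel ?F"
    by (intro integrable_real_mult_indicator integrable_mult_right integrable_pot) simp
  have "ennreal (norm (Q y u - Q x u)) \<le> (\<integral>\<^sup>+z. ennreal (?F z) \<partial>lborel)"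
  proof (rule has_bochner_norm_bound[OF has_bochner_Q_diff[OF u xy(1,2)]])
    show "AE z in lborel. ennreal (norm (indicator {x<..<y} z *\<^sub>R velocity u z)) \<le> ennreal (?F z)"
      using AE_pot_finite by eventually_elim (use xy norm_velocity_le in \<open>auto simp: indicator_def intro!: ennreal_leI\<close>)
  qed measurable
  also have "\<dots> = ennreal (integral\<^sup>L lborel ?F)"
    by (rule nn_integral_eq_integral[OF i]) auto
  finally show ?thesis by (subst (asm) ennreal_le_iff) (auto intro!: integral_nonneg_AE)
qed

lemma integrable_majorant: "integrable lborel (\<lambda>z. norm (generator T u) * (enn2real (pot 0 z) * indicator {..t} z))"
  by (intro integrable_mult_right integrable_pot)

text \<open>All increments are bounded by integrals of one scalar majorant, so the claim reduces to
  absolute continuity of a scalar integral.\<close>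

lemma abs_cont_time_changed:
  assumes u: "u \<in> generator_dom T"
  shows "abs_cont_on_interval 0 t (\<lambda>t. time_changed M \<sigma> T t u)"
  unfolding abs_cont_on_interval_def
proof (intro allI impI)
  fix e :: real assume e: "0 < e"
  have "\<exists>d>0. \<forall>(n::nat) x y. (\<forall>i<n. x i \<le> y i) \<and> disjoint_family_on (\<lambda>i. {x i<..<y i}) {..<n} \<and> (\<Sum>i<n. y i - x i) < d \<longrightarrow>
    (\<Sum>i<n. \<integral>z. (norm (generator T u) * (enn2real (pot 0 z) * indicator {..t} z)) * indicator {x i<..<y i} z \<partial>lborel) < e"
    by (rule integral_uniformly_small[OF integrable_majorant _ e]) simp
  then obtain d where d: "0 < d" "\<forall>(n::nat) x y. (\<forall>i<n. x i \<le> y i) \<and> disjoint_family_on (\<lambda>i. {x i<..<y i}) {..<n} \<and> (\<Sum>i<n. y i - x i) < d \<longrightarrow>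
    (\<Sum>i<n. \<integral>z. (norm (generator T u) * (enn2real (pot 0 z) * indicator {..t} z)) * indicator {x i<..<y i} z \<partial>lborel) < e"
    by (elim exE conjE) (rule that)
  show "\<exists>d>0. \<forall>(n::nat) x y. (\<forall>i<n. 0 \<le> x i \<and> x i \<le> y i \<and> y i \<le> t) \<and> disjoint_family_on (\<lambda>i. {x i<..<y i}) {..<n} \<and>
      (\<Sum>i<n. y i - x i) < d \<longrightarrow> (\<Sum>i<n. norm (time_changed M \<sigma> T (y i) u - time_changed M \<sigma> T (x i) u)) < e"
  proof (intro exI[of _ d] conjI allI impI d(1))
    fix n :: nat and x y :: "nat \<Rightarrow> real"
    assume A: "(\<forall>i<n. 0 \<le> x i \<and> x i \<le> y i \<and> y i \<le> t) \<and> disjoint_family_on (\<lambda>i. {x i<..<y i}) {..<n} \<and> (\<Sum>i<n. y i - x i) < d"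
    have "(\<Sum>i<n. norm (time_changed M \<sigma> T (y i) u - time_changed M \<sigma> T (x i) u))
        \<le> (\<Sum>i<n. \<integral>z. (norm (generator T u) * (enn2real (pot 0 z) * indicator {..t} z)) * indicator {x i<..<y i} z \<partial>lborel)"
    proof (rule sum_mono)
      fix i assume "i \<in> {..<n}"
      then have i: "0 \<le> x i" "x i \<le> y i" "y i \<le> t" using A by auto
      show "norm (time_changed M \<sigma> T (y i) u - time_changed M \<sigma> T (x i) u)
          \<le> (\<integral>z. (norm (generator T u) * (enn2real (pot 0 z) * indicator {..t} z)) * indicator {x i<..<y i} z \<partial>lborel)"
        using norm_Q_diff_le[OF u i] i by (simp only: time_changed_eq order_trans[OF i(1,2)])
    qed
    also have "\<dots> < e" using A by (intro d(2)[rule_format]) auto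
    finally show "(\<Sum>i<n. norm (time_changed M \<sigma> T (y i) u - time_changed M \<sigma> T (x i) u)) < e" .
  qed
qed

lemma Q_dom_small:
  assumes u: "u \<in> generator_dom T" and e: "0 < e"
  shows "\<exists>d>0. \<forall>x y. 0 \<le> x \<longrightarrow> x \<le> y \<longrightarrow> y \<le> t \<longrightarrow> y - x < d \<longrightarrow> norm (Q y u - Q x u) < e"
proof -
  have "\<exists>d>0. \<forall>x y. x \<le> y \<and> y - x < d \<longrightarrow>
    (\<integral>z. (norm (generator T u) * (enn2real (pot 0 z) * indicator {..t} z)) * indicator {x<..<y} z \<partial>lborel) < e"
    by (rule integral_interval_small[OF integrable_majorant _ e]) simp
  then obtain d where d: "0 < d" "\<And>x y. x \<le> y \<and> y - x < d \<Longrightarrow>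
    (\<integral>z. (norm (generator T u) * (enn2real (pot 0 z) * indicator {..t} z)) * indicator {x<..<y} z \<partial>lborel) < e"
    by auto
  show ?thesis
  proof (intro exI[of _ d] conjI allI impI d(1))
    fix x y assume "0 \<le> x" "x \<le> y" "y \<le> t" "y - x < d"
    then show "norm (Q y u - Q x u) < e"
      by (intro le_less_trans[OF norm_Q_diff_le[OF u] d(2)]) auto
  qed
qed

text \<open>An e / 3 argument: the domain of the generator is dense, and the operators Q t are
  contractions.\<close>

lemma Q_small:
  assumes e: "0 < e"
  shows "\<exists>d>0. \<forall>x y. 0 \<le> x \<longrightarrow> x \<le> y \<longrightarrow> y \<le> t \<longrightarrow> y - x < d \<longrightarrow> norm (Q y u - Q x u) < e"
proof -
  have e3: "0 < e / 3" using e by simp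
  obtain w where w: "w \<in> generator_dom T" "norm (u - w) \<le> e / 3" by (rule generator_dom_dense[OF e3])
  obtain d where d: "0 < d" "\<And>x y. 0 \<le> x \<Longrightarrow> x \<le> y \<Longrightarrow> y \<le> t \<Longrightarrow> y - x < d \<Longrightarrow> norm (Q y w - Q x w) < e / 3"
    using Q_dom_small[OF w(1) e3, of t] by auto
  have close: "norm (Q x u - Q x w) \<le> e / 3" for x
    using norm_Q_le[of x "u - w"] w(2) linear_diff[OF bounded_linear.linear[OF bounded_linear_Q[of x]], of u w] by simp
  show ?thesis
  proof (intro exI[of _ d] conjI allI impI d(1))
    fix x y assume "0 \<le> x" "x \<le> y" "y \<le> t" "y - x < d"
    then have "norm (Q y w - Q x w) < e / 3" by (rule d(2))
    moreover have "Q y u - Q x u = (Q y u - Q y w) + (Q y w - Q x w) - (Q x u - Q x w)" by simp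
    from arg_cong[OF this, of norm] have "norm (Q y u - Q x u) \<le> norm (Q y u - Q y w) + norm (Q y w - Q x w) + norm (Q x u - Q x w)"
      using norm_triangle_ineq4[of "(Q y u - Q y w) + (Q y w - Q x w)" "Q x u - Q x w"]
        norm_triangle_ineq[of "Q y u - Q y w" "Q y w - Q x w"] by linarith
    ultimately show "norm (Q y u - Q x u) < e" using close[of x] close[of y] by simp
  qed
qed

lemma continuous_on_Q: "continuous_on {0..} (\<lambda>t. Q t u)"
  unfolding continuous_on_iff
proof (intro ballI allI impI)
  fix t e :: real assume t: "t \<in> {0..}" and e: "0 < e"
  obtain d where d: "0 < d" "\<And>x y. 0 \<le> x \<Longrightarrow> x \<le> y \<Longrightarrow> y \<le> t + 1 \<Longrightarrow> y - x < d \<Longrightarrow> norm (Q y u - Q x u) < e"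
    using Q_small[OF e, of "t + 1" u] by auto
  show "\<exists>d>0. \<forall>s\<in>{0..}. dist s t < d \<longrightarrow> dist (Q s u) (Q t u) < e"
  proof (intro exI[of _ "min d 1"] conjI ballI impI)
    fix s assume s: "s \<in> {0..}" "dist s t < min d 1"
    show "dist (Q s u) (Q t u) < e"
    proof (cases "s \<le> t")
      case True
      then show ?thesis using d(2)[of s t] s t by (simp add: dist_norm norm_minus_commute)
    next
      case False
      then show ?thesis using d(2)[of t s] s t by (simp add: dist_norm)
    qed
  qed (use d in auto)
qed

end

section \<open>The tail function as a convolution kernel\<close>

lemma lborel_reflect: "distr lborel borel (\<lambda>s. t - s) = (lborel :: real measure)"
proof -
  have "distr lborel borel (\<lambda>s. t - s) = distr (distr lborel borel uminus) borel (\<lambda>s. t + s)"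
    by (subst distr_distr) (auto simp: comp_def)
  then show ?thesis by (simp add: lborel_distr_uminus lborel_distr_plus)
qed

context subordinator_process
begin

definition nur :: "real \<Rightarrow> real" where "nur y = (if 0 < y then levy_tail a m y else 0)"

lemma nu_eq_nur: "nu y = ennreal (nur y)" and nur_nonneg: "0 \<le> nur y"
  by (auto simp: nur_def nu_def levy_tail_nonneg)

lemma nur_measurable[measurable]: "nur \<in> borel_measurable borel"
proof -
  have "(\<lambda>y. enn2real (nu y)) \<in> borel_measurable borel" by measurable
  then show ?thesis by (simp add: nu_eq_nur nur_nonneg)
qed

lemma integrable_nur: "integrable lborel (\<lambda>y. nur y * indicator {..t} y)"
proof (rule integrableI_nonneg)
  have "(\<integral>\<^sup>+y. ennreal (nur y * indicator {..t} y) \<partial>lborel) \<le> (\<integral>\<^sup>+y. ennreal (exp t) * (ennreal (exp (- (1 * y))) * nu y) \<partial>lborel)"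
  proof (rule nn_integral_mono)
    fix y :: real
    show "ennreal (nur y * indicator {..t} y) \<le> ennreal (exp t) * (ennreal (exp (- (1 * y))) * nu y)"
    proof (cases "y \<le> t")
      case True
      have "1 * nur y \<le> (exp t * exp (- y)) * nur y"
        using True by (intro mult_right_mono nur_nonneg) (auto simp flip: exp_add)
      then show ?thesis
        using True nur_nonneg[of y] by (simp add: nu_eq_nur mult.assoc flip: ennreal_mult)
    qed simp
  qed
  also have "\<dots> = ennreal (exp t) * (\<integral>\<^sup>+y. ennreal (exp (- (1 * y))) * nu y \<partial>lborel)"
    by (rule nn_integral_cmult) measurable
  also have "\<dots> < \<infinity>"
  proof -
    have "(\<integral>\<^sup>+y. ennreal (exp (- (1 * y))) * nu y \<partial>lborel)
        \<le> ennreal b + (\<integral>\<^sup>+y. ennreal (exp (- (1 * y))) * nu y \<partial>lborel)" by simp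
    also have "\<dots> = ennreal (f 1 / 1)" by (rule Laplace_nu) simp
    finally have "(\<integral>\<^sup>+y. ennreal (exp (- (1 * y))) * nu y \<partial>lborel) < \<infinity>"
      by (rule le_less_trans) simp
    then show ?thesis by (simp add: ennreal_mult_less_top)
  qed
  finally show "(\<integral>\<^sup>+y. ennreal (nur y * indicator {..t} y) \<partial>lborel) < \<infinity>" .
qed (auto simp: nur_nonneg)

text \<open>Both terms of the renewal equation at S = 0 are nonnegative, and their sum is at most
  1.\<close>

lemma pot_le:
  assumes b: "0 < b" shows "AE x in lborel. pot 0 x \<le> ennreal (1 / b)"
  using renewal_equation[OF order_refl]
proof eventually_elim
  fix t assume eq: "ennreal b * pot 0 t + conv nu (pot 0) t = indicator {0<..} t * ennreal (cdfm 0 t)"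
  have "ennreal b * pot 0 t \<le> ennreal b * pot 0 t + conv nu (pot 0) t" by simp
  also have "\<dots> \<le> 1"
    unfolding eq using cdfm_le_1[of 0 t] by (auto simp: indicator_def ennreal_le_1)
  finally have le: "ennreal b * pot 0 t \<le> 1" .
  have "pot 0 t = (ennreal (1 / b) * ennreal b) * pot 0 t"
    using b by (simp flip: ennreal_mult)
  also have "\<dots> = ennreal (1 / b) * (ennreal b * pot 0 t)" by (simp only: mult.assoc)
  also have "\<dots> \<le> ennreal (1 / b) * 1" by (rule mult_left_mono[OF le]) simp
  finally show "pot 0 t \<le> ennreal (1 / b)" by simp
qed

lemma nn_integral_tker_UNIV: "(\<integral>\<^sup>+s. tker s t \<partial>lborel) = conv nu (pot 0) t"
proof -
  have "tker s t = indicator {0<..} s * tker s t" for s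
    by (cases "0 < s") (auto simp: tker_def conv_def kern_eq_0)
  then show ?thesis using nn_integral_tker[of 0 t] by simp
qed

text \<open>This is wanted at every t > 0, not just almost every. Without drift the value is the
  total mass of the law of L t; with drift \<open>pot 0\<close> is at most 1 / b almost everywhere
  and \<nu> is integrable near 0.\<close>

lemma conv_pot_finite:
  assumes t: "0 < t" shows "conv nu (pot 0) t < \<infinity>"
proof (cases "b = 0")
  case True
  interpret R: prob_space "rho t" by (rule prob_space_rho)
  have "emeasure (rho t) UNIV = (\<integral>\<^sup>+s. tker s t \<partial>lborel)"
    unfolding rho_density_driftless[OF True t] by (subst emeasure_density) auto
  then show ?thesis using R.emeasure_space_1 by (simp add: nn_integral_tker_UNIV)
next
  case False
  then have b: "0 < b" using b_nonneg by simp
  have "conv nu (pot 0) t \<le> (\<integral>\<^sup>+x. ennreal (1 / b) * nu (t - x) * indicator {..t} (t - x) \<partial>lborel)"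
    unfolding conv_def
  proof (rule nn_integral_mono_AE)
    show "AE x in lborel. nu (t - x) * pot 0 x \<le> ennreal (1 / b) * nu (t - x) * indicator {..t} (t - x)"
      using pot_le[OF b]
    proof eventually_elim
      fix x assume "pot 0 x \<le> ennreal (1 / b)"
      then have "nu (t - x) * pot 0 x \<le> nu (t - x) * ennreal (1 / b)" by (rule mult_left_mono) simp
      then show "nu (t - x) * pot 0 x \<le> ennreal (1 / b) * nu (t - x) * indicator {..t} (t - x)"
        by (cases "x \<le> 0") (auto simp: pot_eq_0 mult.commute)
    qed
  qed
  also have "\<dots> = (\<integral>\<^sup>+y. ennreal (1 / b) * nu y * indicator {..t} y \<partial>distr lborel borel (\<lambda>x. t - x))"
    by (subst nn_integral_distr) auto
  also have "\<dots> = (\<integral>\<^sup>+y. ennreal (1 / b) * ennreal (nur y * indicator {..t} y) \<partial>lborel)"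
    unfolding lborel_reflect by (rule nn_integral_cong) (auto simp: nu_eq_nur indicator_def)
  also have "\<dots> = ennreal (1 / b) * (\<integral>\<^sup>+y. ennreal (nur y * indicator {..t} y) \<partial>lborel)"
    by (rule nn_integral_cmult) measurable
  also have "(\<integral>\<^sup>+y. ennreal (nur y * indicator {..t} y) \<partial>lborel) = ennreal (\<integral>y. nur y * indicator {..t} y \<partial>lborel)"
    by (rule nn_integral_eq_integral[OF integrable_nur]) (auto simp: nur_nonneg)
  also have "ennreal (1 / b) * \<dots> < \<infinity>" by (simp add: ennreal_mult_less_top)
  finally show ?thesis .
qed

text \<open>As \<nu> decreases, the absolute value opens with a known sign for x < t0, and the
  integrals of \<nu> up to t0 and up to t combine to something nonpositive. What remains is the mass
  of \<nu> on (0, t - t0), counted twice.\<close>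

lemma integral_nur_increment:
  assumes t: "0 \<le> t0" "t0 \<le> t"
  shows "(\<integral>\<^sup>+x. ennreal \<bar>nur (t - x) - nur (t0 - x)\<bar> * indicator {0<..} x \<partial>lborel)
    \<le> ennreal (2 * (\<integral>y. nur y * indicator {..t - t0} y \<partial>lborel))"
proof -
  have refl: "integrable lborel (\<lambda>x. nur (t - x) * indicator {..c} (t - x))"
    "(\<integral>x. nur (t - x) * indicator {..c} (t - x) \<partial>lborel) = (\<integral>y. nur y * indicator {..c} y \<partial>lborel)" for t c
  proof -
    have "integrable (distr lborel borel (\<lambda>x. t - x)) (\<lambda>y. nur y * indicator {..c} y)"
      unfolding lborel_reflect by (rule integrable_nur)
    then show "integrable lborel (\<lambda>x. nur (t - x) * indicator {..c} (t - x))"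
      by (subst (asm) integrable_distr_eq) auto
    have "(\<integral>y. nur y * indicator {..c} y \<partial>distr lborel borel (\<lambda>x. t - x)) = (\<integral>x. nur (t - x) * indicator {..c} (t - x) \<partial>lborel)"
      by (rule integral_distr) measurable
    then show "(\<integral>x. nur (t - x) * indicator {..c} (t - x) \<partial>lborel) = (\<integral>y. nur y * indicator {..c} y \<partial>lborel)"
      unfolding lborel_reflect by simp
  qed
  \<comment> \<open>For 0 < x < t0 the first two terms form the nonnegative difference. For x \<ge>
    t0 they leave \<open>nur (t - x)\<close> with a minus sign, which the last term turns into a
    plus sign.\<close>
  define F where "F x = nur (t0 - x) * indicator {..t0} (t0 - x) - nur (t - x) * indicator {..t} (t - x)
      + 2 * (nur (t - x) * indicator {..t - t0} (t - x))" for x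
  have Fi: "integrable lborel F"
    unfolding F_def by (intro Bochner_Integration.integrable_add Bochner_Integration.integrable_diff integrable_mult_right refl)
  have le: "\<bar>nur (t - x) - nur (t0 - x)\<bar> * indicator {0<..} x \<le> F x" if "x \<noteq> 0" for x
  proof -
    have anti: "nur (t - x) \<le> nur (t0 - x)" if "x < t0"
      using levy_tail_antimono[of "t0 - x" "t - x"] that t by (simp add: nur_def)
    have zero: "nur (t0 - x) = 0" if "t0 \<le> x" using that by (simp add: nur_def)
    consider "x < 0" | "0 < x" "x < t0" | "0 < x" "t0 \<le> x" using \<open>x \<noteq> 0\<close> by linarith
    then show ?thesis
    proof cases
      case 1
      then show ?thesis using t by (simp add: F_def)
    next
      case 2
      then show ?thesis using anti nur_nonneg[of "t - x"] by (simp add: F_def)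
    next
      case 3
      then show ?thesis using zero nur_nonneg[of "t - x"] by (simp add: F_def)
    qed
  qed
  have "(\<integral>\<^sup>+x. ennreal \<bar>nur (t - x) - nur (t0 - x)\<bar> * indicator {0<..} x \<partial>lborel) \<le> (\<integral>\<^sup>+x. ennreal (F x) \<partial>lborel)"
  proof (rule nn_integral_mono_AE)
    show "AE x in lborel. ennreal \<bar>nur (t - x) - nur (t0 - x)\<bar> * indicator {0<..} x \<le> ennreal (F x)"
      using AE_lborel_singleton[of 0]
    proof eventually_elim
      fix x :: real assume "x \<noteq> 0"
      from ennreal_leI[OF le[OF this]]
      show "ennreal \<bar>nur (t - x) - nur (t0 - x)\<bar> * indicator {0<..} x \<le> ennreal (F x)"
        by (auto simp: indicator_def)
    qed
  qed
  also have "\<dots> = ennreal (\<integral>x. F x \<partial>lborel)"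
  proof (rule nn_integral_eq_integral[OF Fi])
    show "AE x in lborel. 0 \<le> F x"
      using AE_lborel_singleton[of 0]
    proof eventually_elim
      fix x :: real assume "x \<noteq> 0"
      from le[OF this] show "0 \<le> F x" by (rule order_trans[rotated]) simp
    qed
  qed
  also have "(\<integral>x. F x \<partial>lborel) = (\<integral>y. nur y * indicator {..t0} y \<partial>lborel) - (\<integral>y. nur y * indicator {..t} y \<partial>lborel)
      + 2 * (\<integral>y. nur y * indicator {..t - t0} y \<partial>lborel)"
  proof -
    have "(\<integral>x. F x \<partial>lborel) = (\<integral>x. nur (t0 - x) * indicator {..t0} (t0 - x) - nur (t - x) * indicator {..t} (t - x) \<partial>lborel)
      + (\<integral>x. 2 * (nur (t - x) * indicator {..t - t0} (t - x)) \<partial>lborel)"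
      unfolding F_def by (intro Bochner_Integration.integral_add Bochner_Integration.integrable_diff integrable_mult_right refl)
    also have "(\<integral>x. nur (t0 - x) * indicator {..t0} (t0 - x) - nur (t - x) * indicator {..t} (t - x) \<partial>lborel)
      = (\<integral>x. nur (t0 - x) * indicator {..t0} (t0 - x) \<partial>lborel) - (\<integral>x. nur (t - x) * indicator {..t} (t - x) \<partial>lborel)"
      by (intro Bochner_Integration.integral_diff refl)
    finally show ?thesis by (simp only: refl integral_mult_right_zero)
  qed
  also have "ennreal \<dots> \<le> ennreal (2 * (\<integral>y. nur y * indicator {..t - t0} y \<partial>lborel))"
  proof (rule ennreal_leI)
    have "(\<integral>y. nur y * indicator {..t0} y \<partial>lborel) \<le> (\<integral>y. nur y * indicator {..t} y \<partial>lborel)"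
      using t by (intro integral_mono integrable_nur) (auto simp: indicator_def nur_nonneg)
    then show "(\<integral>y. nur y * indicator {..t0} y \<partial>lborel) - (\<integral>y. nur y * indicator {..t} y \<partial>lborel)
      + 2 * (\<integral>y. nur y * indicator {..t - t0} y \<partial>lborel) \<le> 2 * (\<integral>y. nur y * indicator {..t - t0} y \<partial>lborel)" by simp
  qed
  finally show ?thesis .
qed

end

section \<open>The memory term and the evolution equation\<close>

context time_change
begin

text \<open>The convolution of \<nu> with the velocity at t, with the integration over x carried out
  first.\<close>

definition memory :: "'b \<Rightarrow> real \<Rightarrow> 'b" where
  "memory u t = weighted_integral lborel (\<lambda>s. enn2real (tker s t)) (orbit (generator T u))"

lemma integrable_tker: "0 < t \<Longrightarrow> integrable lborel (\<lambda>s. enn2real (tker s t))"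
proof (rule integrableI_nonneg)
  assume t: "0 < t"
  have "(\<integral>\<^sup>+s. ennreal (enn2real (tker s t)) \<partial>lborel) \<le> (\<integral>\<^sup>+s. tker s t \<partial>lborel)"
    by (intro nn_integral_mono) (auto simp: ennreal_enn2real_if)
  also have "\<dots> < \<infinity>" using conv_pot_finite[OF t] by (simp add: nn_integral_tker_UNIV)
  finally show "(\<integral>\<^sup>+s. ennreal (enn2real (tker s t)) \<partial>lborel) < \<infinity>" .
qed auto

text \<open>Fubini's theorem with the kernel \<open>nur (t - x) * kern s x\<close>, which is
  integrable on the plane because \<open>conv nu (pot 0) t\<close> is finite.\<close>

lemma has_bochner_memory_pre:
  assumes t: "0 < t"
  shows "has_bochner lborel (\<lambda>x. nur (t - x) *\<^sub>R velocity u x) (memory u t)"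
proof -
  have k: "integrable (lborel \<Otimes>\<^sub>M lborel) (\<lambda>(x, s). nur (t - x) * kern s x)"
  proof (rule integrableI_nonneg)
    show [measurable]: "(\<lambda>(x, s). nur (t - x) * kern s x) \<in> borel_measurable (lborel \<Otimes>\<^sub>M lborel)" by measurable
    have "(\<integral>\<^sup>+p. ennreal ((\<lambda>(x, s). nur (t - x) * kern s x) p) \<partial>(lborel \<Otimes>\<^sub>M lborel))
        = (\<integral>\<^sup>+x. \<integral>\<^sup>+s. ennreal (nur (t - x) * kern s x) \<partial>lborel \<partial>lborel)"
      by (subst lborel.nn_integral_fst[symmetric]) auto
    also have "\<dots> = (\<integral>\<^sup>+x. nu (t - x) * pot 0 x \<partial>lborel)"
    proof (rule nn_integral_cong)
      fix x :: real
      have "(\<integral>\<^sup>+s. ennreal (nur (t - x) * kern s x) \<partial>lborel) = (\<integral>\<^sup>+s. nu (t - x) * ennreal (kern s x) \<partial>lborel)"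
        by (rule nn_integral_cong) (simp add: nu_eq_nur ennreal_mult nur_nonneg kern_nonneg)
      also have "\<dots> = nu (t - x) * (\<integral>\<^sup>+s. ennreal (kern s x) \<partial>lborel)" by (rule nn_integral_cmult) measurable
      finally show "(\<integral>\<^sup>+s. ennreal (nur (t - x) * kern s x) \<partial>lborel) = nu (t - x) * pot 0 x"
        by (simp only: pot_eq_nn_integral_kern)
    qed
    also have "\<dots> < \<infinity>" using conv_pot_finite[OF t] by (simp only: conv_def)
    finally show "(\<integral>\<^sup>+p. ennreal ((\<lambda>(x, s). nur (t - x) * kern s x) p) \<partial>(lborel \<Otimes>\<^sub>M lborel)) < \<infinity>" .
  qed (auto simp: nur_nonneg kern_nonneg)
  have inner: "(\<integral>x. nur (t - x) * kern s x \<partial>lborel) = enn2real (tker s t)" for s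
    by (subst integral_eq_nn_integral)
      (auto simp: nur_nonneg kern_nonneg tker_def conv_def nu_eq_nur ennreal_mult)
  have "has_bochner lborel (\<lambda>x. weighted_integral lborel (\<lambda>s. nur (t - x) * kern s x) (orbit (generator T u))) (memory u t)"
    using orbit.weighted_integral_Fubini(1)[OF lborel.sigma_finite_measure_axioms lborel.sigma_finite_measure_axioms sets_lborel k, of "generator T u"]
    by (simp only: memory_def inner)
  moreover have "AE x in lborel. weighted_integral lborel (\<lambda>s. nur (t - x) * kern s x) (orbit (generator T u)) = nur (t - x) *\<^sub>R velocity u x"
    using AE_pot_finite
    by eventually_elim (simp only: velocity_def orbit.weighted_integral_cmult[OF sets_lborel integrable_kern(1)])
  ultimately show ?thesis by (simp only: has_bochner_cong_AE)
qed

text \<open>The reflection of s into t - s turns the convolution into the integral of the Caputo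
  type operator. Outside 0 < s < t the convolution integrand is already 0: \<open>nur\<close>
  vanishes for s \<le> 0 and the velocity for s \<ge> t.\<close>

lemma has_bochner_memory:
  assumes u: "u \<in> generator_dom T" and t: "0 < t"
  shows "has_bochner lborel (\<lambda>s. indicator {0<..<t} s *\<^sub>R (levy_tail a m s *\<^sub>R vector_derivative (\<lambda>t. time_changed M \<sigma> T t u) (at (t - s)))) (memory u t)"
proof -
  have "has_bochner (distr lborel borel (\<lambda>s. t - s)) (\<lambda>x. nur (t - x) *\<^sub>R velocity u x) (memory u t)"
    unfolding lborel_reflect by (rule has_bochner_memory_pre[OF t])
  then have "has_bochner lborel (\<lambda>s. nur (t - (t - s)) *\<^sub>R velocity u (t - s)) (memory u t)"
    by (rule has_bochner_distr[rotated]) simp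
  moreover have "AE x in distr lborel borel (\<lambda>s. t - s). 0 < x \<longrightarrow> ((\<lambda>t. time_changed M \<sigma> T t u) has_vector_derivative velocity u x) (at x)"
    unfolding lborel_reflect by (rule AE_has_vector_derivative[OF u])
  then have "AE s in lborel. 0 < t - s \<longrightarrow> ((\<lambda>t. time_changed M \<sigma> T t u) has_vector_derivative velocity u (t - s)) (at (t - s))"
    by (rule AE_distrD[rotated]) simp
  then have "AE s in lborel. nur (t - (t - s)) *\<^sub>R velocity u (t - s)
      = indicator {0<..<t} s *\<^sub>R (levy_tail a m s *\<^sub>R vector_derivative (\<lambda>t. time_changed M \<sigma> T t u) (at (t - s)))"
  proof eventually_elim
    fix s assume d: "0 < t - s \<longrightarrow> ((\<lambda>t. time_changed M \<sigma> T t u) has_vector_derivative velocity u (t - s)) (at (t - s))"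
    show "nur (t - (t - s)) *\<^sub>R velocity u (t - s)
      = indicator {0<..<t} s *\<^sub>R (levy_tail a m s *\<^sub>R vector_derivative (\<lambda>t. time_changed M \<sigma> T t u) (at (t - s)))"
    proof (cases "0 < t - s")
      case True
      then have "vector_derivative (\<lambda>t. time_changed M \<sigma> T t u) (at (t - s)) = velocity u (t - s)"
        using d by (intro vector_derivative_at) simp
      then show ?thesis using True by (simp add: nur_def)
    next
      case False
      then show ?thesis by (simp add: velocity_eq_0)
    qed
  qed
  ultimately show ?thesis by (simp only: has_bochner_cong_AE)
qed

text \<open>Without drift L t has the density \<open>tker\<close> at every t > 0, so integrating the
  orbit of A u against its law is the memory term itself.\<close>

lemma Q_generator_driftless:
  assumes b: "b = 0" and t: "0 < t"
  shows "Q t (generator T u) = memory u t"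
proof -
  have "AE s in lborel. tker s t \<noteq> \<infinity>"
    by (rule nn_integral_PInf_AE) (use conv_pot_finite[OF t] nn_integral_tker_UNIV[of t] in auto)
  then have "AE s in lborel. tker s t = ennreal (enn2real (tker s t))"
    by eventually_elim (rule ennreal_eq_top_cases)
  then have "rho t = density lborel (\<lambda>s. ennreal (enn2real (tker s t)))"
    unfolding rho_density_driftless[OF b t] by (intro density_cong) auto
  then show ?thesis
    unfolding Q_def memory_def
    by (simp only: orbit.weighted_integral_density[OF sets_lborel integrable_tker[OF t] enn2real_nonneg])
qed

text \<open>The density of L t splits into a drift part, which integrates to b times the velocity,
  and the memory part. Both this density and the finiteness of \<open>pot 0 t\<close> are available
  for almost every t.\<close>

lemma AE_Q_generator:
  "AE t in lborel. 0 < t \<longrightarrow> Q t (generator T u) = b *\<^sub>R velocity u t + memory u t"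
  using AE_rho_density AE_pot_finite
proof eventually_elim
  fix t assume r: "0 < t \<longrightarrow> rho t = density lborel (\<lambda>s. ennreal b * ennreal (kern s t) + tker s t)" and p: "pot 0 t < \<infinity>"
  show "0 < t \<longrightarrow> Q t (generator T u) = b *\<^sub>R velocity u t + memory u t"
  proof
    assume t: "0 < t"
    have "AE s in lborel. tker s t \<noteq> \<infinity>"
      by (rule nn_integral_PInf_AE) (use conv_pot_finite[OF t] nn_integral_tker_UNIV[of t] in auto)
    then have "AE s in lborel. ennreal b * ennreal (kern s t) + tker s t = ennreal (b * kern s t + enn2real (tker s t))"
    proof eventually_elim
      fix s assume "tker s t \<noteq> \<infinity>"
      from ennreal_eq_top_cases[OF this]
      have "tker s t = ennreal (enn2real (tker s t))" .
      then show "ennreal b * ennreal (kern s t) + tker s t = ennreal (b * kern s t + enn2real (tker s t))"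
        by (simp add: ennreal_mult ennreal_plus b_nonneg kern_nonneg)
    qed
    then have rho: "rho t = density lborel (\<lambda>s. ennreal (b * kern s t + enn2real (tker s t)))"
      using r t by (simp only: simp_thms) (intro density_cong, auto)
    have i: "integrable lborel (\<lambda>s. b * kern s t)" by (intro integrable_mult_right integrable_kern p)
    have "Q t (generator T u) = weighted_integral lborel (\<lambda>s. b * kern s t + enn2real (tker s t)) (orbit (generator T u))"
      unfolding Q_def rho
      by (intro orbit.weighted_integral_density Bochner_Integration.integrable_add i integrable_tker t)
        (simp_all add: b_nonneg kern_nonneg)
    also have "\<dots> = weighted_integral lborel (\<lambda>s. b * kern s t) (orbit (generator T u)) + memory u t"
      unfolding memory_def by (rule orbit.weighted_integral_add[OF sets_lborel i integrable_tker[OF t]])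
    also have "weighted_integral lborel (\<lambda>s. b * kern s t) (orbit (generator T u)) = b *\<^sub>R velocity u t"
      unfolding velocity_def by (rule orbit.weighted_integral_cmult[OF sets_lborel integrable_kern(1)[OF p]])
    finally show "Q t (generator T u) = b *\<^sub>R velocity u t + memory u t" .
  qed
qed

text \<open>With drift the velocity is bounded almost everywhere by the norm of A u divided by b, so
  the increment of the convolution is controlled by the L1 increment of \<nu>.\<close>

lemma norm_memory_diff_le:
  assumes b: "0 < b" and t: "0 < t0" "t0 \<le> t"
  shows "norm (memory u t - memory u t0) \<le> norm (generator T u) / b * (2 * (\<integral>y. nur y * indicator {..t - t0} y \<partial>lborel))"
proof -
  define c where "c = norm (generator T u) / b"
  have c: "0 \<le> c" using b by (simp add: c_def)
  have "ennreal (norm (memory u t - memory u t0)) \<le> (\<integral>\<^sup>+x. ennreal c * (ennreal \<bar>nur (t - x) - nur (t0 - x)\<bar> * indicator {0<..} x) \<partial>lborel)"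
  proof (rule has_bochner_dist_bound[OF has_bochner_memory_pre has_bochner_memory_pre])
    show "AE x in lborel. ennreal (norm (nur (t - x) *\<^sub>R velocity u x - nur (t0 - x) *\<^sub>R velocity u x))
        \<le> ennreal c * (ennreal \<bar>nur (t - x) - nur (t0 - x)\<bar> * indicator {0<..} x)"
      using pot_le[OF b]
    proof eventually_elim
      fix x assume p: "pot 0 x \<le> ennreal (1 / b)"
      show "ennreal (norm (nur (t - x) *\<^sub>R velocity u x - nur (t0 - x) *\<^sub>R velocity u x))
        \<le> ennreal c * (ennreal \<bar>nur (t - x) - nur (t0 - x)\<bar> * indicator {0<..} x)"
      proof (cases "0 < x")
        case True
        have "pot 0 x < \<infinity>" using p by (rule le_less_trans) simp
        then have "norm (velocity u x) \<le> norm (generator T u) * enn2real (pot 0 x)" by (rule norm_velocity_le)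
        also have "\<dots> \<le> norm (generator T u) * (1 / b)"
          using enn2real_mono[OF p] b by (intro mult_left_mono) auto
        finally have v: "norm (velocity u x) \<le> c" by (simp add: c_def)
        have "norm (nur (t - x) *\<^sub>R velocity u x - nur (t0 - x) *\<^sub>R velocity u x) = \<bar>nur (t - x) - nur (t0 - x)\<bar> * norm (velocity u x)"
          by (simp flip: scaleR_left_diff_distrib)
        also have "\<dots> \<le> \<bar>nur (t - x) - nur (t0 - x)\<bar> * c" by (rule mult_left_mono[OF v]) simp
        finally show ?thesis using True c by (simp add: mult.commute ennreal_leI flip: ennreal_mult)
      qed (simp add: velocity_eq_0)
    qed
  qed (use t in auto)
  also have "\<dots> = ennreal c * (\<integral>\<^sup>+x. ennreal \<bar>nur (t - x) - nur (t0 - x)\<bar> * indicator {0<..} x \<partial>lborel)"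
    by (rule nn_integral_cmult) measurable
  also have "\<dots> \<le> ennreal c * ennreal (2 * (\<integral>y. nur y * indicator {..t - t0} y \<partial>lborel))"
    using t by (intro mult_left_mono integral_nur_increment) auto
  also have "\<dots> = ennreal (c * (2 * (\<integral>y. nur y * indicator {..t - t0} y \<partial>lborel)))"
    using c by (intro ennreal_mult[symmetric] mult_nonneg_nonneg integral_nonneg_AE) (auto simp: nur_nonneg)
  finally show ?thesis
    unfolding c_def[symmetric] using c by (subst (asm) ennreal_le_iff) (auto simp: nur_nonneg intro!: mult_nonneg_nonneg integral_nonneg_AE)
qed

lemma continuous_on_memory:
  assumes b: "0 < b" shows "continuous_on {0<..} (memory u)"
  unfolding continuous_on_iff
proof (intro ballI allI impI)
  fix t e :: real assume t: "t \<in> {0<..}" and e: "0 < e"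
  define c where "c = norm (generator T u) / b"
  have c: "0 \<le> c" using b by (simp add: c_def)
  \<comment> \<open>The 2 matches the factor in the bound for increments of the memory term; the
    summand 1 covers c = 0.\<close>
  have e': "0 < e / (2 * (c + 1))" using e c by simp
  have "\<exists>d>0. \<forall>x y. x \<le> y \<and> y - x < d \<longrightarrow> (\<integral>z. (nur z * indicator {..1} z) * indicator {x<..<y} z \<partial>lborel) < e / (2 * (c + 1))"
    by (rule integral_interval_small[OF integrable_nur _ e']) (simp add: nur_nonneg)
  then obtain d where d: "0 < d" "\<And>x y. x \<le> y \<and> y - x < d \<Longrightarrow> (\<integral>z. (nur z * indicator {..1} z) * indicator {x<..<y} z \<partial>lborel) < e / (2 * (c + 1))"
    by auto
  have *: "norm (memory u q - memory u p) < e" if "0 < p" "p \<le> q" "q - p < d" "q - p < 1" for p q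
  proof -
    have "(\<integral>y. nur y * indicator {..q - p} y \<partial>lborel) = (\<integral>z. (nur z * indicator {..1} z) * indicator {0<..<q - p} z \<partial>lborel)"
    proof (rule integral_cong_AE)
      show "AE z in lborel. nur z * indicator {..q - p} z = (nur z * indicator {..1} z) * indicator {0<..<q - p} z"
        using AE_lborel_singleton[of "q - p"] by eventually_elim (use that in \<open>auto simp: indicator_def nur_def\<close>)
    qed measurable
    also have "\<dots> < e / (2 * (c + 1))" using that by (intro d(2)) auto
    finally have N: "(\<integral>y. nur y * indicator {..q - p} y \<partial>lborel) < e / (2 * (c + 1))" .
    have N0: "0 \<le> (\<integral>y. nur y * indicator {..q - p} y \<partial>lborel)" by (intro integral_nonneg_AE) (simp add: nur_nonneg)
    have "norm (memory u q - memory u p) \<le> c * (2 * (\<integral>y. nur y * indicator {..q - p} y \<partial>lborel))"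
      unfolding c_def by (rule norm_memory_diff_le[OF b that(1,2)])
    also have "\<dots> \<le> (c + 1) * (2 * (\<integral>y. nur y * indicator {..q - p} y \<partial>lborel))"
      using N0 by (intro mult_right_mono) auto
    also have "\<dots> < (c + 1) * (2 * (e / (2 * (c + 1))))"
      using N c by (intro mult_strict_left_mono) auto
    also have "\<dots> = e" using c by (simp add: field_simps)
    finally show ?thesis .
  qed
  show "\<exists>d>0. \<forall>s\<in>{0<..}. dist s t < d \<longrightarrow> dist (memory u s) (memory u t) < e"
  proof (intro exI[of _ "min d 1"] conjI ballI impI)
    fix s assume s: "s \<in> {0<..}" "dist s t < min d 1"
    show "dist (memory u s) (memory u t) < e"
    proof (cases "s \<le> t")
      case True
      then show ?thesis using *[of s t] s t by (simp add: dist_norm norm_minus_commute)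
    next
      case False
      then show ?thesis using *[of t s] s t by (simp add: dist_norm)
    qed
  qed (use d in auto)
qed

text \<open>Solving the almost everywhere identity for the velocity yields a continuous function G.
  Since q is the integral of its velocity, it is also the integral of G, and therefore has
  derivative G at every t > 0.\<close>

lemma has_vector_derivative_drift:
  assumes b: "0 < b" and u: "u \<in> generator_dom T" and t: "0 < t"
  shows "((\<lambda>t. time_changed M \<sigma> T t u) has_vector_derivative (Q t (generator T u) - memory u t) /\<^sub>R b) (at t)"
proof -
  define G where "G s = (Q s (generator T u) - memory u s) /\<^sub>R b" for s
  have Gc: "continuous_on {0<..} G"
    unfolding G_def
    by (intro continuous_on_scaleR continuous_on_const continuous_on_diff continuous_on_memory b
        continuous_on_subset[OF continuous_on_Q]) auto
  have eq: "AE s in lborel. 0 < s \<longrightarrow> velocity u s = G s"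
    using AE_Q_generator[of u] by eventually_elim (use b in \<open>simp add: G_def\<close>)
  have inc: "norm (Q y u - Q x u - (y - x) *\<^sub>R w) \<le> e * (y - x)"
    if xy: "0 < x" "x \<le> y" and e: "0 \<le> e" and w: "\<And>s. x < s \<Longrightarrow> s < y \<Longrightarrow> norm (G s - w) \<le> e" for x y w e
  proof -
    have "has_bochner_integral lborel (indicator {x<..<y}) (y - x)"
      using has_bochner_integral_real_indicator[of "{x<..<y}" lborel] xy by simp
    then have hb: "has_bochner lborel (\<lambda>s. indicator {x<..<y} s *\<^sub>R w) ((y - x) *\<^sub>R w)"
      by (rule has_bochner_scaleR_left)
    have "ennreal (norm (Q y u - Q x u - (y - x) *\<^sub>R w)) \<le> (\<integral>\<^sup>+s. ennreal e * indicator {x<..<y} s \<partial>lborel)"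
    proof (rule has_bochner_dist_bound[OF has_bochner_Q_diff[OF u less_imp_le[OF xy(1)] xy(2)] hb])
      show "AE s in lborel. ennreal (norm (indicator {x<..<y} s *\<^sub>R velocity u s - indicator {x<..<y} s *\<^sub>R w)) \<le> ennreal e * indicator {x<..<y} s"
        using eq by eventually_elim (use w xy in \<open>auto simp: indicator_def intro!: ennreal_leI\<close>)
    qed simp
    also have "\<dots> = ennreal (e * (y - x))"
      using xy e by (simp add: nn_integral_cmult_indicator ennreal_mult)
    finally show ?thesis using xy e by (simp add: ennreal_le_iff)
  qed
  have "((\<lambda>t. Q t u) has_vector_derivative G t) (at t)"
    unfolding has_vector_derivative_def has_derivative_within_alt
  proof (intro conjI allI impI bounded_linear_scaleR_left)
    fix e :: real assume e: "0 < e"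
    obtain d where d: "0 < d" "\<And>s. s \<in> {0<..} \<Longrightarrow> dist s t < d \<Longrightarrow> dist (G s) (G t) < e"
      using Gc t e unfolding continuous_on_iff by (metis greaterThan_iff)
    show "\<exists>d>0. \<forall>y\<in>UNIV. norm (y - t) < d \<longrightarrow> norm (Q y u - Q t u - (y - t) *\<^sub>R G t) \<le> e * norm (y - t)"
    proof (intro exI[of _ "min d t"] conjI ballI impI)
      fix y assume y: "norm (y - t) < min d t"
      show "norm (Q y u - Q t u - (y - t) *\<^sub>R G t) \<le> e * norm (y - t)"
      proof (cases "t \<le> y")
        case True
        have "norm (Q y u - Q t u - (y - t) *\<^sub>R G t) \<le> e * (y - t)"
        proof (rule inc[OF t True less_imp_le[OF e]])
          fix s assume "t < s" "s < y"
          then show "norm (G s - G t) \<le> e" using d(2)[of s] y t by (simp add: dist_norm)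
        qed
        then show ?thesis using True by simp
      next
        case False
        have y0: "0 < y" "y \<le> t" using y False by auto
        have "norm (Q t u - Q y u - (t - y) *\<^sub>R G t) \<le> e * (t - y)"
        proof (rule inc[OF y0 less_imp_le[OF e]])
          fix s assume "y < s" "s < t"
          then show "norm (G s - G t) \<le> e" using d(2)[of s] y y0 by (simp add: dist_norm)
        qed
        moreover have "Q y u - Q t u - (y - t) *\<^sub>R G t = - (Q t u - Q y u - (t - y) *\<^sub>R G t)"
          by (simp add: algebra_simps)
        then have "norm (Q y u - Q t u - (y - t) *\<^sub>R G t) = norm (Q t u - Q y u - (t - y) *\<^sub>R G t)"
          by (simp only: norm_minus_cancel)
        ultimately show ?thesis using False by simp
      qed
    qed (use d t in auto)
  qed
  then have "((\<lambda>t. time_changed M \<sigma> T t u) has_vector_derivative G t) (at t)"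
  proof (rule has_vector_derivative_transform_within_open)
    show "open ({0<..} :: real set)" "t \<in> {0<..}" using t by auto
    fix s :: real assume "s \<in> {0<..}"
    then show "Q s u = time_changed M \<sigma> T s u" by (simp add: time_changed_eq)
  qed
  then show ?thesis by (simp only: G_def)
qed

lemma has_DC_derivative_time_changed:
  assumes u: "u \<in> generator_dom T" and t: "0 < t"
  shows "has_DC_derivative b (levy_tail a m) (\<lambda>t. time_changed M \<sigma> T t u) (generator T (time_changed M \<sigma> T t u)) t"
  unfolding has_DC_derivative_def
proof (intro conjI impI abs_cont_time_changed u)
  let ?q = "\<lambda>t. time_changed M \<sigma> T t u"
  have drift: "(?q has_vector_derivative (Q t (generator T u) - memory u t) /\<^sub>R b) (at t)" if "b \<noteq> 0"
    using that b_nonneg by (intro has_vector_derivative_drift u t) auto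
  show "?q differentiable at t" if "b \<noteq> 0"
    using drift[OF that] by (rule differentiableI_vector)
  have "AE x in distr lborel borel (\<lambda>s. t - s). 0 < x \<longrightarrow> (?q has_vector_derivative velocity u x) (at x)"
    unfolding lborel_reflect by (rule AE_has_vector_derivative[OF u])
  then have "AE s in lborel. 0 < t - s \<longrightarrow> (?q has_vector_derivative velocity u (t - s)) (at (t - s))"
    by (rule AE_distrD[rotated]) simp
  then show "AE s in lborel. 0 < s \<and> s < t \<longrightarrow> ?q differentiable at (t - s)"
    by eventually_elim (auto intro: differentiableI_vector)
  note hb = has_bochner_memory[OF u t]
  show "bochner_integrable_on lborel {0<..<t} (\<lambda>s. levy_tail a m s *\<^sub>R vector_derivative ?q (at (t - s)))"
    unfolding bochner_integrable_on_def using hb by blast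
  have "generator T (time_changed M \<sigma> T t u) = Q t (generator T u)"
    using t by (simp add: time_changed_eq generator_Q[OF u])
  also have "\<dots> = b *\<^sub>R vector_derivative ?q (at t) + memory u t"
  proof (cases "b = 0")
    \<comment> \<open>Differentiability of q at t is not known here; whatever value
      \<open>vector_derivative\<close> takes, it is multiplied by 0.\<close>
    case True
    then show ?thesis by (simp add: Q_generator_driftless[OF _ t])
  next
    case False
    then show ?thesis by (simp add: vector_derivative_at[OF drift])
  qed
  also have "memory u t = bochner_integral_on lborel {0<..<t} (\<lambda>s. levy_tail a m s *\<^sub>R vector_derivative ?q (at (t - s)))"
    by (rule bochner_integral_on_eq[OF hb, symmetric])
  finally show "generator T (time_changed M \<sigma> T t u) = b *\<^sub>R vector_derivative ?q (at t)
      + bochner_integral_on lborel {0<..<t} (\<lambda>s. levy_tail a m s *\<^sub>R vector_derivative ?q (at (t - s)))" .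
qed

end

theorem theorem5p1:
  fixes f :: "real \<Rightarrow> real" and a b :: real and m :: "real measure"
    and M :: "'w measure" and \<sigma> :: "real \<Rightarrow> 'w \<Rightarrow> ennreal"
    and T :: "real \<Rightarrow> 'b::banach \<Rightarrow>\<^sub>L 'b"
  assumes "bernstein_with_triplet f a b m"
    and "subordinator M f \<sigma>"
    and "emeasure m {0<..} = \<infinity>"
    and "\<And>c d. 0 < c \<Longrightarrow> c \<le> d \<Longrightarrow> abs_cont_on_interval c d (levy_tail a m)"
    and "C0_semigroup T"
    and "\<And>t u. 0 \<le> t \<Longrightarrow> norm (blinfun_apply (T t) u) \<le> norm u"
  shows
    "(\<forall>t\<ge>0. \<forall>u. bochner_integrable_on (inverse_law M \<sigma> t) {..<\<infinity>}
                   (\<lambda>s. blinfun_apply (T (enn2real s)) u)) \<and>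
     ((\<forall>t\<ge>0. bounded_linear (time_changed M \<sigma> T t)) \<and>
      (\<exists>C. \<forall>t\<ge>0. onorm (time_changed M \<sigma> T t) \<le> C)) \<and>
     (\<forall>u. continuous_on {0..} (\<lambda>t. time_changed M \<sigma> T t u)) \<and>
     (\<forall>u\<in>generator_dom T.
        (\<forall>t>0. time_changed M \<sigma> T t u \<in> generator_dom T \<and>
               has_DC_derivative b (levy_tail a m) (\<lambda>t. time_changed M \<sigma> T t u)
                 (generator T (time_changed M \<sigma> T t u)) t) \<and>
        time_changed M \<sigma> T 0 u = u)"
proof -
  interpret prob_space M using assms(2) by (simp add: subordinator_def)
  interpret time_change f a b m M \<sigma> T
    by unfold_locales (fact assms)+
  show ?thesis
  \<comment> \<open>The uniform bound is C = 1: contractions are averaged over a probability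
    law.\<close>
  proof (intro conjI allI impI ballI exI[of _ 1])
    fix t :: real and u assume t: "0 \<le> t"
    show "bochner_integrable_on (inverse_law M \<sigma> t) {..<\<infinity>} (\<lambda>s. blinfun_apply (T (enn2real s)) u)"
      unfolding bochner_integrable_on_def using has_bochner_time_changed[OF t] by blast
  next
    fix t :: real assume t: "0 \<le> t"
    have eq: "time_changed M \<sigma> T t = Q t" using time_changed_eq[OF t] by (simp add: fun_eq_iff)
    show "bounded_linear (time_changed M \<sigma> T t)" unfolding eq by (rule bounded_linear_Q)
    show "onorm (time_changed M \<sigma> T t) \<le> 1" unfolding eq by (rule onorm_bound) (simp_all add: norm_Q_le)
  next
    fix u
    show "continuous_on {0..} (\<lambda>t. time_changed M \<sigma> T t u)"
      using continuous_on_Q[of u] by (subst continuous_on_cong[OF refl time_changed_eq]) auto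
  next
    fix u and t :: real assume u: "u \<in> generator_dom T" and t: "0 < t"
    show "time_changed M \<sigma> T t u \<in> generator_dom T"
      using generator_Q(1)[OF u] t by (simp add: time_changed_eq)
    show "has_DC_derivative b (levy_tail a m) (\<lambda>t. time_changed M \<sigma> T t u) (generator T (time_changed M \<sigma> T t u)) t"
      by (rule has_DC_derivative_time_changed[OF u t])
  next
    fix u
    show "time_changed M \<sigma> T 0 u = u" by (simp add: time_changed_eq Q_zero)
  qed
qed

end
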